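(* Let $\mathcal V$ be a bicomplete closed symmetric monoidal category whose underlying category is a cofibrantly generated symmetric monoidal model category, and assume that the unit $\mathbb 1$ in $\mathcal V$ is cofibrant. Let $\mathcal C$ be a small category, $\mathcal M$ a model $\mathcal V$-category and $\gamma:\mathcal C\to\mathcal M$ a functor. Then the category $\mathrm{Fact}(\gamma,y)$ of factorizations of $\gamma$ through the Yoneda embedding $y:\mathcal C\to\mathbf U_{\mathcal V}\mathcal C$ is contractible.
   Context: For a $\mathcal V$-category $\mathcal M$, $\mathcal M_0$ denotes the underlying ordinary category. A functor from an ordinary category $\mathcal C$ to a $\mathcal V$-category $\mathcal M$ means an ordinary functor $\mathcal C\to\mathcal M_0$ (equivalently, a $\mathcal V$-functor from the free $\mathcal V$-category $\mathcal C[\mathcal V]$, whose hom objects are $\coprod_{\mathcal C(c,c')}\mathbb 1$). "Symmetric monoidal model category" is in the sense of Hovey. $\mathbf U_{\mathcal V}\mathcal C$ is the $\mathcal V$-category of presheaves on $\mathcal C$ with values in $\mathcal V$, with the projective model structure on its underlying category (weak equivalences and fibrations defined objectwise); it is a model $\mathcal V$-category. The Yoneda embedding is $y(c)=\coprod_{\mathcal C(-,c)}\mathbb 1$. A model $\mathcal V$-category is a bicomplete $\mathcal V$-category $\mathcal M$ with a model structure on $\mathcal M_0$ such that the tensor $\odot:\mathcal V\otimes\mathcal M\to\mathcal M$ is a $\mathcal V$-adjunction of two variables whose underlying adjunction of two variables is Quillen (in the sense of Hovey), and such that for every cofibrant $m\in\mathcal M$ and a cofibrant replacement $\mathbb 1_c\to\mathbb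 1$ the map $\mathbb 1_c\odot m\to\mathbb 1\odot m$ is a weak equivalence. A left Quillen $\mathcal V$-functor is the left adjoint in a $\mathcal V$-adjunction whose underlying adjunction is a Quillen adjunction. An object of $\mathrm{Fact}(\gamma,y)$ is a pair $(L,\eta)$ with $L:\mathbf U_{\mathcal V}\mathcal C\to\mathcal M$ a left Quillen $\mathcal V$-functor and $\eta:Ly\to\gamma$ a natural transformation which is objectwise a weak equivalence. A morphism $(L,\eta)\to(L',\eta')$ is a ($\mathcal V$-)natural transformation $L\to L'$ compatible with $\eta$ and $\eta'$. A category is contractible if its nerve is weakly contractible. *)

theory Defs
  imports "HOL-Homology.Homology" "HOL-Library.FuncSet"
begin

section \<open>Size\<close>

text \<open>
  Smallness is measured against a type \<open>'u\<close>: a set is small if its cardinality is strictly below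
  that of \<open>'u\<close>. If the cardinality of \<open>'u\<close> is inaccessible, the small sets are those of a
  Grothendieck universe. Inaccessibility is not required, only that the cardinality is regular and
  uncountable.
\<close>

definition universe :: "'u itself \<Rightarrow> bool" where
  "universe U \<longleftrightarrow>
     (card_of (UNIV :: nat set), card_of (UNIV :: 'u set)) \<in> ordLess \<and>
     regularCard (card_of (UNIV :: 'u set))"

definition small :: "'u itself \<Rightarrow> 'x set \<Rightarrow> bool" where
  "small U A \<longleftrightarrow> (card_of A, card_of (UNIV :: 'u set)) \<in> ordLess"


section \<open>Ordinary categories\<close>

record ('o, 'a) cat =
  Obj :: "'o set"
  Arr :: "'a set"
  Dom :: "'a \<Rightarrow> 'o"
  Cod :: "'a \<Rightarrow> 'o"
  Idn :: "'o \<Rightarrow> 'a"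
  Comp :: "'a \<Rightarrow> 'a \<Rightarrow> 'a"

definition homset :: "('o, 'a, 'z) cat_scheme \<Rightarrow> 'o \<Rightarrow> 'o \<Rightarrow> 'a set" where
  "homset K x y = {f \<in> Arr K. Dom K f = x \<and> Cod K f = y}"

definition category :: "('o, 'a, 'z) cat_scheme \<Rightarrow> bool" where
  "category K \<longleftrightarrow>
     (\<forall>f\<in>Arr K. Dom K f \<in> Obj K \<and> Cod K f \<in> Obj K) \<and>
     (\<forall>x\<in>Obj K. Idn K x \<in> homset K x x) \<and>
     (\<forall>f\<in>Arr K. \<forall>g\<in>Arr K. Cod K f = Dom K g \<longrightarrow> Comp K g f \<in> homset K (Dom K f) (Cod K g)) \<and>
     (\<forall>f\<in>Arr K. Comp K f (Idn K (Dom K f)) = f \<and> Comp K (Idn K (Cod K f)) f = f) \<and>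
     (\<forall>f\<in>Arr K. \<forall>g\<in>Arr K. \<forall>h\<in>Arr K. Cod K f = Dom K g \<and> Cod K g = Dom K h \<longrightarrow>
        Comp K h (Comp K g f) = Comp K (Comp K h g) f)"

definition small_category :: "'u itself \<Rightarrow> ('o, 'a, 'z) cat_scheme \<Rightarrow> bool" where
  "small_category U K \<longleftrightarrow> category K \<and> small U (Obj K) \<and> small U (Arr K)"

definition cat_op :: "('o, 'a, 'z) cat_scheme \<Rightarrow> ('o, 'a, 'z) cat_scheme" where
  "cat_op K = K\<lparr>Dom := Cod K, Cod := Dom K, Comp := (\<lambda>g f. Comp K f g)\<rparr>"

definition inverse_arr :: "('o, 'a, 'z) cat_scheme \<Rightarrow> 'a \<Rightarrow> 'a \<Rightarrow> bool" where
  "inverse_arr K f g \<longleftrightarrow> f \<in> Arr K \<and> g \<in> homset K (Cod K f) (Dom K f) \<and>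
     Comp K g f = Idn K (Dom K f) \<and> Comp K f g = Idn K (Cod K f)"

definition is_iso :: "('o, 'a, 'z) cat_scheme \<Rightarrow> 'a \<Rightarrow> bool" where
  "is_iso K f \<longleftrightarrow> (\<exists>g. inverse_arr K f g)"

definition inv_arr :: "('o, 'a, 'z) cat_scheme \<Rightarrow> 'a \<Rightarrow> 'a" where
  "inv_arr K f = (THE g. inverse_arr K f g)"

text \<open>Functors are extensional (\<open>undefined\<close> off the source), so that equality of functors is the
  mathematical one; the same applies to all families of arrows below.\<close>

record ('o, 'a, 'p, 'b) functr =
  Fobj :: "'o \<Rightarrow> 'p"
  Farr :: "'a \<Rightarrow> 'b"

definition is_functor ::
  "('o, 'a, 'y) cat_scheme \<Rightarrow> ('p, 'b, 'z) cat_scheme \<Rightarrow> ('o, 'a, 'p, 'b) functr \<Rightarrow> bool" where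
  "is_functor K L F \<longleftrightarrow>
     Fobj F \<in> Obj K \<rightarrow>\<^sub>E Obj L \<and> Farr F \<in> Arr K \<rightarrow>\<^sub>E Arr L \<and>
     (\<forall>f\<in>Arr K. Farr F f \<in> homset L (Fobj F (Dom K f)) (Fobj F (Cod K f))) \<and>
     (\<forall>x\<in>Obj K. Farr F (Idn K x) = Idn L (Fobj F x)) \<and>
     (\<forall>f\<in>Arr K. \<forall>g\<in>Arr K. Cod K f = Dom K g \<longrightarrow>
        Farr F (Comp K g f) = Comp L (Farr F g) (Farr F f))"

definition functor_comp ::
  "('o, 'a, 'z) cat_scheme \<Rightarrow> ('p, 'b, 'q, 'e) functr \<Rightarrow> ('o, 'a, 'p, 'b) functr \<Rightarrow>
   ('o, 'a, 'q, 'e) functr" where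
  "functor_comp K G F =
     \<lparr>Fobj = (\<lambda>x\<in>Obj K. Fobj G (Fobj F x)), Farr = (\<lambda>f\<in>Arr K. Farr G (Farr F f))\<rparr>"

definition nat_trans ::
  "('o, 'a, 'y) cat_scheme \<Rightarrow> ('p, 'b, 'z) cat_scheme \<Rightarrow> ('o, 'a, 'p, 'b) functr \<Rightarrow>
   ('o, 'a, 'p, 'b) functr \<Rightarrow> ('o \<Rightarrow> 'b) \<Rightarrow> bool" where
  "nat_trans K L F G \<theta> \<longleftrightarrow>
     \<theta> \<in> Obj K \<rightarrow>\<^sub>E Arr L \<and>
     (\<forall>x\<in>Obj K. \<theta> x \<in> homset L (Fobj F x) (Fobj G x)) \<and>
     (\<forall>f\<in>Arr K. Comp L (\<theta> (Cod K f)) (Farr F f) = Comp L (Farr G f) (\<theta> (Dom K f)))"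


subsection \<open>Limits and colimits\<close>

definition is_cone ::
  "('o, 'a, 'z) cat_scheme \<Rightarrow> ('i, 'j, 'y) cat_scheme \<Rightarrow> ('i, 'j, 'o, 'a) functr \<Rightarrow>
   'o \<Rightarrow> ('i \<Rightarrow> 'a) \<Rightarrow> bool" where
  "is_cone K J D x p \<longleftrightarrow>
     x \<in> Obj K \<and> (\<forall>j\<in>Obj J. p j \<in> homset K x (Fobj D j)) \<and>
     (\<forall>u\<in>Arr J. Comp K (Farr D u) (p (Dom J u)) = p (Cod J u))"

definition is_limit ::
  "('o, 'a, 'z) cat_scheme \<Rightarrow> ('i, 'j, 'y) cat_scheme \<Rightarrow> ('i, 'j, 'o, 'a) functr \<Rightarrow>
   'o \<Rightarrow> ('i \<Rightarrow> 'a) \<Rightarrow> bool" where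
  "is_limit K J D x p \<longleftrightarrow>
     is_cone K J D x p \<and>
     (\<forall>y q. is_cone K J D y q \<longrightarrow> (\<exists>!h. h \<in> homset K y x \<and> (\<forall>j\<in>Obj J. Comp K (p j) h = q j)))"

definition is_colimit ::
  "('o, 'a, 'z) cat_scheme \<Rightarrow> ('i, 'j, 'y) cat_scheme \<Rightarrow> ('i, 'j, 'o, 'a) functr \<Rightarrow>
   'o \<Rightarrow> ('i \<Rightarrow> 'a) \<Rightarrow> bool" where
  "is_colimit K J D x p \<longleftrightarrow> is_limit (cat_op K) (cat_op J) D x p"

text \<open>Every small index category is isomorphic to one whose objects and arrows are elements
  of \<open>'u\<close>.\<close>

definition complete_cat :: "'u itself \<Rightarrow> ('o, 'a, 'z) cat_scheme \<Rightarrow> bool" where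
  "complete_cat U K \<longleftrightarrow>
     (\<forall>(J :: ('u, 'u) cat) D. small_category U J \<and> is_functor J K D \<longrightarrow>
        (\<exists>x p. is_limit K J D x p))"

definition cocomplete_cat :: "'u itself \<Rightarrow> ('o, 'a, 'z) cat_scheme \<Rightarrow> bool" where
  "cocomplete_cat U K \<longleftrightarrow>
     (\<forall>(J :: ('u, 'u) cat) D. small_category U J \<and> is_functor J K D \<longrightarrow>
        (\<exists>x p. is_colimit K J D x p))"

definition is_initial :: "('o, 'a, 'z) cat_scheme \<Rightarrow> 'o \<Rightarrow> bool" where
  "is_initial K z \<longleftrightarrow> z \<in> Obj K \<and> (\<forall>x\<in>Obj K. \<exists>!f. f \<in> homset K z x)"

definition is_pushout :: "('o, 'a, 'z) cat_scheme \<Rightarrow> 'a \<Rightarrow> 'a \<Rightarrow> 'a \<Rightarrow> 'a \<Rightarrow> bool" where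
  "is_pushout K u w i j \<longleftrightarrow>
     u \<in> Arr K \<and> w \<in> Arr K \<and> i \<in> Arr K \<and> j \<in> Arr K \<and>
     Dom K u = Dom K w \<and> Dom K i = Cod K u \<and> Dom K j = Cod K w \<and> Cod K i = Cod K j \<and>
     Comp K i u = Comp K j w \<and>
     (\<forall>i'\<in>Arr K. \<forall>j'\<in>Arr K.
        Dom K i' = Cod K u \<and> Dom K j' = Cod K w \<and> Cod K i' = Cod K j' \<and>
        Comp K i' u = Comp K j' w \<longrightarrow>
        (\<exists>!h. h \<in> homset K (Cod K i) (Cod K i') \<and> Comp K h i = i' \<and> Comp K h j = j'))"

text \<open>\<open>x\<close> with inclusions \<open>\<iota> s\<close>, \<open>s \<in> S\<close>, is the coproduct of copies of \<open>a\<close> indexed by \<open>S\<close>.\<close>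

definition is_copower ::
  "('o, 'a, 'z) cat_scheme \<Rightarrow> 's set \<Rightarrow> 'o \<Rightarrow> 'o \<Rightarrow> ('s \<Rightarrow> 'a) \<Rightarrow> bool" where
  "is_copower K S a x \<iota> \<longleftrightarrow>
     x \<in> Obj K \<and> (\<forall>s\<in>S. \<iota> s \<in> homset K a x) \<and>
     (\<forall>y\<in>Obj K. \<forall>q. (\<forall>s\<in>S. q s \<in> homset K a y) \<longrightarrow>
        (\<exists>!h. h \<in> homset K x y \<and> (\<forall>s\<in>S. Comp K h (\<iota> s) = q s)))"


section \<open>Model categories\<close>

record 'a model =
  Weq :: "'a set"
  Cof :: "'a set"
  Fib :: "'a set"

definition has_lift :: "('o, 'a, 'z) cat_scheme \<Rightarrow> 'a \<Rightarrow> 'a \<Rightarrow> bool" where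
  "has_lift K i p \<longleftrightarrow>
     (\<forall>u\<in>homset K (Dom K i) (Dom K p). \<forall>v\<in>homset K (Cod K i) (Cod K p).
        Comp K p u = Comp K v i \<longrightarrow>
        (\<exists>h\<in>homset K (Cod K i) (Dom K p). Comp K h i = u \<and> Comp K p h = v))"

definition wide_subcategory :: "('o, 'a, 'z) cat_scheme \<Rightarrow> 'a set \<Rightarrow> bool" where
  "wide_subcategory K S \<longleftrightarrow>
     S \<subseteq> Arr K \<and> (\<forall>x\<in>Obj K. Idn K x \<in> S) \<and>
     (\<forall>f\<in>S. \<forall>g\<in>S. Cod K f = Dom K g \<longrightarrow> Comp K g f \<in> S)"

definition two_out_of_three :: "('o, 'a, 'z) cat_scheme \<Rightarrow> 'a set \<Rightarrow> bool" where
  "two_out_of_three K S \<longleftrightarrow>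
     (\<forall>f\<in>Arr K. \<forall>g\<in>Arr K. Cod K f = Dom K g \<longrightarrow>
        (f \<in> S \<and> g \<in> S \<longrightarrow> Comp K g f \<in> S) \<and>
        (f \<in> S \<and> Comp K g f \<in> S \<longrightarrow> g \<in> S) \<and>
        (g \<in> S \<and> Comp K g f \<in> S \<longrightarrow> f \<in> S))"

definition arrow_retract :: "('o, 'a, 'z) cat_scheme \<Rightarrow> 'a \<Rightarrow> 'a \<Rightarrow> bool" where
  "arrow_retract K f g \<longleftrightarrow>
     (\<exists>i\<in>homset K (Dom K f) (Dom K g). \<exists>r\<in>homset K (Dom K g) (Dom K f).
      \<exists>i'\<in>homset K (Cod K f) (Cod K g). \<exists>r'\<in>homset K (Cod K g) (Cod K f).
        Comp K r i = Idn K (Dom K f) \<and> Comp K r' i' = Idn K (Cod K f) \<and>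
        Comp K g i = Comp K i' f \<and> Comp K f r = Comp K r' g)"

definition retract_closed :: "('o, 'a, 'z) cat_scheme \<Rightarrow> 'a set \<Rightarrow> bool" where
  "retract_closed K S \<longleftrightarrow> (\<forall>f\<in>Arr K. \<forall>g\<in>S. arrow_retract K f g \<longrightarrow> f \<in> S)"

text \<open>
  A functorial factorization \<open>f = \<beta> f \<circ> \<alpha> f\<close> with \<open>\<alpha> f \<in> A\<close>, \<open>\<beta> f \<in> B\<close> and middle object \<open>E f\<close>;
  \<open>\<phi> f g u v\<close> is the map of middle objects induced by the square \<open>(u, v)\<close> from \<open>f\<close> to \<open>g\<close>.
\<close>

definition arrow_square :: "('o, 'a, 'z) cat_scheme \<Rightarrow> 'a \<Rightarrow> 'a \<Rightarrow> 'a \<Rightarrow> 'a \<Rightarrow> bool" where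
  "arrow_square K f g u v \<longleftrightarrow> f \<in> Arr K \<and> g \<in> Arr K \<and>
     u \<in> homset K (Dom K f) (Dom K g) \<and> v \<in> homset K (Cod K f) (Cod K g) \<and> Comp K g u = Comp K v f"

definition functorial_factorization :: "('o, 'a, 'z) cat_scheme \<Rightarrow> 'a set \<Rightarrow> 'a set \<Rightarrow> bool" where
  "functorial_factorization K A B \<longleftrightarrow>
     (\<exists>E \<alpha> \<beta> \<phi>.
        (\<forall>f\<in>Arr K. \<alpha> f \<in> homset K (Dom K f) (E f) \<inter> A \<and> \<beta> f \<in> homset K (E f) (Cod K f) \<inter> B \<and>
           Comp K (\<beta> f) (\<alpha> f) = f) \<and>
        (\<forall>f g u v. arrow_square K f g u v \<longrightarrow>
           \<phi> f g u v \<in> homset K (E f) (E g) \<and>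
           Comp K (\<phi> f g u v) (\<alpha> f) = Comp K (\<alpha> g) u \<and>
           Comp K (\<beta> g) (\<phi> f g u v) = Comp K v (\<beta> f)) \<and>
        (\<forall>f\<in>Arr K. \<phi> f f (Idn K (Dom K f)) (Idn K (Cod K f)) = Idn K (E f)) \<and>
        (\<forall>f g h u v u' v'. arrow_square K f g u v \<and> arrow_square K g h u' v' \<longrightarrow>
           \<phi> f h (Comp K u' u) (Comp K v' v) = Comp K (\<phi> g h u' v') (\<phi> f g u v)))"

definition model_structure :: "('o, 'a, 'z) cat_scheme \<Rightarrow> 'a model \<Rightarrow> bool" where
  "model_structure K N \<longleftrightarrow>
     wide_subcategory K (Weq N) \<and> wide_subcategory K (Cof N) \<and> wide_subcategory K (Fib N) \<and>
     two_out_of_three K (Weq N) \<and>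
     retract_closed K (Weq N) \<and> retract_closed K (Cof N) \<and> retract_closed K (Fib N) \<and>
     (\<forall>i\<in>Cof N \<inter> Weq N. \<forall>p\<in>Fib N. has_lift K i p) \<and>
     (\<forall>i\<in>Cof N. \<forall>p\<in>Fib N \<inter> Weq N. has_lift K i p) \<and>
     functorial_factorization K (Cof N) (Fib N \<inter> Weq N) \<and>
     functorial_factorization K (Cof N \<inter> Weq N) (Fib N)"

definition cofibrant :: "('o, 'a, 'z) cat_scheme \<Rightarrow> 'a model \<Rightarrow> 'o \<Rightarrow> bool" where
  "cofibrant K N x \<longleftrightarrow> x \<in> Obj K \<and> (\<exists>z. is_initial K z \<and> (\<exists>f\<in>homset K z x. f \<in> Cof N))"

text \<open>
  The pushout-product condition for a bifunctor \<open>K1 \<times> K2 \<rightarrow> K3\<close>, given by its action \<open>T\<close> on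
  arrows. Here \<open>k\<close> is the pushout product of \<open>f\<close> and \<open>g\<close>.
\<close>

definition quillen_bifunctor ::
  "('o1, 'a1, 'z1) cat_scheme \<Rightarrow> 'a1 model \<Rightarrow> ('o2, 'a2, 'z2) cat_scheme \<Rightarrow> 'a2 model \<Rightarrow>
   ('o3, 'a3, 'z3) cat_scheme \<Rightarrow> 'a3 model \<Rightarrow> ('a1 \<Rightarrow> 'a2 \<Rightarrow> 'a3) \<Rightarrow> bool" where
  "quillen_bifunctor K1 N1 K2 N2 K3 N3 T \<longleftrightarrow>
     (\<forall>f\<in>Cof N1. \<forall>g\<in>Cof N2. \<forall>i j.
        is_pushout K3 (T f (Idn K2 (Dom K2 g))) (T (Idn K1 (Dom K1 f)) g) i j \<longrightarrow>
        (\<forall>k\<in>homset K3 (Cod K3 i) (Cod K3 (T f g)).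
           Comp K3 k i = T (Idn K1 (Cod K1 f)) g \<and> Comp K3 k j = T f (Idn K2 (Cod K2 g)) \<longrightarrow>
           k \<in> Cof N3 \<and> (f \<in> Weq N1 \<or> g \<in> Weq N2 \<longrightarrow> k \<in> Weq N3)))"

definition quillen_adjunction ::
  "('o, 'a, 'y) cat_scheme \<Rightarrow> 'a model \<Rightarrow> ('p, 'b, 'z) cat_scheme \<Rightarrow> 'b model \<Rightarrow>
   ('o, 'a, 'p, 'b) functr \<Rightarrow> ('p, 'b, 'o, 'a) functr \<Rightarrow> bool" where
  "quillen_adjunction K N K' N' L R \<longleftrightarrow>
     (\<forall>f\<in>Cof N. Farr L f \<in> Cof N') \<and> (\<forall>p\<in>Fib N'. Farr R p \<in> Fib N)"


subsection \<open>Cofibrant generation\<close>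

text \<open>Ordinals are represented by small well-orders on subsets of \<open>'u\<close>, in non-strict form.\<close>

definition order_cat :: "('x \<times> 'x) set \<Rightarrow> ('x, 'x \<times> 'x) cat" where
  "order_cat r = \<lparr>Obj = Field r, Arr = r, Dom = fst, Cod = snd, Idn = (\<lambda>a. (a, a)),
                  Comp = (\<lambda>g f. (fst f, snd g))\<rparr>"

definition small_ordinal :: "'u itself \<Rightarrow> 'u rel \<Rightarrow> bool" where
  "small_ordinal U r \<longleftrightarrow> Well_order r \<and> small U (Field r)"

definition least_of :: "'x rel \<Rightarrow> 'x \<Rightarrow> bool" where
  "least_of r z \<longleftrightarrow> z \<in> Field r \<and> (\<forall>a\<in>Field r. (z, a) \<in> r)"

definition succ_of :: "'x rel \<Rightarrow> 'x \<Rightarrow> 'x \<Rightarrow> bool" where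
  "succ_of r a b \<longleftrightarrow> (a, b) \<in> r \<and> a \<noteq> b \<and> (\<forall>c\<in>underS r b. (c, a) \<in> r)"

definition limit_elem :: "'x rel \<Rightarrow> 'x \<Rightarrow> bool" where
  "limit_elem r b \<longleftrightarrow> b \<in> Field r \<and> \<not> least_of r b \<and> (\<nexists>a. succ_of r a b)"

definition ordinal_sequence ::
  "('o, 'a, 'z) cat_scheme \<Rightarrow> 'u rel \<Rightarrow> ('u, 'u \<times> 'u, 'o, 'a) functr \<Rightarrow> bool" where
  "ordinal_sequence K r X \<longleftrightarrow>
     is_functor (order_cat r) K X \<and>
     (\<forall>b. limit_elem r b \<longrightarrow>
        is_colimit K (order_cat (Restr r (underS r b))) X (Fobj X b) (\<lambda>a. Farr X (a, b)))"

definition steps_in :: "'u rel \<Rightarrow> ('u, 'u \<times> 'u, 'o, 'a) functr \<Rightarrow> 'a set \<Rightarrow> bool" where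
  "steps_in r X S \<longleftrightarrow> (\<forall>a b. succ_of r a b \<longrightarrow> Farr X (a, b) \<in> S)"

definition pushouts_of :: "('o, 'a, 'z) cat_scheme \<Rightarrow> 'a set \<Rightarrow> 'a set" where
  "pushouts_of K I = {g. \<exists>i\<in>I. \<exists>u v. is_pushout K i u v g}"

text \<open>Relative \<open>I\<close>-cell complexes: transfinite compositions of pushouts of elements of \<open>I\<close>.\<close>

definition rel_cell :: "'u itself \<Rightarrow> ('o, 'a, 'z) cat_scheme \<Rightarrow> 'a set \<Rightarrow> 'a set" where
  "rel_cell U K I =
     {f. \<exists>(r :: 'u rel) X x p z. small_ordinal U r \<and> ordinal_sequence K r X \<and>
           steps_in r X (pushouts_of K I) \<and> is_colimit K (order_cat r) X x p \<and>
           least_of r z \<and> f = p z}"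

text \<open>A limit ordinal \<open>r\<close> is \<open>\<kappa>\<close>-filtered if its subsets of cardinality at most \<open>\<kappa>\<close> are bounded
  strictly below \<open>r\<close>.\<close>

definition filtered_ordinal :: "'u set \<Rightarrow> 'u rel \<Rightarrow> bool" where
  "filtered_ordinal \<kappa> r \<longleftrightarrow>
     Field r \<noteq> {} \<and> (\<forall>a\<in>Field r. \<exists>b. (a, b) \<in> r \<and> a \<noteq> b) \<and>
     (\<forall>B\<subseteq>Field r. (card_of B, card_of \<kappa>) \<in> ordLeq \<longrightarrow>
        (\<exists>b\<in>Field r. \<forall>a\<in>B. (a, b) \<in> r \<and> a \<noteq> b))"

text \<open>\<open>A\<close> is small relative to \<open>S\<close>: for some cardinal \<open>\<kappa>\<close> and every \<open>\<kappa>\<close>-filtered sequence with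
  steps in \<open>S\<close>, the canonical map from the colimit of the sets \<open>homset A (X b)\<close> to
  \<open>homset A (colim X)\<close> is surjective and injective.\<close>

definition small_relative_to :: "'u itself \<Rightarrow> ('o, 'a, 'z) cat_scheme \<Rightarrow> 'a set \<Rightarrow> 'o \<Rightarrow> bool" where
  "small_relative_to U K S A \<longleftrightarrow>
     (\<exists>\<kappa> :: 'u set. small U \<kappa> \<and>
        (\<forall>r X x p. small_ordinal U r \<and> filtered_ordinal \<kappa> r \<and> ordinal_sequence K r X \<and>
           steps_in r X S \<and> is_colimit K (order_cat r) X x p \<longrightarrow>
           (\<forall>f\<in>homset K A x. \<exists>b\<in>Field r. \<exists>g\<in>homset K A (Fobj X b). Comp K (p b) g = f) \<and>
           (\<forall>b\<in>Field r. \<forall>g\<in>homset K A (Fobj X b). \<forall>g'\<in>homset K A (Fobj X b).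
              Comp K (p b) g = Comp K (p b) g' \<longrightarrow>
              (\<exists>c. (b, c) \<in> r \<and> Comp K (Farr X (b, c)) g = Comp K (Farr X (b, c)) g'))))"

definition cofibrantly_generated ::
  "'u itself \<Rightarrow> ('o, 'a, 'z) cat_scheme \<Rightarrow> 'a model \<Rightarrow> bool" where
  "cofibrantly_generated U K N \<longleftrightarrow>
     (\<exists>I J. I \<subseteq> Arr K \<and> J \<subseteq> Arr K \<and> small U I \<and> small U J \<and>
        (\<forall>i\<in>I. small_relative_to U K (rel_cell U K I) (Dom K i)) \<and>
        (\<forall>j\<in>J. small_relative_to U K (rel_cell U K J) (Dom K j)) \<and>
        Fib N = {p \<in> Arr K. \<forall>j\<in>J. has_lift K j p} \<and>
        Fib N \<inter> Weq N = {p \<in> Arr K. \<forall>i\<in>I. has_lift K i p})"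


section \<open>Closed symmetric monoidal categories\<close>

text \<open>
  Directions of the structure arrows: \<open>Assoc x y z : (x \<otimes> y) \<otimes> z \<rightarrow> x \<otimes> (y \<otimes> z)\<close>,
  \<open>Lun x : 1 \<otimes> x \<rightarrow> x\<close>, \<open>Run x : x \<otimes> 1 \<rightarrow> x\<close>, \<open>Sym x y : x \<otimes> y \<rightarrow> y \<otimes> x\<close>,
  \<open>Eval x y : [x, y] \<otimes> x \<rightarrow> y\<close> where \<open>[x, y]\<close> is \<open>Ihom x y\<close>.
\<close>

record ('o, 'a) smcat = "('o, 'a) cat" +
  Tobj :: "'o \<Rightarrow> 'o \<Rightarrow> 'o"
  Tarr :: "'a \<Rightarrow> 'a \<Rightarrow> 'a"
  Unit :: "'o"
  Assoc :: "'o \<Rightarrow> 'o \<Rightarrow> 'o \<Rightarrow> 'a"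
  Lun :: "'o \<Rightarrow> 'a"
  Run :: "'o \<Rightarrow> 'a"
  Sym :: "'o \<Rightarrow> 'o \<Rightarrow> 'a"
  Ihom :: "'o \<Rightarrow> 'o \<Rightarrow> 'o"
  Eval :: "'o \<Rightarrow> 'o \<Rightarrow> 'a"

definition tensor_bifunctor :: "('o, 'a) smcat \<Rightarrow> bool" where
  "tensor_bifunctor V \<longleftrightarrow>
     (\<forall>x\<in>Obj V. \<forall>y\<in>Obj V. Tobj V x y \<in> Obj V \<and> Tarr V (Idn V x) (Idn V y) = Idn V (Tobj V x y)) \<and>
     (\<forall>f\<in>Arr V. \<forall>g\<in>Arr V.
        Tarr V f g \<in> homset V (Tobj V (Dom V f) (Dom V g)) (Tobj V (Cod V f) (Cod V g))) \<and>
     (\<forall>f\<in>Arr V. \<forall>f'\<in>Arr V. \<forall>g\<in>Arr V. \<forall>g'\<in>Arr V. Cod V f = Dom V f' \<and> Cod V g = Dom V g' \<longrightarrow>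
        Tarr V (Comp V f' f) (Comp V g' g) = Comp V (Tarr V f' g') (Tarr V f g))"

definition structure_isos :: "('o, 'a) smcat \<Rightarrow> bool" where
  "structure_isos V \<longleftrightarrow>
     Unit V \<in> Obj V \<and>
     (\<forall>x\<in>Obj V. \<forall>y\<in>Obj V. \<forall>z\<in>Obj V.
        Assoc V x y z \<in> homset V (Tobj V (Tobj V x y) z) (Tobj V x (Tobj V y z)) \<and>
        is_iso V (Assoc V x y z)) \<and>
     (\<forall>x\<in>Obj V. Lun V x \<in> homset V (Tobj V (Unit V) x) x \<and> is_iso V (Lun V x)) \<and>
     (\<forall>x\<in>Obj V. Run V x \<in> homset V (Tobj V x (Unit V)) x \<and> is_iso V (Run V x)) \<and>
     (\<forall>x\<in>Obj V. \<forall>y\<in>Obj V. Sym V x y \<in> homset V (Tobj V x y) (Tobj V y x))"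

definition structure_natural :: "('o, 'a) smcat \<Rightarrow> bool" where
  "structure_natural V \<longleftrightarrow>
     (\<forall>f\<in>Arr V. \<forall>g\<in>Arr V. \<forall>h\<in>Arr V.
        Comp V (Assoc V (Cod V f) (Cod V g) (Cod V h)) (Tarr V (Tarr V f g) h) =
        Comp V (Tarr V f (Tarr V g h)) (Assoc V (Dom V f) (Dom V g) (Dom V h))) \<and>
     (\<forall>f\<in>Arr V. Comp V (Lun V (Cod V f)) (Tarr V (Idn V (Unit V)) f) = Comp V f (Lun V (Dom V f))) \<and>
     (\<forall>f\<in>Arr V. Comp V (Run V (Cod V f)) (Tarr V f (Idn V (Unit V))) = Comp V f (Run V (Dom V f))) \<and>
     (\<forall>f\<in>Arr V. \<forall>g\<in>Arr V.
        Comp V (Sym V (Cod V f) (Cod V g)) (Tarr V f g) =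
        Comp V (Tarr V g f) (Sym V (Dom V f) (Dom V g)))"

text \<open>Pentagon, triangle, symmetry and hexagon.\<close>

definition coherence :: "('o, 'a) smcat \<Rightarrow> bool" where
  "coherence V \<longleftrightarrow>
     (\<forall>w\<in>Obj V. \<forall>x\<in>Obj V. \<forall>y\<in>Obj V. \<forall>z\<in>Obj V.
        Comp V (Assoc V w x (Tobj V y z)) (Assoc V (Tobj V w x) y z) =
        Comp V (Tarr V (Idn V w) (Assoc V x y z))
          (Comp V (Assoc V w (Tobj V x y) z) (Tarr V (Assoc V w x y) (Idn V z)))) \<and>
     (\<forall>x\<in>Obj V. \<forall>y\<in>Obj V.
        Comp V (Tarr V (Idn V x) (Lun V y)) (Assoc V x (Unit V) y) = Tarr V (Run V x) (Idn V y)) \<and>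
     (\<forall>x\<in>Obj V. \<forall>y\<in>Obj V. Comp V (Sym V y x) (Sym V x y) = Idn V (Tobj V x y)) \<and>
     (\<forall>x\<in>Obj V. \<forall>y\<in>Obj V. \<forall>z\<in>Obj V.
        Comp V (Assoc V y z x) (Comp V (Sym V x (Tobj V y z)) (Assoc V x y z)) =
        Comp V (Tarr V (Idn V y) (Sym V x z))
          (Comp V (Assoc V y x z) (Tarr V (Sym V x y) (Idn V z))))"

definition closed_structure :: "('o, 'a) smcat \<Rightarrow> bool" where
  "closed_structure V \<longleftrightarrow>
     (\<forall>y\<in>Obj V. \<forall>z\<in>Obj V. Ihom V y z \<in> Obj V \<and> Eval V y z \<in> homset V (Tobj V (Ihom V y z) y) z \<and>
        (\<forall>x\<in>Obj V. \<forall>f\<in>homset V (Tobj V x y) z.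
           \<exists>!h. h \<in> homset V x (Ihom V y z) \<and> Comp V (Eval V y z) (Tarr V h (Idn V y)) = f))"

definition closed_symmetric_monoidal :: "('o, 'a) smcat \<Rightarrow> bool" where
  "closed_symmetric_monoidal V \<longleftrightarrow>
     category V \<and> tensor_bifunctor V \<and> structure_isos V \<and> structure_natural V \<and>
     coherence V \<and> closed_structure V"

definition curry_arr :: "('o, 'a) smcat \<Rightarrow> 'o \<Rightarrow> 'o \<Rightarrow> 'o \<Rightarrow> 'a \<Rightarrow> 'a" where
  "curry_arr V x y z f =
     (THE h. h \<in> homset V x (Ihom V y z) \<and> Comp V (Eval V y z) (Tarr V h (Idn V y)) = f)"

text \<open>For \<open>f : a' \<rightarrow> a\<close> and \<open>g : b \<rightarrow> b'\<close>, the arrow \<open>[f, g] : [a, b] \<rightarrow> [a', b']\<close>.\<close>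

definition Ihom_arr :: "('o, 'a) smcat \<Rightarrow> 'a \<Rightarrow> 'a \<Rightarrow> 'a" where
  "Ihom_arr V f g =
     (let a = Cod V f; b = Dom V g in
      curry_arr V (Ihom V a b) (Dom V f) (Cod V g)
        (Comp V g (Comp V (Eval V a b) (Tarr V (Idn V (Ihom V a b)) f))))"

text \<open>The unit axiom is stated on one side only, the other being equivalent by symmetry.\<close>

definition symmetric_monoidal_model_category :: "('o, 'a) smcat \<Rightarrow> 'a model \<Rightarrow> bool" where
  "symmetric_monoidal_model_category V N \<longleftrightarrow>
     closed_symmetric_monoidal V \<and> model_structure V N \<and>
     quillen_bifunctor V N V N V N (Tarr V) \<and>
     (\<forall>q\<in>Weq N. cofibrant V N (Dom V q) \<and> Cod V q = Unit V \<longrightarrow>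
        (\<forall>x. cofibrant V N x \<longrightarrow> Tarr V q (Idn V x) \<in> Weq N))"


section \<open>Enriched categories\<close>

text \<open>\<open>VComp x y z : M(y, z) \<otimes> M(x, y) \<rightarrow> M(x, z)\<close>.\<close>

record ('m, 'o, 'a) vcat =
  VObj :: "'m set"
  VHom :: "'m \<Rightarrow> 'm \<Rightarrow> 'o"
  VId :: "'m \<Rightarrow> 'a"
  VComp :: "'m \<Rightarrow> 'm \<Rightarrow> 'm \<Rightarrow> 'a"

definition vcategory :: "('o, 'a) smcat \<Rightarrow> ('m, 'o, 'a) vcat \<Rightarrow> bool" where
  "vcategory V M \<longleftrightarrow>
     (\<forall>x\<in>VObj M. \<forall>y\<in>VObj M. VHom M x y \<in> Obj V) \<and>
     (\<forall>x\<in>VObj M. VId M x \<in> homset V (Unit V) (VHom M x x)) \<and>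
     (\<forall>x\<in>VObj M. \<forall>y\<in>VObj M. \<forall>z\<in>VObj M.
        VComp M x y z \<in> homset V (Tobj V (VHom M y z) (VHom M x y)) (VHom M x z)) \<and>
     (\<forall>w\<in>VObj M. \<forall>x\<in>VObj M. \<forall>y\<in>VObj M. \<forall>z\<in>VObj M.
        Comp V (VComp M w x z) (Tarr V (VComp M x y z) (Idn V (VHom M w x))) =
        Comp V (VComp M w y z)
          (Comp V (Tarr V (Idn V (VHom M y z)) (VComp M w x y))
             (Assoc V (VHom M y z) (VHom M x y) (VHom M w x)))) \<and>
     (\<forall>x\<in>VObj M. \<forall>y\<in>VObj M.
        Comp V (VComp M x y y) (Tarr V (VId M y) (Idn V (VHom M x y))) = Lun V (VHom M x y) \<and>
        Comp V (VComp M x x y) (Tarr V (Idn V (VHom M x y)) (VId M x)) = Run V (VHom M x y))"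

definition vop :: "('o, 'a) smcat \<Rightarrow> ('m, 'o, 'a) vcat \<Rightarrow> ('m, 'o, 'a) vcat" where
  "vop V M =
     \<lparr>VObj = VObj M, VHom = (\<lambda>x y. VHom M y x), VId = VId M,
      VComp = (\<lambda>x y z. Comp V (VComp M z y x) (Sym V (VHom M z y) (VHom M y x)))\<rparr>"

text \<open>\<open>V\<close> as a category enriched over itself.\<close>

definition vself :: "('o, 'a) smcat \<Rightarrow> ('o, 'o, 'a) vcat" where
  "vself V =
     \<lparr>VObj = Obj V, VHom = Ihom V, VId = (\<lambda>x. curry_arr V (Unit V) x x (Lun V x)),
      VComp = (\<lambda>x y z.
        curry_arr V (Tobj V (Ihom V y z) (Ihom V x y)) x z
          (Comp V (Eval V y z)
            (Comp V (Tarr V (Idn V (Ihom V y z)) (Eval V x y))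
              (Assoc V (Ihom V y z) (Ihom V x y) x))))\<rparr>"

text \<open>Composition \<open>1 \<cong> 1 \<otimes> 1 \<rightarrow> M(y, z) \<otimes> M(x, y) \<rightarrow> M(x, z)\<close> of elements of the hom objects.\<close>

definition elem_comp ::
  "('o, 'a) smcat \<Rightarrow> ('m, 'o, 'a) vcat \<Rightarrow> 'm \<Rightarrow> 'm \<Rightarrow> 'm \<Rightarrow> 'a \<Rightarrow> 'a \<Rightarrow> 'a" where
  "elem_comp V M x y z g f =
     Comp V (VComp M x y z) (Comp V (Tarr V g f) (inv_arr V (Lun V (Unit V))))"

text \<open>The underlying category \<open>M\<^sub>0\<close>. Its arrows \<open>x \<rightarrow> y\<close> are the elements \<open>1 \<rightarrow> M(x, y)\<close>, tagged
  with their source and target.\<close>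

definition underlying :: "('o, 'a) smcat \<Rightarrow> ('m, 'o, 'a) vcat \<Rightarrow> ('m, 'm \<times> 'm \<times> 'a) cat" where
  "underlying V M =
     \<lparr>Obj = VObj M,
      Arr = {(x, y, f). x \<in> VObj M \<and> y \<in> VObj M \<and> f \<in> homset V (Unit V) (VHom M x y)},
      Dom = (\<lambda>(x, y, f). x),
      Cod = (\<lambda>(x, y, f). y),
      Idn = (\<lambda>x. (x, x, VId M x)),
      Comp = (\<lambda>(y', z, g) (x, y, f). (x, z, elem_comp V M x y z g f))\<rparr>"


subsection \<open>Enriched functors, transformations and adjunctions\<close>

record ('m, 'n, 'a) vfunctr =
  VFobj :: "'m \<Rightarrow> 'n"
  VFarr :: "'m \<times> 'm \<Rightarrow> 'a"

definition is_vfunctor ::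
  "('o, 'a) smcat \<Rightarrow> ('m, 'o, 'a) vcat \<Rightarrow> ('n, 'o, 'a) vcat \<Rightarrow> ('m, 'n, 'a) vfunctr \<Rightarrow> bool" where
  "is_vfunctor V A B F \<longleftrightarrow>
     VFobj F \<in> VObj A \<rightarrow>\<^sub>E VObj B \<and> VFarr F \<in> (VObj A \<times> VObj A) \<rightarrow>\<^sub>E Arr V \<and>
     (\<forall>x\<in>VObj A. \<forall>y\<in>VObj A.
        VFarr F (x, y) \<in> homset V (VHom A x y) (VHom B (VFobj F x) (VFobj F y))) \<and>
     (\<forall>x\<in>VObj A. Comp V (VFarr F (x, x)) (VId A x) = VId B (VFobj F x)) \<and>
     (\<forall>x\<in>VObj A. \<forall>y\<in>VObj A. \<forall>z\<in>VObj A.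
        Comp V (VFarr F (x, z)) (VComp A x y z) =
        Comp V (VComp B (VFobj F x) (VFobj F y) (VFobj F z)) (Tarr V (VFarr F (y, z)) (VFarr F (x, y))))"

definition vfunctor_id :: "('o, 'a) smcat \<Rightarrow> ('m, 'o, 'a) vcat \<Rightarrow> ('m, 'm, 'a) vfunctr" where
  "vfunctor_id V A =
     \<lparr>VFobj = (\<lambda>x\<in>VObj A. x), VFarr = (\<lambda>(x, y)\<in>VObj A \<times> VObj A. Idn V (VHom A x y))\<rparr>"

definition vfunctor_comp ::
  "('o, 'a) smcat \<Rightarrow> ('m, 'o, 'a) vcat \<Rightarrow> ('n, 'p, 'a) vfunctr \<Rightarrow> ('m, 'n, 'a) vfunctr \<Rightarrow>
   ('m, 'p, 'a) vfunctr" where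
  "vfunctor_comp V A G F =
     \<lparr>VFobj = (\<lambda>x\<in>VObj A. VFobj G (VFobj F x)),
      VFarr = (\<lambda>(x, y)\<in>VObj A \<times> VObj A. Comp V (VFarr G (VFobj F x, VFobj F y)) (VFarr F (x, y)))\<rparr>"

definition underlying_functor ::
  "('o, 'a) smcat \<Rightarrow> ('m, 'o, 'a) vcat \<Rightarrow> ('m, 'n, 'a) vfunctr \<Rightarrow>
   ('m, 'm \<times> 'm \<times> 'a, 'n, 'n \<times> 'n \<times> 'a) functr" where
  "underlying_functor V A F =
     \<lparr>Fobj = (\<lambda>x\<in>VObj A. VFobj F x),
      Farr = (\<lambda>(x, y, f)\<in>Arr (underlying V A). (VFobj F x, VFobj F y, Comp V (VFarr F (x, y)) f))\<rparr>"

definition vnat_trans ::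
  "('o, 'a) smcat \<Rightarrow> ('m, 'o, 'a) vcat \<Rightarrow> ('n, 'o, 'a) vcat \<Rightarrow> ('m, 'n, 'a) vfunctr \<Rightarrow>
   ('m, 'n, 'a) vfunctr \<Rightarrow> ('m \<Rightarrow> 'a) \<Rightarrow> bool" where
  "vnat_trans V A B F G \<theta> \<longleftrightarrow>
     \<theta> \<in> VObj A \<rightarrow>\<^sub>E Arr V \<and>
     (\<forall>x\<in>VObj A. \<theta> x \<in> homset V (Unit V) (VHom B (VFobj F x) (VFobj G x))) \<and>
     (\<forall>x\<in>VObj A. \<forall>y\<in>VObj A.
        Comp V (VComp B (VFobj F x) (VFobj F y) (VFobj G y))
          (Comp V (Tarr V (\<theta> y) (VFarr F (x, y))) (inv_arr V (Lun V (VHom A x y)))) =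
        Comp V (VComp B (VFobj F x) (VFobj G x) (VFobj G y))
          (Comp V (Tarr V (VFarr G (x, y)) (\<theta> x)) (inv_arr V (Run V (VHom A x y)))))"

text \<open>\<open>L \<stileturn> R\<close>, by unit and counit.\<close>

definition vadjunction ::
  "('o, 'a) smcat \<Rightarrow> ('m, 'o, 'a) vcat \<Rightarrow> ('n, 'o, 'a) vcat \<Rightarrow>
   ('m, 'n, 'a) vfunctr \<Rightarrow> ('n, 'm, 'a) vfunctr \<Rightarrow> bool" where
  "vadjunction V A B L R \<longleftrightarrow>
     is_vfunctor V A B L \<and> is_vfunctor V B A R \<and>
     (\<exists>\<eta> \<epsilon>.
        vnat_trans V A A (vfunctor_id V A) (vfunctor_comp V A R L) \<eta> \<and>
        vnat_trans V B B (vfunctor_comp V B L R) (vfunctor_id V B) \<epsilon> \<and>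
        (\<forall>x\<in>VObj A. let Lx = VFobj L x; RLx = VFobj R Lx in
           elem_comp V B Lx (VFobj L RLx) Lx (\<epsilon> Lx) (Comp V (VFarr L (x, RLx)) (\<eta> x)) = VId B Lx) \<and>
        (\<forall>y\<in>VObj B. let Ry = VFobj R y; LRy = VFobj L Ry in
           elem_comp V A Ry (VFobj R LRy) Ry (Comp V (VFarr R (LRy, y)) (\<epsilon> y)) (\<eta> Ry) = VId A Ry))"


subsection \<open>Weighted limits and colimits\<close>

text \<open>
  \<open>\<pi> a : e \<rightarrow> B(T a, S a)\<close> is a \<open>V\<close>-natural (extranatural) family in \<open>a\<close>; a universal such family
  exhibits \<open>e\<close> as the end of \<open>B(T -, S -)\<close>, i.e. as the object of \<open>V\<close>-natural transformations
  from \<open>T\<close> to \<open>S\<close>.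
\<close>

definition vnat_family ::
  "('o, 'a) smcat \<Rightarrow> ('m, 'o, 'a) vcat \<Rightarrow> ('n, 'o, 'a) vcat \<Rightarrow> ('m, 'n, 'a) vfunctr \<Rightarrow>
   ('m, 'n, 'a) vfunctr \<Rightarrow> 'o \<Rightarrow> ('m \<Rightarrow> 'a) \<Rightarrow> bool" where
  "vnat_family V A B T S e \<pi> \<longleftrightarrow>
     e \<in> Obj V \<and> (\<forall>a\<in>VObj A. \<pi> a \<in> homset V e (VHom B (VFobj T a) (VFobj S a))) \<and>
     (\<forall>a\<in>VObj A. \<forall>b\<in>VObj A.
        Comp V (VComp B (VFobj T a) (VFobj S a) (VFobj S b)) (Tarr V (VFarr S (a, b)) (\<pi> a)) =
        Comp V (VComp B (VFobj T a) (VFobj T b) (VFobj S b))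
          (Comp V (Tarr V (\<pi> b) (VFarr T (a, b))) (Sym V (VHom A a b) e)))"

definition is_nat_object ::
  "('o, 'a) smcat \<Rightarrow> ('m, 'o, 'a) vcat \<Rightarrow> ('n, 'o, 'a) vcat \<Rightarrow> ('m, 'n, 'a) vfunctr \<Rightarrow>
   ('m, 'n, 'a) vfunctr \<Rightarrow> 'o \<Rightarrow> ('m \<Rightarrow> 'a) \<Rightarrow> bool" where
  "is_nat_object V A B T S e \<pi> \<longleftrightarrow>
     vnat_family V A B T S e \<pi> \<and>
     (\<forall>e' \<pi>'. vnat_family V A B T S e' \<pi>' \<longrightarrow>
        (\<exists>!h. h \<in> homset V e' e \<and> (\<forall>a\<in>VObj A. Comp V (\<pi> a) h = \<pi>' a)))"

text \<open>The \<open>V\<close>-functor \<open>M(m, F -) : A \<rightarrow> V\<close>.\<close>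

definition rep_functor ::
  "('o, 'a) smcat \<Rightarrow> ('n, 'o, 'a) vcat \<Rightarrow> ('m, 'o, 'a) vcat \<Rightarrow> 'm \<Rightarrow> ('n, 'm, 'a) vfunctr \<Rightarrow>
   ('n, 'o, 'a) vfunctr" where
  "rep_functor V A M m F =
     \<lparr>VFobj = (\<lambda>a\<in>VObj A. VHom M m (VFobj F a)),
      VFarr = (\<lambda>(a, b)\<in>VObj A \<times> VObj A.
        curry_arr V (VHom A a b) (VHom M m (VFobj F a)) (VHom M m (VFobj F b))
          (Comp V (VComp M m (VFobj F a) (VFobj F b))
            (Tarr V (VFarr F (a, b)) (Idn V (VHom M m (VFobj F a))))))\<rparr>"

text \<open>
  \<open>l\<close> with \<open>\<mu> a : W a \<rightarrow> M(l, F a)\<close> is the limit of \<open>F\<close> weighted by \<open>W\<close>: the maps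
  \<open>M(m, l) \<rightarrow> [W a, M(m, F a)]\<close> induced by \<open>\<mu>\<close> exhibit \<open>M(m, l)\<close> as the object of \<open>V\<close>-natural
  transformations from \<open>W\<close> to \<open>M(m, F -)\<close>.
\<close>

definition is_weighted_limit ::
  "('o, 'a) smcat \<Rightarrow> ('n, 'o, 'a) vcat \<Rightarrow> ('m, 'o, 'a) vcat \<Rightarrow> ('n, 'o, 'a) vfunctr \<Rightarrow>
   ('n, 'm, 'a) vfunctr \<Rightarrow> 'm \<Rightarrow> ('n \<Rightarrow> 'a) \<Rightarrow> bool" where
  "is_weighted_limit V A M W F l \<mu> \<longleftrightarrow>
     l \<in> VObj M \<and> (\<forall>a\<in>VObj A. \<mu> a \<in> homset V (VFobj W a) (VHom M l (VFobj F a))) \<and>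
     (\<forall>m\<in>VObj M. is_nat_object V A (vself V) W (rep_functor V A M m F) (VHom M m l)
        (\<lambda>a. curry_arr V (VHom M m l) (VFobj W a) (VHom M m (VFobj F a))
           (Comp V (VComp M m l (VFobj F a))
             (Comp V (Tarr V (\<mu> a) (Idn V (VHom M m l))) (Sym V (VHom M m l) (VFobj W a))))))"

definition vcomplete :: "'u itself \<Rightarrow> ('o, 'a) smcat \<Rightarrow> ('m, 'o, 'a) vcat \<Rightarrow> bool" where
  "vcomplete U V M \<longleftrightarrow>
     (\<forall>(A :: ('u, 'o, 'a) vcat) W F.
        vcategory V A \<and> small U (VObj A) \<and> is_vfunctor V A (vself V) W \<and> is_vfunctor V A M F \<longrightarrow>
        (\<exists>l \<mu>. is_weighted_limit V A M W F l \<mu>))"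

text \<open>The colimit of \<open>F : A\<^sup>o\<^sup>p \<rightarrow> M\<close> weighted by \<open>W : A \<rightarrow> V\<close> is the limit, weighted by \<open>W\<close>, of the
  opposite functor \<open>A \<rightarrow> M\<^sup>o\<^sup>p\<close>.\<close>

definition vbicomplete :: "'u itself \<Rightarrow> ('o, 'a) smcat \<Rightarrow> ('m, 'o, 'a) vcat \<Rightarrow> bool" where
  "vbicomplete U V M \<longleftrightarrow> vcomplete U V M \<and> vcomplete U V (vop V M)"


subsection \<open>Tensors and cotensors\<close>

text \<open>
  \<open>t\<close> with \<open>i : v \<rightarrow> M(m, t)\<close> is a tensor of \<open>v\<close> and \<open>m\<close>: the map \<open>M(t, n) \<rightarrow> [v, M(m, n)]\<close> induced
  by \<open>i\<close> is invertible for all \<open>n\<close>. These isomorphisms are \<open>V\<close>-natural in \<open>n\<close>, and there is a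
  unique way to make the tensor a \<open>V\<close>-functor of \<open>v\<close> and \<open>m\<close> so that they are \<open>V\<close>-natural in all
  variables; with cotensors this is the \<open>V\<close>-adjunction of two variables
  \<open>M(v \<odot> m, n) \<cong> [v, M(m, n)] \<cong> M(m, n\<^sup>v)\<close>.
\<close>

definition is_tensor ::
  "('o, 'a) smcat \<Rightarrow> ('m, 'o, 'a) vcat \<Rightarrow> 'o \<Rightarrow> 'm \<Rightarrow> 'm \<Rightarrow> 'a \<Rightarrow> bool" where
  "is_tensor V M v m t i \<longleftrightarrow>
     t \<in> VObj M \<and> i \<in> homset V v (VHom M m t) \<and>
     (\<forall>n\<in>VObj M.
        is_iso V (curry_arr V (VHom M t n) v (VHom M m n)
          (Comp V (VComp M m t n) (Tarr V (Idn V (VHom M t n)) i))))"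

definition two_variable_vadjunction :: "('o, 'a) smcat \<Rightarrow> ('m, 'o, 'a) vcat \<Rightarrow> bool" where
  "two_variable_vadjunction V M \<longleftrightarrow>
     (\<forall>v\<in>Obj V. \<forall>m\<in>VObj M.
        (\<exists>t i. is_tensor V M v m t i) \<and> (\<exists>c j. is_tensor V (vop V M) v m c j))"

definition tensor :: "('o, 'a) smcat \<Rightarrow> ('m, 'o, 'a) vcat \<Rightarrow> 'o \<Rightarrow> 'm \<Rightarrow> 'm \<times> 'a" where
  "tensor V M v m = (SOME (t, i). is_tensor V M v m t i)"

definition tensor_obj :: "('o, 'a) smcat \<Rightarrow> ('m, 'o, 'a) vcat \<Rightarrow> 'o \<Rightarrow> 'm \<Rightarrow> 'm" where
  "tensor_obj V M v m = fst (tensor V M v m)"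

definition tensor_unit :: "('o, 'a) smcat \<Rightarrow> ('m, 'o, 'a) vcat \<Rightarrow> 'o \<Rightarrow> 'm \<Rightarrow> 'a" where
  "tensor_unit V M v m = snd (tensor V M v m)"

text \<open>For \<open>f : v \<rightarrow> v'\<close> in \<open>V\<close> and \<open>g : m \<rightarrow> m'\<close> in \<open>M\<^sub>0\<close>, the arrow \<open>h = f \<odot> g\<close> of \<open>M\<^sub>0\<close> is determined
  by the equality of the two arrows \<open>v \<rightarrow> M(m, v' \<odot> m')\<close> given by \<open>h\<close> after the unit of \<open>v \<odot> m\<close>,
  and by the unit of \<open>v' \<odot> m'\<close> after \<open>f\<close>, precomposed with \<open>g\<close>.\<close>

definition tensor_arr ::
  "('o, 'a) smcat \<Rightarrow> ('m, 'o, 'a) vcat \<Rightarrow> 'a \<Rightarrow> 'm \<times> 'm \<times> 'a \<Rightarrow> 'm \<times> 'm \<times> 'a" where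
  "tensor_arr V M f = (\<lambda>(m, m', g).
     let v = Dom V f; v' = Cod V f; t = tensor_obj V M v m; t' = tensor_obj V M v' m' in
     (t, t', THE h. h \<in> homset V (Unit V) (VHom M t t') \<and>
        Comp V (VComp M m t t')
          (Comp V (Tarr V h (tensor_unit V M v m)) (inv_arr V (Lun V v))) =
        Comp V (VComp M m m' t')
          (Comp V (Tarr V (Comp V (tensor_unit V M v' m') f) g) (inv_arr V (Run V v)))))"


subsection \<open>Model \<open>V\<close>-categories\<close>

definition model_vcategory ::
  "'u itself \<Rightarrow> ('o, 'a) smcat \<Rightarrow> 'a model \<Rightarrow> ('m, 'o, 'a) vcat \<Rightarrow> ('m \<times> 'm \<times> 'a) model \<Rightarrow> bool" where
  "model_vcategory U V N M NM \<longleftrightarrow>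
     vcategory V M \<and> vbicomplete U V M \<and> model_structure (underlying V M) NM \<and>
     two_variable_vadjunction V M \<and>
     quillen_bifunctor V N (underlying V M) NM (underlying V M) NM (tensor_arr V M) \<and>
     (\<forall>q\<in>Weq N. cofibrant V N (Dom V q) \<and> Cod V q = Unit V \<longrightarrow>
        (\<forall>m. cofibrant (underlying V M) NM m \<longrightarrow>
           tensor_arr V M q (Idn (underlying V M) m) \<in> Weq NM))"

definition left_quillen_vfunctor ::
  "('o, 'a) smcat \<Rightarrow> ('m, 'o, 'a) vcat \<Rightarrow> ('m \<times> 'm \<times> 'a) model \<Rightarrow>
   ('n, 'o, 'a) vcat \<Rightarrow> ('n \<times> 'n \<times> 'a) model \<Rightarrow> ('m, 'n, 'a) vfunctr \<Rightarrow> bool" where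
  "left_quillen_vfunctor V A NA B NB L \<longleftrightarrow>
     (\<exists>R. vadjunction V A B L R \<and>
        quillen_adjunction (underlying V A) NA (underlying V B) NB
          (underlying_functor V A L) (underlying_functor V B R))"


section \<open>The projective model \<open>V\<close>-category of presheaves\<close>

type_synonym ('c, 'd, 'o, 'a) presheaf = "('c, 'd, 'o, 'a) functr"

definition presheaves ::
  "('o, 'a) smcat \<Rightarrow> ('c, 'd) cat \<Rightarrow> ('c, 'd, 'o, 'a) presheaf set" where
  "presheaves V C = {F. is_functor (cat_op C) V F}"

text \<open>\<open>e\<close> with \<open>\<pi> c : e \<rightarrow> [F c, G c]\<close> is an end of \<open>[F -, G -]\<close>.\<close>

definition presheaf_wedge ::
  "('o, 'a) smcat \<Rightarrow> ('c, 'd) cat \<Rightarrow> ('c, 'd, 'o, 'a) presheaf \<Rightarrow> ('c, 'd, 'o, 'a) presheaf \<Rightarrow>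
   'o \<Rightarrow> ('c \<Rightarrow> 'a) \<Rightarrow> bool" where
  "presheaf_wedge V C F G e \<pi> \<longleftrightarrow>
     e \<in> Obj V \<and> (\<forall>c\<in>Obj C. \<pi> c \<in> homset V e (Ihom V (Fobj F c) (Fobj G c))) \<and>
     (\<forall>u\<in>Arr C.
        Comp V (Ihom_arr V (Idn V (Fobj F (Cod C u))) (Farr G u)) (\<pi> (Cod C u)) =
        Comp V (Ihom_arr V (Farr F u) (Idn V (Fobj G (Dom C u)))) (\<pi> (Dom C u)))"

definition is_presheaf_end ::
  "('o, 'a) smcat \<Rightarrow> ('c, 'd) cat \<Rightarrow> ('c, 'd, 'o, 'a) presheaf \<Rightarrow> ('c, 'd, 'o, 'a) presheaf \<Rightarrow>
   'o \<Rightarrow> ('c \<Rightarrow> 'a) \<Rightarrow> bool" where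
  "is_presheaf_end V C F G e \<pi> \<longleftrightarrow>
     presheaf_wedge V C F G e \<pi> \<and>
     (\<forall>e' \<pi>'. presheaf_wedge V C F G e' \<pi>' \<longrightarrow>
        (\<exists>!h. h \<in> homset V e' e \<and> (\<forall>c\<in>Obj C. Comp V (\<pi> c) h = \<pi>' c)))"

definition presheaf_end ::
  "('o, 'a) smcat \<Rightarrow> ('c, 'd) cat \<Rightarrow> ('c, 'd, 'o, 'a) presheaf \<Rightarrow> ('c, 'd, 'o, 'a) presheaf \<Rightarrow>
   'o \<times> ('c \<Rightarrow> 'a)" where
  "presheaf_end V C F G = (SOME (e, \<pi>). is_presheaf_end V C F G e \<pi>)"

definition presheaf_hom ::
  "('o, 'a) smcat \<Rightarrow> ('c, 'd) cat \<Rightarrow> ('c, 'd, 'o, 'a) presheaf \<Rightarrow> ('c, 'd, 'o, 'a) presheaf \<Rightarrow> 'o" where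
  "presheaf_hom V C F G = fst (presheaf_end V C F G)"

definition presheaf_proj ::
  "('o, 'a) smcat \<Rightarrow> ('c, 'd) cat \<Rightarrow> ('c, 'd, 'o, 'a) presheaf \<Rightarrow> ('c, 'd, 'o, 'a) presheaf \<Rightarrow>
   'c \<Rightarrow> 'a" where
  "presheaf_proj V C F G = snd (presheaf_end V C F G)"

text \<open>\<open>U\<^sub>V C\<close>. Identities and composition are those of \<open>V\<close> in each component.\<close>

definition UV ::
  "('o, 'a) smcat \<Rightarrow> ('c, 'd) cat \<Rightarrow> (('c, 'd, 'o, 'a) presheaf, 'o, 'a) vcat" where
  "UV V C =
     \<lparr>VObj = presheaves V C,
      VHom = presheaf_hom V C,
      VId = (\<lambda>F. THE h. h \<in> homset V (Unit V) (presheaf_hom V C F F) \<and>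
        (\<forall>c\<in>Obj C. Comp V (presheaf_proj V C F F c) h = VId (vself V) (Fobj F c))),
      VComp = (\<lambda>F G H. THE h.
        h \<in> homset V (Tobj V (presheaf_hom V C G H) (presheaf_hom V C F G)) (presheaf_hom V C F H) \<and>
        (\<forall>c\<in>Obj C.
           Comp V (presheaf_proj V C F H c) h =
           Comp V (VComp (vself V) (Fobj F c) (Fobj G c) (Fobj H c))
             (Tarr V (presheaf_proj V C G H c) (presheaf_proj V C F G c))))\<rparr>"

text \<open>The component \<open>F c \<rightarrow> G c\<close> of an arrow \<open>F \<rightarrow> G\<close> of the underlying category of \<open>U\<^sub>V C\<close>.\<close>

definition component ::
  "('o, 'a) smcat \<Rightarrow> ('c, 'd) cat \<Rightarrow>
   ('c, 'd, 'o, 'a) presheaf \<times> ('c, 'd, 'o, 'a) presheaf \<times> 'a \<Rightarrow> 'c \<Rightarrow> 'a" where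
  "component V C = (\<lambda>(F, G, f) c.
     Comp V (Eval V (Fobj F c) (Fobj G c))
       (Comp V (Tarr V (Comp V (presheaf_proj V C F G c) f) (Idn V (Fobj F c)))
         (inv_arr V (Lun V (Fobj F c)))))"

definition projective_model ::
  "('o, 'a) smcat \<Rightarrow> 'a model \<Rightarrow> ('c, 'd) cat \<Rightarrow>
   (('c, 'd, 'o, 'a) presheaf \<times> ('c, 'd, 'o, 'a) presheaf \<times> 'a) model" where
  "projective_model V N C =
     (let K = underlying V (UV V C);
          w = {f \<in> Arr K. \<forall>c\<in>Obj C. component V C f c \<in> Weq N};
          b = {f \<in> Arr K. \<forall>c\<in>Obj C. component V C f c \<in> Fib N}
      in \<lparr>Weq = w, Cof = {i \<in> Arr K. \<forall>p\<in>b \<inter> w. has_lift K i p}, Fib = b\<rparr>)"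


subsection \<open>The Yoneda embedding\<close>

text \<open>\<open>yoneda_cop V C c d\<close> is the coproduct of copies of the unit indexed by \<open>homset C d c\<close>, together
  with its inclusions.\<close>

definition yoneda_cop :: "('o, 'a) smcat \<Rightarrow> ('c, 'd) cat \<Rightarrow> 'c \<Rightarrow> 'c \<Rightarrow> 'o \<times> ('d \<Rightarrow> 'a)" where
  "yoneda_cop V C c d = (SOME (x, \<iota>). is_copower V (homset C d c) (Unit V) x \<iota>)"

definition yoneda_obj :: "('o, 'a) smcat \<Rightarrow> ('c, 'd) cat \<Rightarrow> 'c \<Rightarrow> ('c, 'd, 'o, 'a) presheaf" where
  "yoneda_obj V C c =
     \<lparr>Fobj = (\<lambda>d\<in>Obj C. fst (yoneda_cop V C c d)),
      Farr = (\<lambda>v\<in>Arr C. THE h.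
        h \<in> homset V (fst (yoneda_cop V C c (Cod C v))) (fst (yoneda_cop V C c (Dom C v))) \<and>
        (\<forall>w\<in>homset C (Cod C v) c.
           Comp V h (snd (yoneda_cop V C c (Cod C v)) w) =
           snd (yoneda_cop V C c (Dom C v)) (Comp C w v)))\<rparr>"

definition yoneda ::
  "('o, 'a) smcat \<Rightarrow> ('c, 'd) cat \<Rightarrow>
   ('c, 'd, ('c, 'd, 'o, 'a) presheaf,
    ('c, 'd, 'o, 'a) presheaf \<times> ('c, 'd, 'o, 'a) presheaf \<times> 'a) functr" where
  "yoneda V C =
     \<lparr>Fobj = (\<lambda>c\<in>Obj C. yoneda_obj V C c),
      Farr = (\<lambda>u\<in>Arr C.
        let c = Dom C u; c' = Cod C u; F = yoneda_obj V C c; G = yoneda_obj V C c' in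
        (F, G, THE h. h \<in> homset V (Unit V) (presheaf_hom V C F G) \<and>
           (\<forall>d\<in>Obj C. \<forall>w\<in>homset C d c.
              Comp V (component V C (F, G, h) d) (snd (yoneda_cop V C c d) w) =
              snd (yoneda_cop V C c' d) (Comp C u w))))\<rparr>"


section \<open>The category of factorizations\<close>

type_synonym ('c, 'd, 'o, 'a, 'm) fact_obj =
  "(('c, 'd, 'o, 'a) presheaf, 'm, 'a) vfunctr \<times> ('c \<Rightarrow> 'm \<times> 'm \<times> 'a)"

type_synonym ('c, 'd, 'o, 'a, 'm) fact_arr =
  "('c, 'd, 'o, 'a, 'm) fact_obj \<times> ('c, 'd, 'o, 'a, 'm) fact_obj \<times>
   (('c, 'd, 'o, 'a) presheaf \<Rightarrow> 'a)"

definition fact_objects ::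
  "('o, 'a) smcat \<Rightarrow> 'a model \<Rightarrow> ('c, 'd) cat \<Rightarrow> ('m, 'o, 'a) vcat \<Rightarrow> ('m \<times> 'm \<times> 'a) model \<Rightarrow>
   ('c, 'd, 'm, 'm \<times> 'm \<times> 'a) functr \<Rightarrow> ('c, 'd, 'o, 'a, 'm) fact_obj set" where
  "fact_objects V N C M NM \<gamma> =
     {(L, \<eta>). left_quillen_vfunctor V (UV V C) (projective_model V N C) M NM L \<and>
        nat_trans C (underlying V M)
          (functor_comp C (underlying_functor V (UV V C) L) (yoneda V C)) \<gamma> \<eta> \<and>
        (\<forall>c\<in>Obj C. \<eta> c \<in> Weq NM)}"

definition fact_arrows ::
  "('o, 'a) smcat \<Rightarrow> 'a model \<Rightarrow> ('c, 'd) cat \<Rightarrow> ('m, 'o, 'a) vcat \<Rightarrow> ('m \<times> 'm \<times> 'a) model \<Rightarrow>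
   ('c, 'd, 'm, 'm \<times> 'm \<times> 'a) functr \<Rightarrow> ('c, 'd, 'o, 'a, 'm) fact_arr set" where
  "fact_arrows V N C M NM \<gamma> =
     {((L, \<eta>), (L', \<eta>'), \<tau>).
        (L, \<eta>) \<in> fact_objects V N C M NM \<gamma> \<and> (L', \<eta>') \<in> fact_objects V N C M NM \<gamma> \<and>
        vnat_trans V (UV V C) M L L' \<tau> \<and>
        (\<forall>c\<in>Obj C. let y = Fobj (yoneda V C) c in
           Comp (underlying V M) (\<eta>' c) (VFobj L y, VFobj L' y, \<tau> y) = \<eta> c)}"

definition Fact ::
  "('o, 'a) smcat \<Rightarrow> 'a model \<Rightarrow> ('c, 'd) cat \<Rightarrow> ('m, 'o, 'a) vcat \<Rightarrow> ('m \<times> 'm \<times> 'a) model \<Rightarrow>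
   ('c, 'd, 'm, 'm \<times> 'm \<times> 'a) functr \<Rightarrow>
   (('c, 'd, 'o, 'a, 'm) fact_obj, ('c, 'd, 'o, 'a, 'm) fact_arr) cat" where
  "Fact V N C M NM \<gamma> =
     \<lparr>Obj = fact_objects V N C M NM \<gamma>,
      Arr = fact_arrows V N C M NM \<gamma>,
      Dom = (\<lambda>(X, Y, \<tau>). X),
      Cod = (\<lambda>(X, Y, \<tau>). Y),
      Idn = (\<lambda>(L, \<eta>). ((L, \<eta>), (L, \<eta>), \<lambda>F\<in>presheaves V C. VId M (VFobj L F))),
      Comp = (\<lambda>(Y', Z, \<sigma>) (X, Y, \<tau>). (X, Z, \<lambda>F\<in>presheaves V C.
        elem_comp V M (VFobj (fst X) F) (VFobj (fst Y) F) (VFobj (fst Z) F) (\<sigma> F) (\<tau> F)))\<rparr>"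


section \<open>Contractible categories\<close>

definition ordinal_cat :: "nat \<Rightarrow> (nat, nat \<times> nat) cat" where
  "ordinal_cat n = order_cat {(i, j). i \<le> j \<and> j \<le> n}"

definition monotone_maps :: "nat \<Rightarrow> nat \<Rightarrow> (nat \<Rightarrow> nat) set" where
  "monotone_maps m n = {\<theta> \<in> {..m} \<rightarrow>\<^sub>E {..n}. \<forall>i j. i \<le> j \<and> j \<le> m \<longrightarrow> \<theta> i \<le> \<theta> j}"

text \<open>The nerve: its \<open>n\<close>-simplices are the functors from the ordinal \<open>0 < \<dots> < n\<close>; a monotone map
  acts by precomposition.\<close>

definition nerve ::
  "('o, 'a, 'z) cat_scheme \<Rightarrow> nat \<Rightarrow> (nat, nat \<times> nat, 'o, 'a) functr set" where
  "nerve K n = {s. is_functor (ordinal_cat n) K s}"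

definition nerve_act ::
  "nat \<Rightarrow> (nat \<Rightarrow> nat) \<Rightarrow> (nat, nat \<times> nat, 'o, 'a) functr \<Rightarrow> (nat, nat \<times> nat, 'o, 'a) functr" where
  "nerve_act m \<theta> s =
     functor_comp (ordinal_cat m) s \<lparr>Fobj = \<theta>, Farr = (\<lambda>(i, j). (\<theta> i, \<theta> j))\<rparr>"

text \<open>
  The geometric realization of a simplicial set with \<open>n\<close>-simplices \<open>X n\<close>, on which
  \<open>\<theta> \<in> monotone_maps m n\<close> acts by \<open>act m \<theta> : X n \<rightarrow> X m\<close>: the quotient of the disjoint union of
  the \<open>X n \<times> standard_simplex n\<close> (\<open>X n\<close> discrete) by the equivalence relation generated by
  \<open>(m, act m \<theta> x, t) \<sim> (n, x, \<theta>\<^sub>* t)\<close>.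
\<close>

definition simplex_push :: "nat \<Rightarrow> (nat \<Rightarrow> nat) \<Rightarrow> (nat \<Rightarrow> real) \<Rightarrow> nat \<Rightarrow> real" where
  "simplex_push m \<theta> t = (\<lambda>j. \<Sum>i | i \<le> m \<and> \<theta> i = j. t i)"

definition realization_pre :: "(nat \<Rightarrow> 's set) \<Rightarrow> (nat \<times> 's \<times> (nat \<Rightarrow> real)) set" where
  "realization_pre X = {(n, x, t). x \<in> X n \<and> t \<in> standard_simplex n}"

definition realization_rel ::
  "(nat \<Rightarrow> 's set) \<Rightarrow> (nat \<Rightarrow> (nat \<Rightarrow> nat) \<Rightarrow> 's \<Rightarrow> 's) \<Rightarrow> (nat \<times> 's \<times> (nat \<Rightarrow> real)) rel" where
  "realization_rel X act =
     {((m, act m \<theta> x, t), (n, x, simplex_push m \<theta> t)) | m n \<theta> x t.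
        \<theta> \<in> monotone_maps m n \<and> x \<in> X n \<and> t \<in> standard_simplex m}"

definition realization_eq ::
  "(nat \<Rightarrow> 's set) \<Rightarrow> (nat \<Rightarrow> (nat \<Rightarrow> nat) \<Rightarrow> 's \<Rightarrow> 's) \<Rightarrow> (nat \<times> 's \<times> (nat \<Rightarrow> real)) rel" where
  "realization_eq X act =
     Restr ((realization_rel X act \<union> (realization_rel X act)\<inverse>)\<^sup>*) (realization_pre X)"

definition realization_open ::
  "(nat \<Rightarrow> 's set) \<Rightarrow> (nat \<Rightarrow> (nat \<Rightarrow> nat) \<Rightarrow> 's \<Rightarrow> 's) \<Rightarrow>
   (nat \<times> 's \<times> (nat \<Rightarrow> real)) set set \<Rightarrow> bool" where
  "realization_open X act W \<longleftrightarrow>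
     W \<subseteq> realization_pre X // realization_eq X act \<and>
     (\<forall>n. \<forall>x\<in>X n.
        openin (subtopology (powertop_real UNIV) (standard_simplex n))
          {t \<in> standard_simplex n. realization_eq X act `` {(n, x, t)} \<in> W})"

definition realization ::
  "(nat \<Rightarrow> 's set) \<Rightarrow> (nat \<Rightarrow> (nat \<Rightarrow> nat) \<Rightarrow> 's \<Rightarrow> 's) \<Rightarrow>
   (nat \<times> 's \<times> (nat \<Rightarrow> real)) set topology" where
  "realization X act = topology (realization_open X act)"

lemma istopology_realization_open: "istopology (realization_open X act)"
  unfolding istopology_def
proof (intro conjI allI impI)
  fix S T
  assume S: "realization_open X act S" and T: "realization_open X act T"
  have *: "{t \<in> standard_simplex n. realization_eq X act `` {(n, x, t)} \<in> S \<inter> T} =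
      {t \<in> standard_simplex n. realization_eq X act `` {(n, x, t)} \<in> S} \<inter>
      {t \<in> standard_simplex n. realization_eq X act `` {(n, x, t)} \<in> T}" for n x
    by blast
  show "realization_open X act (S \<inter> T)"
    unfolding realization_open_def *
  proof (intro conjI allI ballI openin_Int)
    show "S \<inter> T \<subseteq> realization_pre X // realization_eq X act"
      using S unfolding realization_open_def by blast
  qed (use S T in \<open>simp_all only: realization_open_def\<close>)
next
  fix \<K>
  assume K: "\<forall>S\<in>\<K>. realization_open X act S"
  have *: "{t \<in> standard_simplex n. realization_eq X act `` {(n, x, t)} \<in> \<Union>\<K>} =
      (\<Union>S\<in>\<K>. {t \<in> standard_simplex n. realization_eq X act `` {(n, x, t)} \<in> S})" for n x
    by blast
  show "realization_open X act (\<Union>\<K>)"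
    unfolding realization_open_def *
  proof (intro conjI allI ballI)
    show "\<Union>\<K> \<subseteq> realization_pre X // realization_eq X act"
      using K unfolding realization_open_def by blast
    show "openin (subtopology (powertop_real UNIV) (standard_simplex n))
        (\<Union>S\<in>\<K>. {t \<in> standard_simplex n. realization_eq X act `` {(n, x, t)} \<in> S})"
      if "x \<in> X n" for n x
    proof (rule openin_Union)
      fix A
      assume "A \<in> (\<lambda>S. {t \<in> standard_simplex n. realization_eq X act `` {(n, x, t)} \<in> S}) ` \<K>"
      then show "openin (subtopology (powertop_real UNIV) (standard_simplex n)) A"
        using K that unfolding realization_open_def by (elim imageE) simp
    qed
  qed
qed

lemma openin_realization: "openin (realization X act) = realization_open X act"
  by (simp add: realization_def istopology_realization_open topology_inverse')

text \<open>\<open>nsphere n\<close> is the \<open>n\<close>-sphere; the case \<open>n = 0\<close> gives path connectedness.\<close>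

definition weakly_contractible :: "'x topology \<Rightarrow> bool" where
  "weakly_contractible T \<longleftrightarrow>
     topspace T \<noteq> {} \<and>
     (\<forall>n f. continuous_map (nsphere n) T f \<longrightarrow>
        (\<exists>c\<in>topspace T. homotopic_with (\<lambda>_. True) (nsphere n) T f (\<lambda>_. c)))"

definition contractible_category :: "('o, 'a, 'z) cat_scheme \<Rightarrow> bool" where
  "contractible_category K \<longleftrightarrow> weakly_contractible (realization (nerve K) nerve_act)"

end

theory Submission
  imports Defs "HOL-Analysis.Abstract_Topological_Spaces"
begin

text \<open>
  The idea is that \<open>Fact(\<gamma>, y)\<close> contracts onto the factorization that extends a cofibrant replacement
  of \<open>\<gamma>\<close>. A left Quillen \<open>V\<close>-functor \<open>L\<close> on presheaves is the \<open>V\<close>-left Kan extension of its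
  restriction \<open>L y\<close> along \<open>y\<close>. Conversely, every functor \<open>D : C \<rightarrow> M\<close> has an extension, which sends a
  presheaf \<open>F\<close> to the colimit of \<open>D\<close> weighted by \<open>F\<close>; its right adjoint is \<open>m \<mapsto> M(D -, m)\<close>. If the
  objects \<open>D c\<close> are cofibrant, then \<open>M(D c, -)\<close> preserves fibrations and trivial fibrations by the
  pushout-product axiom. As these are objectwise in the projective model structure, the right
  adjoint preserves them too, and the extension is left Quillen (lemma \<open>Lfun_left_quillen\<close>). It is
  also universal: \<open>V\<close>-natural transformations from the extension to any \<open>L'\<close> correspond to ordinary
  transformations \<open>D \<rightarrow> L' y\<close> (theorem \<open>extension_ex1\<close>).

  Let \<open>q : Q \<rightarrow> Id\<close> be a functorial cofibrant replacement on \<open>M\<^sub>0\<close>, and let \<open>\<Phi>\<close> send a factorization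
  \<open>(L, \<eta>)\<close> to the extension of \<open>Q L y\<close>. By universality, \<open>q\<close> induces a transformation from this
  extension to \<open>L\<close>; composing its restriction with \<open>\<eta>\<close> makes \<open>\<Phi> (L, \<eta>)\<close> a factorization, as \<open>q\<close> and
  \<open>\<eta>\<close> are objectwise weak equivalences. So \<open>\<Phi>\<close> is an endofunctor of \<open>Fact(\<gamma>, y)\<close> with a natural
  transformation to the identity. On the other hand \<open>Q \<eta> : Q L y \<rightarrow> Q \<gamma>\<close> induces a natural transformation
  from \<open>\<Phi>\<close> to the constant functor at the extension of \<open>Q \<gamma>\<close>. Both are obtained from the universal
  property alone (locale \<open>weak_factorizations\<close>). A natural transformation induces a homotopy between
  maps of realized nerves (theorem \<open>nerve_homotopy\<close>), so the identity of the realization is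
  homotopic to a constant map, and the realization is weakly contractible.

  Most of the work is to build the extension. Hom objects of presheaves are ends, available since
  \<open>V\<close> is complete. Colimits in \<open>M\<close> weighted by a presheaf are instances of the weighted limits of
  \<open>M\<^sup>o\<^sup>p\<close>, after presheaves have been identified with enriched functors on the free \<open>V\<close>-category on
  \<open>C\<^sup>o\<^sup>p\<close>, and after the objects of \<open>C\<close> have been replaced by elements of the type that measures size
  (theorem \<open>wcolim_exists\<close>).
\<close>

section \<open>Ordinary categories\<close>

lemma homset_iff: "f \<in> homset K x y \<longleftrightarrow> f \<in> Arr K \<and> Dom K f = x \<and> Cod K f = y"
  by (auto simp: homset_def)

locale categ =
  fixes K :: "('o, 'a, 'z) cat_scheme" (structure)
  assumes category: "category K"
begin

lemma Dom_Obj [simp]: "f \<in> Arr K \<Longrightarrow> Dom K f \<in> Obj K"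
  and Cod_Obj [simp]: "f \<in> Arr K \<Longrightarrow> Cod K f \<in> Obj K"
  using category by (auto simp: category_def)

lemma Idn_Arr [simp]: "x \<in> Obj K \<Longrightarrow> Idn K x \<in> Arr K"
  and Dom_Idn [simp]: "x \<in> Obj K \<Longrightarrow> Dom K (Idn K x) = x"
  and Cod_Idn [simp]: "x \<in> Obj K \<Longrightarrow> Cod K (Idn K x) = x"
  using category by (auto simp: category_def homset_def)

lemma homD:
  assumes "f \<in> homset K x y"
  shows "f \<in> Arr K" "Dom K f = x" "Cod K f = y" "x \<in> Obj K" "y \<in> Obj K"
  using assms by (auto simp: homset_iff)

lemma Comp_Arr [simp]: "f \<in> Arr K \<Longrightarrow> g \<in> Arr K \<Longrightarrow> Cod K f = Dom K g \<Longrightarrow> Comp K g f \<in> Arr K"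
  and Dom_Comp [simp]: "f \<in> Arr K \<Longrightarrow> g \<in> Arr K \<Longrightarrow> Cod K f = Dom K g \<Longrightarrow> Dom K (Comp K g f) = Dom K f"
  and Cod_Comp [simp]: "f \<in> Arr K \<Longrightarrow> g \<in> Arr K \<Longrightarrow> Cod K f = Dom K g \<Longrightarrow> Cod K (Comp K g f) = Cod K g"
  using category by (auto simp: category_def homset_def)

lemma Comp_Idn [simp]: "f \<in> Arr K \<Longrightarrow> Dom K f = x \<Longrightarrow> Comp K f (Idn K x) = f"
  and Idn_Comp [simp]: "f \<in> Arr K \<Longrightarrow> Cod K f = x \<Longrightarrow> Comp K (Idn K x) f = f"
  using category by (auto simp: category_def)

lemma Comp_assoc:
  "f \<in> Arr K \<Longrightarrow> g \<in> Arr K \<Longrightarrow> h \<in> Arr K \<Longrightarrow> Cod K f = Dom K g \<Longrightarrow> Cod K g = Dom K h \<Longrightarrow>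
   Comp K (Comp K h g) f = Comp K h (Comp K g f)"
  using category by (auto simp: category_def)

end

lemma is_functorD:
  assumes "is_functor K L F"
  shows "x \<in> Obj K \<Longrightarrow> Fobj F x \<in> Obj L" "f \<in> Arr K \<Longrightarrow> Farr F f \<in> Arr L"
    and "f \<in> Arr K \<Longrightarrow> Dom L (Farr F f) = Fobj F (Dom K f)" "f \<in> Arr K \<Longrightarrow> Cod L (Farr F f) = Fobj F (Cod K f)"
    and "x \<in> Obj K \<Longrightarrow> Farr F (Idn K x) = Idn L (Fobj F x)"
    and "f \<in> Arr K \<Longrightarrow> g \<in> Arr K \<Longrightarrow> Cod K f = Dom K g \<Longrightarrow> Farr F (Comp K g f) = Comp L (Farr F g) (Farr F f)"
  using assms by (auto simp: is_functor_def homset_iff)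

lemma nat_transD:
  assumes "nat_trans K L F G \<theta>"
  shows "x \<in> Obj K \<Longrightarrow> \<theta> x \<in> Arr L" "x \<in> Obj K \<Longrightarrow> Dom L (\<theta> x) = Fobj F x" "x \<in> Obj K \<Longrightarrow> Cod L (\<theta> x) = Fobj G x"
    and "f \<in> Arr K \<Longrightarrow> Comp L (\<theta> (Cod K f)) (Farr F f) = Comp L (Farr G f) (\<theta> (Dom K f))"
  using assms by (auto simp: nat_trans_def homset_iff)

section \<open>Geometric realization and its homotopies\<close>

lemma sum_fibres:
  fixes t :: "nat \<Rightarrow> real"
  assumes "\<And>i. i \<le> m \<Longrightarrow> P (\<theta> i) \<Longrightarrow> \<theta> i \<in> A" "finite A"  "\<And>j. j \<in> A \<Longrightarrow> P j"
  shows "(\<Sum>j\<in>A. simplex_push m \<theta> t j) = (\<Sum>i | i \<le> m \<and> P (\<theta> i). t i)"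
  (is "?lhs = ?rhs")
proof -
  have "?rhs = (\<Sum>j\<in>A. \<Sum>i\<in>{i \<in> {i. i \<le> m \<and> P (\<theta> i)}. \<theta> i = j}. t i)"
    by (rule sum.group [symmetric]) (use assms in auto)
  also have "\<dots> = ?lhs"
    unfolding simplex_push_def by (intro sum.cong) (use assms in auto)
  finally show ?thesis by simp
qed

lemma simplex_push_in_simplex:
  assumes "\<theta> \<in> monotone_maps m n" "t \<in> standard_simplex m"
  shows "simplex_push m \<theta> t \<in> standard_simplex n"
proof -
  have t: "0 \<le> t i" "sum t {..m} = 1" for i
    using assms(2) by (auto simp: standard_simplex_def)
  have \<theta>: "\<theta> i \<le> n" if "i \<le> m" for i
    using assms(1) that by (auto simp: monotone_maps_def)
  have "(\<Sum>j\<le>n. simplex_push m \<theta> t j) = (\<Sum>i | i \<le> m \<and> True. t i)"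
    by (rule sum_fibres) (use \<theta> in auto)
  then have *: "(\<Sum>j\<le>n. simplex_push m \<theta> t j) = 1"
    using t(2) by (simp add: atMost_def)
  have pos: "0 \<le> simplex_push m \<theta> t j" for j
    unfolding simplex_push_def by (rule sum_nonneg) (use t in auto)
  have zero: "simplex_push m \<theta> t j = 0" if "j > n" for j
  proof -
    have "{i. i \<le> m \<and> \<theta> i = j} = {}" using \<theta> that by fastforce
    then show ?thesis by (simp only: simplex_push_def sum.empty)
  qed
  have "simplex_push m \<theta> t j \<le> 1" for j
  proof (cases "j \<le> n")
    case True
    then have "simplex_push m \<theta> t j \<le> (\<Sum>j\<le>n. simplex_push m \<theta> t j)"
      by (intro member_le_sum) (use pos in auto)
    then show ?thesis using * by simp
  qed (use zero in auto)
  then show ?thesis using * pos zero by (auto simp: standard_simplex_def)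
qed

text \<open>A simplicial set, as far as its geometric realization needs one.\<close>

locale simplicial =
  fixes X :: "nat \<Rightarrow> 's set" and act :: "nat \<Rightarrow> (nat \<Rightarrow> nat) \<Rightarrow> 's \<Rightarrow> 's"
  assumes act_closed: "\<And>m n \<theta> x. \<theta> \<in> monotone_maps m n \<Longrightarrow> x \<in> X n \<Longrightarrow> act m \<theta> x \<in> X m"
begin

abbreviation "pre \<equiv> realization_pre X"
abbreviation "req \<equiv> realization_eq X act"

text \<open>The point of the realization with barycentric coordinates \<open>t\<close> in the simplex \<open>x\<close>.\<close>

definition cl :: "nat \<Rightarrow> 's \<Rightarrow> (nat \<Rightarrow> real) \<Rightarrow> (nat \<times> 's \<times> (nat \<Rightarrow> real)) set" where
  "cl n x t = req `` {(n, x, t)}"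

lemma rel_subset: "realization_rel X act \<subseteq> pre \<times> pre"
  by (auto simp: realization_rel_def realization_pre_def act_closed simplex_push_in_simplex)

lemma equiv_req: "equiv pre req"
proof -
  let ?R = "realization_rel X act \<union> (realization_rel X act)\<inverse>"
  have s: "sym (?R\<^sup>*)" by (rule sym_rtrancl) (rule sym_Un_converse)
  have t: "trans (?R\<^sup>*)" by (rule trans_rtrancl)
  show ?thesis unfolding realization_eq_def
  proof (rule equivI)
    show "sym (Restr (?R\<^sup>*) pre)" using s by (auto simp: sym_def)
    show "trans (Restr (?R\<^sup>*) pre)" using t unfolding trans_def by blast
  qed (auto simp: refl_on_def)
qed

text \<open>A function on the disjoint union of the simplices descends to the realization if it respects the
  generating relation, because the equivalence relation consists of zigzags of generators.\<close>

lemma req_induct: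
  assumes "(p, q) \<in> req"
    and "\<And>m n \<theta> x t. \<theta> \<in> monotone_maps m n \<Longrightarrow> x \<in> X n \<Longrightarrow> t \<in> standard_simplex m \<Longrightarrow>
      g (m, act m \<theta> x, t) = g (n, x, simplex_push m \<theta> t)"
  shows "g p = g q"
proof -
  have "(p, q) \<in> (realization_rel X act \<union> (realization_rel X act)\<inverse>)\<^sup>*"
    using assms(1) by (simp add: realization_eq_def)
  then show ?thesis
    by (induction rule: rtrancl_induct) (auto simp: realization_rel_def assms(2))
qed

lemma cl_act:
  assumes "\<theta> \<in> monotone_maps m n" "x \<in> X n" "t \<in> standard_simplex m"
  shows "cl m (act m \<theta> x) t = cl n x (simplex_push m \<theta> t)"
proof -
  have "((m, act m \<theta> x, t), (n, x, simplex_push m \<theta> t)) \<in> realization_rel X act"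
    using assms by (auto simp: realization_rel_def)
  then have "((m, act m \<theta> x, t), (n, x, simplex_push m \<theta> t)) \<in> req"
    using rel_subset by (auto simp: realization_eq_def)
  then show ?thesis
    unfolding cl_def by (rule equiv_class_eq [OF equiv_req])
qed

lemma topspace_realization: "topspace (realization X act) = pre // req"
proof -
  have "realization_open X act (pre // req)"
    unfolding realization_open_def
  proof (intro conjI subset_refl allI ballI)
    fix n x assume "x \<in> X n"
    then have "{t \<in> standard_simplex n. req `` {(n, x, t)} \<in> pre // req} = standard_simplex n"
      by (auto simp: realization_pre_def intro!: quotientI)
    then show "openin (subtopology (powertop_real UNIV) (standard_simplex n))
        {t \<in> standard_simplex n. req `` {(n, x, t)} \<in> pre // req}"
      by (metis openin_topspace topspace_standard_simplex)
  qed
  then show ?thesis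
    unfolding topspace_def openin_realization by (auto simp: realization_open_def)
qed

lemma cl_in_topspace: "x \<in> X n \<Longrightarrow> t \<in> standard_simplex n \<Longrightarrow> cl n x t \<in> topspace (realization X act)"
  by (auto simp: topspace_realization cl_def realization_pre_def intro!: quotientI)

lemma topspace_realizationE:
  assumes "z \<in> topspace (realization X act)"
  obtains n x t where "x \<in> X n" "t \<in> standard_simplex n" "z = cl n x t"
  using assms by (auto simp: topspace_realization cl_def realization_pre_def elim!: quotientE)

abbreviation simplex_top :: "nat \<Rightarrow> (nat \<Rightarrow> real) topology" where
  "simplex_top n \<equiv> subtopology (powertop_real UNIV) (standard_simplex n)"

lemma continuous_cl:
  assumes "x \<in> X n"
  shows "continuous_map (simplex_top n) (realization X act) (cl n x)"
  unfolding continuous_map_def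
proof (intro conjI allI impI)
  show "cl n x \<in> topspace (simplex_top n) \<rightarrow> topspace (realization X act)"
    using assms by (auto simp: cl_in_topspace)
  fix W assume "openin (realization X act) W"
  then show "openin (simplex_top n) {t \<in> topspace (simplex_top n). cl n x t \<in> W}"
    using assms by (simp add: openin_realization realization_open_def cl_def)
qed

text \<open>The disjoint union of which the realization is a quotient.\<close>

definition pre_top :: "(nat \<times> 's \<times> (nat \<Rightarrow> real)) topology" where
  "pre_top = subtopology
     (prod_topology (discrete_topology UNIV) (prod_topology (discrete_topology UNIV) (powertop_real UNIV))) pre"

lemma topspace_pre_top [simp]: "topspace pre_top = pre"
  by (simp add: pre_top_def)

lemma openin_pre_top_slice: "openin pre_top {p \<in> pre. fst p = n \<and> fst (snd p) = x}"
proof -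
  have "openin (prod_topology (discrete_topology UNIV) (prod_topology (discrete_topology UNIV) (powertop_real UNIV)))
      ({n} \<times> ({x} \<times> (UNIV :: (nat \<Rightarrow> real) set)))"
    using openin_topspace [of "powertop_real (UNIV :: nat set)"]
    by (simp add: openin_prod_Times_iff)
  then show ?thesis unfolding pre_top_def openin_subtopology
    by (intro exI[of _ "{n} \<times> ({x} \<times> UNIV)"]) auto
qed

text \<open>A map out of the disjoint union is continuous as soon as it is so on each simplex, also in
  the presence of a parameter.\<close>

lemma continuous_from_pre_top:
  assumes "\<And>n x. x \<in> X n \<Longrightarrow>
      continuous_map (prod_topology I (simplex_top n)) Z (\<lambda>(r, t). h (r, n, x, t))"
  shows "continuous_map (prod_topology I pre_top) Z h"
proof (rule pasting_lemma [where I = "{(n, x). x \<in> X n}"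
      and T = "\<lambda>(n, x). topspace I \<times> {p \<in> pre. fst p = n \<and> fst (snd p) = x}" and f = "\<lambda>_. h"])
  fix i assume i: "i \<in> {(n, x). x \<in> X n}"
  obtain n x where nx: "i = (n, x)" "x \<in> X n" using i by auto
  let ?T = "topspace I \<times> {p \<in> pre. fst p = n \<and> fst (snd p) = x}"
  show "openin (prod_topology I pre_top)
      (case i of (n, x) \<Rightarrow> topspace I \<times> {p \<in> pre. fst p = n \<and> fst (snd p) = x})"
    by (simp add: nx openin_prod_Times_iff openin_pre_top_slice)
  have cd: "continuous_map (subtopology (prod_topology I pre_top) ?T)
      (prod_topology (discrete_topology UNIV) (prod_topology (discrete_topology UNIV) (powertop_real UNIV))) snd"
    by (rule continuous_map_from_subtopology)
      (use continuous_map_snd [of I pre_top] in \<open>auto simp: pre_top_def continuous_map_in_subtopology\<close>)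
  have c3: "continuous_map (subtopology (prod_topology I pre_top) ?T) (powertop_real UNIV) (\<lambda>p. snd (snd (snd p)))"
    using continuous_map_compose [OF cd continuous_map_compose [OF continuous_map_snd continuous_map_snd]]
    by (simp add: o_def)
  have c1: "continuous_map (subtopology (prod_topology I pre_top) ?T) I fst"
    by (intro continuous_map_from_subtopology continuous_map_fst)
  have c: "continuous_map (subtopology (prod_topology I pre_top) ?T) (prod_topology I (simplex_top n))
      (\<lambda>p. (fst p, snd (snd (snd p))))"
    unfolding continuous_map_pairwise continuous_map_in_subtopology o_def
    using c1 c3 by (auto simp: realization_pre_def)
  have "continuous_map (subtopology (prod_topology I pre_top) ?T) Z
      ((\<lambda>(r, t). h (r, n, x, t)) \<circ> (\<lambda>p. (fst p, snd (snd (snd p)))))"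
    by (rule continuous_map_compose [OF c assms [OF nx(2)]])
  then have "continuous_map (subtopology (prod_topology I pre_top) ?T) Z h"
    by (rule continuous_map_eq) auto
  then show "continuous_map (subtopology (prod_topology I pre_top)
      (case i of (n, x) \<Rightarrow> topspace I \<times> {p \<in> pre. fst p = n \<and> fst (snd p) = x})) Z h"
    by (simp add: nx)
next
  fix p assume "p \<in> topspace (prod_topology I pre_top)"
  then show "\<exists>j. j \<in> {(n, x). x \<in> X n} \<and> p \<in> (case j of (n, x) \<Rightarrow>
       topspace I \<times> {p \<in> pre. fst p = n \<and> fst (snd p) = x}) \<and> h p = h p"
    by (intro exI[of _ "(fst (snd p), fst (snd (snd p)))"]) (auto simp: realization_pre_def)
qed auto

text \<open>The topology of the realization is the final one for the maps \<open>cl n x\<close>, which is the quotient of the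
  topology of the disjoint union.\<close>

lemma quotient_map_cl: "quotient_map pre_top (realization X act) (\<lambda>(n, x, t). cl n x t)"
  unfolding quotient_map_def
proof (intro conjI allI impI)
  let ?q = "\<lambda>(n, x, t). cl n x t"
  show "?q ` topspace pre_top = topspace (realization X act)"
    by (auto simp: topspace_realization cl_def quotient_def)
  have cont: "continuous_map pre_top (realization X act) ?q"
  proof -
    have "continuous_map (prod_topology (discrete_topology {()}) pre_top) (realization X act) (?q \<circ> snd)"
    proof (rule continuous_from_pre_top)
      fix n x assume "x \<in> X n"
      then show "continuous_map (prod_topology (discrete_topology {()}) (simplex_top n)) (realization X act)
            (\<lambda>(r, t). (?q \<circ> snd) (r, n, x, t))"
        using continuous_map_compose [OF continuous_map_snd continuous_cl]
        by (simp add: o_def case_prod_unfold)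
    qed
    moreover have "continuous_map pre_top (prod_topology (discrete_topology {()}) pre_top) (\<lambda>p. ((), p))"
      by (simp add: continuous_map_pairwise o_def)
    ultimately have "continuous_map pre_top (realization X act) ((?q \<circ> snd) \<circ> (\<lambda>p. ((), p)))"
      using continuous_map_compose by blast
    then show ?thesis by (simp add: o_def)
  qed
  fix W assume W: "W \<subseteq> topspace (realization X act)"
  show "openin pre_top {p \<in> topspace pre_top. ?q p \<in> W} = openin (realization X act) W"
  proof
    assume "openin (realization X act) W"
    then show "openin pre_top {p \<in> topspace pre_top. ?q p \<in> W}"
      using cont by (simp add: continuous_map_def)
  next
    assume op: "openin pre_top {p \<in> topspace pre_top. ?q p \<in> W}"
    show "openin (realization X act) W"
      unfolding openin_realization realization_open_def
    proof (intro conjI allI ballI)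
      show "W \<subseteq> pre // req" using W by (simp add: topspace_realization)
      fix n x assume x: "x \<in> X n"
      have "continuous_map (simplex_top n) pre_top (\<lambda>t. (n, x, t))"
        unfolding pre_top_def continuous_map_in_subtopology continuous_map_pairwise o_def
        using x by (auto simp: realization_pre_def continuous_map_from_subtopology)
      then have "openin (simplex_top n) {t \<in> topspace (simplex_top n). (n, x, t) \<in> {p \<in> topspace pre_top. ?q p \<in> W}}"
        using op by (simp only: continuous_map_def)
      moreover have "{t \<in> topspace (simplex_top n). (n, x, t) \<in> {p \<in> topspace pre_top. ?q p \<in> W}}
          = {t \<in> standard_simplex n. req `` {(n, x, t)} \<in> W}"
        using x by (auto simp: realization_pre_def cl_def)
      ultimately show "openin (simplex_top n) {t \<in> standard_simplex n. req `` {(n, x, t)} \<in> W}"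
        by simp
    qed
  qed
qed

text \<open>Homotopies on the simplices that respect the simplicial operators descend to the realization,
  since the product with the unit interval, a locally compact Hausdorff space, preserves the quotient
  map.\<close>

lemma homotopy_from_realization:
  fixes h :: "real \<times> nat \<times> 's \<times> (nat \<Rightarrow> real) \<Rightarrow> 'z"
  assumes cont: "\<And>n x. x \<in> X n \<Longrightarrow>
      continuous_map (prod_topology (top_of_set {0..1}) (simplex_top n)) Z (\<lambda>(r, t). h (r, n, x, t))"
    and compat: "\<And>r m n \<theta> x t. r \<in> {0..1} \<Longrightarrow> \<theta> \<in> monotone_maps m n \<Longrightarrow> x \<in> X n \<Longrightarrow>
      t \<in> standard_simplex m \<Longrightarrow> h (r, m, act m \<theta> x, t) = h (r, n, x, simplex_push m \<theta> t)"
  obtains H where "continuous_map (prod_topology (top_of_set {0..1::real}) (realization X act)) Z H"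
    and "\<And>r n x t. r \<in> {0..1} \<Longrightarrow> x \<in> X n \<Longrightarrow> t \<in> standard_simplex n \<Longrightarrow> H (r, cl n x t) = h (r, n, x, t)"
proof -
  define H where "H = (\<lambda>(r, z). h (r, SOME p. p \<in> z))"
  have H: "H (r, cl n x t) = h (r, n, x, t)" if "r \<in> {0..1}" "x \<in> X n" "t \<in> standard_simplex n" for r n x t
  proof -
    have "(n, x, t) \<in> cl n x t"
      unfolding cl_def by (rule equiv_class_self [OF equiv_req]) (use that in \<open>auto simp: realization_pre_def\<close>)
    then have "(SOME p. p \<in> cl n x t) \<in> cl n x t" by (rule someI)
    then have "((n, x, t), SOME p. p \<in> cl n x t) \<in> req" by (simp add: cl_def)
    then have "h (r, n, x, t) = h (r, SOME p. p \<in> cl n x t)"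
      by (rule req_induct [where g = "\<lambda>p. h (r, p)"]) (use compat that in auto)
    then show ?thesis by (simp add: H_def)
  qed
  have q: "quotient_map (prod_topology (top_of_set {0..1::real}) pre_top)
      (prod_topology (top_of_set {0..1}) (realization X act)) (\<lambda>(r, p). (r, (\<lambda>(n, x, t). cl n x t) p))"
  proof (rule quotient_map_prod_right)
    show "locally_compact_space (top_of_set {0..1::real})"
      by (intro compact_imp_locally_compact_space) (simp add: compact_space_subtopology)
  qed (auto simp: quotient_map_cl Hausdorff_space_subtopology)
  have "continuous_map (prod_topology (top_of_set {0..1::real}) pre_top) Z
      (H \<circ> (\<lambda>(r, p). (r, (\<lambda>(n, x, t). cl n x t) p)))"
    by (rule continuous_map_eq [OF continuous_from_pre_top [OF cont]])
      (auto simp: H realization_pre_def)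
  then have "continuous_map (prod_topology (top_of_set {0..1}) (realization X act)) Z H"
    using continuous_compose_quotient_map [OF q] by blast
  then show thesis using H that by blast
qed

end

section \<open>The nerve\<close>

lemma Obj_ordinal_cat [simp]: "Obj (ordinal_cat n) = {..n}"
proof -
  have "k \<in> Field {(i, j). i \<le> j \<and> j \<le> n}" if "k \<le> n" for k
    using that by (intro FieldI1 [of k k]) auto
  then show ?thesis by (auto simp: ordinal_cat_def order_cat_def Field_def)
qed

lemma Arr_ordinal_cat [simp]: "Arr (ordinal_cat n) = {(i, j). i \<le> j \<and> j \<le> n}"
  and Dom_ordinal_cat [simp]: "Dom (ordinal_cat n) = fst"
  and Cod_ordinal_cat [simp]: "Cod (ordinal_cat n) = snd"
  and Idn_ordinal_cat [simp]: "Idn (ordinal_cat n) = (\<lambda>i. (i, i))"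
  and Comp_ordinal_cat [simp]: "Comp (ordinal_cat n) = (\<lambda>g f. (fst f, snd g))"
  by (simp_all add: ordinal_cat_def order_cat_def)

lemma nerve_iff:
  "s \<in> nerve K n \<longleftrightarrow>
     Fobj s \<in> {..n} \<rightarrow>\<^sub>E Obj K \<and> Farr s \<in> {(i, j). i \<le> j \<and> j \<le> n} \<rightarrow>\<^sub>E Arr K \<and>
     (\<forall>i j. i \<le> j \<longrightarrow> j \<le> n \<longrightarrow> Dom K (Farr s (i, j)) = Fobj s i \<and> Cod K (Farr s (i, j)) = Fobj s j) \<and>
     (\<forall>i\<le>n. Farr s (i, i) = Idn K (Fobj s i)) \<and>
     (\<forall>i j k. i \<le> j \<longrightarrow> j \<le> k \<longrightarrow> k \<le> n \<longrightarrow> Farr s (i, k) = Comp K (Farr s (j, k)) (Farr s (i, j)))"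
  (is "_ = ?R")
proof
  assume "s \<in> nerve K n"
  then have s: "is_functor (ordinal_cat n) K s" by (simp add: nerve_def)
  have 1: "Fobj s \<in> {..n} \<rightarrow>\<^sub>E Obj K" and 2: "Farr s \<in> {(i, j). i \<le> j \<and> j \<le> n} \<rightarrow>\<^sub>E Arr K"
    using s by (simp_all add: is_functor_def)
  have 3: "Farr s f \<in> homset K (Fobj s (fst f)) (Fobj s (snd f))" if "f \<in> {(i, j). i \<le> j \<and> j \<le> n}" for f
    using s that by (simp only: is_functor_def Arr_ordinal_cat Dom_ordinal_cat Cod_ordinal_cat)
  have 4: "Farr s (i, i) = Idn K (Fobj s i)" if "i \<le> n" for i
    using s that by (simp add: is_functor_def)
  have 5: "Farr s (fst f, snd g) = Comp K (Farr s g) (Farr s f)"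
    if "f \<in> {(i, j). i \<le> j \<and> j \<le> n}" "g \<in> {(i, j). i \<le> j \<and> j \<le> n}" "snd f = fst g" for f g
    using s that by (simp only: is_functor_def Arr_ordinal_cat Dom_ordinal_cat Cod_ordinal_cat Comp_ordinal_cat)
  show ?R
  proof (intro conjI allI impI)
    show "Dom K (Farr s (i, j)) = Fobj s i" "Cod K (Farr s (i, j)) = Fobj s j" if "i \<le> j" "j \<le> n" for i j
      using 3 [of "(i, j)"] that by (simp_all add: homset_iff)
    show "Farr s (i, k) = Comp K (Farr s (j, k)) (Farr s (i, j))" if "i \<le> j" "j \<le> k" "k \<le> n" for i j k
      using 5 [of "(i, j)" "(j, k)"] that by simp
  qed (use 1 2 4 in simp_all)
next
  assume r: ?R
  show "s \<in> nerve K n"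
    unfolding nerve_def mem_Collect_eq is_functor_def Obj_ordinal_cat Arr_ordinal_cat
      Dom_ordinal_cat Cod_ordinal_cat Idn_ordinal_cat Comp_ordinal_cat
  proof (intro conjI ballI impI)
    fix f assume "f \<in> {(i, j). i \<le> j \<and> j \<le> n}"
    then show "Farr s f \<in> homset K (Fobj s (fst f)) (Fobj s (snd f))"
      using r by (cases f) (simp add: homset_iff PiE_iff)
  next
    fix f g :: "nat \<times> nat"
    assume f: "f \<in> {(i, j). i \<le> j \<and> j \<le> n}" and g: "g \<in> {(i, j). i \<le> j \<and> j \<le> n}" and fg: "snd f = fst g"
    have "\<forall>i j k. i \<le> j \<longrightarrow> j \<le> k \<longrightarrow> k \<le> n \<longrightarrow> Farr s (i, k) = Comp K (Farr s (j, k)) (Farr s (i, j))"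
      using r by blast
    then have "Farr s (fst f, snd g) = Comp K (Farr s (fst g, snd g)) (Farr s (fst f, fst g))"
      by (rule allE [where x = "fst f"], elim allE [where x = "fst g"] allE [where x = "snd g"])
        (use f g fg in auto)
    moreover have "(fst f, fst g) = f" by (simp flip: fg)
    ultimately show "Farr s (fst f, snd g) = Comp K (Farr s g) (Farr s f)"
      by (simp only: prod.collapse)
  next
    show "Fobj s \<in> {..n} \<rightarrow>\<^sub>E Obj K" using r by (elim conjE)
    show "Farr s \<in> {(i, j). i \<le> j \<and> j \<le> n} \<rightarrow>\<^sub>E Arr K" using r by (elim conjE)
    fix i assume "i \<in> {..n}"
    moreover have "\<forall>i\<le>n. Farr s (i, i) = Idn K (Fobj s i)" using r by (elim conjE) assumption
    ultimately show "Farr s (i, i) = Idn K (Fobj s i)" by simp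
  qed
qed

lemma nerveD:
  assumes "s \<in> nerve K n"
  shows "k \<le> n \<Longrightarrow> Fobj s k \<in> Obj K"
    and "j \<le> k \<Longrightarrow> k \<le> n \<Longrightarrow> Farr s (j, k) \<in> Arr K"
    and "j \<le> k \<Longrightarrow> k \<le> n \<Longrightarrow> Dom K (Farr s (j, k)) = Fobj s j"
    and "j \<le> k \<Longrightarrow> k \<le> n \<Longrightarrow> Cod K (Farr s (j, k)) = Fobj s k"
    and "k \<le> n \<Longrightarrow> Farr s (k, k) = Idn K (Fobj s k)"
    and "j \<le> k \<Longrightarrow> k \<le> l \<Longrightarrow> l \<le> n \<Longrightarrow> Farr s (j, l) = Comp K (Farr s (k, l)) (Farr s (j, k))"
  using assms unfolding nerve_iff by (blast intro: PiE_mem)+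

lemma functr_eqI: "Fobj F = Fobj G \<Longrightarrow> Farr F = Farr G \<Longrightarrow> F = (G :: ('o, 'a, 'p, 'b) functr)"
  by (cases F, cases G) simp

lemma monotone_mapsD:
  assumes "\<theta> \<in> monotone_maps m n"
  shows "i \<le> m \<Longrightarrow> \<theta> i \<le> n" "i \<le> j \<Longrightarrow> j \<le> m \<Longrightarrow> \<theta> i \<le> \<theta> j"
  using assms by (auto simp: monotone_maps_def PiE_def Pi_def)

lemma Fobj_nerve_act: "Fobj (nerve_act m \<theta> s) = (\<lambda>i\<in>{..m}. Fobj s (\<theta> i))"
  and Farr_nerve_act: "Farr (nerve_act m \<theta> s) =
      (\<lambda>(i, j)\<in>{(i, j). i \<le> j \<and> j \<le> m}. Farr s (\<theta> i, \<theta> j))"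
  by (auto simp: nerve_act_def functor_comp_def fun_eq_iff restrict_def)

lemma nerve_act_closed:
  assumes "\<theta> \<in> monotone_maps m n" "s \<in> nerve K n"
  shows "nerve_act m \<theta> s \<in> nerve K m"
  using assms(2) monotone_mapsD[OF assms(1)] unfolding nerve_iff Fobj_nerve_act Farr_nerve_act
  by (auto simp: PiE_iff)

lemma simplicial_nerve: "simplicial (nerve K) nerve_act"
  by (simp add: simplicial_def nerve_act_closed)

text \<open>A transformation from \<open>F\<close> to \<open>G\<close> turns a chain \<open>s\<^sub>0 \<rightarrow> \<dots> \<rightarrow> s\<^sub>n\<close> into the chain
  \<open>F s\<^sub>0 \<rightarrow> \<dots> \<rightarrow> F s\<^sub>i \<rightarrow> G s\<^sub>i \<rightarrow> \<dots> \<rightarrow> G s\<^sub>n\<close>.\<close>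

definition prism ::
  "('p, 'b, 'z) cat_scheme \<Rightarrow> ('o, 'a, 'p, 'b) functr \<Rightarrow> ('o, 'a, 'p, 'b) functr \<Rightarrow> ('o \<Rightarrow> 'b) \<Rightarrow>
   nat \<Rightarrow> nat \<Rightarrow> (nat, nat \<times> nat, 'o, 'a) functr \<Rightarrow> (nat, nat \<times> nat, 'p, 'b) functr" where
  "prism L F G a n i s =
     \<lparr>Fobj = (\<lambda>k\<in>{..Suc n}. if k \<le> i then Fobj F (Fobj s k) else Fobj G (Fobj s (k - 1))),
      Farr = (\<lambda>(j, k)\<in>{(j, k). j \<le> k \<and> k \<le> Suc n}.
        if k \<le> i then Farr F (Farr s (j, k))
        else if j \<le> i then Comp L (a (Fobj s (k - 1))) (Farr F (Farr s (j, k - 1)))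
        else Farr G (Farr s (j - 1, k - 1)))\<rparr>"

text \<open>The barycentric coordinates, in that chain, of the point at height \<open>r\<close> over \<open>t\<close> of the prism;
  \<open>r\<close> has to lie in the \<open>i\<close>-th of the intervals into which \<open>t\<close> divides the unit interval.\<close>

definition prism_coord :: "nat \<Rightarrow> (nat \<Rightarrow> real) \<Rightarrow> real \<Rightarrow> nat \<Rightarrow> real" where
  "prism_coord i t r k =
     (if k < i then t k else if k = i then r - sum t {..<i}
      else if k = Suc i then sum t {..i} - r else t (k - 1))"

definition prism_valid :: "nat \<Rightarrow> nat \<Rightarrow> (nat \<Rightarrow> real) \<Rightarrow> real \<Rightarrow> bool" where
  "prism_valid n i t r \<longleftrightarrow> i \<le> n \<and> sum t {..<i} \<le> r \<and> r \<le> sum t {..i}"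

lemma sum_prism_coord_le:
  "k \<le> i \<Longrightarrow> sum (prism_coord i t r) {..<k} = sum t {..<k}"
  "Suc i \<le> k \<Longrightarrow> sum (prism_coord i t r) {..k} = sum t {..<k}"
proof -
  show 1: "k \<le> i \<Longrightarrow> sum (prism_coord i t r) {..<k} = sum t {..<k}" for k
    by (intro sum.cong) (auto simp: prism_coord_def)
  show "Suc i \<le> k \<Longrightarrow> sum (prism_coord i t r) {..k} = sum t {..<k}"
  proof (induction k rule: dec_induct)
    case base
    have "sum (prism_coord i t r) {..Suc i} =
        sum (prism_coord i t r) {..<i} + prism_coord i t r i + prism_coord i t r (Suc i)"
      by (simp flip: lessThan_Suc_atMost)
    then show ?case by (simp add: 1) (simp add: prism_coord_def flip: lessThan_Suc_atMost)
  next
    case (step k)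
    then show ?case by (simp add: prism_coord_def)
  qed
qed

lemma prism_coord_in_simplex:
  assumes t: "t \<in> standard_simplex n" and v: "prism_valid n i t r"
  shows "prism_coord i t r \<in> standard_simplex (Suc n)"
proof -
  let ?c = "prism_coord i t r"
  have pos: "0 \<le> ?c k" for k
    using assms by (auto simp: prism_coord_def prism_valid_def standard_simplex_def)
  have sum: "sum ?c {..Suc n} = 1"
    using t v by (subst sum_prism_coord_le(2))
      (auto simp: prism_valid_def standard_simplex_def lessThan_Suc_atMost)
  have zero: "?c k = 0" if "k > Suc n" for k
    using that t v by (auto simp: prism_coord_def prism_valid_def standard_simplex_def)
  have "?c k \<le> 1" for k
  proof (cases "k \<le> Suc n")
    case True
    then have "?c k \<le> sum ?c {..Suc n}"
      by (intro member_le_sum) (use pos in auto)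
    then show ?thesis using sum by simp
  qed (use zero in auto)
  then show ?thesis using pos sum zero by (auto simp: standard_simplex_def)
qed

definition face :: "nat \<Rightarrow> nat \<Rightarrow> nat \<Rightarrow> nat" where
  "face n i = (\<lambda>k\<in>{..n}. if k \<le> i then k else Suc k)"

lemma face_monotone: "face n i \<in> monotone_maps n (Suc n)"
  by (auto simp: face_def monotone_maps_def PiE_iff)

text \<open>The \<open>i\<close>-th face operator inserts a vanishing coordinate after the \<open>i\<close>-th one.\<close>

lemma simplex_push_face:
  assumes "t \<in> standard_simplex n" "i \<le> n"
  shows "simplex_push n (face n i) t = (\<lambda>k. if k \<le> i then t k else if k = Suc i then 0 else t (k - 1))"
proof
  fix k
  have t: "t j = 0" if "j > n" for j using assms that by (auto simp: standard_simplex_def)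
  have "{j. j \<le> n \<and> face n i j = k} =
      (if k \<le> i then {k} else if k = Suc i then {} else if k \<le> Suc n then {k - 1} else {})"
    using assms(2) by (auto simp: face_def split: if_splits)
  then show "simplex_push n (face n i) t k = (if k \<le> i then t k else if k = Suc i then 0 else t (k - 1))"
    using t by (auto simp: simplex_push_def)
qed

text \<open>A simplicial operator \<open>\<theta>\<close> from dimension \<open>m\<close> to \<open>n\<close> carries the \<open>i\<close>-th piece of a prism to the
  \<open>\<theta> i\<close>-th one: in the chain that doubles the vertex \<open>i\<close>, it acts by \<open>\<theta>\<close> on either side of the
  doubling.\<close>

definition hat :: "nat \<Rightarrow> (nat \<Rightarrow> nat) \<Rightarrow> nat \<Rightarrow> nat \<Rightarrow> nat" where
  "hat m \<theta> i = (\<lambda>k\<in>{..Suc m}. if k \<le> i then \<theta> k else Suc (\<theta> (k - 1)))"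

lemma hat_monotone:
  assumes "\<theta> \<in> monotone_maps m n" "i \<le> m"
  shows "hat m \<theta> i \<in> monotone_maps (Suc m) (Suc n)"
proof -
  have "hat m \<theta> i j \<le> hat m \<theta> i k" if "j \<le> k" "k \<le> Suc m" for j k
  proof -
    consider "k \<le> i" | "j \<le> i" "i < k" | "i < j" using that by linarith
    then show ?thesis
    proof cases
      case 1 then show ?thesis using monotone_mapsD[OF assms(1)] that assms(2) by (auto simp: hat_def)
    next
      case 2
      then have "\<theta> j \<le> \<theta> (k - 1)" using monotone_mapsD(2)[OF assms(1), of j "k - 1"] that by auto
      then show ?thesis using 2 that by (auto simp: hat_def)
    next
      case 3
      then have "\<theta> (j - 1) \<le> \<theta> (k - 1)" using monotone_mapsD(2)[OF assms(1), of "j - 1" "k - 1"] that by auto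
      then show ?thesis using 3 that by (auto simp: hat_def)
    qed
  qed
  moreover have "hat m \<theta> i k \<le> Suc n" if "k \<le> Suc m" for k
    using monotone_mapsD(1)[OF assms(1), of k] monotone_mapsD(1)[OF assms(1), of "k - 1"] that assms(2)
    by (auto simp: hat_def)
  ultimately show ?thesis by (auto simp: monotone_maps_def hat_def PiE_iff)
qed

text \<open>Pushing \<open>t\<close> forward along \<open>\<theta>\<close> merges the intervals into which \<open>t\<close> divides the unit interval. So the
  interval that contains \<open>r\<close> becomes part of the one with index \<open>\<theta> i\<close>, and the two
  coordinates next to the cut at \<open>r\<close> are the only ones that are not sums over fibres of \<open>\<theta>\<close>.\<close>

lemma prism_valid_push:
  assumes \<theta>: "\<theta> \<in> monotone_maps m n" and t: "t \<in> standard_simplex m" and v: "prism_valid m i t r"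
  shows "prism_valid n (\<theta> i) (simplex_push m \<theta> t) r"
    and "simplex_push (Suc m) (hat m \<theta> i) (prism_coord i t r) = prism_coord (\<theta> i) (simplex_push m \<theta> t) r"
proof -
  have i: "i \<le> m" and r: "sum t {..<i} \<le> r" "r \<le> sum t {..i}" using v by (auto simp: prism_valid_def)
  have pos: "0 \<le> t k" for k using t by (auto simp: standard_simplex_def)
  note \<theta>D = monotone_mapsD[OF \<theta>]
  let ?p = "simplex_push m \<theta> t" and ?c = "prism_coord i t r"
  have less: "sum ?p {..<j} = (\<Sum>k | k \<le> m \<and> \<theta> k < j. t k)" for j
    by (rule sum_fibres) auto
  have le: "sum ?p {..j} = (\<Sum>k | k \<le> m \<and> \<theta> k \<le> j. t k)" for j
    by (rule sum_fibres) auto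
  have A: "{k. k \<le> m \<and> \<theta> k < \<theta> i} \<subseteq> {..<i}" using \<theta>D(2)[of i] by (fastforce simp: not_le[symmetric])
  have B: "{..i} \<subseteq> {k. k \<le> m \<and> \<theta> k \<le> \<theta> i}" using \<theta>D(2) i by auto
  have "sum ?p {..<\<theta> i} \<le> sum t {..<i}" unfolding less using A by (intro sum_mono2) (auto simp: pos)
  moreover have "sum t {..i} \<le> sum ?p {..\<theta> i}" unfolding le using B by (intro sum_mono2) (auto simp: pos)
  ultimately show "prism_valid n (\<theta> i) ?p r"
    using r \<theta>D(1) i by (auto simp: prism_valid_def)
  show "simplex_push (Suc m) (hat m \<theta> i) ?c = prism_coord (\<theta> i) ?p r"
  proof
    fix j
    let ?S = "{k. k \<le> Suc m \<and> hat m \<theta> i k = j}"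
    let ?Lo = "{k. k \<le> i \<and> \<theta> k = j}" and ?Hi = "{k. i \<le> k \<and> k \<le> m \<and> Suc (\<theta> k) = j}"
    have S: "?S = ?Lo \<union> Suc ` ?Hi"
    proof (rule Set.set_eqI)
      fix k show "k \<in> ?S \<longleftrightarrow> k \<in> ?Lo \<union> Suc ` ?Hi"
        using i by (cases k) (auto simp: hat_def)
    qed
    have "simplex_push (Suc m) (hat m \<theta> i) ?c j = sum ?c ?Lo + sum ?c (Suc ` ?Hi)"
      unfolding simplex_push_def S by (rule sum.union_disjoint) auto
    also have "sum ?c (Suc ` ?Hi) = sum (\<lambda>k. ?c (Suc k)) ?Hi"
      by (simp add: sum.reindex)
    finally have eq: "simplex_push (Suc m) (hat m \<theta> i) ?c j = sum ?c ?Lo + sum (\<lambda>k. ?c (Suc k)) ?Hi" .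
    have p: "?p j = sum t {k. k \<le> m \<and> \<theta> k = j}" for j by (simp add: simplex_push_def)
    consider "j < \<theta> i" | "j = \<theta> i" | "j = Suc (\<theta> i)" | "j > Suc (\<theta> i)" by linarith
    then show "simplex_push (Suc m) (hat m \<theta> i) ?c j = prism_coord (\<theta> i) ?p r j"
    proof cases
      case 1
      have Hi: "?Hi = {}" using 1 \<theta>D(2)[of i] by fastforce
      have Lo: "{k. k \<le> m \<and> \<theta> k = j} = ?Lo"
      proof (rule Collect_cong)
        fix k
        have "k \<le> i" if "k \<le> m" "\<theta> k = j" using 1 \<theta>D(2)[of i k] that by linarith
        then show "(k \<le> m \<and> \<theta> k = j) = (k \<le> i \<and> \<theta> k = j)" using i by auto
      qed
      have "sum ?c ?Lo = sum t ?Lo" using 1 by (intro sum.cong) (auto simp: prism_coord_def)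
      then show ?thesis unfolding eq Hi using 1 by (simp add: p Lo prism_coord_def [of "\<theta> i"])
    next
      case 2
      have Hi: "?Hi = {}" using 2 \<theta>D(2)[of i] by fastforce
      have Lo: "?Lo = insert i {k. k < i \<and> \<theta> k = j}" using 2 by auto
      have "sum ?c ?Lo = (r - sum t {..<i}) + sum ?c {k. k < i \<and> \<theta> k = j}"
        unfolding Lo by (subst sum.insert) (auto simp: prism_coord_def)
      also have "sum ?c {k. k < i \<and> \<theta> k = j} = sum t {k. k < i \<and> \<theta> k = j}"
        by (intro sum.cong) (auto simp: prism_coord_def)
      also have "sum t {..<i} = sum t {k. k < i \<and> \<theta> k = j} + sum t {k. k \<le> m \<and> \<theta> k < \<theta> i}"
      proof -
        have "{..<i} = {k. k < i \<and> \<theta> k = j} \<union> {k. k \<le> m \<and> \<theta> k < \<theta> i}"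
        proof (intro Set.set_eqI)
          fix k
          have "\<theta> k \<le> \<theta> i" if "k < i" using \<theta>D(2)[of k i] i that by simp
          then show "k \<in> {..<i} \<longleftrightarrow> k \<in> {k. k < i \<and> \<theta> k = j} \<union> {k. k \<le> m \<and> \<theta> k < \<theta> i}"
            using A i 2 by auto
        qed
        moreover have "sum t ({k. k < i \<and> \<theta> k = j} \<union> {k. k \<le> m \<and> \<theta> k < \<theta> i}) =
            sum t {k. k < i \<and> \<theta> k = j} + sum t {k. k \<le> m \<and> \<theta> k < \<theta> i}"
          by (rule sum.union_disjoint) (use 2 in auto)
        ultimately show ?thesis by simp
      qed
      finally have "sum ?c ?Lo = r - sum ?p {..<\<theta> i}" by (simp add: less)
      then show ?thesis unfolding eq Hi using 2 by (simp add: prism_coord_def [of "\<theta> i"])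
    next
      case 3
      have Lo: "?Lo = {}" using 3 \<theta>D(2)[of _ i] i by fastforce
      have Hi: "?Hi = insert i {k. i < k \<and> k \<le> m \<and> \<theta> k = \<theta> i}" using 3 i by auto
      have "sum (\<lambda>k. ?c (Suc k)) ?Hi = (sum t {..i} - r) + sum (\<lambda>k. ?c (Suc k)) {k. i < k \<and> k \<le> m \<and> \<theta> k = \<theta> i}"
        unfolding Hi by (subst sum.insert) (auto simp: prism_coord_def)
      also have "sum (\<lambda>k. ?c (Suc k)) {k. i < k \<and> k \<le> m \<and> \<theta> k = \<theta> i} = sum t {k. i < k \<and> k \<le> m \<and> \<theta> k = \<theta> i}"
        by (intro sum.cong) (auto simp: prism_coord_def)
      also have "(sum t {..i} - r) + \<dots> = sum ?p {..\<theta> i} - r"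
      proof -
        have "{k. k \<le> m \<and> \<theta> k \<le> \<theta> i} = {..i} \<union> {k. i < k \<and> k \<le> m \<and> \<theta> k = \<theta> i}"
        proof (intro Set.set_eqI)
          fix k
          have "\<theta> i \<le> \<theta> k" if "i < k" "k \<le> m" using \<theta>D(2)[of i k] that by simp
          then show "k \<in> {k. k \<le> m \<and> \<theta> k \<le> \<theta> i} \<longleftrightarrow> k \<in> {..i} \<union> {k. i < k \<and> k \<le> m \<and> \<theta> k = \<theta> i}"
            using subsetD [OF B, of k] i by (cases "i < k") auto
        qed
        moreover have "sum t ({..i} \<union> {k. i < k \<and> k \<le> m \<and> \<theta> k = \<theta> i}) = sum t {..i} + sum t {k. i < k \<and> k \<le> m \<and> \<theta> k = \<theta> i}"
          by (rule sum.union_disjoint) auto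
        ultimately show ?thesis by (simp add: le)
      qed
      finally show ?thesis unfolding eq Lo using 3 by (simp add: prism_coord_def [of "\<theta> i"])
    next
      case 4
      have Lo: "?Lo = {}" using 4 \<theta>D(2)[of _ i] i by fastforce
      have Hi: "?Hi = {k. k \<le> m \<and> \<theta> k = j - 1}"
      proof (rule Collect_cong)
        fix k
        have "i \<le> k" if "\<theta> k = j - 1" using 4 i \<theta>D(2)[of k i] that by linarith
        then show "(i \<le> k \<and> k \<le> m \<and> Suc (\<theta> k) = j) = (k \<le> m \<and> \<theta> k = j - 1)" using 4 by auto
      qed
      have "sum (\<lambda>k. ?c (Suc k)) ?Hi = sum t ?Hi"
        using 4 by (intro sum.cong) (auto simp: prism_coord_def)
      then show ?thesis unfolding eq Lo using 4 by (simp add: prism_coord_def [of "\<theta> i"] p Hi)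
    qed
  qed
qed

text \<open>A natural transformation is a functor on the product with the arrow category. On realizations this is
  a homotopy; it is described here by the usual decomposition of the prism over a simplex.\<close>

locale transformation =
  K: categ K + L: categ L
  for K :: "('o, 'a, 'y) cat_scheme" and L :: "('p, 'b, 'z) cat_scheme" +
  fixes F G :: "('o, 'a, 'p, 'b) functr" and a :: "'o \<Rightarrow> 'b"
  assumes F: "is_functor K L F" and G: "is_functor K L G" and a: "nat_trans K L F G a"
begin

lemmas F_simps [simp] = is_functorD [OF F]
lemmas G_simps [simp] = is_functorD [OF G]
lemmas a_simps [simp] = nat_transD(1-3) [OF a]
lemmas a_natural = nat_transD(4) [OF a]

lemma prism_nerve:
  assumes s: "s \<in> nerve K n" and i: "i \<le> n"
  shows "prism L F G a n i s \<in> nerve L (Suc n)"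
proof -
  note [simp] = nerveD(1-5) [OF s] and sc = nerveD(6) [OF s]
  let ?p = "prism L F G a n i s"
  have po: "Fobj ?p k = (if k \<le> i then Fobj F (Fobj s k) else Fobj G (Fobj s (k - 1)))" if "k \<le> Suc n" for k
    using that by (simp add: prism_def)
  have pa: "Farr ?p (j, k) = (if k \<le> i then Farr F (Farr s (j, k))
        else if j \<le> i then Comp L (a (Fobj s (k - 1))) (Farr F (Farr s (j, k - 1)))
        else Farr G (Farr s (j - 1, k - 1)))" if "j \<le> k" "k \<le> Suc n" for j k
    using that by (simp add: prism_def)
  show ?thesis unfolding nerve_iff
  proof (intro conjI allI impI)
    show "Fobj ?p \<in> {..Suc n} \<rightarrow>\<^sub>E Obj L"
      using i by (auto simp: prism_def)
    show "Farr ?p \<in> {(i, j). i \<le> j \<and> j \<le> Suc n} \<rightarrow>\<^sub>E Arr L"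
      using i by (auto simp: prism_def PiE_iff)
    show "Dom L (Farr ?p (j, k)) = Fobj ?p j" "Cod L (Farr ?p (j, k)) = Fobj ?p k" if "j \<le> k" "k \<le> Suc n" for j k
      using i that by (auto simp: po pa)
    show "Farr ?p (k, k) = Idn L (Fobj ?p k)" if "k \<le> Suc n" for k
      using i that by (auto simp: po pa)
    fix j k l assume jkl: "j \<le> k" "k \<le> l" "l \<le> Suc n"
    consider "l \<le> i" | "k \<le> i" "i < l" | "j \<le> i" "i < k" | "i < j" by linarith
    then show "Farr ?p (j, l) = Comp L (Farr ?p (k, l)) (Farr ?p (j, k))"
    proof cases
      case 1
      then show ?thesis using jkl i sc [of j k l] by (simp add: pa)
    next
      case 2
      then show ?thesis using jkl i sc [of j k "l - 1"] by (auto simp: pa L.Comp_assoc)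
    next
      case 3
      then have "j \<le> k - 1" "k - 1 \<le> l - 1" "l - 1 \<le> n" "k - 1 \<le> n" "j \<le> l - 1" using jkl by auto
      then have "Comp L (a (Fobj s (l - 1))) (Farr F (Farr s (j, l - 1))) =
          Comp L (Comp L (a (Fobj s (l - 1))) (Farr F (Farr s (k - 1, l - 1)))) (Farr F (Farr s (j, k - 1)))"
        using sc [of j "k - 1" "l - 1"] by (simp add: L.Comp_assoc)
      also have "Comp L (a (Fobj s (l - 1))) (Farr F (Farr s (k - 1, l - 1))) =
          Comp L (Farr G (Farr s (k - 1, l - 1))) (a (Fobj s (k - 1)))"
        using a_natural [of "Farr s (k - 1, l - 1)"] \<open>k - 1 \<le> l - 1\<close> \<open>l - 1 \<le> n\<close> by simp
      finally show ?thesis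
        using 3 jkl \<open>j \<le> k - 1\<close> \<open>k - 1 \<le> l - 1\<close> \<open>l - 1 \<le> n\<close> \<open>k - 1 \<le> n\<close> by (simp add: pa L.Comp_assoc)
    next
      case 4
      then have "j - 1 \<le> k - 1" "k - 1 \<le> l - 1" "l - 1 \<le> n" "k - 1 \<le> n" using jkl by auto
      then show ?thesis using 4 jkl i sc [of "j - 1" "k - 1" "l - 1"] by (simp add: pa)
    qed
  qed
qed

lemma prism_act:
  assumes \<theta>: "\<theta> \<in> monotone_maps m n" and i: "i \<le> m"
  shows "prism L F G a m i (nerve_act m \<theta> s) = nerve_act (Suc m) (hat m \<theta> i) (prism L F G a n (\<theta> i) s)"
  (is "?lhs = ?rhs")
proof (rule functr_eqI)
  note \<theta>D = monotone_mapsD[OF \<theta>]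
  have hm: "hat m \<theta> i k \<le> Suc n" if "k \<le> Suc m" for k
    using monotone_mapsD(1)[OF hat_monotone[OF \<theta> i]] that by auto
  have h: "hat m \<theta> i k = (if k \<le> i then \<theta> k else Suc (\<theta> (k - 1)))" if "k \<le> Suc m" for k
    using that by (simp add: hat_def)
  have h1: "\<theta> k \<le> \<theta> i" if "k \<le> i" for k using \<theta>D(2) that i by auto
  have h2: "\<theta> i \<le> \<theta> (k - 1)" if "i < k" "k \<le> Suc m" for k using \<theta>D(2)[of i "k - 1"] that by auto
  show "Fobj ?lhs = Fobj ?rhs"
  proof
    fix k
    show "Fobj ?lhs k = Fobj ?rhs k"
    proof (cases "k \<le> Suc m")
      case True
      then show ?thesis using i hm[OF True] h1[of k] h2[of k] \<theta>D(1)
        by (cases "k \<le> i") (auto simp: prism_def Fobj_nerve_act h[OF True])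
    qed (simp add: prism_def Fobj_nerve_act)
  qed
  show "Farr ?lhs = Farr ?rhs"
  proof
    fix jk :: "nat \<times> nat"
    obtain j k where jk: "jk = (j, k)" by fastforce
    show "Farr ?lhs jk = Farr ?rhs jk"
    proof (cases "j \<le> k \<and> k \<le> Suc m")
      case True
      then have le: "hat m \<theta> i j \<le> hat m \<theta> i k" "hat m \<theta> i k \<le> Suc n"
        using monotone_mapsD[OF hat_monotone[OF \<theta> i]] by auto
      have j: "j \<le> Suc m" and k: "k \<le> Suc m" using True by auto
      have e1: "Farr ?rhs jk =
          Farr (prism L F G a n (\<theta> i) s) (hat m \<theta> i j, hat m \<theta> i k)"
        using True by (simp add: jk Farr_nerve_act)
      consider "k \<le> i" | "j \<le> i" "i < k" | "i < j" using True by linarith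
      then show ?thesis
      proof cases
        case 1
        then show ?thesis unfolding e1 unfolding jk using True i le h1[of k]
          by (simp add: prism_def Farr_nerve_act h[OF j] h[OF k])
      next
        case 2
        then show ?thesis unfolding e1 unfolding jk using True i le h1[of j] h2[of k]
          by (auto simp add: prism_def Farr_nerve_act Fobj_nerve_act h[OF j] h[OF k])
      next
        case 3
        then show ?thesis unfolding e1 unfolding jk using True i le h2[of j] h2[of k]
          by (auto simp add: prism_def Farr_nerve_act h[OF j] h[OF k])
      qed
    qed (auto simp add: jk prism_def Farr_nerve_act)
  qed
qed

lemma prism_face:
  assumes "i < n"
  shows "nerve_act n (face n i) (prism L F G a n i s) = nerve_act n (face n i) (prism L F G a n (Suc i) s)"
  by (rule functr_eqI) (use assms in \<open>auto simp: Fobj_nerve_act Farr_nerve_act face_def prism_def fun_eq_iff\<close>)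

lemma prism_bottom:
  assumes s: "s \<in> nerve K n"
  shows "nerve_act n (\<lambda>k\<in>{..n}. Suc k) (prism L F G a n 0 s) = functor_comp (ordinal_cat n) G s"
  by (rule functr_eqI) (auto simp: functor_comp_def Fobj_nerve_act Farr_nerve_act prism_def fun_eq_iff)

lemma prism_top:
  assumes s: "s \<in> nerve K n"
  shows "nerve_act n (\<lambda>k\<in>{..n}. k) (prism L F G a n n s) = functor_comp (ordinal_cat n) F s"
  by (rule functr_eqI) (auto simp: functor_comp_def Fobj_nerve_act Farr_nerve_act prism_def fun_eq_iff)

interpretation NK: simplicial "nerve K" nerve_act by (rule simplicial_nerve)
interpretation NL: simplicial "nerve L" nerve_act by (rule simplicial_nerve)

text \<open>On the common boundary of two neighbouring pieces of the prism, the two recipes agree.\<close>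

lemma prism_class_Suc:
  assumes s: "s \<in> nerve K n" and t: "t \<in> standard_simplex n"
    and v: "prism_valid n i t r" "prism_valid n (Suc i) t r"
  shows "NL.cl (Suc n) (prism L F G a n i s) (prism_coord i t r) =
         NL.cl (Suc n) (prism L F G a n (Suc i) s) (prism_coord (Suc i) t r)"
proof -
  have i: "i < n" and r: "r = sum t {..i}" using v by (auto simp: prism_valid_def lessThan_Suc_atMost)
  have *: "sum t {..i} = sum t {..<i} + t i" by (simp flip: lessThan_Suc_atMost)
  have e: "prism_coord i t r = simplex_push n (face n i) t" "prism_coord (Suc i) t r = simplex_push n (face n i) t"
    using i r by (auto simp: fun_eq_iff simplex_push_face[OF t] prism_coord_def * lessThan_Suc_atMost)
  show ?thesis unfolding e
    using prism_nerve [OF s] i prism_face [OF i, of s]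
    by (simp flip: NL.cl_act [OF face_monotone _ t])
qed

lemma prism_valid_between:
  assumes "t \<in> standard_simplex n" "prism_valid n i t r" "prism_valid n j t r" "i \<le> k" "k \<le> j"
  shows "prism_valid n k t r"
proof -
  have pos: "0 \<le> t k" for k using assms by (auto simp: standard_simplex_def)
  have "sum t {..<k} \<le> sum t {..<j}" "sum t {..i} \<le> sum t {..k}"
    by (rule sum_mono2; use assms pos in auto)+
  then show ?thesis using assms by (auto simp: prism_valid_def)
qed

lemma prism_class_le:
  assumes s: "s \<in> nerve K n" and t: "t \<in> standard_simplex n" and "i \<le> j"
    and v: "prism_valid n i t r" "prism_valid n j t r"
  shows "NL.cl (Suc n) (prism L F G a n i s) (prism_coord i t r) =
         NL.cl (Suc n) (prism L F G a n j s) (prism_coord j t r)"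
  using \<open>i \<le> j\<close> v
proof (induction j rule: dec_induct)
  case (step j)
  have "prism_valid n j t r" by (rule prism_valid_between [OF t step.prems]) (use step in auto)
  then show ?case using step prism_class_Suc [OF s t, of j r] by simp
qed simp

lemma prism_class_eq:
  assumes "s \<in> nerve K n" "t \<in> standard_simplex n" "prism_valid n i t r" "prism_valid n j t r"
  shows "NL.cl (Suc n) (prism L F G a n i s) (prism_coord i t r) =
         NL.cl (Suc n) (prism L F G a n j s) (prism_coord j t r)"
  using prism_class_le [OF assms(1,2) _ assms(3,4)] prism_class_le [OF assms(1,2) _ assms(4,3)]
  by (metis nle_le)

lemma prism_valid_exists:
  assumes t: "t \<in> standard_simplex n" and r: "r \<in> {0..1}"
  shows "\<exists>i. prism_valid n i t r"
proof -
  let ?i = "LEAST i. r \<le> sum t {..i}"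
  have n: "r \<le> sum t {..n}" using assms by (auto simp: standard_simplex_def)
  have 1: "r \<le> sum t {..?i}" by (rule LeastI [of _ n]) (rule n)
  have 2: "?i \<le> n" by (rule Least_le) (rule n)
  have "sum t {..<?i} \<le> r"
  proof (cases ?i)
    case 0
    then show ?thesis using r by (simp only:) simp
  next
    case (Suc k)
    then have "\<not> r \<le> sum t {..k}" using not_less_Least [of k "\<lambda>i. r \<le> sum t {..i}"] by simp
    then show ?thesis by (simp only: Suc) (simp add: lessThan_Suc_atMost)
  qed
  then show ?thesis using 1 2 by (auto simp: prism_valid_def)
qed

text \<open>For \<open>r\<close> on the boundary of two pieces any choice of \<open>i\<close> gives the same point, by \<open>prism_class_eq\<close>.\<close>

definition hmap :: "real \<times> nat \<times> (nat, nat \<times> nat, 'o, 'a) functr \<times> (nat \<Rightarrow> real) \<Rightarrow>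
    (nat \<times> (nat, nat \<times> nat, 'p, 'b) functr \<times> (nat \<Rightarrow> real)) set" where
  "hmap = (\<lambda>(r, n, s, t). let i = (SOME i. prism_valid n i t r) in
     NL.cl (Suc n) (prism L F G a n i s) (prism_coord i t r))"

lemma hmap_eq:
  assumes "s \<in> nerve K n" "t \<in> standard_simplex n" "prism_valid n i t r"
  shows "hmap (r, n, s, t) = NL.cl (Suc n) (prism L F G a n i s) (prism_coord i t r)"
  using prism_class_eq [OF assms(1,2) someI [of "\<lambda>i. prism_valid n i t r", OF assms(3)] assms(3)]
  by (simp add: hmap_def Let_def)

lemma hmap_compat:
  assumes r: "r \<in> {0..1}" and \<theta>: "\<theta> \<in> monotone_maps m n" and s: "s \<in> nerve K n"
    and t: "t \<in> standard_simplex m"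
  shows "hmap (r, m, nerve_act m \<theta> s, t) = hmap (r, n, s, simplex_push m \<theta> t)"
proof -
  obtain i where v: "prism_valid m i t r" using prism_valid_exists [OF t r] by auto
  then have i: "i \<le> m" by (simp add: prism_valid_def)
  then have i': "\<theta> i \<le> n" using monotone_mapsD [OF \<theta>] by auto
  show ?thesis
    unfolding hmap_eq [OF nerve_act_closed [OF \<theta> s] t v]
      hmap_eq [OF s simplex_push_in_simplex [OF \<theta> t] prism_valid_push(1) [OF \<theta> t v]]
      prism_act [OF \<theta> i] prism_valid_push(2) [OF \<theta> t v, symmetric]
    by (rule NL.cl_act [OF hat_monotone [OF \<theta> i] prism_nerve [OF s i'] prism_coord_in_simplex [OF t v]])
qed

lemma continuous_component:
  "continuous_map (prod_topology (top_of_set {0..1}) (subtopology (powertop_real UNIV) S)) euclideanreal (\<lambda>p. snd p k)"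
proof -
  have "continuous_map (subtopology (powertop_real UNIV) S) euclideanreal (\<lambda>t. t k)"
    using continuous_map_product_projection [of k UNIV "\<lambda>_. euclideanreal"]
    by (intro continuous_map_from_subtopology) simp
  then have "continuous_map (prod_topology (top_of_set {0..1}) (subtopology (powertop_real UNIV) S)) euclideanreal ((\<lambda>t. t k) \<circ> snd)"
    by (rule continuous_map_compose [OF continuous_map_snd])
  then show ?thesis by (simp add: o_def)
qed

lemma continuous_parameter:
  "continuous_map (prod_topology (top_of_set {0..1}) Y) euclideanreal fst"
  using continuous_map_fst [of "top_of_set {0..1::real}" Y] by (auto simp: continuous_map_in_subtopology)

text \<open>The pieces of the prism are finitely many closed sets that cover it, and the map is continuous on
  each of them.\<close>

lemma hmap_continuous:
  assumes s: "s \<in> nerve K n"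
  shows "continuous_map (prod_topology (top_of_set {0..1}) (NK.simplex_top n)) (realization (nerve L) nerve_act)
     (\<lambda>(r, t). hmap (r, n, s, t))"
  (is "continuous_map ?X _ _")
proof (rule pasting_lemma_closed [where I = "{..n}"
      and T = "\<lambda>i. {p \<in> topspace ?X. prism_valid n i (snd p) (fst p)}"
      and f = "\<lambda>i (r, t). NL.cl (Suc n) (prism L F G a n i s) (prism_coord i t r)"])
  note c = continuous_component continuous_parameter
  fix i assume i: "i \<in> {..n}"
  let ?T = "{p \<in> topspace ?X. prism_valid n i (snd p) (fst p)}"
  have "?T = {p \<in> topspace ?X. fst p - sum (snd p) {..<i} \<in> {0..}} \<inter> {p \<in> topspace ?X. sum (snd p) {..i} - fst p \<in> {0..}}"
    using i by (auto simp: prism_valid_def)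
  moreover have "closedin ?X {p \<in> topspace ?X. fst p - sum (snd p) {..<i} \<in> {0..}}"
    by (rule closedin_continuous_map_preimage [of _ euclideanreal]) (intro continuous_intros c, auto)
  moreover have "closedin ?X {p \<in> topspace ?X. sum (snd p) {..i} - fst p \<in> {0..}}"
    by (rule closedin_continuous_map_preimage [of _ euclideanreal]) (intro continuous_intros c, auto)
  ultimately show "closedin ?X ?T" by (simp only: closedin_Int)
  have coord: "continuous_map ?X euclideanreal (\<lambda>p. prism_coord i (snd p) (fst p) k)" for k
  proof -
    consider "k < i" | "k = i" | "k = Suc i" | "k > Suc i" by linarith
    then show ?thesis
    proof cases
      case 2
      have "continuous_map ?X euclideanreal (\<lambda>p. fst p - sum (snd p) {..<i})"
        by (intro continuous_intros c) auto
      then show ?thesis using 2 by (simp add: prism_coord_def)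
    next
      case 3
      have "continuous_map ?X euclideanreal (\<lambda>p. sum (snd p) {..i} - fst p)"
        by (intro continuous_intros c) auto
      then show ?thesis using 3 by (simp add: prism_coord_def)
    qed (simp_all add: prism_coord_def c)
  qed
  have c1: "continuous_map (subtopology ?X ?T) (NL.simplex_top (Suc n)) (\<lambda>p. prism_coord i (snd p) (fst p))"
    unfolding continuous_map_in_subtopology
  proof
    show "continuous_map (subtopology ?X ?T) (powertop_real UNIV) (\<lambda>p. prism_coord i (snd p) (fst p))"
      unfolding continuous_map_componentwise_UNIV
      by (intro allI continuous_map_from_subtopology coord)
  qed (auto simp: prism_coord_in_simplex)
  have "continuous_map (subtopology ?X ?T) (realization (nerve L) nerve_act)
     (NL.cl (Suc n) (prism L F G a n i s) \<circ> (\<lambda>p. prism_coord i (snd p) (fst p)))"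
    by (rule continuous_map_compose [OF c1 NL.continuous_cl]) (use s i in \<open>auto intro: prism_nerve\<close>)
  then show "continuous_map (subtopology ?X ?T) (realization (nerve L) nerve_act)
     (\<lambda>(r, t). NL.cl (Suc n) (prism L F G a n i s) (prism_coord i t r))"
    by (simp add: o_def case_prod_unfold)
next
  fix p :: "real \<times> (nat \<Rightarrow> real)"
  assume p: "p \<in> topspace ?X"
  then obtain i where i: "prism_valid n i (snd p) (fst p)"
    using prism_valid_exists [of "snd p" n "fst p"] by auto
  then show "\<exists>j. j \<in> {..n} \<and>
       p \<in> {p \<in> topspace ?X. prism_valid n j (snd p) (fst p)} \<and>
       (case p of (r, t) \<Rightarrow> hmap (r, n, s, t)) =
       (case p of (r, t) \<Rightarrow> NL.cl (Suc n) (prism L F G a n j s) (prism_coord j t r))"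
    using p hmap_eq [OF s _ i] by (intro exI [of _ i]) (auto simp: prism_valid_def)
next
  fix i j p assume "p \<in> topspace ?X \<inter>
      {p \<in> topspace ?X. prism_valid n i (snd p) (fst p)} \<inter>
      {p \<in> topspace ?X. prism_valid n j (snd p) (fst p)}"
  then show "(case p of (r, t) \<Rightarrow> NL.cl (Suc n) (prism L F G a n i s) (prism_coord i t r)) =
      (case p of (r, t) \<Rightarrow> NL.cl (Suc n) (prism L F G a n j s) (prism_coord j t r))"
    using prism_class_eq [OF s, of "snd p" i "fst p" j] by (simp add: case_prod_unfold mem_Times_iff)
qed simp

lemma push_shift:
  assumes t: "t \<in> standard_simplex n"
  shows "prism_coord 0 t 0 = simplex_push n (\<lambda>k\<in>{..n}. Suc k) t"
proof
  fix k
  have "t j = 0" if "j > n" for j using t that by (auto simp: standard_simplex_def)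
  moreover have "{j. j \<le> n \<and> (\<lambda>k\<in>{..n}. Suc k) j = k} = (if k = 0 then {} else if k \<le> Suc n then {k - 1} else {})"
    by (cases k) auto
  ultimately show "prism_coord 0 t 0 k = simplex_push n (\<lambda>k\<in>{..n}. Suc k) t k"
    by (auto simp: prism_coord_def simplex_push_def)
qed

lemma push_last:
  assumes t: "t \<in> standard_simplex n"
  shows "prism_coord n t 1 = simplex_push n (\<lambda>k\<in>{..n}. k) t"
proof
  fix k
  have z: "t j = 0" if "j > n" for j using t that by (auto simp: standard_simplex_def)
  have o: "sum t {..n} = 1" "sum t {..<n} + t n = 1"
    using t by (auto simp: standard_simplex_def lessThan_Suc_atMost[symmetric])
  have "{j. j \<le> n \<and> (\<lambda>k\<in>{..n}. k) j = k} = (if k \<le> n then {k} else {})"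
    by auto
  then have "simplex_push n (\<lambda>k\<in>{..n}. k) t k = (if k \<le> n then t k else 0)"
    by (simp add: simplex_push_def)
  then show "prism_coord n t 1 k = simplex_push n (\<lambda>k\<in>{..n}. k) t k"
    using z o by (auto simp: prism_coord_def)
qed

text \<open>At height \<open>0\<close> only the face of the first piece that omits its first vertex is left; it is the image of \<open>s\<close>
  under \<open>G\<close>. At height \<open>1\<close> it is the face of the last piece that omits its last vertex, the image under \<open>F\<close>.\<close>

theorem nerve_homotopy:
  obtains H where
    "continuous_map (prod_topology (top_of_set {0..1::real}) (realization (nerve K) nerve_act))
       (realization (nerve L) nerve_act) H"
    "\<And>n s t. s \<in> nerve K n \<Longrightarrow> t \<in> standard_simplex n \<Longrightarrow>
       H (0, NK.cl n s t) = NL.cl n (functor_comp (ordinal_cat n) G s) t"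
    "\<And>n s t. s \<in> nerve K n \<Longrightarrow> t \<in> standard_simplex n \<Longrightarrow>
       H (1, NK.cl n s t) = NL.cl n (functor_comp (ordinal_cat n) F s) t"
proof -
  obtain H where H: "continuous_map (prod_topology (top_of_set {0..1::real}) (realization (nerve K) nerve_act))
       (realization (nerve L) nerve_act) H"
    and H': "\<And>r n s t. r \<in> {0..1} \<Longrightarrow> s \<in> nerve K n \<Longrightarrow> t \<in> standard_simplex n \<Longrightarrow>
       H (r, NK.cl n s t) = hmap (r, n, s, t)"
    using NK.homotopy_from_realization [OF hmap_continuous hmap_compat] by blast
  show thesis
  proof (rule that [OF H])
    fix n s t assume s: "s \<in> nerve K n" and t: "t \<in> standard_simplex n"
    have pos: "0 \<le> t k" and one: "sum t {..n} = 1" for k using t by (auto simp: standard_simplex_def)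
    have v0: "prism_valid n 0 t 0" using pos by (auto simp: prism_valid_def)
    have m0: "(\<lambda>k\<in>{..n}. Suc k) \<in> monotone_maps n (Suc n)" by (auto simp: monotone_maps_def)
    show "H (0, NK.cl n s t) = NL.cl n (functor_comp (ordinal_cat n) G s) t"
      using NL.cl_act [OF m0 prism_nerve [OF s] t]
      by (simp add: H' s t hmap_eq [OF s t v0] push_shift [OF t] flip: prism_bottom [OF s])
    have v1: "prism_valid n n t 1" using one pos[of n] by (auto simp: prism_valid_def simp flip: lessThan_Suc_atMost)
    have m1: "(\<lambda>k\<in>{..n}. k) \<in> monotone_maps n (Suc n)" by (auto simp: monotone_maps_def)
    show "H (1, NK.cl n s t) = NL.cl n (functor_comp (ordinal_cat n) F s) t"
      using NL.cl_act [OF m1 prism_nerve [OF s] t]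
      by (simp add: H' s t hmap_eq [OF s t v1] push_last [OF t] flip: prism_top [OF s])
  qed
qed

end

section \<open>A criterion for contractibility\<close>

abbreviation (input) "identity_functor K \<equiv> \<lparr>Fobj = (\<lambda>x\<in>Obj K. x), Farr = (\<lambda>f\<in>Arr K. f)\<rparr>"
abbreviation (input) "constant_functor K z \<equiv> \<lparr>Fobj = (\<lambda>x\<in>Obj K. z), Farr = (\<lambda>f\<in>Arr K. Idn K z)\<rparr>"

text \<open>The two transformations give homotopies from the map induced by \<open>\<Phi>\<close> to the identity and to the map
  induced by a constant functor. The latter is constant on the realization, since all degenerate
  simplices over the vertex \<open>z\<close> represent the same point.\<close>

theorem contractible_categoryI:
  fixes K :: "('o, 'a, 'z) cat_scheme"
  assumes K: "category K" and z: "z \<in> Obj K" and \<Phi>: "is_functor K K \<Phi>"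
    and a: "nat_trans K K \<Phi> (identity_functor K) a"
    and b: "nat_trans K K \<Phi> (constant_functor K z) b"
  shows "contractible_category K"
proof -
  let ?R = "realization (nerve K) nerve_act"
  interpret categ K using K by unfold_locales
  have I: "is_functor K K (identity_functor K)" and Z: "is_functor K K (constant_functor K z)"
    using z by (auto simp: is_functor_def homset_iff)
  interpret A: transformation K K \<Phi> "identity_functor K" a by unfold_locales (fact \<Phi> I a)+
  interpret B: transformation K K \<Phi> "constant_functor K z" b by unfold_locales (fact \<Phi> Z b)+
  interpret N: simplicial "nerve K" nerve_act by (rule simplicial_nerve)
  obtain H1 where H1: "continuous_map (prod_topology (top_of_set {0..1::real}) ?R) ?R H1"
    "\<And>n s t. s \<in> nerve K n \<Longrightarrow> t \<in> standard_simplex n \<Longrightarrow> H1 (0, N.cl n s t) = N.cl n (functor_comp (ordinal_cat n) (identity_functor K) s) t"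
    "\<And>n s t. s \<in> nerve K n \<Longrightarrow> t \<in> standard_simplex n \<Longrightarrow> H1 (1, N.cl n s t) = N.cl n (functor_comp (ordinal_cat n) \<Phi> s) t"
    using A.nerve_homotopy by blast
  obtain H2 where H2: "continuous_map (prod_topology (top_of_set {0..1::real}) ?R) ?R H2"
    "\<And>n s t. s \<in> nerve K n \<Longrightarrow> t \<in> standard_simplex n \<Longrightarrow> H2 (0, N.cl n s t) = N.cl n (functor_comp (ordinal_cat n) (constant_functor K z) s) t"
    "\<And>n s t. s \<in> nerve K n \<Longrightarrow> t \<in> standard_simplex n \<Longrightarrow> H2 (1, N.cl n s t) = N.cl n (functor_comp (ordinal_cat n) \<Phi> s) t"
    using B.nerve_homotopy by blast
  define zz where "zz n = (\<lparr>Fobj = (\<lambda>k\<in>{..n}. z), Farr = (\<lambda>f\<in>{(i, j). i \<le> j \<and> j \<le> n}. Idn K z)\<rparr> :: (nat, nat \<times> nat, 'o, 'a) functr)" for n :: nat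
  have zz: "zz n \<in> nerve K n" for n unfolding nerve_iff using z by (auto simp: zz_def)
  define pt where "pt = N.cl 0 (zz 0) (\<lambda>j. if j = 0 then 1 else 0)"
  have pt: "pt \<in> topspace ?R" unfolding pt_def by (intro N.cl_in_topspace zz) simp
  have idI: "functor_comp (ordinal_cat n) (identity_functor K) s = s" if "s \<in> nerve K n" for n s
    using that by (intro functr_eqI) (auto simp: nerve_iff functor_comp_def fun_eq_iff PiE_def extensional_def restrict_def Pi_def)
  have toZ: "N.cl n (functor_comp (ordinal_cat n) (constant_functor K z) s) t = pt" if s: "s \<in> nerve K n" and t: "t \<in> standard_simplex n" for n s t
  proof -
    have m: "(\<lambda>k\<in>{..n}. 0) \<in> monotone_maps n 0" by (auto simp: monotone_maps_def)
    have "functor_comp (ordinal_cat n) (constant_functor K z) s = nerve_act n (\<lambda>k\<in>{..n}. 0) (zz 0)"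
      using s by (intro functr_eqI) (auto simp: nerve_iff functor_comp_def Fobj_nerve_act Farr_nerve_act zz_def fun_eq_iff PiE_def Pi_def)
    moreover have "simplex_push n (\<lambda>k\<in>{..n}. 0) t = (\<lambda>j. if j = 0 then 1 else 0)"
      using simplex_push_in_simplex [OF m t] by (simp only: standard_simplex_0) simp
    ultimately show ?thesis using N.cl_act [OF m zz t] by (simp add: pt_def)
  qed
  have h1: "homotopic_with (\<lambda>_. True) ?R ?R (\<lambda>x. H1 (0, x)) (\<lambda>x. H1 (1, x))"
    unfolding homotopic_with_def using H1(1) by (intro exI [of _ H1]) auto
  have h2: "homotopic_with (\<lambda>_. True) ?R ?R (\<lambda>x. H2 (0, x)) (\<lambda>x. H2 (1, x))"
    unfolding homotopic_with_def using H2(1) by (intro exI [of _ H2]) auto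
  have "homotopic_with (\<lambda>_. True) ?R ?R id (\<lambda>x. H1 (1, x))"
    by (rule homotopic_with_eq [OF h1]) (auto elim!: N.topspace_realizationE simp: H1(2) idI)
  moreover have "homotopic_with (\<lambda>_. True) ?R ?R (\<lambda>x. pt) (\<lambda>x. H1 (1, x))"
    by (rule homotopic_with_eq [OF h2]) (auto elim!: N.topspace_realizationE simp: H1(3) H2(2,3) toZ)
  ultimately have idpt: "homotopic_with (\<lambda>_. True) ?R ?R id (\<lambda>x. pt)"
    using homotopic_with_trans homotopic_with_symD by blast
  show ?thesis
    unfolding contractible_category_def weakly_contractible_def
  proof (intro conjI allI impI)
    show "topspace ?R \<noteq> {}" using pt by auto
    fix n f assume f: "continuous_map (nsphere n) ?R f"
    have "homotopic_with (\<lambda>_. True) (nsphere n) ?R (id \<circ> f) ((\<lambda>x. pt) \<circ> f)"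
      by (rule homotopic_with_compose_continuous_map_right [OF idpt f]) simp
    then show "\<exists>c\<in>topspace ?R. homotopic_with (\<lambda>_. True) (nsphere n) ?R f (\<lambda>_. c)"
      using pt by (intro bexI [of _ pt]) (auto simp: o_def)
  qed
qed

section \<open>Closed symmetric monoidal categories\<close>

lemma (in categ) inv_arr_unique:
  assumes "is_iso K f"
  shows "inverse_arr K f (inv_arr K f)"
  unfolding inv_arr_def
proof (rule theI')
  obtain g where g: "inverse_arr K f g" using assms by (auto simp: is_iso_def)
  show "\<exists>!g. inverse_arr K f g"
  proof (rule ex1I [of _ g], rule g)
    fix h assume h: "inverse_arr K f h"
    have "h = Comp K h (Comp K f g)" using g h by (simp add: inverse_arr_def homset_iff)
    also have "\<dots> = Comp K (Comp K h f) g" using g h by (subst Comp_assoc) (auto simp: inverse_arr_def homset_iff)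
    also have "\<dots> = g" using g h by (simp add: inverse_arr_def homset_iff)
    finally show "h = g" .
  qed
qed

lemma (in categ) inv_arr_simps:
  assumes "is_iso K f" "Dom K f = x" "Cod K f = y"
  shows "f \<in> Arr K" "inv_arr K f \<in> Arr K" "Dom K (inv_arr K f) = y" "Cod K (inv_arr K f) = x"
    "Comp K (inv_arr K f) f = Idn K x" "Comp K f (inv_arr K f) = Idn K y"
  using inv_arr_unique [OF assms(1)] assms by (auto simp: inverse_arr_def homset_iff)

lemma (in categ) iso_cancel_left:
  assumes "is_iso K f" "g \<in> Arr K" "h \<in> Arr K" "Cod K g = Dom K f" "Cod K h = Dom K f"
    and "Comp K f g = Comp K f h"
  shows "g = h"
proof -
  note f = inv_arr_simps [OF assms(1) refl refl]
  have "g = Comp K (Comp K (inv_arr K f) f) g" using f assms(2-5) by simp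
  also have "\<dots> = Comp K (inv_arr K f) (Comp K f h)"
    using f assms(2-5) by (subst Comp_assoc) (simp_all add: assms(6))
  also have "\<dots> = Comp K (Comp K (inv_arr K f) f) h" using f assms(2-5) by (subst Comp_assoc) simp_all
  finally show ?thesis using f assms(2-5) by simp
qed

lemma (in categ) iso_cancel_right:
  assumes "is_iso K f" "g \<in> Arr K" "h \<in> Arr K" "Dom K g = Cod K f" "Dom K h = Cod K f"
    and "Comp K g f = Comp K h f"
  shows "g = h"
proof -
  note f = inv_arr_simps [OF assms(1) refl refl]
  have "g = Comp K g (Comp K f (inv_arr K f))" using f assms(2-5) by simp
  also have "\<dots> = Comp K (Comp K h f) (inv_arr K f)"
    using f assms(2-5) by (subst Comp_assoc [symmetric]) (simp_all add: assms(6))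
  also have "\<dots> = Comp K h (Comp K f (inv_arr K f))" using f assms(2-5) by (subst Comp_assoc) simp_all
  finally show ?thesis using f assms(2-5) by simp
qed

locale smc =
  fixes V :: "('o, 'a) smcat"
  assumes csm: "closed_symmetric_monoidal V"

sublocale smc \<subseteq> categ V
  using csm by unfold_locales (simp add: closed_symmetric_monoidal_def)

context smc
begin

abbreviation vcomp (infixr "\<cdot>" 55) where "g \<cdot> f \<equiv> Comp V g f"
abbreviation vten (infixr "\<boxtimes>" 70) where "f \<boxtimes> g \<equiv> Tarr V f g"
abbreviation vobj (infixr "\<boxdot>" 70) where "x \<boxdot> y \<equiv> Tobj V x y"
abbreviation "I \<equiv> Unit V"
abbreviation "idn \<equiv> Idn V"
abbreviation "ass \<equiv> Assoc V"
abbreviation "lun \<equiv> Lun V"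
abbreviation "run \<equiv> Run V"
abbreviation "sy \<equiv> Sym V"
abbreviation "lun' x \<equiv> inv_arr V (Lun V x)"
abbreviation "run' x \<equiv> inv_arr V (Run V x)"
abbreviation "hm \<equiv> homset V"

lemma Tobj_Obj [simp]: "x \<in> Obj V \<Longrightarrow> y \<in> Obj V \<Longrightarrow> x \<boxdot> y \<in> Obj V"
  and Tarr_Idn [simp]: "x \<in> Obj V \<Longrightarrow> y \<in> Obj V \<Longrightarrow> idn x \<boxtimes> idn y = idn (x \<boxdot> y)"
  and Tarr_Arr [simp]: "f \<in> Arr V \<Longrightarrow> g \<in> Arr V \<Longrightarrow> f \<boxtimes> g \<in> Arr V"
  and Dom_Tarr [simp]: "f \<in> Arr V \<Longrightarrow> g \<in> Arr V \<Longrightarrow> Dom V (f \<boxtimes> g) = Dom V f \<boxdot> Dom V g"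
  and Cod_Tarr [simp]: "f \<in> Arr V \<Longrightarrow> g \<in> Arr V \<Longrightarrow> Cod V (f \<boxtimes> g) = Cod V f \<boxdot> Cod V g"
  using csm by (auto simp: closed_symmetric_monoidal_def tensor_bifunctor_def homset_iff)

text \<open>As rewrite rules, the following normalize composites of tensor products of arrows.\<close>

lemma merge:
  "f \<in> Arr V \<Longrightarrow> f' \<in> Arr V \<Longrightarrow> g \<in> Arr V \<Longrightarrow> g' \<in> Arr V \<Longrightarrow> Cod V f = Dom V f' \<Longrightarrow> Cod V g = Dom V g' \<Longrightarrow>
   (f' \<boxtimes> g') \<cdot> (f \<boxtimes> g) = (f' \<cdot> f) \<boxtimes> (g' \<cdot> g)"
  using csm by (auto simp: closed_symmetric_monoidal_def tensor_bifunctor_def)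

lemma merge':
  "f \<in> Arr V \<Longrightarrow> f' \<in> Arr V \<Longrightarrow> g \<in> Arr V \<Longrightarrow> g' \<in> Arr V \<Longrightarrow> Cod V f = Dom V f' \<Longrightarrow> Cod V g = Dom V g' \<Longrightarrow>
   k \<in> Arr V \<Longrightarrow> Cod V k = Dom V f \<boxdot> Dom V g \<Longrightarrow>
   (f' \<boxtimes> g') \<cdot> (f \<boxtimes> g) \<cdot> k = ((f' \<cdot> f) \<boxtimes> (g' \<cdot> g)) \<cdot> k"
  by (simp add: merge flip: Comp_assoc)

lemma ObjI [simp]: "I \<in> Obj V"
  using csm by (simp add: closed_symmetric_monoidal_def structure_isos_def)

lemma ass_iso [simp]: "x \<in> Obj V \<Longrightarrow> y \<in> Obj V \<Longrightarrow> z \<in> Obj V \<Longrightarrow> is_iso V (ass x y z)"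
  and lun_iso [simp]: "x \<in> Obj V \<Longrightarrow> is_iso V (lun x)"
  and run_iso [simp]: "x \<in> Obj V \<Longrightarrow> is_iso V (run x)"
  using csm by (auto simp: closed_symmetric_monoidal_def structure_isos_def)

lemma structure_arrows [simp]:
  "x \<in> Obj V \<Longrightarrow> y \<in> Obj V \<Longrightarrow> z \<in> Obj V \<Longrightarrow> ass x y z \<in> Arr V"
  "x \<in> Obj V \<Longrightarrow> y \<in> Obj V \<Longrightarrow> z \<in> Obj V \<Longrightarrow> Dom V (ass x y z) = (x \<boxdot> y) \<boxdot> z"
  "x \<in> Obj V \<Longrightarrow> y \<in> Obj V \<Longrightarrow> z \<in> Obj V \<Longrightarrow> Cod V (ass x y z) = x \<boxdot> (y \<boxdot> z)"
  "x \<in> Obj V \<Longrightarrow> lun x \<in> Arr V" "x \<in> Obj V \<Longrightarrow> Dom V (lun x) = I \<boxdot> x" "x \<in> Obj V \<Longrightarrow> Cod V (lun x) = x"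
  "x \<in> Obj V \<Longrightarrow> run x \<in> Arr V" "x \<in> Obj V \<Longrightarrow> Dom V (run x) = x \<boxdot> I" "x \<in> Obj V \<Longrightarrow> Cod V (run x) = x"
  "x \<in> Obj V \<Longrightarrow> y \<in> Obj V \<Longrightarrow> sy x y \<in> Arr V"
  "x \<in> Obj V \<Longrightarrow> y \<in> Obj V \<Longrightarrow> Dom V (sy x y) = x \<boxdot> y"
  "x \<in> Obj V \<Longrightarrow> y \<in> Obj V \<Longrightarrow> Cod V (sy x y) = y \<boxdot> x"
  using csm by (auto simp: closed_symmetric_monoidal_def structure_isos_def homset_iff)

lemma unitor_inverses [simp]:
  assumes "x \<in> Obj V"
  shows "lun' x \<in> Arr V" "Dom V (lun' x) = x" "Cod V (lun' x) = I \<boxdot> x"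
    "lun' x \<cdot> lun x = idn (I \<boxdot> x)" "lun x \<cdot> lun' x = idn x"
    "run' x \<in> Arr V" "Dom V (run' x) = x" "Cod V (run' x) = x \<boxdot> I"
    "run' x \<cdot> run x = idn (x \<boxdot> I)" "run x \<cdot> run' x = idn x"
  using assms inv_arr_simps [OF lun_iso [OF assms]] inv_arr_simps [OF run_iso [OF assms]] by auto

lemma unitor_inverses' [simp]:
  assumes "k \<in> Arr V" "Cod V k = x" "x \<in> Obj V"
  shows "lun x \<cdot> lun' x \<cdot> k = k" "run x \<cdot> run' x \<cdot> k = k"
  using assms by (simp_all flip: Comp_assoc)

lemma ass_natural:
  "f \<in> Arr V \<Longrightarrow> g \<in> Arr V \<Longrightarrow> h \<in> Arr V \<Longrightarrow>
   ass (Cod V f) (Cod V g) (Cod V h) \<cdot> ((f \<boxtimes> g) \<boxtimes> h) = (f \<boxtimes> (g \<boxtimes> h)) \<cdot> ass (Dom V f) (Dom V g) (Dom V h)"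
  and lun_natural: "f \<in> Arr V \<Longrightarrow> lun (Cod V f) \<cdot> (idn I \<boxtimes> f) = f \<cdot> lun (Dom V f)"
  and run_natural: "f \<in> Arr V \<Longrightarrow> run (Cod V f) \<cdot> (f \<boxtimes> idn I) = f \<cdot> run (Dom V f)"
  and sym_natural: "f \<in> Arr V \<Longrightarrow> g \<in> Arr V \<Longrightarrow>
     sy (Cod V f) (Cod V g) \<cdot> (f \<boxtimes> g) = (g \<boxtimes> f) \<cdot> sy (Dom V f) (Dom V g)"
  using csm by (auto simp: closed_symmetric_monoidal_def structure_natural_def)

lemma lun'_natural: "f \<in> Arr V \<Longrightarrow> (idn I \<boxtimes> f) \<cdot> lun' (Dom V f) = lun' (Cod V f) \<cdot> f"
  by (rule iso_cancel_left [OF lun_iso [of "Cod V f"]])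
    (simp_all add: lun_natural Comp_assoc flip: Comp_assoc [of _ _ "lun _"])

lemma run'_natural: "f \<in> Arr V \<Longrightarrow> (f \<boxtimes> idn I) \<cdot> run' (Dom V f) = run' (Cod V f) \<cdot> f"
  by (rule iso_cancel_left [OF run_iso [of "Cod V f"]])
    (simp_all add: run_natural Comp_assoc flip: Comp_assoc [of _ _ "run _"])

lemma pentagon:
  "w \<in> Obj V \<Longrightarrow> x \<in> Obj V \<Longrightarrow> y \<in> Obj V \<Longrightarrow> z \<in> Obj V \<Longrightarrow>
   ass w x (y \<boxdot> z) \<cdot> ass (w \<boxdot> x) y z = (idn w \<boxtimes> ass x y z) \<cdot> ass w (x \<boxdot> y) z \<cdot> (ass w x y \<boxtimes> idn z)"
  and triangle: "x \<in> Obj V \<Longrightarrow> y \<in> Obj V \<Longrightarrow> (idn x \<boxtimes> lun y) \<cdot> ass x I y = run x \<boxtimes> idn y"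
  and sym_sym [simp]: "x \<in> Obj V \<Longrightarrow> y \<in> Obj V \<Longrightarrow> sy y x \<cdot> sy x y = idn (x \<boxdot> y)"
  and hexagon: "x \<in> Obj V \<Longrightarrow> y \<in> Obj V \<Longrightarrow> z \<in> Obj V \<Longrightarrow>
     ass y z x \<cdot> sy x (y \<boxdot> z) \<cdot> ass x y z = (idn y \<boxtimes> sy x z) \<cdot> ass y x z \<cdot> (sy x y \<boxtimes> idn z)"
  using csm by (auto simp: closed_symmetric_monoidal_def coherence_def)

lemma lun_faithful:
  assumes "f \<in> Arr V" "g \<in> Arr V" "Dom V f = Dom V g" "Cod V f = Cod V g" "idn I \<boxtimes> f = idn I \<boxtimes> g"
  shows "f = g"
  by (rule iso_cancel_right [OF lun_iso [of "Dom V f"]])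
    (use assms lun_natural [of f] lun_natural [of g] in simp_all)

lemma run_faithful:
  assumes "f \<in> Arr V" "g \<in> Arr V" "Dom V f = Dom V g" "Cod V f = Cod V g" "f \<boxtimes> idn I = g \<boxtimes> idn I"
  shows "f = g"
  by (rule iso_cancel_right [OF run_iso [of "Dom V f"]])
    (use assms run_natural [of f] run_natural [of g] in simp_all)

lemma iso_tensor:
  assumes "is_iso V f" "is_iso V g"
  shows "is_iso V (f \<boxtimes> g)"
proof -
  note f = inv_arr_simps [OF assms(1) refl refl] and g = inv_arr_simps [OF assms(2) refl refl]
  have "inverse_arr V (f \<boxtimes> g) (inv_arr V f \<boxtimes> inv_arr V g)"
    using f g by (simp add: inverse_arr_def homset_iff merge)
  then show ?thesis by (auto simp: is_iso_def)
qed

lemma iso_idn: "x \<in> Obj V \<Longrightarrow> is_iso V (idn x)"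
  unfolding is_iso_def inverse_arr_def by (rule exI [of _ "idn x"]) (simp add: homset_iff)

text \<open>The classical argument of Kelly: as \<open>I \<otimes> -\<close> is faithful, it suffices to compare the two arrows after
  tensoring with \<open>I\<close>, where both are computed by the pentagon and the triangle.\<close>

lemma lun_tensor:
  assumes x: "x \<in> Obj V" and y: "y \<in> Obj V"
  shows "lun (x \<boxdot> y) \<cdot> ass I x y = lun x \<boxtimes> idn y"
  (is "?lhs = ?rhs")
proof (rule lun_faithful)
  note [simp] = x y
  let ?A = "ass I (I \<boxdot> x) y" and ?B = "ass I I x \<boxtimes> idn y"
  have "((idn I \<boxtimes> ?lhs) \<cdot> ?A) \<cdot> ?B
      = (idn I \<boxtimes> lun (x \<boxdot> y)) \<cdot> (idn I \<boxtimes> ass I x y) \<cdot> ?A \<cdot> ?B"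
    by (simp add: Comp_assoc merge')
  also have "\<dots> = ((idn I \<boxtimes> lun (x \<boxdot> y)) \<cdot> ass I I (x \<boxdot> y)) \<cdot> ass (I \<boxdot> I) x y"
    using pentagon [of I I x y] by (simp add: Comp_assoc)
  also have "\<dots> = (run I \<boxtimes> (idn x \<boxtimes> idn y)) \<cdot> ass (I \<boxdot> I) x y"
    by (simp only: triangle ObjI Tobj_Obj x y Tarr_Idn)
  also have "\<dots> = ass I x y \<cdot> ((run I \<boxtimes> idn x) \<boxtimes> idn y)"
    using ass_natural [of "run I" "idn x" "idn y"] by simp
  also have "\<dots> = ass I x y \<cdot> (((idn I \<boxtimes> lun x) \<cdot> ass I I x) \<boxtimes> idn y)"
    by (simp add: triangle)
  also have "\<dots> = (ass I x y \<cdot> ((idn I \<boxtimes> lun x) \<boxtimes> idn y)) \<cdot> ?B"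
    by (simp add: Comp_assoc merge)
  also have "\<dots> = ((idn I \<boxtimes> ?rhs) \<cdot> ?A) \<cdot> ?B"
    using ass_natural [of "idn I" "lun x" "idn y"] by simp
  finally have "(idn I \<boxtimes> ?lhs) \<cdot> ?A = (idn I \<boxtimes> ?rhs) \<cdot> ?A"
    by (rule iso_cancel_right [rotated -1]) (simp_all add: iso_tensor iso_idn)
  then show "idn I \<boxtimes> ?lhs = idn I \<boxtimes> ?rhs"
    by (rule iso_cancel_right [rotated -1]) simp_all
qed (use assms in simp_all)

lemma run_tensor:
  assumes x: "x \<in> Obj V" and y: "y \<in> Obj V"
  shows "(idn x \<boxtimes> run y) \<cdot> ass x y I = run (x \<boxdot> y)"
  (is "?lhs = _")
proof (rule run_faithful)
  note [simp] = x y
  have "ass x y I \<cdot> (?lhs \<boxtimes> idn I)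
      = (ass x y I \<cdot> ((idn x \<boxtimes> run y) \<boxtimes> idn I)) \<cdot> (ass x y I \<boxtimes> idn I)"
    by (simp add: Comp_assoc merge)
  also have "\<dots> = ((idn x \<boxtimes> (run y \<boxtimes> idn I)) \<cdot> ass x (y \<boxdot> I) I) \<cdot> (ass x y I \<boxtimes> idn I)"
    using ass_natural [of "idn x" "run y" "idn I"] by simp
  also have "\<dots> = ((idn x \<boxtimes> ((idn y \<boxtimes> lun I) \<cdot> ass y I I)) \<cdot> ass x (y \<boxdot> I) I) \<cdot> (ass x y I \<boxtimes> idn I)"
    by (simp add: triangle)
  also have "\<dots> = (idn x \<boxtimes> (idn y \<boxtimes> lun I)) \<cdot> (idn x \<boxtimes> ass y I I) \<cdot> ass x (y \<boxdot> I) I \<cdot> (ass x y I \<boxtimes> idn I)"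
    by (simp add: Comp_assoc merge')
  also have "\<dots> = ((idn x \<boxtimes> (idn y \<boxtimes> lun I)) \<cdot> ass x y (I \<boxdot> I)) \<cdot> ass (x \<boxdot> y) I I"
    using pentagon [of x y I I] by (simp add: Comp_assoc)
  also have "\<dots> = (ass x y I \<cdot> ((idn x \<boxtimes> idn y) \<boxtimes> lun I)) \<cdot> ass (x \<boxdot> y) I I"
    using ass_natural [of "idn x" "idn y" "lun I"] by simp
  also have "\<dots> = ass x y I \<cdot> (run (x \<boxdot> y) \<boxtimes> idn I)"
    by (simp add: Comp_assoc triangle)
  finally show "?lhs \<boxtimes> idn I = run (x \<boxdot> y) \<boxtimes> idn I"
    by (rule iso_cancel_left [rotated -1]) simp_all
qed (use assms in simp_all)

text \<open>Cancelling \<open>lun I\<close> in its own naturality square gives \<open>I \<otimes> lun I = lun (I \<otimes> I)\<close>, to which \<open>lun_tensor\<close> and the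
  triangle apply.\<close>

lemma run_Unit: "run I = lun I"
proof (rule run_faithful)
  have "lun I \<cdot> (idn I \<boxtimes> lun I) = lun I \<cdot> lun (I \<boxdot> I)"
    using lun_natural [of "lun I"] by simp
  then have "idn I \<boxtimes> lun I = lun (I \<boxdot> I)"
    by (rule iso_cancel_left [rotated -1]) simp_all
  then show "run I \<boxtimes> idn I = lun I \<boxtimes> idn I"
    using lun_tensor [of I I] triangle [of I I] by simp
qed simp_all

lemma sym_iso: "x \<in> Obj V \<Longrightarrow> y \<in> Obj V \<Longrightarrow> is_iso V (sy x y)"
  unfolding is_iso_def inverse_arr_def by (rule exI [of _ "sy y x"]) (simp add: homset_iff)

lemma iso_comp:
  assumes "is_iso V f" "is_iso V g" "Cod V f = Dom V g"
  shows "is_iso V (g \<cdot> f)"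
proof -
  note f = inv_arr_simps [OF assms(1) refl refl] and g = inv_arr_simps [OF assms(2) refl refl]
  have 1: "inv_arr V g \<cdot> g \<cdot> f = f" using f g assms(3) by (simp flip: Comp_assoc)
  have 2: "f \<cdot> inv_arr V f \<cdot> inv_arr V g = inv_arr V g" using f g assms(3) by (simp flip: Comp_assoc)
  have "inverse_arr V (g \<cdot> f) (inv_arr V f \<cdot> inv_arr V g)"
    using f g assms(3) 1 2 by (simp add: inverse_arr_def homset_iff Comp_assoc)
  then show ?thesis by (auto simp: is_iso_def)
qed

text \<open>The left hand side \<open>f\<close> is invertible, so \<open>f \<otimes> I = run x \<otimes> I\<close> may be checked after composing with \<open>f\<close>.
  It is then the hexagon for \<open>x\<close>, \<open>I\<close>, \<open>I\<close>.\<close>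

lemma lun_sym:
  assumes x: "x \<in> Obj V"
  shows "lun x \<cdot> sy x I = run x"
proof -
  note [simp] = x
  let ?f = "lun x \<cdot> sy x I"
  have iso: "is_iso V ?f" using x by (intro iso_comp sym_iso lun_iso) simp_all
  have "?f \<cdot> (?f \<boxtimes> idn I) = ?f \<cdot> (lun x \<boxtimes> idn I) \<cdot> (sy x I \<boxtimes> idn I)"
    by (simp add: merge)
  also have "\<dots> = ?f \<cdot> lun (x \<boxdot> I) \<cdot> ass I x I \<cdot> (sy x I \<boxtimes> idn I)"
    by (simp add: Comp_assoc flip: lun_tensor)
  also have "\<dots> = (?f \<cdot> lun (x \<boxdot> I)) \<cdot> ass I x I \<cdot> (sy x I \<boxtimes> idn I)"
    by (simp add: Comp_assoc)
  also have "?f \<cdot> lun (x \<boxdot> I) = lun x \<cdot> (idn I \<boxtimes> ?f)"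
    using lun_natural [of ?f] by simp
  also have "idn I \<boxtimes> ?f = (idn I \<boxtimes> lun x) \<cdot> (idn I \<boxtimes> sy x I)" by (simp add: merge)
  also have "(lun x \<cdot> ((idn I \<boxtimes> lun x) \<cdot> (idn I \<boxtimes> sy x I))) \<cdot> ass I x I \<cdot> (sy x I \<boxtimes> idn I)
      = lun x \<cdot> (idn I \<boxtimes> lun x) \<cdot> ((idn I \<boxtimes> sy x I) \<cdot> ass I x I \<cdot> (sy x I \<boxtimes> idn I))"
    by (simp add: Comp_assoc)
  also have "\<dots> = lun x \<cdot> ((idn I \<boxtimes> lun x) \<cdot> ass I I x) \<cdot> sy x (I \<boxdot> I) \<cdot> ass x I I"
    by (simp add: Comp_assoc flip: hexagon)
  also have "\<dots> = lun x \<cdot> ((lun I \<boxtimes> idn x) \<cdot> sy x (I \<boxdot> I)) \<cdot> ass x I I"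
    by (simp add: triangle run_Unit Comp_assoc)
  also have "\<dots> = lun x \<cdot> (sy x I \<cdot> (idn x \<boxtimes> lun I)) \<cdot> ass x I I"
    using sym_natural [of "idn x" "lun I"] by simp
  also have "\<dots> = ?f \<cdot> (run x \<boxtimes> idn I)"
    by (simp add: Comp_assoc triangle)
  finally have "?f \<boxtimes> idn I = run x \<boxtimes> idn I"
    by (rule iso_cancel_left [OF iso, rotated -1]) simp_all
  then show ?thesis by (rule run_faithful [rotated -1]) simp_all
qed

lemma sym_Unit: "sy I I = idn (I \<boxdot> I)"
  by (rule iso_cancel_left [OF lun_iso [OF ObjI]]) (simp_all add: lun_sym run_Unit)

lemma run_sym: "x \<in> Obj V \<Longrightarrow> run x \<cdot> sy I x = lun x"
  using lun_sym [of x] by (simp add: Comp_assoc flip: lun_sym)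

text \<open>The corresponding statements for the inverse unitors.\<close>

lemma ass_lun':
  assumes [simp]: "x \<in> Obj V" "y \<in> Obj V"
  shows "ass I x y \<cdot> (lun' x \<boxtimes> idn y) = lun' (x \<boxdot> y)"
  by (rule iso_cancel_left [OF lun_iso [of "x \<boxdot> y"]])
    (simp_all add: lun_tensor merge flip: Comp_assoc)

lemma ass_run':
  assumes [simp]: "x \<in> Obj V" "y \<in> Obj V"
  shows "ass x y I \<cdot> run' (x \<boxdot> y) = idn x \<boxtimes> run' y"
  by (rule iso_cancel_left [OF iso_tensor [OF iso_idn [of x] run_iso [of y]]])
    (simp_all add: run_tensor merge flip: Comp_assoc)

lemma ass_middle:
  assumes [simp]: "x \<in> Obj V" "y \<in> Obj V"
  shows "ass x I y \<cdot> (run' x \<boxtimes> idn y) = idn x \<boxtimes> lun' y"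
  by (rule iso_cancel_left [OF iso_tensor [OF iso_idn [of x] lun_iso [of y]]])
    (simp_all add: triangle merge flip: Comp_assoc)

subsection \<open>Internal homs\<close>

abbreviation "ihom \<equiv> Ihom V"
abbreviation "ev \<equiv> Eval V"

lemma closed_simps [simp]:
  "y \<in> Obj V \<Longrightarrow> z \<in> Obj V \<Longrightarrow> ihom y z \<in> Obj V"
  "y \<in> Obj V \<Longrightarrow> z \<in> Obj V \<Longrightarrow> ev y z \<in> Arr V"
  "y \<in> Obj V \<Longrightarrow> z \<in> Obj V \<Longrightarrow> Dom V (ev y z) = ihom y z \<boxdot> y"
  "y \<in> Obj V \<Longrightarrow> z \<in> Obj V \<Longrightarrow> Cod V (ev y z) = z"
  using csm by (auto simp: closed_symmetric_monoidal_def closed_structure_def homset_iff)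

lemma curry_ex1:
  assumes "x \<in> Obj V" "y \<in> Obj V" "z \<in> Obj V" "f \<in> hm (x \<boxdot> y) z"
  shows "\<exists>!h. h \<in> hm x (ihom y z) \<and> ev y z \<cdot> (h \<boxtimes> idn y) = f"
  using csm assms by (auto simp: closed_symmetric_monoidal_def closed_structure_def)

lemma curry_simps:
  assumes "x \<in> Obj V" "y \<in> Obj V" "z \<in> Obj V" "f \<in> Arr V" "Dom V f = x \<boxdot> y" "Cod V f = z"
  shows "curry_arr V x y z f \<in> Arr V" "Dom V (curry_arr V x y z f) = x"
    "Cod V (curry_arr V x y z f) = ihom y z" "ev y z \<cdot> (curry_arr V x y z f \<boxtimes> idn y) = f"
  using theI' [OF curry_ex1 [OF assms(1-3), of f]] assms(4-)
  unfolding curry_arr_def [symmetric] by (auto simp: homset_iff)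

lemma curry_unique:
  assumes "h \<in> Arr V" "h' \<in> Arr V" "Dom V h' = Dom V h" "Cod V h = ihom y z" "Cod V h' = ihom y z"
    and "y \<in> Obj V" "z \<in> Obj V" "ev y z \<cdot> (h \<boxtimes> idn y) = ev y z \<cdot> (h' \<boxtimes> idn y)"
  shows "h = h'"
  using curry_ex1 [of "Dom V h" y z "ev y z \<cdot> (h' \<boxtimes> idn y)"] assms by (auto simp: homset_iff)

lemma eval_curry:
  assumes "x \<in> Obj V" "y \<in> Obj V" "z \<in> Obj V" "f \<in> Arr V" "Dom V f = x \<boxdot> y" "Cod V f = z"
    and "h \<in> Arr V" "Cod V h = x" "k \<in> Arr V" "Cod V k = y"
  shows "ev y z \<cdot> ((curry_arr V x y z f \<cdot> h) \<boxtimes> k) = f \<cdot> (h \<boxtimes> k)"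
  (is "?lhs = _")
proof -
  note [simp] = curry_simps [OF assms(1-6)]
  have "?lhs = (ev y z \<cdot> (curry_arr V x y z f \<boxtimes> idn y)) \<cdot> (h \<boxtimes> k)"
    using assms by (subst Comp_assoc) (simp_all add: merge del: curry_simps)
  then show ?thesis by simp
qed

text \<open>Functoriality of the internal hom, uncurried.\<close>

lemma Ihom_arr_simps:
  assumes [simp]: "f \<in> Arr V" "g \<in> Arr V"
  shows "Ihom_arr V f g \<in> Arr V" "Dom V (Ihom_arr V f g) = ihom (Cod V f) (Dom V g)"
    "Cod V (Ihom_arr V f g) = ihom (Dom V f) (Cod V g)"
  unfolding Ihom_arr_def Let_def by (rule curry_simps; simp)+

lemma eval_Ihom_arr:
  assumes [simp]: "f \<in> Arr V" "g \<in> Arr V" "h \<in> Arr V" "Cod V h = ihom (Cod V f) (Dom V g)"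
    and [simp]: "y = Dom V f" "z = Cod V g"
  shows "ev y z \<cdot> ((Ihom_arr V f g \<cdot> h) \<boxtimes> idn y) = g \<cdot> ev (Cod V f) (Dom V g) \<cdot> (h \<boxtimes> f)"
  (is "_ = ?rhs")
proof -
  have "ev (Dom V f) (Cod V g) \<cdot> ((Ihom_arr V f g \<cdot> h) \<boxtimes> idn (Dom V f))
     = (g \<cdot> ev (Cod V f) (Dom V g) \<cdot> (idn (ihom (Cod V f) (Dom V g)) \<boxtimes> f)) \<cdot> (h \<boxtimes> idn (Dom V f))"
    unfolding Ihom_arr_def Let_def by (rule eval_curry) simp_all
  also have "\<dots> = ?rhs"
    by (simp add: Comp_assoc merge)
  finally show ?thesis by simp
qed

subsection \<open>A calculus for actions\<close>

text \<open>
  In a \<open>V\<close>-category, arrows \<open>X \<rightarrow> M(x, y)\<close> of \<open>V\<close> behave like arrows \<open>x \<rightarrow> y\<close> with a parameter in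
  \<open>X\<close>. The three composites along an action \<open>\<mu> : H \<otimes> G \<rightarrow> K\<close> that occur are those of two such
  parametrized arrows, and those in which the left or the right one has no parameter, that is, has
  the parameter object \<open>1\<close>, which is then suppressed.
\<close>

definition bc :: "'a \<Rightarrow> 'a \<Rightarrow> 'a \<Rightarrow> 'a" where "bc \<mu> f g = \<mu> \<cdot> (f \<boxtimes> g)"
definition lc :: "'a \<Rightarrow> 'a \<Rightarrow> 'a \<Rightarrow> 'a" where "lc \<mu> e f = \<mu> \<cdot> (e \<boxtimes> f) \<cdot> lun' (Dom V f)"
definition rc :: "'a \<Rightarrow> 'a \<Rightarrow> 'a \<Rightarrow> 'a" where "rc \<mu> f e = \<mu> \<cdot> (f \<boxtimes> e) \<cdot> run' (Dom V f)"

lemma bc_simps [simp]: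
  assumes "\<mu> \<in> Arr V" "f \<in> Arr V" "g \<in> Arr V" "Dom V \<mu> = Cod V f \<boxdot> Cod V g"
  shows "bc \<mu> f g \<in> Arr V" "Dom V (bc \<mu> f g) = Dom V f \<boxdot> Dom V g" "Cod V (bc \<mu> f g) = Cod V \<mu>"
  using assms by (simp_all add: bc_def)

lemma lc_simps [simp]:
  assumes "\<mu> \<in> Arr V" "e \<in> Arr V" "f \<in> Arr V" "Dom V e = I" "Dom V \<mu> = Cod V e \<boxdot> Cod V f"
  shows "lc \<mu> e f \<in> Arr V" "Dom V (lc \<mu> e f) = Dom V f" "Cod V (lc \<mu> e f) = Cod V \<mu>"
  using assms by (simp_all add: lc_def)

lemma rc_simps [simp]:
  assumes "\<mu> \<in> Arr V" "f \<in> Arr V" "e \<in> Arr V" "Dom V e = I" "Dom V \<mu> = Cod V f \<boxdot> Cod V e"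
  shows "rc \<mu> f e \<in> Arr V" "Dom V (rc \<mu> f e) = Dom V f" "Cod V (rc \<mu> f e) = Cod V \<mu>"
  using assms by (simp_all add: rc_def)

lemma bc_comp:
  assumes "\<mu> \<in> Arr V" "f \<in> Arr V" "g \<in> Arr V" "Dom V \<mu> = Cod V f \<boxdot> Cod V g"
    "a \<in> Arr V" "b \<in> Arr V" "Cod V a = Dom V f" "Cod V b = Dom V g"
  shows "bc \<mu> (f \<cdot> a) (g \<cdot> b) = bc \<mu> f g \<cdot> (a \<boxtimes> b)"
  using assms by (simp add: bc_def Comp_assoc merge)

lemma lc_comp:
  assumes "\<mu> \<in> Arr V" "e \<in> Arr V" "f \<in> Arr V" "Dom V e = I" "Dom V \<mu> = Cod V e \<boxdot> Cod V f"
    "a \<in> Arr V" "Cod V a = Dom V f"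
  shows "lc \<mu> e (f \<cdot> a) = lc \<mu> e f \<cdot> a"
proof -
  have "lc \<mu> e (f \<cdot> a) = \<mu> \<cdot> (e \<boxtimes> f) \<cdot> (idn I \<boxtimes> a) \<cdot> lun' (Dom V a)"
    using assms by (simp add: lc_def merge')
  also have "(idn I \<boxtimes> a) \<cdot> lun' (Dom V a) = lun' (Dom V f) \<cdot> a"
    using assms by (simp add: lun'_natural)
  finally show ?thesis using assms by (simp add: lc_def Comp_assoc)
qed

lemma rc_comp:
  assumes "\<mu> \<in> Arr V" "e \<in> Arr V" "f \<in> Arr V" "Dom V e = I" "Dom V \<mu> = Cod V f \<boxdot> Cod V e"
    "a \<in> Arr V" "Cod V a = Dom V f"
  shows "rc \<mu> (f \<cdot> a) e = rc \<mu> f e \<cdot> a"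
proof -
  have "rc \<mu> (f \<cdot> a) e = \<mu> \<cdot> (f \<boxtimes> e) \<cdot> (a \<boxtimes> idn I) \<cdot> run' (Dom V a)"
    using assms by (simp add: rc_def merge')
  also have "(a \<boxtimes> idn I) \<cdot> run' (Dom V a) = run' (Dom V f) \<cdot> a"
    using assms by (simp add: run'_natural)
  finally show ?thesis using assms by (simp add: rc_def Comp_assoc)
qed

lemma lc_eq_rc: "Dom V e = I \<Longrightarrow> Dom V f = I \<Longrightarrow> lc \<mu> e f = rc \<mu> e f"
  by (simp add: lc_def rc_def run_Unit)

text \<open>Post-composition with an arrow compatible with two actions.\<close>

lemma lc_map:
  assumes "p \<cdot> \<mu> = \<nu> \<cdot> (a \<boxtimes> b)" "\<mu> \<in> Arr V" "\<nu> \<in> Arr V" "p \<in> Arr V" "a \<in> Arr V" "b \<in> Arr V"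
    "Dom V p = Cod V \<mu>" "Dom V \<nu> = Cod V a \<boxdot> Cod V b" "Dom V \<mu> = Dom V a \<boxdot> Dom V b"
    "e \<in> Arr V" "f \<in> Arr V" "Dom V e = I" "Cod V e = Dom V a" "Cod V f = Dom V b"
  shows "p \<cdot> lc \<mu> e f = lc \<nu> (a \<cdot> e) (b \<cdot> f)"
  (is "?lhs = ?rhs")
proof -
  have "?lhs = (p \<cdot> \<mu>) \<cdot> (e \<boxtimes> f) \<cdot> lun' (Dom V f)"
    unfolding lc_def using assms(2-) by (subst Comp_assoc) simp_all
  also have "\<dots> = ?rhs"
    unfolding lc_def assms(1) using assms(2-) by (simp add: Comp_assoc merge')
  finally show ?thesis .
qed

lemma rc_map:
  assumes "p \<cdot> \<mu> = \<nu> \<cdot> (a \<boxtimes> b)" "\<mu> \<in> Arr V" "\<nu> \<in> Arr V" "p \<in> Arr V" "a \<in> Arr V" "b \<in> Arr V"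
    "Dom V p = Cod V \<mu>" "Dom V \<nu> = Cod V a \<boxdot> Cod V b" "Dom V \<mu> = Dom V a \<boxdot> Dom V b"
    "e \<in> Arr V" "f \<in> Arr V" "Dom V e = I" "Cod V f = Dom V a" "Cod V e = Dom V b"
  shows "p \<cdot> rc \<mu> f e = rc \<nu> (a \<cdot> f) (b \<cdot> e)"
  (is "?lhs = ?rhs")
proof -
  have "?lhs = (p \<cdot> \<mu>) \<cdot> (f \<boxtimes> e) \<cdot> run' (Dom V f)"
    unfolding rc_def using assms(2-) by (subst Comp_assoc) simp_all
  also have "\<dots> = ?rhs"
    unfolding rc_def assms(1) using assms(2-) by (simp add: Comp_assoc merge')
  finally show ?thesis .
qed

lemma bc_map:
  assumes "p \<cdot> \<mu> = \<nu> \<cdot> (a \<boxtimes> b)" "\<mu> \<in> Arr V" "\<nu> \<in> Arr V" "p \<in> Arr V" "a \<in> Arr V" "b \<in> Arr V"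
    "Dom V p = Cod V \<mu>" "Dom V \<nu> = Cod V a \<boxdot> Cod V b" "Dom V \<mu> = Dom V a \<boxdot> Dom V b"
    "e \<in> Arr V" "f \<in> Arr V" "Cod V f = Dom V a" "Cod V e = Dom V b"
  shows "p \<cdot> bc \<mu> f e = bc \<nu> (a \<cdot> f) (b \<cdot> e)"
  (is "?lhs = ?rhs")
proof -
  have "?lhs = (p \<cdot> \<mu>) \<cdot> (f \<boxtimes> e)"
    unfolding bc_def using assms(2-) by (subst Comp_assoc) simp_all
  also have "\<dots> = ?rhs"
    unfolding bc_def assms(1) using assms(2-) by (simp add: Comp_assoc merge)
  finally show ?thesis .
qed

text \<open>An associativity square for actions \<open>\<mu> : H \<otimes> G \<rightarrow> K\<close>, \<open>\<nu> : K \<otimes> F \<rightarrow> Z\<close>, \<open>\<mu>' : G \<otimes> F \<rightarrow> K'\<close> and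
  \<open>\<nu>' : H \<otimes> K' \<rightarrow> Z\<close>; by coherence, the three composites are associative in every combination.\<close>

definition asq :: "'a \<Rightarrow> 'a \<Rightarrow> 'a \<Rightarrow> 'a \<Rightarrow> 'o \<Rightarrow> 'o \<Rightarrow> 'o \<Rightarrow> bool" where
  "asq \<mu> \<nu> \<mu>' \<nu>' H G F \<longleftrightarrow> H \<in> Obj V \<and> G \<in> Obj V \<and> F \<in> Obj V \<and>
     \<mu> \<in> Arr V \<and> \<nu> \<in> Arr V \<and> \<mu>' \<in> Arr V \<and> \<nu>' \<in> Arr V \<and>
     Dom V \<mu> = H \<boxdot> G \<and> Dom V \<nu> = Cod V \<mu> \<boxdot> F \<and> Dom V \<mu>' = G \<boxdot> F \<and> Dom V \<nu>' = H \<boxdot> Cod V \<mu>' \<and>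
     Cod V \<nu> = Cod V \<nu>' \<and> \<nu> \<cdot> (\<mu> \<boxtimes> idn F) = \<nu>' \<cdot> (idn H \<boxtimes> \<mu>') \<cdot> ass H G F"

lemma asq_bb:
  assumes "asq \<mu> \<nu> \<mu>' \<nu>' H G F"
    and "h \<in> Arr V" "Cod V h = H" "g \<in> Arr V" "Cod V g = G" "f \<in> Arr V" "Cod V f = F"
  shows "bc \<nu> (bc \<mu> h g) f = bc \<nu>' h (bc \<mu>' g f) \<cdot> ass (Dom V h) (Dom V g) (Dom V f)"
proof -
  have [simp]: "H \<in> Obj V" "G \<in> Obj V" "F \<in> Obj V" "\<mu> \<in> Arr V" "\<nu> \<in> Arr V" "\<mu>' \<in> Arr V" "\<nu>' \<in> Arr V"
     "Dom V \<mu> = H \<boxdot> G" "Dom V \<nu> = Cod V \<mu> \<boxdot> F" "Dom V \<mu>' = G \<boxdot> F" "Dom V \<nu>' = H \<boxdot> Cod V \<mu>'"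
     "Cod V \<nu> = Cod V \<nu>'" and eq: "\<nu> \<cdot> (\<mu> \<boxtimes> idn F) = \<nu>' \<cdot> (idn H \<boxtimes> \<mu>') \<cdot> ass H G F"
    using assms(1) by (auto simp: asq_def)
  note [simp] = assms(2-)
  have "bc \<nu> (bc \<mu> h g) f = (\<nu> \<cdot> (\<mu> \<boxtimes> idn F)) \<cdot> ((h \<boxtimes> g) \<boxtimes> f)"
    by (simp add: bc_def Comp_assoc merge)
  also have "\<dots> = \<nu>' \<cdot> (idn H \<boxtimes> \<mu>') \<cdot> ass H G F \<cdot> ((h \<boxtimes> g) \<boxtimes> f)"
    unfolding eq by (simp add: Comp_assoc)
  also have "ass H G F \<cdot> ((h \<boxtimes> g) \<boxtimes> f) = (h \<boxtimes> (g \<boxtimes> f)) \<cdot> ass (Dom V h) (Dom V g) (Dom V f)"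
    using ass_natural [of h g f] by simp
  finally show ?thesis by (simp add: bc_def Comp_assoc merge')
qed

lemma asq_typing:
  assumes "asq \<mu> \<nu> \<mu>' \<nu>' H G F"
  shows "H \<in> Obj V" "G \<in> Obj V" "F \<in> Obj V" "\<mu> \<in> Arr V" "\<nu> \<in> Arr V" "\<mu>' \<in> Arr V" "\<nu>' \<in> Arr V"
     "Dom V \<mu> = H \<boxdot> G" "Dom V \<nu> = Cod V \<mu> \<boxdot> F" "Dom V \<mu>' = G \<boxdot> F" "Dom V \<nu>' = H \<boxdot> Cod V \<mu>'"
     "Cod V \<nu> = Cod V \<nu>'"
  using assms by (auto simp: asq_def)

lemma bc_precomp_left:
  assumes "\<mu> \<in> Arr V" "f \<in> Arr V" "g \<in> Arr V" "Dom V \<mu> = Cod V f \<boxdot> Cod V g" "a \<in> Arr V" "Cod V a = Dom V f"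
  shows "bc \<mu> (f \<cdot> a) g = bc \<mu> f g \<cdot> (a \<boxtimes> idn (Dom V g))"
  using bc_comp [OF assms(1-5), of "idn (Dom V g)"] assms by simp

lemma bc_precomp_right:
  assumes "\<mu> \<in> Arr V" "f \<in> Arr V" "g \<in> Arr V" "Dom V \<mu> = Cod V f \<boxdot> Cod V g" "a \<in> Arr V" "Cod V a = Dom V g"
  shows "bc \<mu> f (g \<cdot> a) = bc \<mu> f g \<cdot> (idn (Dom V f) \<boxtimes> a)"
  using bc_comp [OF assms(1-4), of "idn (Dom V f)" a] assms by simp

lemma lc_bc: "\<mu> \<in> Arr V \<Longrightarrow> e \<in> Arr V \<Longrightarrow> f \<in> Arr V \<Longrightarrow> Dom V e = I \<Longrightarrow> Dom V \<mu> = Cod V e \<boxdot> Cod V f \<Longrightarrow>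
    lc \<mu> e f = bc \<mu> e f \<cdot> lun' (Dom V f)"
  and rc_bc: "\<mu> \<in> Arr V \<Longrightarrow> e \<in> Arr V \<Longrightarrow> f \<in> Arr V \<Longrightarrow> Dom V e = I \<Longrightarrow> Dom V \<mu> = Cod V f \<boxdot> Cod V e \<Longrightarrow>
    rc \<mu> f e = bc \<mu> f e \<cdot> run' (Dom V f)"
  by (simp_all add: lc_def rc_def bc_def Comp_assoc)

context
  fixes \<mu> \<nu> \<mu>' \<nu>' H G F h g f
  assumes sq: "asq \<mu> \<nu> \<mu>' \<nu>' H G F"
    and h: "h \<in> Arr V" "Cod V h = H" and g: "g \<in> Arr V" "Cod V g = G" and f: "f \<in> Arr V" "Cod V f = F"
begin

lemma asq_lb: "Dom V h = I \<Longrightarrow> bc \<nu> (lc \<mu> h g) f = lc \<nu>' h (bc \<mu>' g f)"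
  using asq_typing [OF sq] h g f asq_bb [OF sq h g f] ass_lun' [of "Dom V g" "Dom V f"]
  by (simp add: lc_bc bc_precomp_left Comp_assoc)

lemma asq_rl: "Dom V g = I \<Longrightarrow> bc \<nu> (rc \<mu> h g) f = bc \<nu>' h (lc \<mu>' g f)"
  using asq_typing [OF sq] h g f asq_bb [OF sq h g f] ass_middle [of "Dom V h" "Dom V f"]
  by (simp add: rc_bc lc_bc bc_precomp_left bc_precomp_right Comp_assoc)

lemma asq_br: "Dom V f = I \<Longrightarrow> rc \<nu> (bc \<mu> h g) f = bc \<nu>' h (rc \<mu>' g f)"
  using asq_typing [OF sq] h g f asq_bb [OF sq h g f] ass_run' [of "Dom V h" "Dom V g"]
  by (simp add: rc_bc bc_precomp_right Comp_assoc)

end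

context
  fixes \<mu> \<nu> \<mu>' \<nu>' H G F h g f
  assumes sq: "asq \<mu> \<nu> \<mu>' \<nu>' H G F"
    and h: "h \<in> Arr V" "Cod V h = H" and g: "g \<in> Arr V" "Cod V g = G" and f: "f \<in> Arr V" "Cod V f = F"
begin

lemma asq_ll: "Dom V h = I \<Longrightarrow> Dom V g = I \<Longrightarrow> lc \<nu> (lc \<mu> h g) f = lc \<nu>' h (lc \<mu>' g f)"
  using asq_typing [OF sq] h g f asq_lb [OF sq h g f]
  by (simp add: lc_bc [of \<nu>] lc_bc [of \<mu>'] lc_comp)

lemma asq_lr: "Dom V h = I \<Longrightarrow> Dom V f = I \<Longrightarrow> rc \<nu> (lc \<mu> h g) f = lc \<nu>' h (rc \<mu>' g f)"
  using asq_typing [OF sq] h g f asq_lb [OF sq h g f]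
  by (simp add: rc_bc [of \<nu>] rc_bc [of \<mu>'] lc_comp)

lemma asq_rr: "Dom V g = I \<Longrightarrow> Dom V f = I \<Longrightarrow> rc \<nu> (rc \<mu> h g) f = rc \<nu>' h (lc \<mu>' g f)"
  using asq_typing [OF sq] h g f asq_rl [OF sq h g f]
  by (simp add: rc_bc [of \<nu>] rc_bc [of \<nu>'])

end

end

section \<open>Enriched categories\<close>

locale vct = smc V for V :: "('o, 'a) smcat" +
  fixes M :: "('m, 'o, 'a) vcat"
  assumes vcat: "vcategory V M"
begin

abbreviation "hob \<equiv> VHom M"
abbreviation "cmp \<equiv> VComp M"
abbreviation "vid \<equiv> VId M"
abbreviation "M0 \<equiv> underlying V M"

lemma vcat_simps [simp]:
  "x \<in> VObj M \<Longrightarrow> y \<in> VObj M \<Longrightarrow> hob x y \<in> Obj V"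
  "x \<in> VObj M \<Longrightarrow> vid x \<in> Arr V" "x \<in> VObj M \<Longrightarrow> Dom V (vid x) = I" "x \<in> VObj M \<Longrightarrow> Cod V (vid x) = hob x x"
  "x \<in> VObj M \<Longrightarrow> y \<in> VObj M \<Longrightarrow> z \<in> VObj M \<Longrightarrow> cmp x y z \<in> Arr V"
  "x \<in> VObj M \<Longrightarrow> y \<in> VObj M \<Longrightarrow> z \<in> VObj M \<Longrightarrow> Dom V (cmp x y z) = hob y z \<boxdot> hob x y"
  "x \<in> VObj M \<Longrightarrow> y \<in> VObj M \<Longrightarrow> z \<in> VObj M \<Longrightarrow> Cod V (cmp x y z) = hob x z"
  using vcat by (auto simp: vcategory_def homset_iff)

lemma vcat_asq:
  "w \<in> VObj M \<Longrightarrow> x \<in> VObj M \<Longrightarrow> y \<in> VObj M \<Longrightarrow> z \<in> VObj M \<Longrightarrow>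
   asq (cmp x y z) (cmp w x z) (cmp w x y) (cmp w y z) (hob y z) (hob x y) (hob w x)"
  using vcat by (simp add: asq_def vcategory_def)

lemma vid_lc [simp]:
  assumes [simp]: "x \<in> VObj M" "y \<in> VObj M" "f \<in> Arr V" "Cod V f = hob x y"
  shows "lc (cmp x y y) (vid y) f = f"
proof -
  have "cmp x y y \<cdot> (vid y \<boxtimes> idn (hob x y)) = lun (hob x y)"
    using vcat by (simp add: vcategory_def)
  then have "lc (cmp x y y) (vid y) (idn (hob x y)) = idn (hob x y)"
    by (simp add: lc_def flip: Comp_assoc)
  then show ?thesis using lc_comp [of "cmp x y y" "vid y" "idn (hob x y)" f] by simp
qed

lemma vid_rc [simp]:
  assumes [simp]: "x \<in> VObj M" "y \<in> VObj M" "f \<in> Arr V" "Cod V f = hob x y"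
  shows "rc (cmp x x y) f (vid x) = f"
proof -
  have "cmp x x y \<cdot> (idn (hob x y) \<boxtimes> vid x) = run (hob x y)"
    using vcat by (simp add: vcategory_def)
  then have "rc (cmp x x y) (idn (hob x y)) (vid x) = idn (hob x y)"
    by (simp add: rc_def flip: Comp_assoc)
  then show ?thesis using rc_comp [of "cmp x x y" "vid x" "idn (hob x y)" f] by simp
qed

lemma vid_lc_right [simp]:
  "x \<in> VObj M \<Longrightarrow> y \<in> VObj M \<Longrightarrow> f \<in> Arr V \<Longrightarrow> Dom V f = I \<Longrightarrow> Cod V f = hob x y \<Longrightarrow> lc (cmp x x y) f (vid x) = f"
  by (simp add: lc_eq_rc)

lemma elem_comp_lc: "Dom V f = I \<Longrightarrow> elem_comp V M x y z g f = lc (cmp x y z) g f"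
  by (simp add: elem_comp_def lc_def)

lemma underlying_simps:
  "Obj (underlying V M) = VObj M"
  "(x, y, f) \<in> Arr (underlying V M) \<longleftrightarrow> x \<in> VObj M \<and> y \<in> VObj M \<and> f \<in> Arr V \<and> Dom V f = I \<and> Cod V f = hob x y"
  "Dom (underlying V M) (x, y, f) = x" "Cod (underlying V M) (x, y, f) = y"
  "Idn (underlying V M) x = (x, x, vid x)"
  "Dom V f = I \<Longrightarrow> Comp (underlying V M) (y', z, g) (x, y, f) = (x, z, lc (cmp x y z) g f)"
  by (auto simp: underlying_def homset_iff elem_comp_lc)

lemma underlying_category: "category (underlying V M)"
  unfolding category_def
proof (intro conjI ballI impI)
  fix f g h assume fgh: "f \<in> Arr (underlying V M)" "g \<in> Arr (underlying V M)" "h \<in> Arr (underlying V M)"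
    "Cod (underlying V M) f = Dom (underlying V M) g \<and> Cod (underlying V M) g = Dom (underlying V M) h"
  then show "Comp (underlying V M) h (Comp (underlying V M) g f) = Comp (underlying V M) (Comp (underlying V M) h g) f"
    by (cases f, cases g, cases h) (simp add: underlying_simps asq_ll [OF vcat_asq])
qed (auto simp: underlying_simps homset_iff)

end

sublocale vct \<subseteq> und: categ "underlying V M"
  by unfold_locales (rule underlying_category)

section \<open>Limits over small index categories\<close>

lemma cat_op_simps [simp]:
  "Obj (cat_op K) = Obj K" "Arr (cat_op K) = Arr K" "Dom (cat_op K) = Cod K" "Cod (cat_op K) = Dom K"
  "Idn (cat_op K) = Idn K" "Comp (cat_op K) g f = Comp K f g"
  by (simp_all add: cat_op_def)

lemma homset_cat_op [simp]: "homset (cat_op K) x y = homset K y x"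
  by (auto simp: homset_iff)

lemma ex1D: "\<exists>!x. P x \<Longrightarrow> P a \<Longrightarrow> P b \<Longrightarrow> a = b"
  by blast

lemma small_inj:
  assumes "small TYPE('u) A"
  obtains f :: "'x \<Rightarrow> 'u" where "inj_on f A"
  using assms card_of_ordLeq [of A "UNIV :: 'u set"] ordLess_imp_ordLeq by (auto simp: small_def)

lemma small_image: "small U A \<Longrightarrow> small U (f ` A)"
  unfolding small_def using card_of_image ordLeq_ordLess_trans by blast

lemma universe_infinite: "universe TYPE('u) \<Longrightarrow> infinite (UNIV :: 'u set)"
  unfolding universe_def using infinite_iff_card_of_nat ordLess_imp_ordLeq by blast

lemma small_Un:
  assumes "universe TYPE('u)" "small TYPE('u) A" "small TYPE('u) B"
  shows "small TYPE('u) (A \<union> B)"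
  using assms card_of_Un_ordLess_infinite [OF universe_infinite [OF assms(1)]] by (simp add: small_def)

text \<open>Completeness speaks of index categories on the type that measures size. A small index category is
  transported there along injections of its objects and arrows.\<close>

lemma complete_cat_limit:
  fixes J :: "('i, 'j) cat" and K :: "('o, 'a, 'z) cat_scheme"
  assumes cpl: "complete_cat TYPE('u) K" and J: "small_category TYPE('u) J" and D: "is_functor J K D"
  shows "\<exists>x p. is_limit K J D x p"
proof -
  have Jc: "category J" using J by (simp add: small_category_def)
  interpret J: categ J by unfold_locales (rule Jc)
  obtain f :: "'i \<Rightarrow> 'u" where f: "inj_on f (Obj J)" using J small_inj by (auto simp: small_category_def)
  obtain g :: "'j \<Rightarrow> 'u" where g: "inj_on g (Arr J)" using J small_inj by (auto simp: small_category_def)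
  let ?f = "inv_into (Obj J) f" and ?g = "inv_into (Arr J) g"
  define J' :: "('u, 'u) cat" where "J' = \<lparr>Obj = f ` Obj J, Arr = g ` Arr J,
      Dom = f \<circ> Dom J \<circ> ?g, Cod = f \<circ> Cod J \<circ> ?g, Idn = g \<circ> Idn J \<circ> ?f, Comp = (\<lambda>v u. g (Comp J (?g v) (?g u)))\<rparr>"
  define D' :: "('u, 'u, 'o, 'a) functr" where "D' = \<lparr>Fobj = (\<lambda>x\<in>f ` Obj J. Fobj D (?f x)), Farr = (\<lambda>u\<in>g ` Arr J. Farr D (?g u))\<rparr>"
  have [simp]: "x \<in> Obj J \<Longrightarrow> ?f (f x) = x" "u \<in> Arr J \<Longrightarrow> ?g (g u) = u" for x u
    using f g by auto
  have feq [simp]: "x \<in> Obj J \<Longrightarrow> y \<in> Obj J \<Longrightarrow> f x = f y \<longleftrightarrow> x = y" for x y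
    using f by (auto simp: inj_on_eq_iff)
  have J'c: "category J'"
    unfolding category_def by (auto simp: J'_def homset_iff J.Comp_assoc)
  have 1: "small_category TYPE('u) J'"
    using J J'c by (simp add: small_category_def J'_def small_image)
  have 2: "is_functor J' K D'"
    using D unfolding is_functor_def by (auto simp: J'_def D'_def homset_iff)
  obtain x p where lim: "is_limit K J' D' x p"
    using cpl 1 2 unfolding complete_cat_def by blast
  have cone: "is_cone K J' D' y q' \<longleftrightarrow> is_cone K J D y q" if "\<And>j. j \<in> Obj J \<Longrightarrow> q' (f j) = q j" for y q q'
    unfolding is_cone_def using that by (auto simp: J'_def D'_def)
  have "is_limit K J D x (p \<circ> f)"
    unfolding is_limit_def
  proof (intro conjI allI impI)
    show "is_cone K J D x (p \<circ> f)"
      using lim cone [of p "p \<circ> f"] by (simp add: is_limit_def)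
    fix y q assume "is_cone K J D y q"
    then have "is_cone K J' D' y (q \<circ> ?f)" using cone [of "q \<circ> ?f" q] by simp
    then have "\<exists>!h. h \<in> homset K y x \<and> (\<forall>j\<in>Obj J'. Comp K (p j) h = (q \<circ> ?f) j)"
      using lim unfolding is_limit_def by blast
    then show "\<exists>!h. h \<in> homset K y x \<and> (\<forall>j\<in>Obj J. Comp K ((p \<circ> f) j) h = q j)"
      by (simp add: J'_def)
  qed
  then show ?thesis by blast
qed

text \<open>A copower is a colimit over a discrete category, transported to the type that measures size.\<close>

lemma cocomplete_cat_copower:
  fixes K :: "('o, 'a, 'z) cat_scheme" and S :: "'s set"
  assumes cpl: "cocomplete_cat TYPE('u) K" and K: "category K" and S: "small TYPE('u) S" and a: "a \<in> Obj K"
  shows "\<exists>x \<iota>. is_copower K S a x \<iota>"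
proof -
  interpret categ K by unfold_locales (rule K)
  obtain f :: "'s \<Rightarrow> 'u" where f: "inj_on f S" using S small_inj by auto
  define J :: "('u, 'u) cat" where "J = \<lparr>Obj = f ` S, Arr = f ` S, Dom = id, Cod = id, Idn = id, Comp = (\<lambda>_ u. u)\<rparr>"
  define D :: "('u, 'u, 'o, 'a) functr" where "D = \<lparr>Fobj = (\<lambda>x\<in>f ` S. a), Farr = (\<lambda>u\<in>f ` S. Idn K a)\<rparr>"
  have 1: "small_category TYPE('u) J"
    using S by (simp add: small_category_def J_def category_def homset_iff small_image)
  have 2: "is_functor J K D"
    using a by (auto simp: J_def D_def is_functor_def homset_iff)
  obtain x p where lim: "is_limit (cat_op K) (cat_op J) D x p"
    using cpl 1 2 unfolding cocomplete_cat_def is_colimit_def by blast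
  have univ: "\<exists>!h. h \<in> homset K x y \<and> (\<forall>j\<in>Obj J. Comp K h (p j) = q j)"
    if "is_cone (cat_op K) (cat_op J) D y q" for y q
    using lim that by (simp add: is_limit_def)
  have cone: "is_cone (cat_op K) (cat_op J) D y q \<longleftrightarrow> y \<in> Obj K \<and> (\<forall>s\<in>S. q (f s) \<in> homset K a y)" for y q
    using a unfolding is_cone_def by (auto simp: J_def D_def homset_iff)
  have "is_copower K S a x (p \<circ> f)"
    unfolding is_copower_def
  proof (intro conjI ballI allI impI)
    show "x \<in> Obj K" "\<And>s. s \<in> S \<Longrightarrow> (p \<circ> f) s \<in> homset K a x"
      using lim cone by (auto simp: is_limit_def)
    fix y q assume "y \<in> Obj K" "\<forall>s\<in>S. q s \<in> homset K a y"
    then have "is_cone (cat_op K) (cat_op J) D y (q \<circ> inv_into S f)"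
      using f by (simp add: cone)
    then have "\<exists>!h. h \<in> homset K x y \<and> (\<forall>j\<in>Obj J. Comp K h (p j) = (q \<circ> inv_into S f) j)"
      by (rule univ)
    then show "\<exists>!h. h \<in> homset K x y \<and> (\<forall>s\<in>S. Comp K h ((p \<circ> f) s) = q s)"
      using f by (simp add: J_def)
  qed
  then show ?thesis by blast
qed

section \<open>Presheaves\<close>

context smc
begin

text \<open>The tensor product preserves copowers in both variables, being a left adjoint in each.\<close>

lemma copower_tensor_right:
  assumes cop: "is_copower V S a x \<iota>" and [simp]: "a \<in> Obj V" "X \<in> Obj V"
  shows "is_copower V S (a \<boxdot> X) (x \<boxdot> X) (\<lambda>s. \<iota> s \<boxtimes> idn X)"
  unfolding is_copower_def
proof (intro conjI ballI allI impI)
  have x [simp]: "x \<in> Obj V" and \<iota>: "\<And>s. s \<in> S \<Longrightarrow> \<iota> s \<in> hm a x"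
    and univ: "\<And>y q. y \<in> Obj V \<Longrightarrow> \<forall>s\<in>S. q s \<in> hm a y \<Longrightarrow> \<exists>!h. h \<in> hm x y \<and> (\<forall>s\<in>S. h \<cdot> \<iota> s = q s)"
    using cop by (auto simp: is_copower_def)
  have \<iota>s [simp]: "s \<in> S \<Longrightarrow> \<iota> s \<in> Arr V" "s \<in> S \<Longrightarrow> Dom V (\<iota> s) = a" "s \<in> S \<Longrightarrow> Cod V (\<iota> s) = x" for s
    using \<iota> by (auto simp: homset_iff)
  show "x \<boxdot> X \<in> Obj V" "\<And>s. s \<in> S \<Longrightarrow> \<iota> s \<boxtimes> idn X \<in> hm (a \<boxdot> X) (x \<boxdot> X)"
    by (auto simp: homset_iff)
  fix y q assume y [simp]: "y \<in> Obj V" and q: "\<forall>s\<in>S. q s \<in> hm (a \<boxdot> X) y"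
  let ?c = "\<lambda>s. curry_arr V a X y (q s)"
  have qs [simp]: "s \<in> S \<Longrightarrow> q s \<in> Arr V" "s \<in> S \<Longrightarrow> Dom V (q s) = a \<boxdot> X" "s \<in> S \<Longrightarrow> Cod V (q s) = y" for s
    using q by (auto simp: homset_iff)
  have cs: "s \<in> S \<Longrightarrow> ?c s \<in> hm a (ihom X y)" for s
    by (simp add: homset_iff curry_simps)
  obtain h where h: "h \<in> hm x (ihom X y)" "\<And>s. s \<in> S \<Longrightarrow> h \<cdot> \<iota> s = ?c s"
    using ex1_implies_ex [OF univ [of "ihom X y" ?c]] cs by auto
  have hs [simp]: "h \<in> Arr V" "Dom V h = x" "Cod V h = ihom X y" using h by (auto simp: homset_iff)
  show "\<exists>!k. k \<in> hm (x \<boxdot> X) y \<and> (\<forall>s\<in>S. k \<cdot> (\<iota> s \<boxtimes> idn X) = q s)"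
  proof (rule ex1I [of _ "ev X y \<cdot> (h \<boxtimes> idn X)"], intro conjI ballI)
    fix s assume s: "s \<in> S"
    have "(ev X y \<cdot> (h \<boxtimes> idn X)) \<cdot> (\<iota> s \<boxtimes> idn X) = ev X y \<cdot> ((h \<cdot> \<iota> s) \<boxtimes> idn X)"
      using s by (simp add: Comp_assoc merge)
    then show "(ev X y \<cdot> (h \<boxtimes> idn X)) \<cdot> (\<iota> s \<boxtimes> idn X) = q s"
      using s by (simp add: h curry_simps)
  next
    fix k assume k: "k \<in> hm (x \<boxdot> X) y \<and> (\<forall>s\<in>S. k \<cdot> (\<iota> s \<boxtimes> idn X) = q s)"
    then have [simp]: "k \<in> Arr V" "Dom V k = x \<boxdot> X" "Cod V k = y" by (auto simp: homset_iff)
    let ?k = "curry_arr V x X y k"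
    note [simp] = curry_simps [of x X y k, simplified]
    have "?k \<cdot> \<iota> s = ?c s" if s: "s \<in> S" for s
      by (rule curry_unique [of _ _ X y])
        (use s k eval_curry [of x X y k "\<iota> s" "idn X"] in \<open>simp_all add: curry_simps\<close>)
    then have "?k = h"
      by (intro ex1D [OF univ [of "ihom X y" ?c]]) (use cs h in \<open>simp_all add: homset_iff\<close>)
    then have "ev X y \<cdot> (?k \<boxtimes> idn X) = ev X y \<cdot> (h \<boxtimes> idn X)" by simp
    then show "k = ev X y \<cdot> (h \<boxtimes> idn X)" by simp
  qed (simp add: homset_iff)
qed

lemma copower_tensor_left:
  assumes cop: "is_copower V S a x \<iota>" and [simp]: "a \<in> Obj V" "X \<in> Obj V"
  shows "is_copower V S (X \<boxdot> a) (X \<boxdot> x) (\<lambda>s. idn X \<boxtimes> \<iota> s)"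
  unfolding is_copower_def
proof (intro conjI ballI allI impI)
  have x [simp]: "x \<in> Obj V" and \<iota>: "\<And>s. s \<in> S \<Longrightarrow> \<iota> s \<in> hm a x"
    using cop by (auto simp: is_copower_def)
  have \<iota>s [simp]: "s \<in> S \<Longrightarrow> \<iota> s \<in> Arr V" "s \<in> S \<Longrightarrow> Dom V (\<iota> s) = a" "s \<in> S \<Longrightarrow> Cod V (\<iota> s) = x" for s
    using \<iota> by (auto simp: homset_iff)
  show "X \<boxdot> x \<in> Obj V" "\<And>s. s \<in> S \<Longrightarrow> idn X \<boxtimes> \<iota> s \<in> hm (X \<boxdot> a) (X \<boxdot> x)"
    by (auto simp: homset_iff)
  fix y q assume y [simp]: "y \<in> Obj V" and q: "\<forall>s\<in>S. q s \<in> hm (X \<boxdot> a) y"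
  have qs [simp]: "s \<in> S \<Longrightarrow> q s \<in> Arr V" "s \<in> S \<Longrightarrow> Dom V (q s) = X \<boxdot> a" "s \<in> S \<Longrightarrow> Cod V (q s) = y" for s
    using q by (auto simp: homset_iff)
  have univ: "\<exists>!h. h \<in> hm (x \<boxdot> X) y \<and> (\<forall>s\<in>S. h \<cdot> (\<iota> s \<boxtimes> idn X) = q s \<cdot> sy a X)"
    using copower_tensor_right [OF assms] unfolding is_copower_def by (auto simp: homset_iff)
  have nat: "sy x X \<cdot> (\<iota> s \<boxtimes> idn X) = (idn X \<boxtimes> \<iota> s) \<cdot> sy a X" "sy X x \<cdot> (idn X \<boxtimes> \<iota> s) = (\<iota> s \<boxtimes> idn X) \<cdot> sy X a"
    if "s \<in> S" for s
    using that sym_natural [of "\<iota> s" "idn X"] sym_natural [of "idn X" "\<iota> s"] by simp_all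
  from univ obtain h where h: "h \<in> hm (x \<boxdot> X) y" "\<And>s. s \<in> S \<Longrightarrow> h \<cdot> (\<iota> s \<boxtimes> idn X) = q s \<cdot> sy a X" by blast
  have hs [simp]: "h \<in> Arr V" "Dom V h = x \<boxdot> X" "Cod V h = y" using h by (auto simp: homset_iff)
  show "\<exists>!k. k \<in> hm (X \<boxdot> x) y \<and> (\<forall>s\<in>S. k \<cdot> (idn X \<boxtimes> \<iota> s) = q s)"
  proof (rule ex1I [of _ "h \<cdot> sy X x"], intro conjI ballI)
    fix s assume s: "s \<in> S"
    have "(h \<cdot> sy X x) \<cdot> (idn X \<boxtimes> \<iota> s) = (h \<cdot> (\<iota> s \<boxtimes> idn X)) \<cdot> sy X a"
      using s by (simp add: Comp_assoc nat)
    then show "(h \<cdot> sy X x) \<cdot> (idn X \<boxtimes> \<iota> s) = q s"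
      using s by (simp add: h Comp_assoc)
  next
    fix k assume k: "k \<in> hm (X \<boxdot> x) y \<and> (\<forall>s\<in>S. k \<cdot> (idn X \<boxtimes> \<iota> s) = q s)"
    then have [simp]: "k \<in> Arr V" "Dom V k = X \<boxdot> x" "Cod V k = y" by (auto simp: homset_iff)
    have "(k \<cdot> sy x X) \<cdot> (\<iota> s \<boxtimes> idn X) = q s \<cdot> sy a X" if s: "s \<in> S" for s
    proof -
      have "(k \<cdot> sy x X) \<cdot> (\<iota> s \<boxtimes> idn X) = (k \<cdot> (idn X \<boxtimes> \<iota> s)) \<cdot> sy a X"
        using s by (simp add: Comp_assoc nat)
      then show ?thesis using k s by simp
    qed
    then have "k \<cdot> sy x X = h" by (intro ex1D [OF univ]) (use h in \<open>simp_all add: homset_iff\<close>)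
    then have "h \<cdot> sy X x = (k \<cdot> sy x X) \<cdot> sy X x" by simp
    also have "\<dots> = k" by (simp add: Comp_assoc)
    finally show "k = h \<cdot> sy X x" by simp
  qed (simp add: homset_iff)
qed

lemma copower_unique:
  assumes "is_copower V S a x \<iota>" "h \<in> Arr V" "h' \<in> Arr V" "Dom V h = x" "Dom V h' = x" "Cod V h = Cod V h'"
    and "\<And>s. s \<in> S \<Longrightarrow> h \<cdot> \<iota> s = h' \<cdot> \<iota> s"
  shows "h = h'"
proof -
  have "\<forall>s\<in>S. h' \<cdot> \<iota> s \<in> hm a (Cod V h')" using assms by (auto simp: is_copower_def homset_iff)
  moreover have "\<exists>!k. k \<in> hm x y \<and> (\<forall>s\<in>S. k \<cdot> \<iota> s = q s)"
    if "y \<in> Obj V" "\<forall>s\<in>S. q s \<in> hm a y" for y q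
    using assms(1) that by (simp add: is_copower_def)
  from this [of "Cod V h'" "\<lambda>s. h' \<cdot> \<iota> s"]
  have "\<forall>s\<in>S. h' \<cdot> \<iota> s \<in> hm a (Cod V h') \<Longrightarrow> \<exists>!k. k \<in> hm x (Cod V h') \<and> (\<forall>s\<in>S. k \<cdot> \<iota> s = h' \<cdot> \<iota> s)"
    using Cod_Obj [OF assms(3)] by simp
  ultimately have "\<exists>!k. k \<in> hm x (Cod V h') \<and> (\<forall>s\<in>S. k \<cdot> \<iota> s = h' \<cdot> \<iota> s)"
    by simp
  then show ?thesis by (rule ex1D) (use assms in \<open>simp_all add: homset_iff\<close>)
qed

end

text \<open>The index category of the diagram whose limit is an end over \<open>C\<close>: it has an object for each
  object and for each arrow of \<open>C\<close>, and each arrow of \<open>C\<close> receives a map from both its ends.\<close>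

definition end_index :: "('c, 'd) cat \<Rightarrow> ('c + 'd, ('c + 'd) + 'd + 'd) cat" where
  "end_index C = \<lparr>Obj = Inl ` Obj C \<union> Inr ` Arr C,
     Arr = Inl ` (Inl ` Obj C \<union> Inr ` Arr C) \<union> (Inr \<circ> Inl) ` Arr C \<union> (Inr \<circ> Inr) ` Arr C,
     Dom = case_sum id (case_sum (Inl \<circ> Cod C) (Inl \<circ> Dom C)),
     Cod = case_sum id (case_sum Inr Inr),
     Idn = Inl, Comp = (\<lambda>g f. case f of Inl x \<Rightarrow> g | Inr u \<Rightarrow> f)\<rparr>"

lemma end_index_small:
  assumes "universe TYPE('u)" "small_category TYPE('u) C"
  shows "small_category TYPE('u) (end_index C)"
proof -
  interpret categ C using assms by unfold_locales (simp add: small_category_def)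
  have "category (end_index C)"
    unfolding category_def by (auto simp: end_index_def homset_iff)
  moreover have s: "small TYPE('u) (Obj C)" "small TYPE('u) (Arr C)" using assms by (auto simp: small_category_def)
  ultimately show ?thesis
    using s unfolding small_category_def
    by (simp add: end_index_def small_Un [OF assms(1)] small_image)
qed

text \<open>A cone over the index category above is a wedge: its components at arrows of \<open>C\<close> are determined by
  those at objects, and their agreement on both sides is the wedge condition.\<close>

lemma (in smc) presheaf_end_exists:
  assumes u: "universe TYPE('u)" and cpl: "complete_cat TYPE('u) V" and C: "small_category TYPE('u) C"
    and F: "F \<in> presheaves V C" and G: "G \<in> presheaves V C"
  shows "\<exists>e \<pi>. is_presheaf_end V C F G e \<pi>"
proof -
  interpret C: categ C using C by unfold_locales (simp add: small_category_def)
  have [simp]: "c \<in> Obj C \<Longrightarrow> Fobj F c \<in> Obj V" "v \<in> Arr C \<Longrightarrow> Farr F v \<in> Arr V"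
    "v \<in> Arr C \<Longrightarrow> Dom V (Farr F v) = Fobj F (Cod C v)" "v \<in> Arr C \<Longrightarrow> Cod V (Farr F v) = Fobj F (Dom C v)" for c v
    using F by (auto simp: presheaves_def is_functor_def homset_iff)
  have [simp]: "c \<in> Obj C \<Longrightarrow> Fobj G c \<in> Obj V" "v \<in> Arr C \<Longrightarrow> Farr G v \<in> Arr V"
    "v \<in> Arr C \<Longrightarrow> Dom V (Farr G v) = Fobj G (Cod C v)" "v \<in> Arr C \<Longrightarrow> Cod V (Farr G v) = Fobj G (Dom C v)" for c v
    using G by (auto simp: presheaves_def is_functor_def homset_iff)
  let ?J = "end_index C"
  define o' where "o' = case_sum (\<lambda>c. ihom (Fobj F c) (Fobj G c)) (\<lambda>v. ihom (Fobj F (Cod C v)) (Fobj G (Dom C v)))"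
  define l where "l v = Ihom_arr V (Idn V (Fobj F (Cod C v))) (Farr G v)" for v
  define r where "r v = Ihom_arr V (Farr F v) (Idn V (Fobj G (Dom C v)))" for v
  have o'_simps [simp]: "o' (Inl c) = ihom (Fobj F c) (Fobj G c)" "o' (Inr v) = ihom (Fobj F (Cod C v)) (Fobj G (Dom C v))" for c v
    by (simp_all add: o'_def)
  have lr [simp]: "l v \<in> Arr V" "Dom V (l v) = o' (Inl (Cod C v))" "Cod V (l v) = o' (Inr v)"
      "r v \<in> Arr V" "Dom V (r v) = o' (Inl (Dom C v))" "Cod V (r v) = o' (Inr v)" if "v \<in> Arr C" for v
    using that by (simp_all add: l_def r_def Ihom_arr_simps)
  have o_Obj [simp]: "x \<in> Obj ?J \<Longrightarrow> o' x \<in> Obj V" for x by (auto simp: end_index_def)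
  define D where "D = \<lparr>Fobj = (\<lambda>x\<in>Obj ?J. o' x),
     Farr = (\<lambda>v\<in>Arr ?J. case_sum (\<lambda>x. idn (o' x)) (case_sum l r) v)\<rparr>"
  have Do: "Fobj D x = o' x" if "x \<in> Obj ?J" for x using that by (simp add: D_def)
  have Da: "Farr D (Inl x) = idn (o' x)" if "x \<in> Obj ?J" for x using that by (simp add: D_def end_index_def)
  have Dlr: "Farr D (Inr (Inl v)) = l v" "Farr D (Inr (Inr v)) = r v" if "v \<in> Arr C" for v
    using that by (simp_all add: D_def end_index_def)
  have JO: "Inl c \<in> Obj ?J \<longleftrightarrow> c \<in> Obj C" "Inr v \<in> Obj ?J \<longleftrightarrow> v \<in> Arr C" for c v by (auto simp: end_index_def)
  have arrE: P if "f \<in> Arr ?J" "\<And>x. x \<in> Obj ?J \<Longrightarrow> f = Inl x \<Longrightarrow> P"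
     "\<And>v. v \<in> Arr C \<Longrightarrow> f = Inr (Inl v) \<Longrightarrow> P" "\<And>v. v \<in> Arr C \<Longrightarrow> f = Inr (Inr v) \<Longrightarrow> P" for f P
    using that by (auto simp: end_index_def)
  have J: "Dom ?J (Inl x) = x" "Cod ?J (Inl x) = x" "Dom ?J (Inr (Inl v)) = Inl (Cod C v)" "Dom ?J (Inr (Inr v)) = Inl (Dom C v)"
     "Cod ?J (Inr (Inl v)) = Inr v" "Cod ?J (Inr (Inr v)) = Inr v" "Idn ?J x = Inl x"
     "Comp ?J g (Inl x) = g" "Comp ?J g (Inr u) = Inr u" for x v g u
    by (simp_all add: end_index_def)
  have Dhom: "Farr D f \<in> hm (Fobj D (Dom ?J f)) (Fobj D (Cod ?J f))" if "f \<in> Arr ?J" for f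
    using that by (elim arrE) (simp_all add: J Do Da Dlr JO homset_iff)
  have "is_functor ?J V D"
    unfolding is_functor_def
  proof (intro conjI ballI impI)
    show "Fobj D \<in> Obj ?J \<rightarrow>\<^sub>E Obj V" by (auto simp: D_def)
    show "Farr D \<in> Arr ?J \<rightarrow>\<^sub>E Arr V" using Dhom by (auto simp: homset_iff) (simp add: D_def)
    show "Farr D (Idn ?J x) = idn (Fobj D x)" if "x \<in> Obj ?J" for x using that by (simp add: J Do Da)
    show "Farr D (Comp ?J g f) = Farr D g \<cdot> Farr D f" if "f \<in> Arr ?J" "g \<in> Arr ?J" "Cod ?J f = Dom ?J g" for f g
      using that(2,1,3) by (elim arrE) (simp_all add: J Do Da Dlr JO)
  qed (use Dhom in simp)
  then obtain x p where lim: "is_limit V ?J D x p"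
    using complete_cat_limit [OF cpl end_index_small [OF u C]] by blast
  have objs: "(\<forall>x\<in>Obj ?J. Q x) \<longleftrightarrow> (\<forall>c\<in>Obj C. Q (Inl c)) \<and> (\<forall>v\<in>Arr C. Q (Inr v))" for Q
    by (auto simp: end_index_def)
  have arrs: "(\<forall>x\<in>Arr ?J. Q x) \<longleftrightarrow> (\<forall>x\<in>Obj ?J. Q (Inl x)) \<and> (\<forall>v\<in>Arr C. Q (Inr (Inl v)) \<and> Q (Inr (Inr v)))" for Q
    by (auto simp: end_index_def)
  have cone: "is_cone V ?J D y q \<longleftrightarrow> presheaf_wedge V C F G y (q \<circ> Inl) \<and> (\<forall>v\<in>Arr C. q (Inr v) = l v \<cdot> q (Inl (Cod C v)))"
    (is "_ \<longleftrightarrow> ?w \<and> ?e") for y q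
  proof
    assume cn: "is_cone V ?J D y q"
    then have q: "y \<in> Obj V" "\<And>x. x \<in> Obj ?J \<Longrightarrow> q x \<in> hm y (o' x)" "\<And>v. v \<in> Arr C \<Longrightarrow> l v \<cdot> q (Inl (Cod C v)) = q (Inr v)"
      "\<And>v. v \<in> Arr C \<Longrightarrow> r v \<cdot> q (Inl (Dom C v)) = q (Inr v)"
      unfolding is_cone_def arrs by (simp_all add: J Do Dlr)
    show "?w \<and> ?e"
      using q(1,3,4) q(2) [of "Inl _"] unfolding presheaf_wedge_def l_def [symmetric] r_def [symmetric] by (simp add: JO)
  next
    assume we: "?w \<and> ?e"
    have q: "y \<in> Obj V" "\<And>c. c \<in> Obj C \<Longrightarrow> q (Inl c) \<in> hm y (o' (Inl c))"
       "\<And>v. v \<in> Arr C \<Longrightarrow> l v \<cdot> q (Inl (Cod C v)) = r v \<cdot> q (Inl (Dom C v))"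
       "\<And>v. v \<in> Arr C \<Longrightarrow> q (Inr v) = l v \<cdot> q (Inl (Cod C v))"
      using we unfolding presheaf_wedge_def l_def [symmetric] r_def [symmetric] by simp_all
    have q': "q x \<in> hm y (o' x)" if "x \<in> Obj ?J" for x
    proof (cases x)
      case (Inl c) then show ?thesis using q(2) that by (simp add: JO)
    next
      case (Inr v)
      have v: "v \<in> Arr C" using that Inr by (simp add: JO)
      have "l v \<cdot> q (Inl (Cod C v)) \<in> hm y (o' (Inr v))"
        using v q(2) [of "Cod C v"] by (auto simp: homset_iff)
      then show ?thesis using q(4) [OF v] Inr by simp
    qed
    show "is_cone V ?J D y q"
      unfolding is_cone_def arrs
    proof (intro conjI ballI)
      fix x assume x: "x \<in> Obj ?J"
      then show "q x \<in> hm y (Fobj D x)" by (simp add: Do q')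
      show "Farr D (Inl x) \<cdot> q (Dom ?J (Inl x)) = q (Cod ?J (Inl x))"
        using x q' [OF x] by (simp add: J Da homset_iff)
    qed (simp_all add: q(1,3,4) J Dlr)
  qed
  have "is_presheaf_end V C F G x (p \<circ> Inl)"
    unfolding is_presheaf_end_def
  proof (intro conjI allI impI)
    show "presheaf_wedge V C F G x (p \<circ> Inl)" using lim cone by (simp add: is_limit_def)
    fix y \<pi> assume w: "presheaf_wedge V C F G y \<pi>"
    let ?q = "case_sum \<pi> (\<lambda>v. l v \<cdot> \<pi> (Cod C v))"
    have "is_cone V ?J D y ?q" using w by (simp add: cone comp_def)
    then have ex: "\<exists>!h. h \<in> hm y x \<and> (\<forall>j\<in>Obj ?J. p j \<cdot> h = ?q j)"
      using lim unfolding is_limit_def by blast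
    have "is_cone V ?J D x p" using lim by (simp add: is_limit_def)
    then have pr: "\<forall>v\<in>Arr C. p (Inr v) = l v \<cdot> p (Inl (Cod C v))" and pw: "presheaf_wedge V C F G x (p \<circ> Inl)"
      by (simp_all add: cone)
    have p: "p (Inl c) \<in> Arr V" "Dom V (p (Inl c)) = x" "Cod V (p (Inl c)) = ihom (Fobj F c) (Fobj G c)" if "c \<in> Obj C" for c
      using pw that by (auto simp: presheaf_wedge_def homset_iff)
    have "(\<forall>j\<in>Obj ?J. p j \<cdot> h = ?q j) \<longleftrightarrow> (\<forall>c\<in>Obj C. p (Inl c) \<cdot> h = \<pi> c)" if h: "h \<in> hm y x" for h
    proof -
      have "p (Inr v) \<cdot> h = l v \<cdot> \<pi> (Cod C v)" if "\<forall>c\<in>Obj C. p (Inl c) \<cdot> h = \<pi> c" "v \<in> Arr C" for v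
      proof -
        have "p (Inr v) \<cdot> h = l v \<cdot> p (Inl (Cod C v)) \<cdot> h"
          using pr h that p by (simp add: Comp_assoc homset_iff)
        then show ?thesis using that by simp
      qed
      then show ?thesis unfolding objs by auto
    qed
    then show "\<exists>!h. h \<in> hm y x \<and> (\<forall>c\<in>Obj C. (p \<circ> Inl) c \<cdot> h = \<pi> c)"
      using ex by (simp cong: conj_cong)
  qed
  then show ?thesis by blast
qed

lemma the_ex1: "a = (THE x. P x) \<Longrightarrow> \<exists>!x. P x \<Longrightarrow> P a"
  by (simp add: theI')

text \<open>The \<open>V\<close>-category of presheaves is determined by its evaluation arrows
  \<open>act F G c : [F, G] \<otimes> F c \<rightarrow> G c\<close>; ends enter only through the universal property of these.\<close>

locale psh = smc V for V :: "('o, 'a) smcat" +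
  fixes C :: "('c, 'd) cat"
  assumes C_category: "category C"
    and end_exists: "\<And>F G. F \<in> presheaves V C \<Longrightarrow> G \<in> presheaves V C \<Longrightarrow> \<exists>e \<pi>. is_presheaf_end V C F G e \<pi>"
    and copower_exists: "\<And>c d. \<exists>x \<iota>. is_copower V (homset C d c) (Unit V) x \<iota>"

sublocale psh \<subseteq> C: categ C
  by unfold_locales (rule C_category)

context psh
begin

abbreviation "Psh \<equiv> presheaves V C"
abbreviation "ph \<equiv> presheaf_hom V C"

lemma psh_simps [simp]:
  assumes "F \<in> Psh"
  shows "c \<in> Obj C \<Longrightarrow> Fobj F c \<in> Obj V" "u \<in> Arr C \<Longrightarrow> Farr F u \<in> Arr V"
    "u \<in> Arr C \<Longrightarrow> Dom V (Farr F u) = Fobj F (Cod C u)" "u \<in> Arr C \<Longrightarrow> Cod V (Farr F u) = Fobj F (Dom C u)"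
    "c \<in> Obj C \<Longrightarrow> Farr F (Idn C c) = idn (Fobj F c)"
  using assms by (auto simp: presheaves_def is_functor_def homset_iff)

lemma psh_comp:
  assumes "F \<in> Psh" "u \<in> Arr C" "v \<in> Arr C" "Cod C u = Dom C v"
  shows "Farr F (Comp C v u) = Farr F u \<cdot> Farr F v"
proof -
  have "\<forall>f\<in>Arr C. \<forall>g\<in>Arr C. Dom C f = Cod C g \<longrightarrow> Farr F (Comp C f g) = Farr F g \<cdot> Farr F f"
    using assms(1) unfolding presheaves_def is_functor_def mem_Collect_eq cat_op_simps by blast
  then show ?thesis using assms(2,3) assms(4) [symmetric] by blast
qed

lemma presheaf_end:
  "F \<in> Psh \<Longrightarrow> G \<in> Psh \<Longrightarrow> is_presheaf_end V C F G (ph F G) (presheaf_proj V C F G)"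
  unfolding presheaf_hom_def presheaf_proj_def presheaf_end_def
  using someI_ex [of "\<lambda>p. is_presheaf_end V C F G (fst p) (snd p)"] end_exists [of F G]
  by (auto simp: case_prod_unfold)

lemma ph_Obj [simp]: "F \<in> Psh \<Longrightarrow> G \<in> Psh \<Longrightarrow> ph F G \<in> Obj V"
  using presheaf_end by (auto simp: is_presheaf_end_def presheaf_wedge_def)

lemma proj_simps [simp]:
  assumes "F \<in> Psh" "G \<in> Psh" "c \<in> Obj C"
  shows "presheaf_proj V C F G c \<in> Arr V" "Dom V (presheaf_proj V C F G c) = ph F G"
    "Cod V (presheaf_proj V C F G c) = ihom (Fobj F c) (Fobj G c)"
  using presheaf_end [OF assms(1,2)] assms(3) by (auto simp: is_presheaf_end_def presheaf_wedge_def homset_iff)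

definition act :: "('c, 'd, 'o, 'a) presheaf \<Rightarrow> ('c, 'd, 'o, 'a) presheaf \<Rightarrow> 'c \<Rightarrow> 'a" where
  "act F G c = ev (Fobj F c) (Fobj G c) \<cdot> (presheaf_proj V C F G c \<boxtimes> idn (Fobj F c))"

lemma act_simps [simp]:
  assumes "F \<in> Psh" "G \<in> Psh" "c \<in> Obj C"
  shows "act F G c \<in> Arr V" "Dom V (act F G c) = ph F G \<boxdot> Fobj F c" "Cod V (act F G c) = Fobj G c"
  using assms by (simp_all add: act_def)

lemma bc_act:
  assumes "F \<in> Psh" "G \<in> Psh" "c \<in> Obj C" "h \<in> Arr V" "Cod V h = ph F G" "k \<in> Arr V" "Cod V k = Fobj F c"
  shows "bc (act F G c) h k = ev (Fobj F c) (Fobj G c) \<cdot> ((presheaf_proj V C F G c \<cdot> h) \<boxtimes> k)"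
  using assms by (simp add: bc_def act_def Comp_assoc merge)

text \<open>The wedge condition, uncurried: extranaturality of arrows into internal homs is naturality of the
  corresponding evaluated arrows.\<close>

lemma wedge_iff:
  assumes F: "F \<in> Psh" and G: "G \<in> Psh" and X: "X \<in> Obj V"
    and \<pi>: "\<And>c. c \<in> Obj C \<Longrightarrow> \<pi> c \<in> hm X (ihom (Fobj F c) (Fobj G c))"
  shows "presheaf_wedge V C F G X \<pi> \<longleftrightarrow>
    (\<forall>u\<in>Arr C. Farr G u \<cdot> (ev (Fobj F (Cod C u)) (Fobj G (Cod C u)) \<cdot> (\<pi> (Cod C u) \<boxtimes> idn (Fobj F (Cod C u)))) =
       ev (Fobj F (Dom C u)) (Fobj G (Dom C u)) \<cdot> (\<pi> (Dom C u) \<boxtimes> Farr F u))"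
proof -
  note [simp] = F G X
  have [simp]: "c \<in> Obj C \<Longrightarrow> \<pi> c \<in> Arr V" "c \<in> Obj C \<Longrightarrow> Dom V (\<pi> c) = X"
    "c \<in> Obj C \<Longrightarrow> Cod V (\<pi> c) = ihom (Fobj F c) (Fobj G c)" for c
    using \<pi> by (auto simp: homset_iff)
  have "Ihom_arr V (idn (Fobj F (Cod C u))) (Farr G u) \<cdot> \<pi> (Cod C u) =
        Ihom_arr V (Farr F u) (idn (Fobj G (Dom C u))) \<cdot> \<pi> (Dom C u) \<longleftrightarrow>
      Farr G u \<cdot> (ev (Fobj F (Cod C u)) (Fobj G (Cod C u)) \<cdot> (\<pi> (Cod C u) \<boxtimes> idn (Fobj F (Cod C u)))) =
       ev (Fobj F (Dom C u)) (Fobj G (Dom C u)) \<cdot> (\<pi> (Dom C u) \<boxtimes> Farr F u)" (is "?l = ?r \<longleftrightarrow> ?L = ?R")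
    if u: "u \<in> Arr C" for u
  proof -
    note [simp] = u Ihom_arr_simps
    have "?l = ?r \<longleftrightarrow> ev (Fobj F (Cod C u)) (Fobj G (Dom C u)) \<cdot> (?l \<boxtimes> idn (Fobj F (Cod C u))) =
        ev (Fobj F (Cod C u)) (Fobj G (Dom C u)) \<cdot> (?r \<boxtimes> idn (Fobj F (Cod C u)))" (is "_ \<longleftrightarrow> ?a = ?b")
      using curry_unique [of ?l ?r "Fobj F (Cod C u)" "Fobj G (Dom C u)"] by auto
    moreover have "?a = ?L" by (simp add: eval_Ihom_arr)
    moreover have "?b = ?R" by (simp add: eval_Ihom_arr)
    ultimately show ?thesis by simp
  qed
  then show ?thesis using \<pi> by (auto simp: presheaf_wedge_def)
qed

lemma act_natural:
  assumes [simp]: "F \<in> Psh" "G \<in> Psh" "u \<in> Arr C" "h \<in> Arr V" "Cod V h = ph F G" "x \<in> Arr V" "Cod V x = Fobj F (Cod C u)"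
  shows "Farr G u \<cdot> bc (act F G (Cod C u)) h x = bc (act F G (Dom C u)) h (Farr F u \<cdot> x)"
  (is "?lhs = ?rhs")
proof -
  have "presheaf_wedge V C F G (ph F G) (presheaf_proj V C F G)"
    using presheaf_end [of F G] by (simp add: is_presheaf_end_def)
  then have *: "Farr G u \<cdot> act F G (Cod C u) = act F G (Dom C u) \<cdot> (idn (ph F G) \<boxtimes> Farr F u)"
    by (subst (asm) wedge_iff) (auto simp: homset_iff act_def Comp_assoc merge)
  have "?lhs = (Farr G u \<cdot> act F G (Cod C u)) \<cdot> (h \<boxtimes> x)"
    by (simp add: bc_def Comp_assoc)
  also have "\<dots> = ?rhs"
    unfolding * by (simp add: bc_def Comp_assoc merge)
  finally show ?thesis .
qed

text \<open>Parametrized natural families, and their correspondence to arrows into hom objects.\<close>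

definition nat_fam :: "('c, 'd, 'o, 'a) presheaf \<Rightarrow> ('c, 'd, 'o, 'a) presheaf \<Rightarrow> 'o \<Rightarrow> ('c \<Rightarrow> 'a) \<Rightarrow> bool" where
  "nat_fam F G X \<kappa> \<longleftrightarrow> (\<forall>c\<in>Obj C. \<kappa> c \<in> hm (X \<boxdot> Fobj F c) (Fobj G c)) \<and>
     (\<forall>u\<in>Arr C. Farr G u \<cdot> \<kappa> (Cod C u) = \<kappa> (Dom C u) \<cdot> (idn X \<boxtimes> Farr F u))"

lemma ph_unique:
  assumes F: "F \<in> Psh" and G: "G \<in> Psh" and h: "h \<in> Arr V" "Cod V h = ph F G" and h': "h' \<in> Arr V" "Cod V h' = ph F G"
    and "Dom V h = Dom V h'"
    and eq: "\<And>c. c \<in> Obj C \<Longrightarrow> bc (act F G c) h (idn (Fobj F c)) = bc (act F G c) h' (idn (Fobj F c))"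
  shows "h = h'"
proof -
  note [simp] = F G h h' \<open>Dom V h = Dom V h'\<close>
  let ?p = "presheaf_proj V C F G"
  have p: "?p c \<cdot> h = ?p c \<cdot> h'" if c: "c \<in> Obj C" for c
    by (rule curry_unique [of _ _ "Fobj F c" "Fobj G c"]) (use c eq [OF c] in \<open>simp_all add: bc_act\<close>)
  have end': "is_presheaf_end V C F G (ph F G) ?p" by (rule presheaf_end) simp_all
  then have w: "presheaf_wedge V C F G (ph F G) ?p" by (simp add: is_presheaf_end_def)
  have "presheaf_wedge V C F G (Dom V h') (\<lambda>c. ?p c \<cdot> h')"
    using w unfolding presheaf_wedge_def
    by (simp add: homset_iff Ihom_arr_simps flip: Comp_assoc)
  then have "\<exists>!k. k \<in> hm (Dom V h') (ph F G) \<and> (\<forall>c\<in>Obj C. ?p c \<cdot> k = ?p c \<cdot> h')"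
    using end' by (simp add: is_presheaf_end_def)
  then show ?thesis by (rule ex1D) (use p in \<open>simp_all add: homset_iff\<close>)
qed

lemma ph_exists:
  assumes F: "F \<in> Psh" and G: "G \<in> Psh" and X: "X \<in> Obj V" and nat: "nat_fam F G X \<kappa>"
  obtains h where "h \<in> hm X (ph F G)" "\<And>c. c \<in> Obj C \<Longrightarrow> bc (act F G c) h (idn (Fobj F c)) = \<kappa> c"
proof -
  note [simp] = F G X
  have [simp]: "c \<in> Obj C \<Longrightarrow> \<kappa> c \<in> Arr V" "c \<in> Obj C \<Longrightarrow> Dom V (\<kappa> c) = X \<boxdot> Fobj F c" "c \<in> Obj C \<Longrightarrow> Cod V (\<kappa> c) = Fobj G c" for c
    using nat by (auto simp: nat_fam_def homset_iff)
  let ?\<pi> = "\<lambda>c. curry_arr V X (Fobj F c) (Fobj G c) (\<kappa> c)"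
  have \<pi>: "?\<pi> c \<in> hm X (ihom (Fobj F c) (Fobj G c))" if "c \<in> Obj C" for c
    using that by (simp add: homset_iff curry_simps)
  have "presheaf_wedge V C F G X ?\<pi>"
  proof (rule wedge_iff [OF F G X \<pi>, THEN iffD2], assumption, rule ballI)
    fix u assume u: "u \<in> Arr C"
    then show "Farr G u \<cdot> (ev (Fobj F (Cod C u)) (Fobj G (Cod C u)) \<cdot> (?\<pi> (Cod C u) \<boxtimes> idn (Fobj F (Cod C u)))) =
       ev (Fobj F (Dom C u)) (Fobj G (Dom C u)) \<cdot> (?\<pi> (Dom C u) \<boxtimes> Farr F u)"
      using nat eval_curry [of X "Fobj F (Dom C u)" "Fobj G (Dom C u)" "\<kappa> (Dom C u)" "idn X" "Farr F u"]
      by (simp add: curry_simps nat_fam_def)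
  qed
  moreover have "is_presheaf_end V C F G (ph F G) (presheaf_proj V C F G)" by (rule presheaf_end) simp_all
  ultimately have "\<exists>h. h \<in> hm X (ph F G) \<and> (\<forall>c\<in>Obj C. presheaf_proj V C F G c \<cdot> h = ?\<pi> c)"
    unfolding is_presheaf_end_def by blast
  then obtain h where h: "h \<in> hm X (ph F G)" "\<And>c. c \<in> Obj C \<Longrightarrow> presheaf_proj V C F G c \<cdot> h = ?\<pi> c" by blast
  have "bc (act F G c) h (idn (Fobj F c)) = \<kappa> c" if "c \<in> Obj C" for c
    using h that by (simp add: homset_iff bc_act curry_simps)
  then show thesis using h that by blast
qed

subsection \<open>Identities and composition of presheaves\<close>

abbreviation "U \<equiv> UV V C"
abbreviation "ucmp \<equiv> VComp U"

lemma UV_simps [simp]: "VObj U = Psh" "VHom U = ph"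
  by (simp_all add: UV_def)

text \<open>The defining equations of identities, rewritten through evaluation; the unique existence of the arrow
  is the universal property of the end.\<close>

lemma VId_UV:
  assumes F: "F \<in> Psh"
  shows "VId U F \<in> Arr V" "Dom V (VId U F) = I" "Cod V (VId U F) = ph F F"
    "c \<in> Obj C \<Longrightarrow> x \<in> Arr V \<Longrightarrow> Cod V x = Fobj F c \<Longrightarrow> lc (act F F c) (VId U F) x = x"
proof -
  note [simp] = F
  let ?P = "\<lambda>h. h \<in> hm I (ph F F) \<and> (\<forall>c\<in>Obj C. presheaf_proj V C F F c \<cdot> h = VId (vself V) (Fobj F c))"
  have vs: "VId (vself V) y = curry_arr V I y y (lun y)" for y by (simp add: vself_def)
  have proj: "presheaf_proj V C F F c \<cdot> h = VId (vself V) (Fobj F c) \<longleftrightarrow> bc (act F F c) h (idn (Fobj F c)) = lun (Fobj F c)"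
    if "c \<in> Obj C" "h \<in> hm I (ph F F)" for c h
  proof -
    have [simp]: "h \<in> Arr V" "Dom V h = I" "Cod V h = ph F F" using that by (auto simp: homset_iff)
    note [simp] = that(1) curry_simps
    show ?thesis
      using curry_unique [of "presheaf_proj V C F F c \<cdot> h" "VId (vself V) (Fobj F c)" "Fobj F c" "Fobj F c"]
      by (auto simp: vs bc_act)
  qed
  have "nat_fam F F I (\<lambda>c. lun (Fobj F c))"
    unfolding nat_fam_def
  proof (intro conjI ballI)
    show "Farr F u \<cdot> lun (Fobj F (Cod C u)) = lun (Fobj F (Dom C u)) \<cdot> (idn I \<boxtimes> Farr F u)" if "u \<in> Arr C" for u
      using that lun_natural [of "Farr F u"] by simp
  qed (simp add: homset_iff)
  then obtain h where h: "h \<in> hm I (ph F F)" "\<And>c. c \<in> Obj C \<Longrightarrow> bc (act F F c) h (idn (Fobj F c)) = lun (Fobj F c)"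
    using ph_exists [of F F I] by auto
  have "VId U F = (THE h. ?P h)" by (simp add: UV_def)
  moreover have "\<exists>!h. ?P h"
  proof (rule ex1I [of _ h])
    show "?P h" using h proj by simp
    fix k assume k: "?P k"
    show "k = h" by (rule ph_unique [of F F]) (use h k proj in \<open>auto simp: homset_iff\<close>)
  qed
  ultimately have P: "?P (VId U F)" using theI' [of ?P] by simp
  then show t [simp]: "VId U F \<in> Arr V" "Dom V (VId U F) = I" "Cod V (VId U F) = ph F F"
    by (auto simp: homset_iff)
  assume c [simp]: "c \<in> Obj C" and [simp]: "x \<in> Arr V" "Cod V x = Fobj F c"
  have "bc (act F F c) (VId U F) (idn (Fobj F c)) = lun (Fobj F c)"
    using P c proj [of c "VId U F"] by blast
  then have "lc (act F F c) (VId U F) (idn (Fobj F c)) = idn (Fobj F c)" by (simp add: lc_bc)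
  then show "lc (act F F c) (VId U F) x = x"
    using lc_comp [of "act F F c" "VId U F" "idn (Fobj F c)" x] by simp
qed

text \<open>Composition is characterized by associativity of evaluation. In this form it makes all the associative
  laws of actions applicable to composition of presheaves.\<close>

lemma VComp_UV:
  assumes F: "F \<in> Psh" and G: "G \<in> Psh" and H: "H \<in> Psh"
  shows "ucmp F G H \<in> Arr V" "Dom V (ucmp F G H) = ph G H \<boxdot> ph F G" "Cod V (ucmp F G H) = ph F H"
    "c \<in> Obj C \<Longrightarrow> asq (ucmp F G H) (act F H c) (act F G c) (act G H c) (ph G H) (ph F G) (Fobj F c)"
proof -
  note [simp] = F G H
  let ?X = "ph G H \<boxdot> ph F G"
  let ?rhs = "\<lambda>c. VComp (vself V) (Fobj F c) (Fobj G c) (Fobj H c) \<cdot> (presheaf_proj V C G H c \<boxtimes> presheaf_proj V C F G c)"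
  let ?P = "\<lambda>h. h \<in> hm ?X (ph F H) \<and> (\<forall>c\<in>Obj C. presheaf_proj V C F H c \<cdot> h = ?rhs c)"
  let ?k = "\<lambda>c. act G H c \<cdot> (idn (ph G H) \<boxtimes> act F G c) \<cdot> ass (ph G H) (ph F G) (Fobj F c)"
  have proj: "presheaf_proj V C F H c \<cdot> h = ?rhs c \<longleftrightarrow> bc (act F H c) h (idn (Fobj F c)) = ?k c"
    if c: "c \<in> Obj C" and h: "h \<in> hm ?X (ph F H)" for c h
  proof -
    have [simp]: "h \<in> Arr V" "Dom V h = ?X" "Cod V h = ph F H" using h by (auto simp: homset_iff)
    note [simp] = c curry_simps
    let ?f = "Fobj F c" and ?g = "Fobj G c" and ?h = "Fobj H c"
    let ?p = "presheaf_proj V C G H c" and ?q = "presheaf_proj V C F G c"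
    let ?m = "ev ?g ?h \<cdot> (idn (ihom ?g ?h) \<boxtimes> ev ?f ?g) \<cdot> ass (ihom ?g ?h) (ihom ?f ?g) ?f"
    have "ev ?f ?h \<cdot> (?rhs c \<boxtimes> idn ?f) = ?m \<cdot> ((?p \<boxtimes> ?q) \<boxtimes> idn ?f)"
      unfolding vself_def by simp (rule eval_curry; simp)
    also have "\<dots> = ev ?g ?h \<cdot> (idn (ihom ?g ?h) \<boxtimes> ev ?f ?g) \<cdot> (ass (ihom ?g ?h) (ihom ?f ?g) ?f \<cdot> ((?p \<boxtimes> ?q) \<boxtimes> idn ?f))"
      by (simp add: Comp_assoc)
    also have "ass (ihom ?g ?h) (ihom ?f ?g) ?f \<cdot> ((?p \<boxtimes> ?q) \<boxtimes> idn ?f) = (?p \<boxtimes> (?q \<boxtimes> idn ?f)) \<cdot> ass (ph G H) (ph F G) ?f"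
      using ass_natural [of ?p ?q "idn ?f"] by simp
    also have "ev ?g ?h \<cdot> (idn (ihom ?g ?h) \<boxtimes> ev ?f ?g) \<cdot> (?p \<boxtimes> (?q \<boxtimes> idn ?f)) \<cdot> ass (ph G H) (ph F G) ?f = ?k c"
      by (simp add: act_def Comp_assoc merge merge')
    finally have k: "ev ?f ?h \<cdot> (?rhs c \<boxtimes> idn ?f) = ?k c" .
    have rhs: "?rhs c \<in> Arr V" "Dom V (?rhs c) = ?X" "Cod V (?rhs c) = ihom ?f ?h"
      by (simp_all add: vself_def)
    have b: "bc (act F H c) h (idn ?f) = ev ?f ?h \<cdot> ((presheaf_proj V C F H c \<cdot> h) \<boxtimes> idn ?f)"
      by (simp add: bc_act)
    show ?thesis
    proof
      assume "presheaf_proj V C F H c \<cdot> h = ?rhs c"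
      then show "bc (act F H c) h (idn ?f) = ?k c" by (simp only: b k)
    next
      assume "bc (act F H c) h (idn ?f) = ?k c"
      then show "presheaf_proj V C F H c \<cdot> h = ?rhs c"
        by (intro curry_unique [of "presheaf_proj V C F H c \<cdot> h" "?rhs c" ?f ?h]) (simp_all only: rhs b k, simp_all)
    qed
  qed
  have "nat_fam F H ?X ?k"
    unfolding nat_fam_def
  proof (intro conjI ballI)
    fix u assume [simp]: "u \<in> Arr C"
    let ?c = "Cod C u" and ?d = "Dom C u"
    have 1: "Farr H u \<cdot> act G H ?c = act G H ?d \<cdot> (idn (ph G H) \<boxtimes> Farr G u)"
      using act_natural [of G H u "idn (ph G H)" "idn (Fobj G ?c)"] by (simp add: bc_def)
    have 2: "Farr G u \<cdot> act F G ?c = act F G ?d \<cdot> (idn (ph F G) \<boxtimes> Farr F u)"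
      using act_natural [of F G u "idn (ph F G)" "idn (Fobj F ?c)"] by (simp add: bc_def)
    have "Farr H u \<cdot> ?k ?c = (Farr H u \<cdot> act G H ?c) \<cdot> (idn (ph G H) \<boxtimes> act F G ?c) \<cdot> ass (ph G H) (ph F G) (Fobj F ?c)"
      by (simp add: Comp_assoc)
    also have "\<dots> = act G H ?d \<cdot> (idn (ph G H) \<boxtimes> (Farr G u \<cdot> act F G ?c)) \<cdot> ass (ph G H) (ph F G) (Fobj F ?c)"
      unfolding 1 by (simp add: Comp_assoc merge')
    also have "\<dots> = act G H ?d \<cdot> (idn (ph G H) \<boxtimes> act F G ?d) \<cdot> (idn (ph G H) \<boxtimes> (idn (ph F G) \<boxtimes> Farr F u)) \<cdot> ass (ph G H) (ph F G) (Fobj F ?c)"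
      unfolding 2 by (simp add: merge' del: Tarr_Idn)
    also have "(idn (ph G H) \<boxtimes> (idn (ph F G) \<boxtimes> Farr F u)) \<cdot> ass (ph G H) (ph F G) (Fobj F ?c) =
       ass (ph G H) (ph F G) (Fobj F ?d) \<cdot> (idn ?X \<boxtimes> Farr F u)"
      using ass_natural [of "idn (ph G H)" "idn (ph F G)" "Farr F u"] by simp
    finally show "Farr H u \<cdot> ?k ?c = ?k ?d \<cdot> (idn ?X \<boxtimes> Farr F u)"
      by (simp add: Comp_assoc)
  qed (simp add: homset_iff)
  from ph_exists [OF F H _ this]
  obtain h where h: "h \<in> hm ?X (ph F H)" "\<And>c. c \<in> Obj C \<Longrightarrow> bc (act F H c) h (idn (Fobj F c)) = ?k c"
    by auto
  have "ucmp F G H = (THE h. ?P h)" by (simp add: UV_def)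
  moreover have "\<exists>!h. ?P h"
  proof (rule ex1I [of _ h])
    show "?P h" using h proj by simp
    fix k assume k: "?P k"
    show "k = h" by (rule ph_unique [of F H]) (use h k proj in \<open>auto simp: homset_iff\<close>)
  qed
  ultimately have P: "?P (ucmp F G H)" using theI' [of ?P] by simp
  then show t [simp]: "ucmp F G H \<in> Arr V" "Dom V (ucmp F G H) = ?X" "Cod V (ucmp F G H) = ph F H"
    by (auto simp: homset_iff)
  assume c [simp]: "c \<in> Obj C"
  have "bc (act F H c) (ucmp F G H) (idn (Fobj F c)) = ?k c" using P c proj [of c "ucmp F G H"] by blast
  then show "asq (ucmp F G H) (act F H c) (act F G c) (act G H c) (ph G H) (ph F G) (Fobj F c)"
    by (simp add: asq_def bc_def)
qed

lemmas VId_UV_simps [simp] = VId_UV(1-3)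
lemmas VComp_UV_simps [simp] = VComp_UV(1-3)

text \<open>Arrows \<open>1 \<rightarrow> [F, G]\<close> are natural transformations, in the ordinary sense.\<close>

lemma ph_elem_exists:
  assumes F: "F \<in> Psh" and G: "G \<in> Psh" and \<phi>: "\<And>c. c \<in> Obj C \<Longrightarrow> \<phi> c \<in> hm (Fobj F c) (Fobj G c)"
    and nat: "\<And>u. u \<in> Arr C \<Longrightarrow> Farr G u \<cdot> \<phi> (Cod C u) = \<phi> (Dom C u) \<cdot> Farr F u"
  obtains e where "e \<in> hm I (ph F G)" "\<And>c. c \<in> Obj C \<Longrightarrow> lc (act F G c) e (idn (Fobj F c)) = \<phi> c"
proof -
  note [simp] = F G
  have [simp]: "c \<in> Obj C \<Longrightarrow> \<phi> c \<in> Arr V" "c \<in> Obj C \<Longrightarrow> Dom V (\<phi> c) = Fobj F c" "c \<in> Obj C \<Longrightarrow> Cod V (\<phi> c) = Fobj G c" for c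
    using \<phi> by (auto simp: homset_iff)
  have "nat_fam F G I (\<lambda>c. \<phi> c \<cdot> lun (Fobj F c))"
    unfolding nat_fam_def
  proof (intro conjI ballI)
    fix u assume [simp]: "u \<in> Arr C"
    have "Farr G u \<cdot> \<phi> (Cod C u) \<cdot> lun (Fobj F (Cod C u)) = (\<phi> (Dom C u) \<cdot> Farr F u) \<cdot> lun (Fobj F (Cod C u))"
      by (simp add: Comp_assoc flip: nat)
    also have "\<dots> = \<phi> (Dom C u) \<cdot> lun (Fobj F (Dom C u)) \<cdot> (idn I \<boxtimes> Farr F u)"
      using lun_natural [of "Farr F u"] by (simp add: Comp_assoc)
    finally show "Farr G u \<cdot> \<phi> (Cod C u) \<cdot> lun (Fobj F (Cod C u)) = (\<phi> (Dom C u) \<cdot> lun (Fobj F (Dom C u))) \<cdot> (idn I \<boxtimes> Farr F u)"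
      by (simp add: Comp_assoc)
  qed (simp add: homset_iff)
  from ph_exists [OF F G ObjI this]
  obtain h where h: "h \<in> hm I (ph F G)" "\<And>c. c \<in> Obj C \<Longrightarrow> bc (act F G c) h (idn (Fobj F c)) = \<phi> c \<cdot> lun (Fobj F c)"
    by auto
  have "lc (act F G c) h (idn (Fobj F c)) = \<phi> c" if "c \<in> Obj C" for c
  proof -
    have "lc (act F G c) h (idn (Fobj F c)) = bc (act F G c) h (idn (Fobj F c)) \<cdot> lun' (Fobj F c)"
      using that h(1) by (simp add: lc_bc homset_iff)
    then show ?thesis using that by (simp add: h(2) Comp_assoc)
  qed
  then show thesis using h(1) that by blast
qed

lemma ph_elem_unique:
  assumes F: "F \<in> Psh" and G: "G \<in> Psh" and h: "h \<in> hm I (ph F G)" and h': "h' \<in> hm I (ph F G)"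
    and eq: "\<And>c. c \<in> Obj C \<Longrightarrow> lc (act F G c) h (idn (Fobj F c)) = lc (act F G c) h' (idn (Fobj F c))"
  shows "h = h'"
proof (rule ph_unique [OF F G])
  have [simp]: "h \<in> Arr V" "h' \<in> Arr V" "Dom V h = I" "Dom V h' = I" "Cod V h = ph F G" "Cod V h' = ph F G"
    using h h' by (auto simp: homset_iff)
  then show "h \<in> Arr V" "h' \<in> Arr V" "Cod V h = ph F G" "Cod V h' = ph F G" "Dom V h = Dom V h'" by simp_all
  note [simp] = F G
  fix c assume [simp]: "c \<in> Obj C"
  have "bc (act F G c) k (idn (Fobj F c)) = lc (act F G c) k (idn (Fobj F c)) \<cdot> lun (Fobj F c)"
    if "k \<in> Arr V" "Dom V k = I" "Cod V k = ph F G" for k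
    using that by (simp add: lc_bc Comp_assoc)
  then show "bc (act F G c) h (idn (Fobj F c)) = bc (act F G c) h' (idn (Fobj F c))"
    by (simp add: eq)
qed

lemma component_eq:
  assumes "F \<in> Psh" "G \<in> Psh" "c \<in> Obj C" "f \<in> hm I (ph F G)"
  shows "component V C (F, G, f) c = lc (act F G c) f (idn (Fobj F c))"
  using assms by (simp add: component_def lc_def act_def homset_iff Comp_assoc merge')

subsection \<open>Representable presheaves\<close>

definition yob :: "'c \<Rightarrow> ('c, 'd, 'o, 'a) presheaf" where "yob = yoneda_obj V C"
definition inc :: "'c \<Rightarrow> 'c \<Rightarrow> 'd \<Rightarrow> 'a" where "inc c d = snd (yoneda_cop V C c d)"

lemma yoneda_cop: "is_copower V (homset C d c) I (fst (yoneda_cop V C c d)) (inc c d)"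
  unfolding inc_def yoneda_cop_def
  using someI_ex [of "\<lambda>p. is_copower V (homset C d c) I (fst p) (snd p)"] copower_exists [of d c]
  by (auto simp: case_prod_unfold)

lemma Fobj_yob: "d \<in> Obj C \<Longrightarrow> Fobj (yob c) d = fst (yoneda_cop V C c d)"
  by (simp add: yob_def yoneda_obj_def)

lemma copower_yob: "d \<in> Obj C \<Longrightarrow> is_copower V (homset C d c) I (Fobj (yob c) d) (inc c d)"
  by (simp add: Fobj_yob yoneda_cop)

lemma copower_exists_arrow:
  assumes "is_copower V S a x \<iota>" "y \<in> Obj V" "\<And>s. s \<in> S \<Longrightarrow> q s \<in> hm a y"
  obtains h where "h \<in> hm x y" "\<And>s. s \<in> S \<Longrightarrow> h \<cdot> \<iota> s = q s"
  using assms unfolding is_copower_def by blast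

lemma inc_hom:
  assumes "w \<in> homset C d c"
  shows "inc c d w \<in> Arr V" "Dom V (inc c d w) = I" "Cod V (inc c d w) = Fobj (yob c) d"
proof -
  have "d \<in> Obj C" using assms by (auto simp: homset_iff)
  then have "inc c d w \<in> hm I (Fobj (yob c) d)" using copower_yob [of d c] assms by (simp add: is_copower_def)
  then show "inc c d w \<in> Arr V" "Dom V (inc c d w) = I" "Cod V (inc c d w) = Fobj (yob c) d" by (auto simp: homset_iff)
qed

lemma yob_arr:
  assumes c: "c \<in> Obj C" and v: "v \<in> Arr C"
  shows "Farr (yob c) v \<in> hm (Fobj (yob c) (Cod C v)) (Fobj (yob c) (Dom C v))"
    "w \<in> homset C (Cod C v) c \<Longrightarrow> Farr (yob c) v \<cdot> inc c (Cod C v) w = inc c (Dom C v) (Comp C w v)"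
proof -
  let ?P = "\<lambda>h. h \<in> hm (Fobj (yob c) (Cod C v)) (Fobj (yob c) (Dom C v)) \<and>
      (\<forall>w\<in>homset C (Cod C v) c. h \<cdot> inc c (Cod C v) w = inc c (Dom C v) (Comp C w v))"
  have "Farr (yob c) v = (THE h. ?P h)"
    using v by (simp add: yob_def yoneda_obj_def inc_def)
  moreover have "\<exists>!h. ?P h"
  proof -
    have o: "Fobj (yob c) (Dom C v) \<in> Obj V" using copower_yob [of "Dom C v" c] v by (simp add: is_copower_def)
    have q: "inc c (Dom C v) (Comp C w v) \<in> hm I (Fobj (yob c) (Dom C v))" if "w \<in> homset C (Cod C v) c" for w
    proof -
      have "Comp C w v \<in> homset C (Dom C v) c" using that v by (auto simp: homset_iff)
      from inc_hom [OF this] show ?thesis by (simp add: homset_iff)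
    qed
    then show ?thesis using copower_yob [of "Cod C v" c] v o unfolding is_copower_def by simp
  qed
  ultimately have P: "?P (Farr (yob c) v)" by (rule the_ex1)
  then show "Farr (yob c) v \<in> hm (Fobj (yob c) (Cod C v)) (Fobj (yob c) (Dom C v))" by blast
  show "w \<in> homset C (Cod C v) c \<Longrightarrow> Farr (yob c) v \<cdot> inc c (Cod C v) w = inc c (Dom C v) (Comp C w v)" using P by blast
qed

lemma yob_Psh [simp]:
  assumes c: "c \<in> Obj C"
  shows "yob c \<in> Psh"
proof -
  have o: "Fobj (yob c) d \<in> Obj V" if "d \<in> Obj C" for d
    using copower_yob [OF that] by (simp add: is_copower_def)
  have a: "Farr (yob c) v \<in> Arr V" "Dom V (Farr (yob c) v) = Fobj (yob c) (Cod C v)" "Cod V (Farr (yob c) v) = Fobj (yob c) (Dom C v)"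
    if "v \<in> Arr C" for v
    using yob_arr(1) [OF c that] by (auto simp: homset_iff)
  have "is_functor (cat_op C) V (yob c)"
    unfolding is_functor_def cat_op_simps
  proof (intro conjI ballI impI)
    show "Fobj (yob c) \<in> Obj C \<rightarrow>\<^sub>E Obj V" using o by (auto simp: yob_def yoneda_obj_def)
    show "Farr (yob c) \<in> Arr C \<rightarrow>\<^sub>E Arr V" using a by (auto simp: yob_def yoneda_obj_def)
    show "Farr (yob c) v \<in> hm (Fobj (yob c) (Cod C v)) (Fobj (yob c) (Dom C v))" if "v \<in> Arr C" for v
      by (rule yob_arr [OF c that])
    show "Farr (yob c) (Idn C d) = idn (Fobj (yob c) d)" if d: "d \<in> Obj C" for d
    proof (rule copower_unique [OF copower_yob [OF d]])
      fix w assume w: "w \<in> homset C d c"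
      then show "Farr (yob c) (Idn C d) \<cdot> inc c d w = idn (Fobj (yob c) d) \<cdot> inc c d w"
        using yob_arr(2) [OF c, of "Idn C d" w] d inc_hom [OF w] by (auto simp: homset_iff)
    qed (use a [of "Idn C d"] o d in simp_all)
    fix v u assume vu: "v \<in> Arr C" "u \<in> Arr C" "Dom C v = Cod C u"
    show "Farr (yob c) (Comp C v u) = Farr (yob c) u \<cdot> Farr (yob c) v"
    proof (rule copower_unique [OF copower_yob [of "Cod C v"]])
      fix w assume w: "w \<in> homset C (Cod C v) c"
      have wv: "Comp C w v \<in> homset C (Cod C u) c" using w vu by (auto simp: homset_iff)
      have "Farr (yob c) (Comp C v u) \<cdot> inc c (Cod C v) w = inc c (Dom C u) (Comp C w (Comp C v u))"
        using yob_arr(2) [OF c, of "Comp C v u" w] vu w by simp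
      also have "\<dots> = inc c (Dom C u) (Comp C (Comp C w v) u)"
        using w vu by (simp add: C.Comp_assoc homset_iff)
      also have "\<dots> = Farr (yob c) u \<cdot> (Farr (yob c) v \<cdot> inc c (Cod C v) w)"
        using yob_arr(2) [OF c vu(1) w] yob_arr(2) [OF c vu(2) wv] vu by simp
      also have "\<dots> = (Farr (yob c) u \<cdot> Farr (yob c) v) \<cdot> inc c (Cod C v) w"
        using a vu inc_hom [OF w] by (simp add: Comp_assoc)
      finally show "Farr (yob c) (Comp C v u) \<cdot> inc c (Cod C v) w = (Farr (yob c) u \<cdot> Farr (yob c) v) \<cdot> inc c (Cod C v) w" .
    qed (use a vu in simp_all)
  qed
  then show ?thesis by (simp add: presheaves_def)
qed

text \<open>Arrows into \<open>[y c, F]\<close> are determined by their action on the inclusions.\<close>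

lemma ph_yob_unique:
  assumes c: "c \<in> Obj C" and F: "F \<in> Psh" and h: "h \<in> Arr V" "Cod V h = ph (yob c) F"
    and h': "h' \<in> Arr V" "Cod V h' = ph (yob c) F" "Dom V h' = Dom V h"
    and eq: "\<And>d w. w \<in> homset C d c \<Longrightarrow> rc (act (yob c) F d) h (inc c d w) = rc (act (yob c) F d) h' (inc c d w)"
  shows "h = h'"
proof (rule ph_unique [of "yob c" F])
  note [simp] = c F h h'
  show "yob c \<in> Psh" "F \<in> Psh" "h \<in> Arr V" "Cod V h = ph (yob c) F" "h' \<in> Arr V" "Cod V h' = ph (yob c) F" "Dom V h = Dom V h'"
    by simp_all
  fix d assume d [simp]: "d \<in> Obj C"
  let ?X = "Dom V h"
  show "bc (act (yob c) F d) h (idn (Fobj (yob c) d)) = bc (act (yob c) F d) h' (idn (Fobj (yob c) d))"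
  proof (rule copower_unique [OF copower_tensor_left [OF copower_yob [OF d] ObjI, of ?X]])
    fix w assume w: "w \<in> homset C d c"
    note [simp] = inc_hom [OF w]
    have "bc (act (yob c) F d) k (idn (Fobj (yob c) d)) \<cdot> (idn ?X \<boxtimes> inc c d w) = rc (act (yob c) F d) k (inc c d w) \<cdot> run ?X"
      if [simp]: "k \<in> Arr V" "Cod V k = ph (yob c) F" "Dom V k = ?X" for k
      by (simp add: bc_def rc_def Comp_assoc merge)
    then show "bc (act (yob c) F d) h (idn (Fobj (yob c) d)) \<cdot> (idn ?X \<boxtimes> inc c d w) =
        bc (act (yob c) F d) h' (idn (Fobj (yob c) d)) \<cdot> (idn ?X \<boxtimes> inc c d w)"
      by (simp add: eq [OF w])
  qed simp_all
qed

definition ym :: "'d \<Rightarrow> 'a" where "ym u = snd (snd (Farr (yoneda V C) u))"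

lemma yoneda_simps:
  "c \<in> Obj C \<Longrightarrow> Fobj (yoneda V C) c = yob c"
  "u \<in> Arr C \<Longrightarrow> Farr (yoneda V C) u = (yob (Dom C u), yob (Cod C u), ym u)"
  by (simp_all add: yoneda_def yob_def ym_def Let_def)

text \<open>The defining equations of \<open>y u\<close> determine it since \<open>y c\<close> is a copower; it exists since they are natural
  by associativity of composition in \<open>C\<close>.\<close>

lemma ym_props:
  assumes u: "u \<in> Arr C"
  shows "ym u \<in> Arr V" "Dom V (ym u) = I" "Cod V (ym u) = ph (yob (Dom C u)) (yob (Cod C u))"
    "w \<in> homset C d (Dom C u) \<Longrightarrow>
       lc (act (yob (Dom C u)) (yob (Cod C u)) d) (ym u) (inc (Dom C u) d w) = inc (Cod C u) d (Comp C u w)"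
proof -
  let ?c = "Dom C u" and ?c' = "Cod C u"
  note [simp] = u
  let ?P = "\<lambda>h. h \<in> hm I (ph (yob ?c) (yob ?c')) \<and>
     (\<forall>d\<in>Obj C. \<forall>w\<in>homset C d ?c. component V C (yob ?c, yob ?c', h) d \<cdot> inc ?c d w = inc ?c' d (Comp C u w))"
  have comp: "component V C (yob ?c, yob ?c', h) d \<cdot> inc ?c d w = lc (act (yob ?c) (yob ?c') d) h (inc ?c d w)"
    if h: "h \<in> hm I (ph (yob ?c) (yob ?c'))" and w: "w \<in> homset C d ?c" for h d w
  proof -
    have d [simp]: "d \<in> Obj C" using w by (auto simp: homset_iff)
    note [simp] = inc_hom [OF w]
    have [simp]: "h \<in> Arr V" "Dom V h = I" "Cod V h = ph (yob ?c) (yob ?c')" using h by (auto simp: homset_iff)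
    show ?thesis
      using lc_comp [of "act (yob ?c) (yob ?c') d" h "idn (Fobj (yob ?c) d)" "inc ?c d w"] h
      by (simp add: component_eq)
  qed
  have uw: "Comp C u w \<in> homset C d ?c'" if "w \<in> homset C d ?c" for d w
    using that by (auto simp: homset_iff)
  define \<phi> where "\<phi> d = (SOME h. h \<in> hm (Fobj (yob ?c) d) (Fobj (yob ?c') d) \<and> (\<forall>w\<in>homset C d ?c. h \<cdot> inc ?c d w = inc ?c' d (Comp C u w)))" for d
  have \<phi>: "\<phi> d \<in> hm (Fobj (yob ?c) d) (Fobj (yob ?c') d) \<and> (\<forall>w\<in>homset C d ?c. \<phi> d \<cdot> inc ?c d w = inc ?c' d (Comp C u w))" if d: "d \<in> Obj C" for d
    unfolding \<phi>_def
  proof (rule someI_ex)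
    have o: "Fobj (yob ?c') d \<in> Obj V" using d by simp
    have q: "inc ?c' d (Comp C u w) \<in> hm I (Fobj (yob ?c') d)" if "w \<in> homset C d ?c" for w
      using inc_hom [OF uw [OF that]] by (simp add: homset_iff)
    obtain h where "h \<in> hm (Fobj (yob ?c) d) (Fobj (yob ?c') d)" "\<And>w. w \<in> homset C d ?c \<Longrightarrow> h \<cdot> inc ?c d w = inc ?c' d (Comp C u w)"
      by (rule copower_exists_arrow [OF copower_yob [OF d, of ?c] o, of "\<lambda>w. inc ?c' d (Comp C u w)"]) (use q in blast)+
    then show "\<exists>h. h \<in> hm (Fobj (yob ?c) d) (Fobj (yob ?c') d) \<and> (\<forall>w\<in>homset C d ?c. h \<cdot> inc ?c d w = inc ?c' d (Comp C u w))"
      by blast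
  qed
  have \<phi>s [simp]: "\<phi> d \<in> Arr V" "Dom V (\<phi> d) = Fobj (yob ?c) d" "Cod V (\<phi> d) = Fobj (yob ?c') d" if "d \<in> Obj C" for d
    using \<phi> [OF that] by (auto simp: homset_iff)
  have nat: "Farr (yob ?c') v \<cdot> \<phi> (Cod C v) = \<phi> (Dom C v) \<cdot> Farr (yob ?c) v" if v [simp]: "v \<in> Arr C" for v
  proof (rule copower_unique [OF copower_yob [of "Cod C v" ?c]])
    fix w assume w: "w \<in> homset C (Cod C v) ?c"
    have wv: "Comp C w v \<in> homset C (Dom C v) ?c" using w by (auto simp: homset_iff)
    note [simp] = inc_hom [OF w]
    have "(Farr (yob ?c') v \<cdot> \<phi> (Cod C v)) \<cdot> inc ?c (Cod C v) w = Farr (yob ?c') v \<cdot> inc ?c' (Cod C v) (Comp C u w)"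
      using \<phi> [of "Cod C v"] w by (simp add: Comp_assoc)
    also have "\<dots> = inc ?c' (Dom C v) (Comp C u (Comp C w v))"
      using w uw [OF w] by (simp add: yob_arr(2) C.Comp_assoc homset_iff)
    also have "\<dots> = \<phi> (Dom C v) \<cdot> Farr (yob ?c) v \<cdot> inc ?c (Cod C v) w"
      using \<phi> [of "Dom C v"] wv w by (simp add: yob_arr(2))
    finally show "(Farr (yob ?c') v \<cdot> \<phi> (Cod C v)) \<cdot> inc ?c (Cod C v) w = (\<phi> (Dom C v) \<cdot> Farr (yob ?c) v) \<cdot> inc ?c (Cod C v) w"
      by (simp add: Comp_assoc)
  qed simp_all
  obtain e where e: "e \<in> hm I (ph (yob ?c) (yob ?c'))" "\<And>d. d \<in> Obj C \<Longrightarrow> lc (act (yob ?c) (yob ?c') d) e (idn (Fobj (yob ?c) d)) = \<phi> d"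
    by (rule ph_elem_exists [of "yob ?c" "yob ?c'" \<phi>]) (use \<phi> nat in auto)
  have Pe: "?P e"
    using e \<phi> by (simp add: component_eq)
  have "ym u = (THE h. ?P h)"
    by (simp add: ym_def yoneda_def Let_def yob_def inc_def)
  moreover have "\<exists>!h. ?P h"
  proof (rule ex1I [of _ e], rule Pe)
    fix k assume k: "?P k"
    show "k = e"
    proof (rule ph_yob_unique)
      fix d w assume w: "w \<in> homset C d ?c"
      then have "d \<in> Obj C" by (auto simp: homset_iff)
      then have "lc (act (yob ?c) (yob ?c') d) k (inc ?c d w) = lc (act (yob ?c) (yob ?c') d) e (inc ?c d w)"
        using k Pe w comp [of k w d] comp [of e w d] by simp
      then show "rc (act (yob ?c) (yob ?c') d) k (inc ?c d w) = rc (act (yob ?c) (yob ?c') d) e (inc ?c d w)"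
        using k e inc_hom [OF w] by (simp add: homset_iff lc_eq_rc)
    qed (use k e in \<open>simp_all add: homset_iff\<close>)
  qed
  ultimately have P: "?P (ym u)" by (rule the_ex1)
  then show "ym u \<in> Arr V" "Dom V (ym u) = I" "Cod V (ym u) = ph (yob ?c) (yob ?c')"
    by (auto simp: homset_iff)
  assume w: "w \<in> homset C d ?c"
  then have "d \<in> Obj C" by (auto simp: homset_iff)
  then show "lc (act (yob ?c) (yob ?c') d) (ym u) (inc ?c d w) = inc ?c' d (Comp C u w)"
    using P w comp [of "ym u" w d] by simp
qed

end

context psh
begin

lemma nat_fam_elem:
  assumes F: "F \<in> Psh" and G: "G \<in> Psh" and \<phi>: "\<And>c. c \<in> Obj C \<Longrightarrow> \<phi> c \<in> hm (Fobj F c) (Fobj G c)"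
    and nat: "\<And>u. u \<in> Arr C \<Longrightarrow> Farr G u \<cdot> \<phi> (Cod C u) = \<phi> (Dom C u) \<cdot> Farr F u"
  shows "nat_fam F G I (\<lambda>c. \<phi> c \<cdot> lun (Fobj F c))"
  unfolding nat_fam_def
proof (intro conjI ballI)
  note [simp] = F G
  have [simp]: "c \<in> Obj C \<Longrightarrow> \<phi> c \<in> Arr V" "c \<in> Obj C \<Longrightarrow> Dom V (\<phi> c) = Fobj F c" "c \<in> Obj C \<Longrightarrow> Cod V (\<phi> c) = Fobj G c" for c
    using \<phi> by (auto simp: homset_iff)
  show "\<phi> c \<cdot> lun (Fobj F c) \<in> hm (I \<boxdot> Fobj F c) (Fobj G c)" if "c \<in> Obj C" for c
    using that by (simp add: homset_iff)
  fix u assume [simp]: "u \<in> Arr C"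
  have "Farr G u \<cdot> \<phi> (Cod C u) \<cdot> lun (Fobj F (Cod C u)) = (\<phi> (Dom C u) \<cdot> Farr F u) \<cdot> lun (Fobj F (Cod C u))"
    by (simp add: Comp_assoc flip: nat)
  also have "\<dots> = \<phi> (Dom C u) \<cdot> lun (Fobj F (Dom C u)) \<cdot> (idn I \<boxtimes> Farr F u)"
    using lun_natural [of "Farr F u"] by (simp add: Comp_assoc)
  finally show "Farr G u \<cdot> \<phi> (Cod C u) \<cdot> lun (Fobj F (Cod C u)) = (\<phi> (Dom C u) \<cdot> lun (Fobj F (Dom C u))) \<cdot> (idn I \<boxtimes> Farr F u)"
    by (simp add: Comp_assoc)
qed

subsection \<open>The Yoneda lemma\<close>

text \<open>The arrow \<open>F c \<rightarrow> [y c, F]\<close> that sends \<open>x\<close> to the transformation \<open>w \<mapsto> F w x\<close>.\<close>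

definition th :: "('c, 'd, 'o, 'a) presheaf \<Rightarrow> 'c \<Rightarrow> 'a" where
  "th F c = (SOME h. h \<in> hm (Fobj F c) (ph (yob c) F) \<and>
     (\<forall>d. \<forall>w\<in>homset C d c. rc (act (yob c) F d) h (inc c d w) = Farr F w))"

lemma th_props:
  assumes F: "F \<in> Psh" and c: "c \<in> Obj C"
  shows "th F c \<in> Arr V" "Dom V (th F c) = Fobj F c" "Cod V (th F c) = ph (yob c) F"
    "w \<in> homset C d c \<Longrightarrow> rc (act (yob c) F d) (th F c) (inc c d w) = Farr F w"
proof -
  note [simp] = F c
  let ?Q = "\<lambda>h d. h \<in> hm (Fobj F c \<boxdot> Fobj (yob c) d) (Fobj F d) \<and>
     (\<forall>w\<in>homset C d c. h \<cdot> (idn (Fobj F c) \<boxtimes> inc c d w) = Farr F w \<cdot> run (Fobj F c))"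
  define \<kappa> where "\<kappa> d = (SOME h. ?Q h d)" for d
  have \<kappa>: "?Q (\<kappa> d) d" if d [simp]: "d \<in> Obj C" for d
    unfolding \<kappa>_def
  proof (rule someI_ex)
    have q: "Farr F w \<cdot> run (Fobj F c) \<in> hm (Fobj F c \<boxdot> I) (Fobj F d)" if "w \<in> homset C d c" for w
      using that by (auto simp: homset_iff)
    have "is_copower V (homset C d c) (Fobj F c \<boxdot> I) (Fobj F c \<boxdot> Fobj (yob c) d) (\<lambda>w. idn (Fobj F c) \<boxtimes> inc c d w)"
      by (rule copower_tensor_left [OF copower_yob]) simp_all
    then obtain h where "h \<in> hm (Fobj F c \<boxdot> Fobj (yob c) d) (Fobj F d)"
       "\<And>w. w \<in> homset C d c \<Longrightarrow> h \<cdot> (idn (Fobj F c) \<boxtimes> inc c d w) = Farr F w \<cdot> run (Fobj F c)"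
      by (rule copower_exists_arrow [of _ _ _ _ "Fobj F d" "\<lambda>w. Farr F w \<cdot> run (Fobj F c)"]) (use q in auto)
    then show "\<exists>h. ?Q h d" by blast
  qed
  have [simp]: "\<kappa> d \<in> Arr V" "Dom V (\<kappa> d) = Fobj F c \<boxdot> Fobj (yob c) d" "Cod V (\<kappa> d) = Fobj F d" if "d \<in> Obj C" for d
    using \<kappa> [OF that] by (auto simp: homset_iff)
  have "nat_fam (yob c) F (Fobj F c) \<kappa>"
    unfolding nat_fam_def
  proof (intro conjI ballI)
    fix v assume v [simp]: "v \<in> Arr C"
    show "Farr F v \<cdot> \<kappa> (Cod C v) = \<kappa> (Dom C v) \<cdot> (idn (Fobj F c) \<boxtimes> Farr (yob c) v)"
    proof (rule copower_unique [OF copower_tensor_left [OF copower_yob [of "Cod C v" c] ObjI, of "Fobj F c"]])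
      fix w assume w: "w \<in> homset C (Cod C v) c"
      have wv: "Comp C w v \<in> homset C (Dom C v) c" using w by (auto simp: homset_iff)
      note [simp] = inc_hom [OF w]
      have "(\<kappa> (Dom C v) \<cdot> (idn (Fobj F c) \<boxtimes> Farr (yob c) v)) \<cdot> (idn (Fobj F c) \<boxtimes> inc c (Cod C v) w)
         = \<kappa> (Dom C v) \<cdot> (idn (Fobj F c) \<boxtimes> inc c (Dom C v) (Comp C w v))"
        by (simp add: Comp_assoc merge yob_arr(2) [OF c v w])
      also have "\<dots> = Farr F (Comp C w v) \<cdot> run (Fobj F c)" using \<kappa> [of "Dom C v"] wv by simp
      also have "\<dots> = (Farr F v \<cdot> Farr F w) \<cdot> run (Fobj F c)" using w by (simp add: psh_comp homset_iff)
      also have "\<dots> = Farr F v \<cdot> Farr F w \<cdot> run (Fobj F c)" using w by (auto simp add: Comp_assoc homset_iff)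
      also have "\<dots> = (Farr F v \<cdot> \<kappa> (Cod C v)) \<cdot> (idn (Fobj F c) \<boxtimes> inc c (Cod C v) w)"
        using \<kappa> [of "Cod C v"] w by (simp add: Comp_assoc)
      finally show "(Farr F v \<cdot> \<kappa> (Cod C v)) \<cdot> (idn (Fobj F c) \<boxtimes> inc c (Cod C v) w)
         = (\<kappa> (Dom C v) \<cdot> (idn (Fobj F c) \<boxtimes> Farr (yob c) v)) \<cdot> (idn (Fobj F c) \<boxtimes> inc c (Cod C v) w)" by simp
    qed simp_all
  qed (simp add: homset_iff)
  from ph_exists [OF yob_Psh [OF c] F _ this]
  obtain h where h: "h \<in> hm (Fobj F c) (ph (yob c) F)" "\<And>d. d \<in> Obj C \<Longrightarrow> bc (act (yob c) F d) h (idn (Fobj (yob c) d)) = \<kappa> d"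
    by auto
  have hs [simp]: "h \<in> Arr V" "Dom V h = Fobj F c" "Cod V h = ph (yob c) F" using h by (auto simp: homset_iff)
  have h2: "rc (act (yob c) F d) h (inc c d w) = Farr F w" if w: "w \<in> homset C d c" for d w
  proof -
    note [simp] = C.homD [OF w]
    note [simp] = inc_hom [OF w]
    have "rc (act (yob c) F d) h (inc c d w) = bc (act (yob c) F d) h (idn (Fobj (yob c) d) \<cdot> inc c d w) \<cdot> run' (Fobj F c)"
      by (simp add: rc_bc)
    also have "\<dots> = (\<kappa> d \<cdot> (idn (Fobj F c) \<boxtimes> inc c d w)) \<cdot> run' (Fobj F c)"
      by (subst bc_precomp_right) (simp_all add: h(2))
    also have "\<dots> = Farr F w" using \<kappa> [of d] w by (simp add: Comp_assoc)
    finally show ?thesis .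
  qed
  have "th F c \<in> hm (Fobj F c) (ph (yob c) F) \<and> (\<forall>d. \<forall>w\<in>homset C d c. rc (act (yob c) F d) (th F c) (inc c d w) = Farr F w)"
    unfolding th_def by (rule someI [of _ h]) (use h(1) h2 in blast)
  then show "th F c \<in> Arr V" "Dom V (th F c) = Fobj F c" "Cod V (th F c) = ph (yob c) F"
    "w \<in> homset C d c \<Longrightarrow> rc (act (yob c) F d) (th F c) (inc c d w) = Farr F w" by (auto simp: homset_iff)
qed

lemmas th_simps [simp] = th_props(1-3)

text \<open>The universal element of \<open>y c\<close>.\<close>

definition uni :: "'c \<Rightarrow> 'a" where "uni c = inc c c (Idn C c)"

lemma uni_simps [simp]:
  assumes "c \<in> Obj C"
  shows "uni c \<in> Arr V" "Dom V (uni c) = I" "Cod V (uni c) = Fobj (yob c) c"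
  unfolding uni_def by (rule inc_hom; use assms in \<open>simp add: homset_iff\<close>)+

lemma th_uni:
  assumes [simp]: "F \<in> Psh" "c \<in> Obj C" "x \<in> Arr V" "Cod V x = Fobj F c"
  shows "rc (act (yob c) F c) (th F c \<cdot> x) (uni c) = x"
proof -
  have i: "Idn C c \<in> homset C c c" by (simp add: homset_iff)
  show ?thesis
    using th_props(4) [OF assms(1,2) i] by (subst rc_comp) (simp_all add: uni_def inc_hom [OF i])
qed

text \<open>Transport along \<open>F \<rightarrow> G\<close> of the map named by an element of \<open>F c\<close> is the map named by the image of the
  element: the Yoneda correspondence is natural in the presheaf.\<close>

lemma th_act:
  assumes [simp]: "F \<in> Psh" "G \<in> Psh" "c \<in> Obj C"
  shows "bc (ucmp (yob c) F G) (idn (ph F G)) (th F c) = th G c \<cdot> act F G c"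
  (is "?lhs = ?rhs")
proof (rule ph_yob_unique)
  fix d w assume w: "w \<in> homset C d c"
  note [simp] = C.homD [OF w]
  note [simp] = inc_hom [OF w]
  have "rc (act (yob c) G d) ?lhs (inc c d w) =
      bc (act F G d) (idn (ph F G)) (rc (act (yob c) F d) (th F c) (inc c d w))"
    by (rule asq_br [OF VComp_UV(4)]) simp_all
  also have "\<dots> = bc (act F G d) (idn (ph F G)) (Farr F w \<cdot> idn (Fobj F c))"
    using th_props(4) [OF assms(1,3) w] by simp
  also have "\<dots> = Farr G w \<cdot> act F G c"
    using act_natural [of F G w "idn (ph F G)" "idn (Fobj F c)"] by (simp add: bc_def)
  also have "\<dots> = rc (act (yob c) G d) ?rhs (inc c d w)"
    by (subst rc_comp) (simp_all add: th_props(4) [OF assms(2,3) w])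
  finally show "rc (act (yob c) G d) ?lhs (inc c d w) =
      rc (act (yob c) G d) ?rhs (inc c d w)" .
qed simp_all

lemmas ym_simps [simp] = ym_props(1-3)

text \<open>Naturality of the Yoneda correspondence in \<open>c\<close>.\<close>

lemma th_restrict:
  assumes [simp]: "F \<in> Psh" "u \<in> Arr C"
  shows "th F (Dom C u) \<cdot> Farr F u = rc (ucmp (yob (Dom C u)) (yob (Cod C u)) F) (th F (Cod C u)) (ym u)"
  (is "?lhs = ?rhs")
proof (rule ph_yob_unique)
  fix d w assume w: "w \<in> homset C d (Dom C u)"
  note [simp] = C.homD [OF w]
  have uw: "Comp C u w \<in> homset C d (Cod C u)" by (simp add: homset_iff)
  note [simp] = inc_hom [OF w] inc_hom [OF uw]
  have "rc (act (yob (Dom C u)) F d) ?rhs (inc (Dom C u) d w)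
     = rc (act (yob (Cod C u)) F d) (th F (Cod C u)) (lc (act (yob (Dom C u)) (yob (Cod C u)) d) (ym u) (inc (Dom C u) d w))"
    by (rule asq_rr [OF VComp_UV(4)]) simp_all
  also have "\<dots> = Farr F (Comp C u w)"
    by (simp add: ym_props(4) [OF assms(2) w] th_props(4) [OF _ _ uw])
  also have "\<dots> = Farr F w \<cdot> Farr F u" by (simp add: psh_comp)
  also have "\<dots> = rc (act (yob (Dom C u)) F d) ?lhs (inc (Dom C u) d w)"
    by (subst rc_comp) (simp_all add: th_props(4) [OF _ _ w])
  finally show "rc (act (yob (Dom C u)) F d) ?lhs (inc (Dom C u) d w) =
     rc (act (yob (Dom C u)) F d) ?rhs (inc (Dom C u) d w)"
    by simp
qed simp_all

lemma th_uni_VId: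
  assumes [simp]: "c \<in> Obj C"
  shows "th (yob c) c \<cdot> uni c = VId U (yob c)"
proof (rule ph_yob_unique)
  fix d w assume w: "w \<in> homset C d c"
  note [simp] = C.homD [OF w]
  have i: "Idn C c \<in> homset C (Cod C w) c" by (simp add: homset_iff)
  note [simp] = inc_hom [OF w]
  have "rc (act (yob c) (yob c) d) (th (yob c) c \<cdot> uni c) (inc c d w) = Farr (yob c) w \<cdot> uni c"
    by (subst rc_comp) (simp_all add: th_props(4) [OF _ _ w])
  also have "\<dots> = inc c d w" using yob_arr(2) [of c w, OF _ _ i] by (simp add: uni_def)
  also have "\<dots> = rc (act (yob c) (yob c) d) (VId U (yob c)) (inc c d w)"
    by (simp add: VId_UV(4) flip: lc_eq_rc)
  finally show "rc (act (yob c) (yob c) d) (th (yob c) c \<cdot> uni c) (inc c d w) = rc (act (yob c) (yob c) d) (VId U (yob c)) (inc c d w)" .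
qed simp_all

end

section \<open>Extension of functors along the Yoneda embedding\<close>

subsection \<open>Enriched functors on presheaves\<close>

locale psh_vct = psh V C + vct V M
  for V :: "('o, 'a) smcat" and C :: "('c, 'd) cat" and M :: "('m, 'o, 'a) vcat"
begin

context
  fixes L' :: "(('c, 'd, 'o, 'a) presheaf, 'm, 'a) vfunctr"
  assumes L': "is_vfunctor V U M L'"
begin

lemma vfun_simps:
  "F \<in> Psh \<Longrightarrow> VFobj L' F \<in> VObj M"
  "F \<in> Psh \<Longrightarrow> G \<in> Psh \<Longrightarrow> VFarr L' (F, G) \<in> Arr V"
  "F \<in> Psh \<Longrightarrow> G \<in> Psh \<Longrightarrow> Dom V (VFarr L' (F, G)) = ph F G"
  "F \<in> Psh \<Longrightarrow> G \<in> Psh \<Longrightarrow> Cod V (VFarr L' (F, G)) = hob (VFobj L' F) (VFobj L' G)"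
  "F \<in> Psh \<Longrightarrow> VFarr L' (F, F) \<cdot> VId U F = vid (VFobj L' F)"
  using L' by (auto simp: is_vfunctor_def homset_iff)

lemma vfun_comp:
  assumes "F \<in> Psh" "G \<in> Psh" "H \<in> Psh"
  shows "VFarr L' (F, H) \<cdot> ucmp F G H =
     cmp (VFobj L' F) (VFobj L' G) (VFobj L' H) \<cdot> (VFarr L' (G, H) \<boxtimes> VFarr L' (F, G))"
  using L' assms unfolding is_vfunctor_def UV_simps by blast

lemma vfun_lc:
  assumes [simp]: "F \<in> Psh" "G \<in> Psh" "H \<in> Psh" "e \<in> Arr V" "Dom V e = I" "Cod V e = ph G H" "f \<in> Arr V" "Cod V f = ph F G"
  shows "VFarr L' (F, H) \<cdot> lc (ucmp F G H) e f =
     lc (cmp (VFobj L' F) (VFobj L' G) (VFobj L' H)) (VFarr L' (G, H) \<cdot> e) (VFarr L' (F, G) \<cdot> f)"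
  by (rule lc_map [OF vfun_comp]) (simp_all add: vfun_simps)

lemma vfun_rc:
  assumes [simp]: "F \<in> Psh" "G \<in> Psh" "H \<in> Psh" "e \<in> Arr V" "Dom V e = I" "Cod V e = ph F G" "f \<in> Arr V" "Cod V f = ph G H"
  shows "VFarr L' (F, H) \<cdot> rc (ucmp F G H) f e =
     rc (cmp (VFobj L' F) (VFobj L' G) (VFobj L' H)) (VFarr L' (G, H) \<cdot> f) (VFarr L' (F, G) \<cdot> e)"
  by (rule rc_map [OF vfun_comp]) (simp_all add: vfun_simps)

lemma vfun_bc:
  assumes [simp]: "F \<in> Psh" "G \<in> Psh" "H \<in> Psh" "e \<in> Arr V" "Cod V e = ph F G" "f \<in> Arr V" "Cod V f = ph G H"
  shows "VFarr L' (F, H) \<cdot> bc (ucmp F G H) f e =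
     bc (cmp (VFobj L' F) (VFobj L' G) (VFobj L' H)) (VFarr L' (G, H) \<cdot> f) (VFarr L' (F, G) \<cdot> e)"
  by (rule bc_map [OF vfun_comp]) (simp_all add: vfun_simps)

end

end

subsection \<open>The right adjoint\<close>

text \<open>A functor \<open>D : C \<rightarrow> M\<close>, and the functor \<open>M(D -, m)\<close>, which will be the right adjoint of the
  extension of \<open>D\<close>.\<close>

locale diag = psh_vct V C M
  for V :: "('o, 'a) smcat" and C :: "('c, 'd) cat" and M :: "('m, 'o, 'a) vcat" +
  fixes D :: "('c, 'd, 'm, 'm \<times> 'm \<times> 'a) functr"
  assumes D: "is_functor C (underlying V M) D"
begin

abbreviation "Do \<equiv> Fobj D"
definition Da :: "'d \<Rightarrow> 'a" where "Da u = snd (snd (Farr D u))"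

lemma D_simps [simp]:
  "c \<in> Obj C \<Longrightarrow> Do c \<in> VObj M" "u \<in> Arr C \<Longrightarrow> Da u \<in> Arr V" "u \<in> Arr C \<Longrightarrow> Dom V (Da u) = I"
  "u \<in> Arr C \<Longrightarrow> Cod V (Da u) = hob (Do (Dom C u)) (Do (Cod C u))" "c \<in> Obj C \<Longrightarrow> Da (Idn C c) = vid (Do c)"
  and Farr_D: "u \<in> Arr C \<Longrightarrow> Farr D u = (Do (Dom C u), Do (Cod C u), Da u)"
proof -
  show 1: "Do c \<in> VObj M" if "c \<in> Obj C" for c
    using D that by (auto simp: is_functor_def underlying_simps)
  have a: "Farr D u \<in> Arr (underlying V M) \<and> Dom (underlying V M) (Farr D u) = Do (Dom C u) \<and> Cod (underlying V M) (Farr D u) = Do (Cod C u)"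
    if "u \<in> Arr C" for u
    using D that by (auto simp: is_functor_def homset_iff)
  show "Da u \<in> Arr V" "Dom V (Da u) = I" "Cod V (Da u) = hob (Do (Dom C u)) (Do (Cod C u))"
    "Farr D u = (Do (Dom C u), Do (Cod C u), Da u)" if "u \<in> Arr C"
    using a [OF that] by (cases "Farr D u"; simp add: underlying_simps Da_def)+
  show "Da (Idn C c) = vid (Do c)" if "c \<in> Obj C"
    using D that by (auto simp: is_functor_def underlying_simps Da_def)
qed

lemma Da_comp:
  assumes "u \<in> Arr C" "v \<in> Arr C" "Cod C u = Dom C v"
  shows "Da (Comp C v u) = lc (cmp (Do (Dom C u)) (Do (Cod C u)) (Do (Cod C v))) (Da v) (Da u)"
proof -
  have "Farr D (Comp C v u) = Comp (underlying V M) (Farr D v) (Farr D u)"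
    using D assms unfolding is_functor_def by blast
  also have "\<dots> = (Do (Dom C u), Do (Cod C v),
      lc (cmp (Do (Dom C u)) (Do (Cod C u)) (Do (Cod C v))) (Da v) (Da u))"
    using assms by (simp add: Farr_D underlying_simps)
  finally show ?thesis by (simp add: Da_def [of "Comp C v u"])
qed

definition Rob :: "'m \<Rightarrow> ('c, 'd, 'o, 'a) presheaf" where
  "Rob m = \<lparr>Fobj = (\<lambda>c\<in>Obj C. hob (Do c) m),
     Farr = (\<lambda>u\<in>Arr C. rc (cmp (Do (Dom C u)) (Do (Cod C u)) m) (idn (hob (Do (Cod C u)) m)) (Da u))\<rparr>"

lemma Fobj_Rob [simp]: "c \<in> Obj C \<Longrightarrow> Fobj (Rob m) c = hob (Do c) m"
  by (simp add: Rob_def)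

lemma Farr_Rob:
  assumes [simp]: "u \<in> Arr C" "m \<in> VObj M" "x \<in> Arr V" "Cod V x = hob (Do (Cod C u)) m"
  shows "Farr (Rob m) u \<cdot> x = rc (cmp (Do (Dom C u)) (Do (Cod C u)) m) x (Da u)"
  using rc_comp [of "cmp (Do (Dom C u)) (Do (Cod C u)) m" "Da u" "idn (hob (Do (Cod C u)) m)" x]
  by (simp add: Rob_def)

text \<open>Functoriality is associativity of composition in \<open>M\<close>; precomposition reverses the direction of
  arrows.\<close>

lemma Rob_Psh [simp]:
  assumes m [simp]: "m \<in> VObj M"
  shows "Rob m \<in> Psh"
proof -
  have "is_functor (cat_op C) V (Rob m)"
    unfolding is_functor_def cat_op_simps
  proof (intro conjI ballI impI)
    show "Fobj (Rob m) \<in> Obj C \<rightarrow>\<^sub>E Obj V" "Farr (Rob m) \<in> Arr C \<rightarrow>\<^sub>E Arr V"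
      by (auto simp: Rob_def)
    show "Farr (Rob m) u \<in> hm (Fobj (Rob m) (Cod C u)) (Fobj (Rob m) (Dom C u))" if "u \<in> Arr C" for u
      using that by (simp add: homset_iff Rob_def)
    show "Farr (Rob m) (Idn C c) = idn (Fobj (Rob m) c)" if "c \<in> Obj C" for c
      using that by (simp add: Rob_def)
    fix v u assume [simp]: "v \<in> Arr C" "u \<in> Arr C" and vu [simp]: "Dom C v = Cod C u"
    let ?i = "idn (hob (Do (Cod C v)) m)"
    have "Farr (Rob m) (Comp C v u) = rc (cmp (Do (Dom C u)) (Do (Cod C v)) m) ?i
       (lc (cmp (Do (Dom C u)) (Do (Cod C u)) (Do (Cod C v))) (Da v) (Da u))"
      by (simp add: Rob_def Da_comp)
    also have "\<dots> = rc (cmp (Do (Dom C u)) (Do (Cod C u)) m) (rc (cmp (Do (Cod C u)) (Do (Cod C v)) m) ?i (Da v)) (Da u)"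
      by (rule asq_rr [OF vcat_asq, symmetric]) simp_all
    also have "rc (cmp (Do (Cod C u)) (Do (Cod C v)) m) ?i (Da v) = Farr (Rob m) v"
      by (simp add: Rob_def)
    finally show "Farr (Rob m) (Comp C v u) = Farr (Rob m) u \<cdot> Farr (Rob m) v"
      by (subst Farr_Rob) (simp_all add: Rob_def)
  qed
  then show ?thesis by (simp add: presheaves_def)
qed

text \<open>Postcomposition in \<open>M\<close>, as an arrow \<open>M(m, n) \<rightarrow> [M(D -, m), M(D -, n)]\<close>.\<close>

definition Rar :: "'m \<Rightarrow> 'm \<Rightarrow> 'a" where
  "Rar m n = (SOME h. h \<in> hm (hob m n) (ph (Rob m) (Rob n)) \<and>
     (\<forall>c\<in>Obj C. bc (act (Rob m) (Rob n) c) h (idn (Fobj (Rob m) c)) = cmp (Do c) m n))"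

lemma Rar_props:
  assumes [simp]: "m \<in> VObj M" "n \<in> VObj M"
  shows "Rar m n \<in> Arr V" "Dom V (Rar m n) = hob m n" "Cod V (Rar m n) = ph (Rob m) (Rob n)"
    "c \<in> Obj C \<Longrightarrow> bc (act (Rob m) (Rob n) c) (Rar m n) (idn (hob (Do c) m)) = cmp (Do c) m n"
proof -
  have "nat_fam (Rob m) (Rob n) (hob m n) (\<lambda>c. cmp (Do c) m n)"
    unfolding nat_fam_def
  proof (intro conjI ballI)
    fix u assume [simp]: "u \<in> Arr C"
    let ?c = "Do (Cod C u)" and ?d = "Do (Dom C u)"
    have "Farr (Rob n) u \<cdot> cmp ?c m n = rc (cmp ?d ?c n) (bc (cmp ?c m n) (idn (hob m n)) (idn (hob ?c m))) (Da u)"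
      by (subst Farr_Rob) (simp_all add: bc_def)
    also have "\<dots> = bc (cmp ?d m n) (idn (hob m n)) (rc (cmp ?d ?c m) (idn (hob ?c m)) (Da u))"
      by (rule asq_br [OF vcat_asq]) simp_all
    also have "\<dots> = cmp ?d m n \<cdot> (idn (hob m n) \<boxtimes> Farr (Rob m) u)"
      by (simp add: bc_def Rob_def)
    finally show "Farr (Rob n) u \<cdot> cmp ?c m n = cmp ?d m n \<cdot> (idn (hob m n) \<boxtimes> Farr (Rob m) u)" .
  qed (simp add: homset_iff)
  then have "\<exists>h. h \<in> hm (hob m n) (ph (Rob m) (Rob n)) \<and>
     (\<forall>c\<in>Obj C. bc (act (Rob m) (Rob n) c) h (idn (Fobj (Rob m) c)) = cmp (Do c) m n)"
    by (rule ph_exists [rotated 3]) auto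
  from someI_ex [OF this, folded Rar_def]
  show "Rar m n \<in> Arr V" "Dom V (Rar m n) = hob m n" "Cod V (Rar m n) = ph (Rob m) (Rob n)"
    "c \<in> Obj C \<Longrightarrow> bc (act (Rob m) (Rob n) c) (Rar m n) (idn (hob (Do c) m)) = cmp (Do c) m n"
    by (auto simp: homset_iff)
qed

lemmas Rar_simps [simp] = Rar_props(1-3)

lemma bc_Rar:
  assumes [simp]: "m \<in> VObj M" "n \<in> VObj M" "c \<in> Obj C" "f \<in> Arr V" "Cod V f = hob m n" "x \<in> Arr V" "Cod V x = hob (Do c) m"
  shows "bc (act (Rob m) (Rob n) c) (Rar m n \<cdot> f) x = bc (cmp (Do c) m n) f x"
proof -
  have "bc (act (Rob m) (Rob n) c) (Rar m n \<cdot> f) (idn (hob (Do c) m) \<cdot> x) = cmp (Do c) m n \<cdot> (f \<boxtimes> x)"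
    by (subst bc_comp) (simp_all add: Rar_props(4))
  then show ?thesis by (simp add: bc_def)
qed

lemma lc_Rar:
  assumes [simp]: "m \<in> VObj M" "n \<in> VObj M" "c \<in> Obj C" "f \<in> Arr V" "Dom V f = I" "Cod V f = hob m n" "x \<in> Arr V" "Cod V x = hob (Do c) m"
  shows "lc (act (Rob m) (Rob n) c) (Rar m n \<cdot> f) x = lc (cmp (Do c) m n) f x"
  by (simp add: lc_bc bc_Rar)

definition Rfun :: "('m, ('c, 'd, 'o, 'a) presheaf, 'a) vfunctr" where
  "Rfun = \<lparr>VFobj = (\<lambda>m\<in>VObj M. Rob m), VFarr = (\<lambda>(m, n)\<in>VObj M \<times> VObj M. Rar m n)\<rparr>"

lemma Rfun_simps [simp]:
  "m \<in> VObj M \<Longrightarrow> VFobj Rfun m = Rob m" "m \<in> VObj M \<Longrightarrow> n \<in> VObj M \<Longrightarrow> VFarr Rfun (m, n) = Rar m n"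
  by (simp_all add: Rfun_def)

text \<open>Two arrows into a hom object of presheaves agree if they act in the same way, and both sides of the
  functor laws act by composition in \<open>M\<close>.\<close>

lemma Rfun_vfunctor: "is_vfunctor V M U Rfun"
  unfolding is_vfunctor_def
proof (intro conjI ballI)
  show "VFobj Rfun \<in> VObj M \<rightarrow>\<^sub>E VObj U" "VFarr Rfun \<in> VObj M \<times> VObj M \<rightarrow>\<^sub>E Arr V"
    by (auto simp: Rfun_def)
  fix m assume [simp]: "m \<in> VObj M"
  have "Rar m m \<cdot> vid m = VId U (Rob m)"
    by (rule ph_elem_unique [of "Rob m" "Rob m"]) (simp_all add: homset_iff lc_Rar VId_UV(4))
  then show "VFarr Rfun (m, m) \<cdot> vid m = VId U (VFobj Rfun m)" by simp
  fix n assume [simp]: "n \<in> VObj M"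
  show "VFarr Rfun (m, n) \<in> hm (hob m n) (VHom U (VFobj Rfun m) (VFobj Rfun n))"
    by (simp add: homset_iff)
  fix p assume [simp]: "p \<in> VObj M"
  have "Rar m p \<cdot> cmp m n p = bc (ucmp (Rob m) (Rob n) (Rob p)) (Rar n p) (Rar m n)"
  proof (rule ph_unique [of "Rob m" "Rob p"])
    fix c assume [simp]: "c \<in> Obj C"
    let ?i = "idn (hob (Do c) m)" and ?f = "idn (hob n p)" and ?g = "idn (hob m n)"
    have "bc (act (Rob m) (Rob p) c) (Rar m p \<cdot> cmp m n p) ?i = bc (cmp (Do c) m p) (bc (cmp m n p) ?f ?g) ?i"
      by (simp add: bc_Rar) (simp add: bc_def)
    also have "\<dots> = bc (cmp (Do c) n p) ?f (bc (cmp (Do c) m n) ?g ?i) \<cdot> ass (hob n p) (hob m n) (hob (Do c) m)"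
      by (subst asq_bb [OF vcat_asq]) simp_all
    also have "\<dots> = bc (act (Rob n) (Rob p) c) (Rar n p \<cdot> ?f) (bc (act (Rob m) (Rob n) c) (Rar m n \<cdot> ?g) ?i) \<cdot> ass (hob n p) (hob m n) (hob (Do c) m)"
      by (simp only: bc_Rar Idn_Arr Cod_Idn vcat_simps D_simps bc_simps \<open>m \<in> VObj M\<close> \<open>n \<in> VObj M\<close> \<open>p \<in> VObj M\<close> \<open>c \<in> Obj C\<close>)
    also have "\<dots> = bc (act (Rob m) (Rob p) c) (bc (ucmp (Rob m) (Rob n) (Rob p)) (Rar n p) (Rar m n)) ?i"
      by (subst asq_bb [OF VComp_UV(4)]) simp_all
    finally show "bc (act (Rob m) (Rob p) c) (Rar m p \<cdot> cmp m n p) (idn (Fobj (Rob m) c)) =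
        bc (act (Rob m) (Rob p) c) (bc (ucmp (Rob m) (Rob n) (Rob p)) (Rar n p) (Rar m n)) (idn (Fobj (Rob m) c))" by simp
  qed simp_all
  then show "VFarr Rfun (m, p) \<cdot> cmp m n p = ucmp (VFobj Rfun m) (VFobj Rfun n) (VFobj Rfun p) \<cdot> (VFarr Rfun (n, p) \<boxtimes> VFarr Rfun (m, n))"
    by (simp add: bc_def)
qed

end

context diag
begin

subsection \<open>Weighted colimits\<close>

text \<open>\<open>l\<close> is the colimit of \<open>D\<close> weighted by the presheaf \<open>F\<close>, with coprojections \<open>\<nu>\<close>: arrows \<open>X \<rightarrow> M(l, m)\<close> are
  natural families \<open>X \<otimes> F c \<rightarrow> M(D c, m)\<close>.\<close>

definition wcolim :: "('c, 'd, 'o, 'a) presheaf \<Rightarrow> 'm \<Rightarrow> ('c \<Rightarrow> 'a) \<Rightarrow> bool" where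
  "wcolim F l \<nu> \<longleftrightarrow> l \<in> VObj M \<and> (\<forall>c\<in>Obj C. \<nu> c \<in> hm (Fobj F c) (hob (Do c) l)) \<and>
     (\<forall>u\<in>Arr C. Farr (Rob l) u \<cdot> \<nu> (Cod C u) = \<nu> (Dom C u) \<cdot> Farr F u) \<and>
     (\<forall>m\<in>VObj M. \<forall>X\<in>Obj V. \<forall>\<kappa>. nat_fam F (Rob m) X \<kappa> \<longrightarrow>
        (\<exists>!h. h \<in> hm X (hob l m) \<and> (\<forall>c\<in>Obj C. bc (cmp (Do c) l m) h (\<nu> c) = \<kappa> c)))"

end

locale lan = diag V C M D
  for V :: "('o, 'a) smcat" and C :: "('c, 'd) cat" and M :: "('m, 'o, 'a) vcat"
    and D :: "('c, 'd, 'm, 'm \<times> 'm \<times> 'a) functr" +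
  fixes Lo :: "('c, 'd, 'o, 'a) presheaf \<Rightarrow> 'm" and la :: "('c, 'd, 'o, 'a) presheaf \<Rightarrow> 'c \<Rightarrow> 'a"
  assumes colim: "\<And>F. F \<in> Psh \<Longrightarrow> wcolim F (Lo F) (la F)"
begin

lemma Lo_simps [simp]:
  "F \<in> Psh \<Longrightarrow> Lo F \<in> VObj M"
  "F \<in> Psh \<Longrightarrow> c \<in> Obj C \<Longrightarrow> la F c \<in> Arr V"
  "F \<in> Psh \<Longrightarrow> c \<in> Obj C \<Longrightarrow> Dom V (la F c) = Fobj F c"
  "F \<in> Psh \<Longrightarrow> c \<in> Obj C \<Longrightarrow> Cod V (la F c) = hob (Do c) (Lo F)"
  using colim [of F] by (auto simp: wcolim_def homset_iff)

lemma la_natural: "F \<in> Psh \<Longrightarrow> u \<in> Arr C \<Longrightarrow> Farr (Rob (Lo F)) u \<cdot> la F (Cod C u) = la F (Dom C u) \<cdot> Farr F u"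
  using colim [of F] by (auto simp: wcolim_def)

lemma la_hom: "F \<in> Psh \<Longrightarrow> c \<in> Obj C \<Longrightarrow> la F c \<in> hm (Fobj F c) (Fobj (Rob (Lo F)) c)"
  by (simp add: homset_iff)

lemma l_ex1:
  "F \<in> Psh \<Longrightarrow> m \<in> VObj M \<Longrightarrow> X \<in> Obj V \<Longrightarrow> nat_fam F (Rob m) X \<kappa> \<Longrightarrow>
   \<exists>!h. h \<in> hm X (hob (Lo F) m) \<and> (\<forall>c\<in>Obj C. bc (cmp (Do c) (Lo F) m) h (la F c) = \<kappa> c)"
  using colim [of F] unfolding wcolim_def by blast

text \<open>Uniqueness in the universal property applies to any two arrows, since composing \<open>la F\<close> with an
  arrow out of the colimit always gives a natural family.\<close>

lemma l_unique:
  assumes F: "F \<in> Psh" and m: "m \<in> VObj M" and h: "h \<in> Arr V" "Cod V h = hob (Lo F) m"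
    and h': "h' \<in> Arr V" "Cod V h' = hob (Lo F) m" "Dom V h = Dom V h'"
    and eq: "\<And>c. c \<in> Obj C \<Longrightarrow> bc (cmp (Do c) (Lo F) m) h (la F c) = bc (cmp (Do c) (Lo F) m) h' (la F c)"
  shows "h = h'"
proof (rule ex1D [OF l_ex1 [OF F m Dom_Obj [OF h'(1)], of "\<lambda>c. bc (cmp (Do c) (Lo F) m) h' (la F c)"]])
  note [simp] = F m h h'
  show "nat_fam F (Rob m) (Dom V h') (\<lambda>c. bc (cmp (Do c) (Lo F) m) h' (la F c))"
    unfolding nat_fam_def
  proof (intro conjI ballI)
    fix u assume [simp]: "u \<in> Arr C"
    let ?c = "Do (Cod C u)" and ?d = "Do (Dom C u)"
    have "Farr (Rob m) u \<cdot> bc (cmp ?c (Lo F) m) h' (la F (Cod C u)) =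
        rc (cmp ?d ?c m) (bc (cmp ?c (Lo F) m) h' (la F (Cod C u))) (Da u)"
      by (subst Farr_Rob) simp_all
    also have "\<dots> = bc (cmp ?d (Lo F) m) h' (rc (cmp ?d ?c (Lo F)) (la F (Cod C u)) (Da u))"
      by (rule asq_br [OF vcat_asq]) simp_all
    also have "rc (cmp ?d ?c (Lo F)) (la F (Cod C u)) (Da u) = la F (Dom C u) \<cdot> Farr F u"
      by (simp add: la_natural flip: Farr_Rob)
    also have "bc (cmp ?d (Lo F) m) h' \<dots> = bc (cmp ?d (Lo F) m) h' (la F (Dom C u)) \<cdot> (idn (Dom V h') \<boxtimes> Farr F u)"
      by (rule bc_precomp_right) simp_all
    finally show "Farr (Rob m) u \<cdot> bc (cmp ?c (Lo F) m) h' (la F (Cod C u)) =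
        bc (cmp ?d (Lo F) m) h' (la F (Dom C u)) \<cdot> (idn (Dom V h') \<boxtimes> Farr F u)" .
  qed (simp add: homset_iff)
qed (use h h' eq in \<open>auto simp: homset_iff\<close>)

lemma le_unique:
  assumes F: "F \<in> Psh" and m: "m \<in> VObj M" and h: "h \<in> hm I (hob (Lo F) m)" and h': "h' \<in> hm I (hob (Lo F) m)"
    and eq: "\<And>c. c \<in> Obj C \<Longrightarrow> lc (cmp (Do c) (Lo F) m) h (la F c) = lc (cmp (Do c) (Lo F) m) h' (la F c)"
  shows "h = h'"
proof (rule l_unique [OF F m])
  have [simp]: "h \<in> Arr V" "h' \<in> Arr V" "Dom V h = I" "Dom V h' = I" "Cod V h = hob (Lo F) m" "Cod V h' = hob (Lo F) m"
    using h h' by (auto simp: homset_iff)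
  then show "h \<in> Arr V" "h' \<in> Arr V" "Cod V h = hob (Lo F) m" "Cod V h' = hob (Lo F) m" "Dom V h = Dom V h'" by simp_all
  note [simp] = F m
  fix c assume [simp]: "c \<in> Obj C"
  have "bc (cmp (Do c) (Lo F) m) k (la F c) = lc (cmp (Do c) (Lo F) m) k (la F c) \<cdot> lun (Fobj F c)"
    if "k \<in> Arr V" "Dom V k = I" "Cod V k = hob (Lo F) m" for k
    using that by (simp add: lc_bc Comp_assoc)
  then show "bc (cmp (Do c) (Lo F) m) h (la F c) = bc (cmp (Do c) (Lo F) m) h' (la F c)"
    by (simp add: eq)
qed

lemma le_exists:
  assumes F: "F \<in> Psh" and m: "m \<in> VObj M" and \<phi>: "\<And>c. c \<in> Obj C \<Longrightarrow> \<phi> c \<in> hm (Fobj F c) (hob (Do c) m)"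
    and nat: "\<And>u. u \<in> Arr C \<Longrightarrow> Farr (Rob m) u \<cdot> \<phi> (Cod C u) = \<phi> (Dom C u) \<cdot> Farr F u"
  shows "\<exists>h. h \<in> hm I (hob (Lo F) m) \<and> (\<forall>c\<in>Obj C. lc (cmp (Do c) (Lo F) m) h (la F c) = \<phi> c)"
proof -
  note [simp] = F m
  have \<phi>': "\<And>c. c \<in> Obj C \<Longrightarrow> \<phi> c \<in> hm (Fobj F c) (Fobj (Rob m) c)" using \<phi> by simp
  have "\<exists>!h. h \<in> hm I (hob (Lo F) m) \<and> (\<forall>c\<in>Obj C. bc (cmp (Do c) (Lo F) m) h (la F c) = \<phi> c \<cdot> lun (Fobj F c))"
    by (rule l_ex1 [OF F m ObjI nat_fam_elem [OF F _ \<phi>' nat]]) simp_all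
  then obtain h where h: "h \<in> hm I (hob (Lo F) m)" "\<And>c. c \<in> Obj C \<Longrightarrow> bc (cmp (Do c) (Lo F) m) h (la F c) = \<phi> c \<cdot> lun (Fobj F c)"
    by blast
  have "lc (cmp (Do c) (Lo F) m) h (la F c) = \<phi> c" if "c \<in> Obj C" for c
  proof -
    have "lc (cmp (Do c) (Lo F) m) h (la F c) = bc (cmp (Do c) (Lo F) m) h (la F c) \<cdot> lun' (Fobj F c)"
      using that h(1) by (simp add: lc_bc homset_iff)
    then show ?thesis using that \<phi> [OF that] by (simp add: h(2) Comp_assoc homset_iff)
  qed
  then show ?thesis using h(1) by blast
qed

subsection \<open>The extension and its adjunction\<close>

text \<open>The action of the extension on hom objects, induced on weighted colimits by the action
  \<open>[F, G] \<otimes> F c \<rightarrow> G c\<close> followed by the coprojection of \<open>G\<close>.\<close>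

definition Lar :: "('c, 'd, 'o, 'a) presheaf \<Rightarrow> ('c, 'd, 'o, 'a) presheaf \<Rightarrow> 'a" where
  "Lar F G = (SOME h. h \<in> hm (ph F G) (hob (Lo F) (Lo G)) \<and>
     (\<forall>c\<in>Obj C. bc (cmp (Do c) (Lo F) (Lo G)) h (la F c) = la G c \<cdot> act F G c))"

lemma Lar_props:
  assumes F [simp]: "F \<in> Psh" and G [simp]: "G \<in> Psh"
  shows "Lar F G \<in> Arr V" "Dom V (Lar F G) = ph F G" "Cod V (Lar F G) = hob (Lo F) (Lo G)"
    "c \<in> Obj C \<Longrightarrow> bc (cmp (Do c) (Lo F) (Lo G)) (Lar F G) (la F c) = la G c \<cdot> act F G c"
proof -
  have "nat_fam F (Rob (Lo G)) (ph F G) (\<lambda>c. la G c \<cdot> act F G c)"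
    unfolding nat_fam_def
  proof (intro conjI ballI)
    fix u assume [simp]: "u \<in> Arr C"
    have R [simp]: "Farr (Rob (Lo G)) u \<in> Arr V" "Dom V (Farr (Rob (Lo G)) u) = hob (Do (Cod C u)) (Lo G)"
      by simp_all
    have "Farr (Rob (Lo G)) u \<cdot> la G (Cod C u) \<cdot> act F G (Cod C u) = (Farr (Rob (Lo G)) u \<cdot> la G (Cod C u)) \<cdot> act F G (Cod C u)"
      by (simp add: Comp_assoc)
    also have "\<dots> = la G (Dom C u) \<cdot> Farr G u \<cdot> act F G (Cod C u)"
      unfolding la_natural [OF G \<open>u \<in> Arr C\<close>] by (simp add: Comp_assoc)
    also have "Farr G u \<cdot> act F G (Cod C u) = act F G (Dom C u) \<cdot> (idn (ph F G) \<boxtimes> Farr F u)"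
      using act_natural [of F G u "idn (ph F G)" "idn (Fobj F (Cod C u))"] by (simp add: bc_def)
    finally show "Farr (Rob (Lo G)) u \<cdot> la G (Cod C u) \<cdot> act F G (Cod C u) = (la G (Dom C u) \<cdot> act F G (Dom C u)) \<cdot> (idn (ph F G) \<boxtimes> Farr F u)"
      by (simp add: Comp_assoc)
  qed (simp add: homset_iff)
  then have "\<exists>h. h \<in> hm (ph F G) (hob (Lo F) (Lo G)) \<and>
     (\<forall>c\<in>Obj C. bc (cmp (Do c) (Lo F) (Lo G)) h (la F c) = la G c \<cdot> act F G c)"
    by (intro ex1_implies_ex [OF l_ex1]) simp_all
  from someI_ex [OF this, folded Lar_def]
  show "Lar F G \<in> Arr V" "Dom V (Lar F G) = ph F G" "Cod V (Lar F G) = hob (Lo F) (Lo G)"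
    "c \<in> Obj C \<Longrightarrow> bc (cmp (Do c) (Lo F) (Lo G)) (Lar F G) (la F c) = la G c \<cdot> act F G c"
    by (auto simp: homset_iff)
qed

lemmas Lar_simps [simp] = Lar_props(1-3)

lemma bc_Lar:
  assumes [simp]: "F \<in> Psh" "G \<in> Psh" "c \<in> Obj C" "f \<in> Arr V" "Cod V f = ph F G" "x \<in> Arr V" "Cod V x = Fobj F c"
  shows "bc (cmp (Do c) (Lo F) (Lo G)) (Lar F G \<cdot> f) (la F c \<cdot> x) = la G c \<cdot> bc (act F G c) f x"
  by (subst bc_comp) (simp_all add: Lar_props(4) Comp_assoc bc_def [of "act F G c"])

lemma lc_Lar:
  assumes [simp]: "F \<in> Psh" "G \<in> Psh" "c \<in> Obj C" "f \<in> Arr V" "Dom V f = I" "Cod V f = ph F G" "x \<in> Arr V" "Cod V x = Fobj F c"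
  shows "lc (cmp (Do c) (Lo F) (Lo G)) (Lar F G \<cdot> f) (la F c \<cdot> x) = la G c \<cdot> lc (act F G c) f x"
  by (simp add: lc_bc bc_Lar Comp_assoc)

lemma rc_Lar:
  assumes [simp]: "F \<in> Psh" "G \<in> Psh" "c \<in> Obj C" "f \<in> Arr V" "Dom V x = I" "Cod V f = ph F G" "x \<in> Arr V" "Cod V x = Fobj F c"
  shows "rc (cmp (Do c) (Lo F) (Lo G)) (Lar F G \<cdot> f) (la F c \<cdot> x) = la G c \<cdot> rc (act F G c) f x"
  by (simp add: rc_bc bc_Lar Comp_assoc)

definition Lfun :: "(('c, 'd, 'o, 'a) presheaf, 'm, 'a) vfunctr" where
  "Lfun = \<lparr>VFobj = (\<lambda>F\<in>Psh. Lo F), VFarr = (\<lambda>(F, G)\<in>Psh \<times> Psh. Lar F G)\<rparr>"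

lemma Lfun_simps [simp]:
  "F \<in> Psh \<Longrightarrow> VFobj Lfun F = Lo F" "F \<in> Psh \<Longrightarrow> G \<in> Psh \<Longrightarrow> VFarr Lfun (F, G) = Lar F G"
  by (simp_all add: Lfun_def)

lemma Lfun_vfunctor: "is_vfunctor V U M Lfun"
  unfolding is_vfunctor_def UV_simps
proof (intro conjI ballI)
  show "VFobj Lfun \<in> Psh \<rightarrow>\<^sub>E VObj M" "VFarr Lfun \<in> Psh \<times> Psh \<rightarrow>\<^sub>E Arr V"
    by (auto simp: Lfun_def)
  fix F assume [simp]: "F \<in> Psh"
  have "Lar F F \<cdot> VId U F = vid (Lo F)"
  proof (rule le_unique [of F "Lo F"])
    fix c assume [simp]: "c \<in> Obj C"
    show "lc (cmp (Do c) (Lo F) (Lo F)) (Lar F F \<cdot> VId U F) (la F c) = lc (cmp (Do c) (Lo F) (Lo F)) (vid (Lo F)) (la F c)"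
      using lc_Lar [of F F c "VId U F" "idn (Fobj F c)"] by (simp add: VId_UV(4))
  qed (simp_all add: homset_iff)
  then show "VFarr Lfun (F, F) \<cdot> VId U F = vid (VFobj Lfun F)" by simp
  fix G assume [simp]: "G \<in> Psh"
  show "VFarr Lfun (F, G) \<in> hm (ph F G) (hob (VFobj Lfun F) (VFobj Lfun G))"
    by (simp add: homset_iff)
  fix H assume [simp]: "H \<in> Psh"
  have "Lar F H \<cdot> ucmp F G H = bc (cmp (Lo F) (Lo G) (Lo H)) (Lar G H) (Lar F G)"
  proof (rule l_unique [of F "Lo H"])
    fix c assume [simp]: "c \<in> Obj C"
    let ?f = "idn (ph G H)" and ?g = "idn (ph F G)" and ?i = "idn (Fobj F c)"
    have "bc (cmp (Do c) (Lo F) (Lo H)) (Lar F H \<cdot> ucmp F G H) (la F c) = la H c \<cdot> bc (act F H c) (bc (ucmp F G H) ?f ?g) ?i"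
      using bc_Lar [of F H c "ucmp F G H" ?i] by (simp add: bc_def)
    also have "bc (act F H c) (bc (ucmp F G H) ?f ?g) ?i = bc (act G H c) ?f (bc (act F G c) ?g ?i) \<cdot> ass (ph G H) (ph F G) (Fobj F c)"
      by (subst asq_bb [OF VComp_UV(4)]) simp_all
    also have "la H c \<cdot> bc (act G H c) ?f (bc (act F G c) ?g ?i) \<cdot> ass (ph G H) (ph F G) (Fobj F c)
        = bc (cmp (Do c) (Lo G) (Lo H)) (Lar G H \<cdot> ?f) (la G c \<cdot> bc (act F G c) ?g ?i) \<cdot> ass (ph G H) (ph F G) (Fobj F c)"
      by (subst bc_Lar) (simp_all add: Comp_assoc)
    also have "la G c \<cdot> bc (act F G c) ?g ?i = bc (cmp (Do c) (Lo F) (Lo G)) (Lar F G) (la F c)"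
      by (simp add: Lar_props(4)) (simp add: bc_def)
    also have "bc (cmp (Do c) (Lo G) (Lo H)) (Lar G H \<cdot> ?f) \<dots> \<cdot> ass (ph G H) (ph F G) (Fobj F c)
       = bc (cmp (Do c) (Lo F) (Lo H)) (bc (cmp (Lo F) (Lo G) (Lo H)) (Lar G H) (Lar F G)) (la F c)"
      by (subst asq_bb [OF vcat_asq]) simp_all
    finally show "bc (cmp (Do c) (Lo F) (Lo H)) (Lar F H \<cdot> ucmp F G H) (la F c) =
       bc (cmp (Do c) (Lo F) (Lo H)) (bc (cmp (Lo F) (Lo G) (Lo H)) (Lar G H) (Lar F G)) (la F c)" .
  qed simp_all
  then show "VFarr Lfun (F, H) \<cdot> ucmp F G H = cmp (VFobj Lfun F) (VFobj Lfun G) (VFobj Lfun H) \<cdot> (VFarr Lfun (G, H) \<boxtimes> VFarr Lfun (F, G))"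
    by (simp add: bc_def)
qed

text \<open>The unit is the family of coprojections, read as an arrow \<open>1 \<rightarrow> [F, M(D -, L F)]\<close>.\<close>

definition eta :: "('c, 'd, 'o, 'a) presheaf \<Rightarrow> 'a" where
  "eta F = (SOME e. e \<in> hm I (ph F (Rob (Lo F))) \<and> (\<forall>c\<in>Obj C. lc (act F (Rob (Lo F)) c) e (idn (Fobj F c)) = la F c))"

lemma eta_props:
  assumes [simp]: "F \<in> Psh"
  shows "eta F \<in> Arr V" "Dom V (eta F) = I" "Cod V (eta F) = ph F (Rob (Lo F))"
    "c \<in> Obj C \<Longrightarrow> x \<in> Arr V \<Longrightarrow> Cod V x = Fobj F c \<Longrightarrow> lc (act F (Rob (Lo F)) c) (eta F) x = la F c \<cdot> x"
proof -
  obtain e where "e \<in> hm I (ph F (Rob (Lo F)))" "\<And>c. c \<in> Obj C \<Longrightarrow> lc (act F (Rob (Lo F)) c) e (idn (Fobj F c)) = la F c"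
    by (rule ph_elem_exists [of F "Rob (Lo F)" "la F"]) (use la_hom la_natural in auto)
  then have "\<exists>e. e \<in> hm I (ph F (Rob (Lo F))) \<and> (\<forall>c\<in>Obj C. lc (act F (Rob (Lo F)) c) e (idn (Fobj F c)) = la F c)"
    by blast
  from someI_ex [OF this, folded eta_def]
  have *: "eta F \<in> Arr V" "Dom V (eta F) = I" "Cod V (eta F) = ph F (Rob (Lo F))"
    and e: "\<And>c. c \<in> Obj C \<Longrightarrow> lc (act F (Rob (Lo F)) c) (eta F) (idn (Fobj F c)) = la F c"
    by (auto simp: homset_iff)
  then show "eta F \<in> Arr V" "Dom V (eta F) = I" "Cod V (eta F) = ph F (Rob (Lo F))" by simp_all
  assume "c \<in> Obj C" "x \<in> Arr V" "Cod V x = Fobj F c"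
  then show "lc (act F (Rob (Lo F)) c) (eta F) x = la F c \<cdot> x"
    using lc_comp [of "act F (Rob (Lo F)) c" "eta F" "idn (Fobj F c)" x] * by (simp add: e)
qed

lemmas eta_simps [simp] = eta_props(1-3)

text \<open>The counit at \<open>m\<close> is the arrow out of the colimit weighted by \<open>M(D -, m)\<close> that corresponds to the
  identity arrows of \<open>M(D c, m)\<close>.\<close>

definition eps :: "'m \<Rightarrow> 'a" where
  "eps m = (SOME e. e \<in> hm I (hob (Lo (Rob m)) m) \<and>
     (\<forall>c\<in>Obj C. lc (cmp (Do c) (Lo (Rob m)) m) e (la (Rob m) c) = idn (hob (Do c) m)))"

lemma eps_props:
  assumes [simp]: "m \<in> VObj M"
  shows "eps m \<in> Arr V" "Dom V (eps m) = I" "Cod V (eps m) = hob (Lo (Rob m)) m"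
    "c \<in> Obj C \<Longrightarrow> x \<in> Arr V \<Longrightarrow> Cod V x = hob (Do c) m \<Longrightarrow> lc (cmp (Do c) (Lo (Rob m)) m) (eps m) (la (Rob m) c \<cdot> x) = x"
proof -
  have "\<exists>e. e \<in> hm I (hob (Lo (Rob m)) m) \<and>
     (\<forall>c\<in>Obj C. lc (cmp (Do c) (Lo (Rob m)) m) e (la (Rob m) c) = idn (hob (Do c) m))"
  proof (rule le_exists)
    show "Farr (Rob m) u \<cdot> idn (hob (Do (Cod C u)) m) = idn (hob (Do (Dom C u)) m) \<cdot> Farr (Rob m) u" if "u \<in> Arr C" for u
      using that psh_simps [of "Rob m"] by simp
  qed (simp_all add: homset_iff)
  from someI_ex [OF this, folded eps_def]
  have *: "eps m \<in> Arr V" "Dom V (eps m) = I" "Cod V (eps m) = hob (Lo (Rob m)) m"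
    and e: "\<And>c. c \<in> Obj C \<Longrightarrow> lc (cmp (Do c) (Lo (Rob m)) m) (eps m) (la (Rob m) c) = idn (hob (Do c) m)"
    by (auto simp: homset_iff)
  then show "eps m \<in> Arr V" "Dom V (eps m) = I" "Cod V (eps m) = hob (Lo (Rob m)) m" by simp_all
  assume "c \<in> Obj C" "x \<in> Arr V" "Cod V x = hob (Do c) m"
  then show "lc (cmp (Do c) (Lo (Rob m)) m) (eps m) (la (Rob m) c \<cdot> x) = x"
    using lc_comp [of "cmp (Do c) (Lo (Rob m)) m" "eps m" "la (Rob m) c" x] * by (simp add: e)
qed

lemmas eps_simps [simp] = eps_props(1-3)

text \<open>Naturality and the triangle identities are equations between arrows into hom objects of presheaves or
  out of weighted colimits. They are verified after evaluation, or on coprojections, where the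
  defining properties of \<open>eta\<close> and \<open>eps\<close> leave only associativity.\<close>

lemma adjunction: "vadjunction V U M Lfun Rfun"
proof -
  have 1: "vnat_trans V U U (vfunctor_id V U) (vfunctor_comp V U Rfun Lfun) (\<lambda>F\<in>Psh. eta F)"
    unfolding vnat_trans_def UV_simps
  proof (intro conjI ballI)
    fix F assume F [simp]: "F \<in> Psh"
    show "(\<lambda>F\<in>Psh. eta F) F \<in> hm I (ph (VFobj (vfunctor_id V U) F) (VFobj (vfunctor_comp V U Rfun Lfun) F))"
      by (simp add: vfunctor_id_def vfunctor_comp_def homset_iff)
    fix G assume G [simp]: "G \<in> Psh"
    have "lc (ucmp F G (Rob (Lo G))) (eta G) (idn (ph F G)) = rc (ucmp F (Rob (Lo F)) (Rob (Lo G))) (Rar (Lo F) (Lo G) \<cdot> Lar F G) (eta F)"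
    proof (rule ph_unique [of F "Rob (Lo G)"])
      fix c assume [simp]: "c \<in> Obj C"
      let ?i = "idn (Fobj F c)"
      have "bc (act F (Rob (Lo G)) c) (lc (ucmp F G (Rob (Lo G))) (eta G) (idn (ph F G))) ?i =
          lc (act G (Rob (Lo G)) c) (eta G) (bc (act F G c) (idn (ph F G)) ?i)"
        by (rule asq_lb [OF VComp_UV(4)]) simp_all
      also have "\<dots> = la G c \<cdot> act F G c"
        by (simp add: eta_props(4)) (simp add: bc_def)
      also have "\<dots> = bc (act (Rob (Lo F)) (Rob (Lo G)) c) (Rar (Lo F) (Lo G) \<cdot> Lar F G) (lc (act F (Rob (Lo F)) c) (eta F) ?i)"
        by (simp add: eta_props(4) bc_Rar Lar_props(4))
      also have "\<dots> = bc (act F (Rob (Lo G)) c) (rc (ucmp F (Rob (Lo F)) (Rob (Lo G))) (Rar (Lo F) (Lo G) \<cdot> Lar F G) (eta F)) ?i"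
        by (rule asq_rl [OF VComp_UV(4), symmetric]) simp_all
      finally show "bc (act F (Rob (Lo G)) c) (lc (ucmp F G (Rob (Lo G))) (eta G) (idn (ph F G))) ?i =
         bc (act F (Rob (Lo G)) c) (rc (ucmp F (Rob (Lo F)) (Rob (Lo G))) (Rar (Lo F) (Lo G) \<cdot> Lar F G) (eta F)) ?i" .
    qed simp_all
    then show "ucmp (VFobj (vfunctor_id V U) F) (VFobj (vfunctor_id V U) G) (VFobj (vfunctor_comp V U Rfun Lfun) G) \<cdot>
          ((\<lambda>F\<in>Psh. eta F) G \<boxtimes> VFarr (vfunctor_id V U) (F, G)) \<cdot> lun' (ph F G) =
        ucmp (VFobj (vfunctor_id V U) F) (VFobj (vfunctor_comp V U Rfun Lfun) F) (VFobj (vfunctor_comp V U Rfun Lfun) G) \<cdot>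
          (VFarr (vfunctor_comp V U Rfun Lfun) (F, G) \<boxtimes> (\<lambda>F\<in>Psh. eta F) F) \<cdot> run' (ph F G)"
      by (simp add: vfunctor_id_def vfunctor_comp_def lc_def rc_def)
  qed auto
  have 2: "vnat_trans V M M (vfunctor_comp V M Lfun Rfun) (vfunctor_id V M) (\<lambda>m\<in>VObj M. eps m)"
    unfolding vnat_trans_def
  proof (intro conjI ballI)
    fix m assume m [simp]: "m \<in> VObj M"
    show "(\<lambda>m\<in>VObj M. eps m) m \<in> hm I (hob (VFobj (vfunctor_comp V M Lfun Rfun) m) (VFobj (vfunctor_id V M) m))"
      by (simp add: vfunctor_id_def vfunctor_comp_def homset_iff)
    fix n assume n [simp]: "n \<in> VObj M"
    let ?L = "Lar (Rob m) (Rob n) \<cdot> Rar m n"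
    have "lc (cmp (Lo (Rob m)) (Lo (Rob n)) n) (eps n) ?L = rc (cmp (Lo (Rob m)) m n) (idn (hob m n)) (eps m)"
    proof (rule l_unique [of "Rob m" n])
      fix c assume [simp]: "c \<in> Obj C"
      let ?l = "la (Rob m) c" and ?i = "idn (hob (Do c) m)"
      have "bc (cmp (Do c) (Lo (Rob m)) n) (lc (cmp (Lo (Rob m)) (Lo (Rob n)) n) (eps n) ?L) ?l =
         lc (cmp (Do c) (Lo (Rob n)) n) (eps n) (bc (cmp (Do c) (Lo (Rob m)) (Lo (Rob n))) ?L ?l)"
        by (rule asq_lb [OF vcat_asq]) simp_all
      also have "bc (cmp (Do c) (Lo (Rob m)) (Lo (Rob n))) ?L ?l = la (Rob n) c \<cdot> cmp (Do c) m n"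
        using bc_Lar [of "Rob m" "Rob n" c "Rar m n" ?i] by (simp add: Rar_props(4))
      also have "lc (cmp (Do c) (Lo (Rob n)) n) (eps n) \<dots> = cmp (Do c) m n"
        by (simp add: eps_props(4))
      also have "\<dots> = bc (cmp (Do c) m n) (idn (hob m n)) (lc (cmp (Do c) (Lo (Rob m)) m) (eps m) (?l \<cdot> ?i))"
        by (subst eps_props(4)) (simp_all add: bc_def)
      also have "\<dots> = bc (cmp (Do c) (Lo (Rob m)) n) (rc (cmp (Lo (Rob m)) m n) (idn (hob m n)) (eps m)) ?l"
        by (subst asq_rl [OF vcat_asq]) simp_all
      finally show "bc (cmp (Do c) (Lo (Rob m)) n) (lc (cmp (Lo (Rob m)) (Lo (Rob n)) n) (eps n) ?L) ?l =
          bc (cmp (Do c) (Lo (Rob m)) n) (rc (cmp (Lo (Rob m)) m n) (idn (hob m n)) (eps m)) ?l" .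
    qed simp_all
    then show "cmp (VFobj (vfunctor_comp V M Lfun Rfun) m) (VFobj (vfunctor_comp V M Lfun Rfun) n) (VFobj (vfunctor_id V M) n) \<cdot>
          ((\<lambda>m\<in>VObj M. eps m) n \<boxtimes> VFarr (vfunctor_comp V M Lfun Rfun) (m, n)) \<cdot> lun' (hob m n) =
        cmp (VFobj (vfunctor_comp V M Lfun Rfun) m) (VFobj (vfunctor_id V M) m) (VFobj (vfunctor_id V M) n) \<cdot>
          (VFarr (vfunctor_id V M) (m, n) \<boxtimes> (\<lambda>m\<in>VObj M. eps m) m) \<cdot> run' (hob m n)"
      by (simp add: vfunctor_id_def vfunctor_comp_def lc_def rc_def)
  qed auto
  have 3: "lc (cmp (Lo F) (Lo (Rob (Lo F))) (Lo F)) (eps (Lo F)) (Lar F (Rob (Lo F)) \<cdot> eta F) = vid (Lo F)"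
    if [simp]: "F \<in> Psh" for F
  proof (rule le_unique [of F "Lo F"])
    fix c assume [simp]: "c \<in> Obj C"
    let ?R = "Rob (Lo F)"
    have "lc (cmp (Do c) (Lo F) (Lo F)) (lc (cmp (Lo F) (Lo ?R) (Lo F)) (eps (Lo F)) (Lar F ?R \<cdot> eta F)) (la F c) =
       lc (cmp (Do c) (Lo ?R) (Lo F)) (eps (Lo F)) (lc (cmp (Do c) (Lo F) (Lo ?R)) (Lar F ?R \<cdot> eta F) (la F c))"
      by (rule asq_ll [OF vcat_asq]) simp_all
    also have "lc (cmp (Do c) (Lo F) (Lo ?R)) (Lar F ?R \<cdot> eta F) (la F c) = la ?R c \<cdot> la F c"
      using lc_Lar [of F ?R c "eta F" "idn (Fobj F c)"] by (simp add: eta_props(4))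
    also have "lc (cmp (Do c) (Lo ?R) (Lo F)) (eps (Lo F)) \<dots> = la F c" by (simp add: eps_props(4))
    finally show "lc (cmp (Do c) (Lo F) (Lo F)) (lc (cmp (Lo F) (Lo ?R) (Lo F)) (eps (Lo F)) (Lar F ?R \<cdot> eta F)) (la F c) =
        lc (cmp (Do c) (Lo F) (Lo F)) (vid (Lo F)) (la F c)" by simp
  qed (simp_all add: homset_iff)
  have 4: "lc (ucmp (Rob m) (Rob (Lo (Rob m))) (Rob m)) (Rar (Lo (Rob m)) m \<cdot> eps m) (eta (Rob m)) = VId U (Rob m)"
    if [simp]: "m \<in> VObj M" for m
  proof (rule ph_elem_unique [of "Rob m" "Rob m"])
    fix c assume [simp]: "c \<in> Obj C"
    let ?R = "Rob (Lo (Rob m))" and ?i = "idn (Fobj (Rob m) c)"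
    have "lc (act (Rob m) (Rob m) c) (lc (ucmp (Rob m) ?R (Rob m)) (Rar (Lo (Rob m)) m \<cdot> eps m) (eta (Rob m))) ?i =
       lc (act ?R (Rob m) c) (Rar (Lo (Rob m)) m \<cdot> eps m) (lc (act (Rob m) ?R c) (eta (Rob m)) ?i)"
      by (rule asq_ll [OF VComp_UV(4)]) simp_all
    also have "\<dots> = lc (cmp (Do c) (Lo (Rob m)) m) (eps m) (la (Rob m) c \<cdot> ?i)"
      by (simp add: eta_props(4) lc_Rar)
    also have "\<dots> = lc (act (Rob m) (Rob m) c) (VId U (Rob m)) ?i"
      by (subst eps_props(4)) (simp_all add: VId_UV(4))
    finally show "lc (act (Rob m) (Rob m) c) (lc (ucmp (Rob m) ?R (Rob m)) (Rar (Lo (Rob m)) m \<cdot> eps m) (eta (Rob m))) ?i =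
       lc (act (Rob m) (Rob m) c) (VId U (Rob m)) ?i" .
  qed (simp_all add: homset_iff)
  have elem_comp_U: "elem_comp V U F G H g f = lc (ucmp F G H) g f" if "Dom V f = I" for F G H g f
    using that by (simp add: elem_comp_def lc_def)
  show ?thesis
    unfolding vadjunction_def Let_def
    by (intro conjI Lfun_vfunctor Rfun_vfunctor exI [of _ "\<lambda>F\<in>Psh. eta F"] exI [of _ "\<lambda>m\<in>VObj M. eps m"] 1 2)
      (simp_all add: elem_comp_lc elem_comp_U 3 4)
qed

end

context diag
begin

text \<open>The action of \<open>D\<close> on arrows, as a single arrow on the object \<open>y c (d)\<close>, the copower of the unit
  indexed by the arrows \<open>d \<rightarrow> c\<close>.\<close>

definition tau :: "'c \<Rightarrow> 'c \<Rightarrow> 'a" where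
  "tau c d = (SOME h. h \<in> hm (Fobj (yob c) d) (hob (Do d) (Do c)) \<and> (\<forall>w\<in>homset C d c. h \<cdot> inc c d w = Da w))"

lemma tau_props:
  assumes [simp]: "c \<in> Obj C" and d [simp]: "d \<in> Obj C"
  shows "tau c d \<in> Arr V" "Dom V (tau c d) = Fobj (yob c) d" "Cod V (tau c d) = hob (Do d) (Do c)"
    "w \<in> homset C d c \<Longrightarrow> tau c d \<cdot> inc c d w = Da w"
proof -
  obtain h where "h \<in> hm (Fobj (yob c) d) (hob (Do d) (Do c))" "\<And>w. w \<in> homset C d c \<Longrightarrow> h \<cdot> inc c d w = Da w"
    by (rule copower_exists_arrow [OF copower_yob [OF d, of c], of "hob (Do d) (Do c)" Da]) (auto simp: homset_iff)
  then have "\<exists>h. h \<in> hm (Fobj (yob c) d) (hob (Do d) (Do c)) \<and> (\<forall>w\<in>homset C d c. h \<cdot> inc c d w = Da w)" by blast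
  from someI_ex [OF this, folded tau_def]
  show "tau c d \<in> Arr V" "Dom V (tau c d) = Fobj (yob c) d" "Cod V (tau c d) = hob (Do d) (Do c)"
    "w \<in> homset C d c \<Longrightarrow> tau c d \<cdot> inc c d w = Da w"
    by (auto simp: homset_iff)
qed

lemmas tau_simps [simp] = tau_props(1-3)

end

context lan
begin

subsection \<open>Restriction along the Yoneda embedding\<close>

text \<open>The components of the isomorphism between \<open>D\<close> and the restriction of its extension.\<close>

definition io :: "'c \<Rightarrow> 'a" where "io c = la (yob c) c \<cdot> uni c"

lemma io_simps [simp]:
  assumes "c \<in> Obj C"
  shows "io c \<in> Arr V" "Dom V (io c) = I" "Cod V (io c) = hob (Do c) (Lo (yob c))"
  using assms by (simp_all add: io_def)

text \<open>Naturality of the coprojections reduces them, for a representable weight, to their value at the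
  universal element.\<close>

lemma la_inc:
  assumes w: "w \<in> homset C d c"
  shows "la (yob c) d \<cdot> inc c d w = lc (cmp (Do d) (Do c) (Lo (yob c))) (io c) (Da w)"
proof -
  note [simp] = C.homD [OF w]
  have i: "Idn C c \<in> homset C (Cod C w) c" by (simp add: homset_iff)
  have "la (yob c) d \<cdot> inc c d w = la (yob c) d \<cdot> (Farr (yob c) w \<cdot> uni c)"
    using yob_arr(2) [of c w, OF _ _ i] by (simp add: uni_def)
  also have "\<dots> = (la (yob c) d \<cdot> Farr (yob c) w) \<cdot> uni c" by (simp add: Comp_assoc)
  also have "la (yob c) d \<cdot> Farr (yob c) w = Farr (Rob (Lo (yob c))) w \<cdot> la (yob c) c"
    using la_natural [of "yob c" w] by simp
  also have "\<dots> \<cdot> uni c = Farr (Rob (Lo (yob c))) w \<cdot> la (yob c) c \<cdot> uni c"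
    using psh_simps [of "Rob (Lo (yob c))"] by (simp add: Comp_assoc)
  also have "\<dots> = rc (cmp (Do d) (Do c) (Lo (yob c))) (io c) (Da w)"
    using Farr_Rob [of w "Lo (yob c)" "la (yob c) c \<cdot> uni c"] by (simp add: io_def)
  finally show ?thesis by (simp add: lc_eq_rc)
qed

lemma io_natural:
  assumes [simp]: "u \<in> Arr C"
  shows "lc (cmp (Do (Dom C u)) (Lo (yob (Dom C u))) (Lo (yob (Cod C u)))) (Lar (yob (Dom C u)) (yob (Cod C u)) \<cdot> ym u) (io (Dom C u)) =
     lc (cmp (Do (Dom C u)) (Do (Cod C u)) (Lo (yob (Cod C u)))) (io (Cod C u)) (Da u)"
proof -
  have i: "Idn C (Dom C u) \<in> homset C (Dom C u) (Dom C u)" and u: "u \<in> homset C (Dom C u) (Cod C u)"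
    by (simp_all add: homset_iff)
  show ?thesis
    using ym_props(4) [OF assms i] la_inc [OF u] by (simp add: io_def lc_Lar uni_def [symmetric])
qed

text \<open>The inverse of \<open>io c\<close>: the arrows \<open>D w\<close> for \<open>w : d \<rightarrow> c\<close> form a natural family on \<open>y c\<close>, hence induce an
  arrow out of the colimit of \<open>D\<close> weighted by \<open>y c\<close>.\<close>

lemma jo_ex:
  assumes c [simp]: "c \<in> Obj C"
  shows "\<exists>j. j \<in> hm I (hob (Lo (yob c)) (Do c)) \<and>
     (\<forall>d. \<forall>w\<in>homset C d c. lc (cmp (Do d) (Lo (yob c)) (Do c)) j (la (yob c) d \<cdot> inc c d w) = Da w)"
proof -
  have "\<exists>j. j \<in> hm I (hob (Lo (yob c)) (Do c)) \<and> (\<forall>d\<in>Obj C. lc (cmp (Do d) (Lo (yob c)) (Do c)) j (la (yob c) d) = tau c d)"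
  proof (rule le_exists)
    show "tau c d \<in> hm (Fobj (yob c) d) (hob (Do d) (Do c))" if "d \<in> Obj C" for d using that by (simp add: homset_iff)
    fix v assume v [simp]: "v \<in> Arr C"
    have R [simp]: "Farr (Rob (Do c)) v \<in> Arr V" "Dom V (Farr (Rob (Do c)) v) = hob (Do (Cod C v)) (Do c)"
       "Cod V (Farr (Rob (Do c)) v) = hob (Do (Dom C v)) (Do c)"
      by simp_all
    show "Farr (Rob (Do c)) v \<cdot> tau c (Cod C v) = tau c (Dom C v) \<cdot> Farr (yob c) v"
    proof (rule copower_unique [OF copower_yob [of "Cod C v" c]])
      fix w assume w: "w \<in> homset C (Cod C v) c"
      have wv: "Comp C w v \<in> homset C (Dom C v) c" using w by (auto simp: homset_iff)
      note [simp] = C.homD [OF w]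
      note [simp] = inc_hom [OF w]
      have "(Farr (Rob (Do c)) v \<cdot> tau c (Cod C v)) \<cdot> inc c (Cod C v) w = Farr (Rob (Do c)) v \<cdot> Da w"
        using w by (simp add: Comp_assoc tau_props(4))
      also have "\<dots> = Da (Comp C w v)"
        by (subst Farr_Rob) (simp_all add: Da_comp lc_eq_rc)
      also have "\<dots> = tau c (Dom C v) \<cdot> (Farr (yob c) v \<cdot> inc c (Cod C v) w)"
        using wv by (simp add: yob_arr(2) [OF c v w] tau_props(4))
      finally show "(Farr (Rob (Do c)) v \<cdot> tau c (Cod C v)) \<cdot> inc c (Cod C v) w = (tau c (Dom C v) \<cdot> Farr (yob c) v) \<cdot> inc c (Cod C v) w"
        by (simp add: Comp_assoc)
    qed simp_all
  qed simp_all
  then obtain j where j: "j \<in> hm I (hob (Lo (yob c)) (Do c))"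
    "\<And>d. d \<in> Obj C \<Longrightarrow> lc (cmp (Do d) (Lo (yob c)) (Do c)) j (la (yob c) d) = tau c d" by blast
  have "lc (cmp (Do d) (Lo (yob c)) (Do c)) j (la (yob c) d \<cdot> inc c d w) = Da w" if w: "w \<in> homset C d c" for d w
  proof -
    note [simp] = C.homD [OF w]
    note [simp] = inc_hom [OF w]
    have [simp]: "j \<in> Arr V" "Dom V j = I" "Cod V j = hob (Lo (yob c)) (Do c)" using j by (auto simp: homset_iff)
    show ?thesis using j(2) [of d] w by (subst lc_comp) (simp_all add: tau_props(4))
  qed
  then show ?thesis using j(1) by blast
qed

lemma io_iso:
  assumes c [simp]: "c \<in> Obj C"
  obtains j where "j \<in> hm I (hob (Lo (yob c)) (Do c))"
    "lc (cmp (Do c) (Lo (yob c)) (Do c)) j (io c) = vid (Do c)"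
    "lc (cmp (Lo (yob c)) (Do c) (Lo (yob c))) (io c) j = vid (Lo (yob c))"
proof -
  let ?m = "cmp (Lo (yob c)) (Do c) (Lo (yob c))" and ?n = "cmp (Do c) (Lo (yob c)) (Do c)"
  obtain j where j: "j \<in> hm I (hob (Lo (yob c)) (Do c))"
    "\<And>d w. w \<in> homset C d c \<Longrightarrow> lc (cmp (Do d) (Lo (yob c)) (Do c)) j (la (yob c) d \<cdot> inc c d w) = Da w"
    using jo_ex [OF c] by blast
  have [simp]: "j \<in> Arr V" "Dom V j = I" "Cod V j = hob (Lo (yob c)) (Do c)" using j by (auto simp: homset_iff)
  have i: "Idn C c \<in> homset C c c" by (simp add: homset_iff)
  have 1: "lc ?n j (io c) = vid (Do c)"
    using j(2) [OF i] by (simp add: io_def uni_def)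
  have 2: "lc ?m (io c) j = vid (Lo (yob c))"
  proof (rule le_unique [of "yob c" "Lo (yob c)"])
    fix d assume d [simp]: "d \<in> Obj C"
    show "lc (cmp (Do d) (Lo (yob c)) (Lo (yob c))) (lc ?m (io c) j) (la (yob c) d) =
        lc (cmp (Do d) (Lo (yob c)) (Lo (yob c))) (vid (Lo (yob c))) (la (yob c) d)"
    proof (rule copower_unique [OF copower_yob [OF d, of c]])
      fix w assume w: "w \<in> homset C d c"
      note [simp] = C.homD [OF w]
      note [simp] = inc_hom [OF w]
      have "lc (cmp (Do d) (Lo (yob c)) (Lo (yob c))) (lc ?m (io c) j) (la (yob c) d) \<cdot> inc c d w
         = lc (cmp (Do d) (Lo (yob c)) (Lo (yob c))) (lc ?m (io c) j) (la (yob c) d \<cdot> inc c d w)"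
        by (subst lc_comp) simp_all
      also have "\<dots> = lc (cmp (Do d) (Do c) (Lo (yob c))) (io c) (lc (cmp (Do d) (Lo (yob c)) (Do c)) j (la (yob c) d \<cdot> inc c d w))"
        by (rule asq_ll [OF vcat_asq]) simp_all
      also have "\<dots> = la (yob c) d \<cdot> inc c d w" unfolding j(2) [OF w] by (simp only: la_inc [OF w])
      finally show "lc (cmp (Do d) (Lo (yob c)) (Lo (yob c))) (lc ?m (io c) j) (la (yob c) d) \<cdot> inc c d w
        = lc (cmp (Do d) (Lo (yob c)) (Lo (yob c))) (vid (Lo (yob c))) (la (yob c) d) \<cdot> inc c d w" by simp
    qed simp_all
  qed (simp_all add: homset_iff)
  show thesis using that [OF j(1) 1 2] .
qed

subsection \<open>The universal property of the extension\<close>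

context
  fixes L' :: "(('c, 'd, 'o, 'a) presheaf, 'm, 'a) vfunctr" and \<zeta> :: "'c \<Rightarrow> 'a"
  assumes L': "is_vfunctor V U M L'"
    and \<zeta>: "\<And>c. c \<in> Obj C \<Longrightarrow> \<zeta> c \<in> hm I (hob (Do c) (VFobj L' (yob c)))"
    and \<zeta>_natural: "\<And>u. u \<in> Arr C \<Longrightarrow>
       lc (cmp (Do (Dom C u)) (VFobj L' (yob (Dom C u))) (VFobj L' (yob (Cod C u))))
          (VFarr L' (yob (Dom C u), yob (Cod C u)) \<cdot> ym u) (\<zeta> (Dom C u)) =
       lc (cmp (Do (Dom C u)) (Do (Cod C u)) (VFobj L' (yob (Cod C u)))) (\<zeta> (Cod C u)) (Da u)"
begin

lemmas L'_simps = vfun_simps [OF L']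

lemma \<zeta>_simps: "c \<in> Obj C \<Longrightarrow> \<zeta> c \<in> Arr V" "c \<in> Obj C \<Longrightarrow> Dom V (\<zeta> c) = I"
  "c \<in> Obj C \<Longrightarrow> Cod V (\<zeta> c) = hob (Do c) (VFobj L' (yob c))"
  using \<zeta> by (auto simp: homset_iff)

text \<open>An element \<open>x\<close> of \<open>F c\<close> is the map \<open>\<theta> x : y c \<rightarrow> F\<close>; so the extension has to send its image in
  \<open>M(D c, L F)\<close> to \<open>L' (\<theta> x) \<circ> \<zeta> c\<close>.\<close>

definition ext_cone :: "('c, 'd, 'o, 'a) presheaf \<Rightarrow> 'c \<Rightarrow> 'a" where
  "ext_cone F c = rc (cmp (Do c) (VFobj L' (yob c)) (VFobj L' F)) (VFarr L' (yob c, F) \<cdot> th F c) (\<zeta> c)"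

lemma ext_cone_simps:
  assumes "F \<in> Psh" "c \<in> Obj C"
  shows "ext_cone F c \<in> Arr V" "Dom V (ext_cone F c) = Fobj F c" "Cod V (ext_cone F c) = hob (Do c) (VFobj L' F)"
  using assms by (simp_all add: ext_cone_def L'_simps \<zeta>_simps)

lemma ext_cone_comp:
  assumes "F \<in> Psh" "c \<in> Obj C" "x \<in> Arr V" "Cod V x = Fobj F c"
  shows "ext_cone F c \<cdot> x = rc (cmp (Do c) (VFobj L' (yob c)) (VFobj L' F)) (VFarr L' (yob c, F) \<cdot> th F c \<cdot> x) (\<zeta> c)"
  unfolding ext_cone_def using assms by (subst rc_comp [symmetric]) (simp_all add: L'_simps \<zeta>_simps Comp_assoc)

lemma ext_cone_natural:
  assumes F [simp]: "F \<in> Psh" and u [simp]: "u \<in> Arr C"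
  shows "Farr (Rob (VFobj L' F)) u \<cdot> ext_cone F (Cod C u) = ext_cone F (Dom C u) \<cdot> Farr F u"
proof -
  let ?c = "Cod C u" and ?d = "Dom C u"
  let ?Lc = "VFobj L' (yob ?c)" and ?Ld = "VFobj L' (yob ?d)" and ?LF = "VFobj L' F"
  let ?t = "VFarr L' (yob ?c, F) \<cdot> th F ?c"
  note [simp] = L'_simps \<zeta>_simps ext_cone_simps
  have "Farr (Rob ?LF) u \<cdot> ext_cone F ?c = rc (cmp (Do ?d) (Do ?c) ?LF) (rc (cmp (Do ?c) ?Lc ?LF) ?t (\<zeta> ?c)) (Da u)"
    by (subst Farr_Rob) (simp_all add: ext_cone_def)
  also have "\<dots> = rc (cmp (Do ?d) ?Lc ?LF) ?t (lc (cmp (Do ?d) (Do ?c) ?Lc) (\<zeta> ?c) (Da u))"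
    by (rule asq_rr [OF vcat_asq]) simp_all
  also have "\<dots> = rc (cmp (Do ?d) ?Lc ?LF) ?t (lc (cmp (Do ?d) ?Ld ?Lc) (VFarr L' (yob ?d, yob ?c) \<cdot> ym u) (\<zeta> ?d))"
    by (simp add: \<zeta>_natural)
  also have "\<dots> = rc (cmp (Do ?d) ?Ld ?LF) (rc (cmp ?Ld ?Lc ?LF) ?t (VFarr L' (yob ?d, yob ?c) \<cdot> ym u)) (\<zeta> ?d)"
    by (rule asq_rr [OF vcat_asq, symmetric]) simp_all
  also have "rc (cmp ?Ld ?Lc ?LF) ?t (VFarr L' (yob ?d, yob ?c) \<cdot> ym u) = VFarr L' (yob ?d, F) \<cdot> rc (ucmp (yob ?d) (yob ?c) F) (th F ?c) (ym u)"
    by (simp add: vfun_rc [OF L'])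
  also have "rc (cmp (Do ?d) ?Ld ?LF) \<dots> (\<zeta> ?d) = ext_cone F ?d \<cdot> Farr F u"
    by (simp add: ext_cone_comp th_restrict)
  finally show ?thesis .
qed

definition ext :: "('c, 'd, 'o, 'a) presheaf \<Rightarrow> 'a" where
  "ext = (\<lambda>F\<in>Psh. SOME h. h \<in> hm I (hob (Lo F) (VFobj L' F)) \<and>
      (\<forall>c\<in>Obj C. lc (cmp (Do c) (Lo F) (VFobj L' F)) h (la F c) = ext_cone F c))"

lemma ext_props:
  assumes F [simp]: "F \<in> Psh"
  shows "ext F \<in> Arr V" "Dom V (ext F) = I" "Cod V (ext F) = hob (Lo F) (VFobj L' F)"
    "c \<in> Obj C \<Longrightarrow> lc (cmp (Do c) (Lo F) (VFobj L' F)) (ext F) (la F c) = ext_cone F c"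
proof -
  have "\<exists>h. h \<in> hm I (hob (Lo F) (VFobj L' F)) \<and> (\<forall>c\<in>Obj C. lc (cmp (Do c) (Lo F) (VFobj L' F)) h (la F c) = ext_cone F c)"
    by (rule le_exists) (simp_all add: L'_simps homset_iff ext_cone_simps ext_cone_natural)
  from someI_ex [OF this]
  have "ext F \<in> hm I (hob (Lo F) (VFobj L' F)) \<and> (\<forall>c\<in>Obj C. lc (cmp (Do c) (Lo F) (VFobj L' F)) (ext F) (la F c) = ext_cone F c)"
    by (simp add: ext_def)
  then show "ext F \<in> Arr V" "Dom V (ext F) = I" "Cod V (ext F) = hob (Lo F) (VFobj L' F)"
    "c \<in> Obj C \<Longrightarrow> lc (cmp (Do c) (Lo F) (VFobj L' F)) (ext F) (la F c) = ext_cone F c"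
    by (auto simp: homset_iff)
qed

text \<open>Naturality is tested on the coprojections of the weighted colimit. There both sides are built from
  \<open>\<zeta>\<close> and the Yoneda correspondence, and agree by its naturality in the presheaf.\<close>

lemma ext_vnat: "vnat_trans V U M Lfun L' ext"
  unfolding vnat_trans_def UV_simps
proof (intro conjI ballI)
  note [simp] = L'_simps \<zeta>_simps ext_cone_simps ext_props(1-3)
  show "ext \<in> Psh \<rightarrow>\<^sub>E Arr V"
  proof (rule PiE_I)
    show "ext F \<in> Arr V" if "F \<in> Psh" for F using that by simp
    show "ext F = undefined" if "F \<notin> Psh" for F using that by (simp add: ext_def)
  qed
  fix F assume F [simp]: "F \<in> Psh"
  show "ext F \<in> hm I (hob (VFobj Lfun F) (VFobj L' F))" by (simp add: homset_iff)
  fix G assume G [simp]: "G \<in> Psh"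
  let ?LF = "VFobj L' F" and ?LG = "VFobj L' G"
  have "lc (cmp (Lo F) (Lo G) ?LG) (ext G) (Lar F G) = rc (cmp (Lo F) ?LF ?LG) (VFarr L' (F, G)) (ext F)"
  proof (rule l_unique [of F ?LG])
    fix c assume c [simp]: "c \<in> Obj C"
    let ?Lc = "VFobj L' (yob c)"
    have "bc (cmp (Do c) (Lo F) ?LG) (lc (cmp (Lo F) (Lo G) ?LG) (ext G) (Lar F G)) (la F c)
       = lc (cmp (Do c) (Lo G) ?LG) (ext G) (bc (cmp (Do c) (Lo F) (Lo G)) (Lar F G) (la F c))"
      by (rule asq_lb [OF vcat_asq]) simp_all
    also have "\<dots> = lc (cmp (Do c) (Lo G) ?LG) (ext G) (la G c) \<cdot> act F G c"
      by (subst lc_comp [symmetric]) (simp_all add: Lar_props(4))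
    also have "\<dots> = rc (cmp (Do c) ?Lc ?LG) (VFarr L' (yob c, G) \<cdot> th G c \<cdot> act F G c) (\<zeta> c)"
      by (simp add: ext_props(4) ext_cone_comp)
    also have "VFarr L' (yob c, G) \<cdot> th G c \<cdot> act F G c = VFarr L' (yob c, G) \<cdot> bc (ucmp (yob c) F G) (idn (ph F G)) (th F c)"
      by (simp add: th_act)
    also have "\<dots> = bc (cmp ?Lc ?LF ?LG) (VFarr L' (F, G)) (VFarr L' (yob c, F) \<cdot> th F c)"
      by (subst vfun_bc [OF L']) simp_all
    also have "rc (cmp (Do c) ?Lc ?LG) \<dots> (\<zeta> c) = bc (cmp (Do c) ?LF ?LG) (VFarr L' (F, G)) (rc (cmp (Do c) ?Lc ?LF) (VFarr L' (yob c, F) \<cdot> th F c) (\<zeta> c))"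
      by (rule asq_br [OF vcat_asq]) simp_all
    also have "\<dots> = bc (cmp (Do c) ?LF ?LG) (VFarr L' (F, G)) (lc (cmp (Do c) (Lo F) ?LF) (ext F) (la F c))"
      by (simp add: ext_props(4) ext_cone_def)
    also have "\<dots> = bc (cmp (Do c) (Lo F) ?LG) (rc (cmp (Lo F) ?LF ?LG) (VFarr L' (F, G)) (ext F)) (la F c)"
      by (rule asq_rl [OF vcat_asq, symmetric]) simp_all
    finally show "bc (cmp (Do c) (Lo F) ?LG) (lc (cmp (Lo F) (Lo G) ?LG) (ext G) (Lar F G)) (la F c) =
       bc (cmp (Do c) (Lo F) ?LG) (rc (cmp (Lo F) ?LF ?LG) (VFarr L' (F, G)) (ext F)) (la F c)" .
  qed simp_all
  then show "cmp (VFobj Lfun F) (VFobj Lfun G) ?LG \<cdot> (ext G \<boxtimes> VFarr Lfun (F, G)) \<cdot> lun' (ph F G) =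
      cmp (VFobj Lfun F) ?LF ?LG \<cdot> (VFarr L' (F, G) \<boxtimes> ext F) \<cdot> run' (ph F G)"
    by (simp add: lc_def rc_def)
qed

lemma ext_io:
  assumes c [simp]: "c \<in> Obj C"
  shows "lc (cmp (Do c) (Lo (yob c)) (VFobj L' (yob c))) (ext (yob c)) (io c) = \<zeta> c"
  (is "?lhs = _")
proof -
  note [simp] = L'_simps \<zeta>_simps ext_cone_simps ext_props(1-3)
  have "?lhs = ext_cone (yob c) c \<cdot> uni c"
    unfolding io_def by (subst lc_comp) (simp_all add: ext_props(4))
  also have "\<dots> = \<zeta> c" by (simp add: ext_cone_comp th_uni_VId flip: lc_eq_rc)
  finally show ?thesis .
qed

text \<open>Every element of \<open>F c\<close> names a map \<open>y c \<rightarrow> F\<close>; so naturality with respect to \<open>[y c, F]\<close> determines the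
  coprojections of \<open>\<tau> F\<close> from the component at \<open>y c\<close>.\<close>

lemma ext_unique:
  assumes \<tau>: "vnat_trans V U M Lfun L' \<tau>"
    and \<tau>_io: "\<And>c. c \<in> Obj C \<Longrightarrow> lc (cmp (Do c) (Lo (yob c)) (VFobj L' (yob c))) (\<tau> (yob c)) (io c) = \<zeta> c"
  shows "\<tau> = ext"
proof (rule HOL.ext)
  note [simp] = L'_simps \<zeta>_simps ext_cone_simps ext_props(1-3)
  fix F
  show "\<tau> F = ext F"
  proof (cases "F \<in> Psh")
    case False
    then show ?thesis using \<tau> by (auto simp: vnat_trans_def ext_def PiE_def extensional_def)
  next
    case F [simp]: True
    have \<tau>s [simp]: "\<tau> H \<in> Arr V" "Dom V (\<tau> H) = I" "Cod V (\<tau> H) = hob (Lo H) (VFobj L' H)" if "H \<in> Psh" for H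
      using \<tau> that by (auto simp: vnat_trans_def homset_iff)
    show ?thesis
    proof (rule le_unique [of F "VFobj L' F"])
      fix c assume c [simp]: "c \<in> Obj C"
      let ?y = "yob c" and ?LF = "VFobj L' F" and ?Lc = "VFobj L' (yob c)"
      have "lc (cmp (Lo ?y) (Lo F) ?LF) (\<tau> F) (Lar ?y F) = rc (cmp (Lo ?y) ?Lc ?LF) (VFarr L' (?y, F)) (\<tau> ?y)"
        using \<tau> by (simp add: vnat_trans_def lc_def rc_def)
      then have "lc (cmp (Lo ?y) (Lo F) ?LF) (\<tau> F) (Lar ?y F) \<cdot> th F c = rc (cmp (Lo ?y) ?Lc ?LF) (VFarr L' (?y, F)) (\<tau> ?y) \<cdot> th F c"
        by simp
      then have nat: "lc (cmp (Lo ?y) (Lo F) ?LF) (\<tau> F) (Lar ?y F \<cdot> th F c) = rc (cmp (Lo ?y) ?Lc ?LF) (VFarr L' (?y, F) \<cdot> th F c) (\<tau> ?y)"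
        by (subst lc_comp, simp_all) (subst rc_comp, simp_all)
      have "la F c = rc (cmp (Do c) (Lo ?y) (Lo F)) (Lar ?y F \<cdot> th F c) (io c)"
        using th_uni [of F c "idn (Fobj F c)"] unfolding io_def by (subst rc_Lar) simp_all
      then have "lc (cmp (Do c) (Lo F) ?LF) (\<tau> F) (la F c) =
          lc (cmp (Do c) (Lo F) ?LF) (\<tau> F) (rc (cmp (Do c) (Lo ?y) (Lo F)) (Lar ?y F \<cdot> th F c) (io c))"
        by simp
      also have "\<dots> = rc (cmp (Do c) (Lo ?y) ?LF) (lc (cmp (Lo ?y) (Lo F) ?LF) (\<tau> F) (Lar ?y F \<cdot> th F c)) (io c)"
        by (rule asq_lr [OF vcat_asq, symmetric]) simp_all
      also have "\<dots> = rc (cmp (Do c) ?Lc ?LF) (VFarr L' (?y, F) \<cdot> th F c) (lc (cmp (Do c) (Lo ?y) ?Lc) (\<tau> ?y) (io c))"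
        unfolding nat by (rule asq_rr [OF vcat_asq]) simp_all
      also have "\<dots> = ext_cone F c" by (simp add: \<tau>_io ext_cone_def)
      finally show "lc (cmp (Do c) (Lo F) ?LF) (\<tau> F) (la F c) = lc (cmp (Do c) (Lo F) ?LF) (ext F) (la F c)"
        by (simp add: ext_props(4))
    qed (simp_all add: homset_iff)
  qed
qed

theorem extension_ex1:
  "\<exists>!\<tau>. vnat_trans V U M Lfun L' \<tau> \<and>
     (\<forall>c\<in>Obj C. lc (cmp (Do c) (Lo (yob c)) (VFobj L' (yob c))) (\<tau> (yob c)) (io c) = \<zeta> c)"
  using ext_vnat ext_io ext_unique by blast

end

end

section \<open>Model categories\<close>

lemma has_liftD:
  assumes "has_lift K i p" "u \<in> homset K (Dom K i) (Dom K p)" "v \<in> homset K (Cod K i) (Cod K p)" "Comp K p u = Comp K v i"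
  obtains h where "h \<in> homset K (Cod K i) (Dom K p)" "Comp K h i = u" "Comp K p h = v"
  using assms unfolding has_lift_def by blast

context categ
begin

text \<open>The retract argument: a map with the left lifting property against the second factor of one of
  its factorizations is a retract of the first factor, and dually.\<close>

lemma retract_left:
  assumes f: "f \<in> Arr K" and \<alpha>: "\<alpha> \<in> homset K (Dom K f) e" and \<beta>: "\<beta> \<in> homset K e (Cod K f)" "Comp K \<beta> \<alpha> = f"
    and lift: "has_lift K f \<beta>"
  shows "arrow_retract K f \<alpha>"
proof -
  have [simp]: "\<alpha> \<in> Arr K" "Dom K \<alpha> = Dom K f" "Cod K \<alpha> = e" "\<beta> \<in> Arr K" "Dom K \<beta> = e" "Cod K \<beta> = Cod K f"
    using \<alpha> \<beta> by (auto simp: homset_iff)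
  obtain h where h: "h \<in> homset K (Cod K f) (Dom K \<beta>)" "Comp K h f = \<alpha>" "Comp K \<beta> h = Idn K (Cod K f)"
    using lift by (rule has_liftD [of _ _ _ \<alpha> "Idn K (Cod K f)"]) (use f \<alpha> \<beta>(2) in \<open>auto simp: homset_iff\<close>)
  show ?thesis unfolding arrow_retract_def
    by (rule bexI [of _ "Idn K (Dom K f)"], rule bexI [of _ "Idn K (Dom K f)"], rule bexI [of _ h], rule bexI [of _ \<beta>])
      (use f h \<beta>(2) in \<open>auto simp: homset_iff\<close>)
qed

lemma retract_right:
  assumes f: "f \<in> Arr K" and \<alpha>: "\<alpha> \<in> homset K (Dom K f) e" and \<beta>: "\<beta> \<in> homset K e (Cod K f)" "Comp K \<beta> \<alpha> = f"
    and lift: "has_lift K \<alpha> f"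
  shows "arrow_retract K f \<beta>"
proof -
  have [simp]: "\<alpha> \<in> Arr K" "Dom K \<alpha> = Dom K f" "Cod K \<alpha> = e" "\<beta> \<in> Arr K" "Dom K \<beta> = e" "Cod K \<beta> = Cod K f"
    using \<alpha> \<beta> by (auto simp: homset_iff)
  obtain h where h: "h \<in> homset K (Cod K \<alpha>) (Dom K f)" "Comp K h \<alpha> = Idn K (Dom K f)" "Comp K f h = \<beta>"
    using lift by (rule has_liftD [of _ _ _ "Idn K (Dom K f)" \<beta>]) (use f \<alpha> \<beta>(2) in \<open>auto simp: homset_iff\<close>)
  show ?thesis unfolding arrow_retract_def
    by (rule bexI [of _ \<alpha>], rule bexI [of _ h], rule bexI [of _ "Idn K (Cod K f)"], rule bexI [of _ "Idn K (Cod K f)"])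
      (use f h \<beta>(2) in \<open>auto simp: homset_iff\<close>)
qed

lemma factorization:
  assumes "functorial_factorization K A B" "f \<in> Arr K"
  obtains e \<alpha> \<beta> where "\<alpha> \<in> homset K (Dom K f) e" "\<alpha> \<in> A" "\<beta> \<in> homset K e (Cod K f)" "\<beta> \<in> B" "Comp K \<beta> \<alpha> = f"
proof -
  obtain E \<alpha> \<beta> where "\<forall>f\<in>Arr K. \<alpha> f \<in> homset K (Dom K f) (E f) \<inter> A \<and> \<beta> f \<in> homset K (E f) (Cod K f) \<inter> B \<and>
      Comp K (\<beta> f) (\<alpha> f) = f"
    using assms(1) unfolding functorial_factorization_def by (elim exE conjE) (rule that)
  then show thesis using that [of "\<alpha> f" "E f" "\<beta> f"] assms(2) by blast
qed

context
  fixes N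
  assumes N: "model_structure K N"
begin

lemma model_factor:
  "functorial_factorization K (Cof N) (Fib N \<inter> Weq N)"
  "functorial_factorization K (Cof N \<inter> Weq N) (Fib N)"
  using N by (simp_all add: model_structure_def)

lemma model_retract:
  "retract_closed K (Weq N)" "retract_closed K (Cof N)" "retract_closed K (Fib N)"
  using N by (simp_all add: model_structure_def)

lemma Cof_if_lift:
  assumes f: "f \<in> Arr K" and lift: "\<And>p. p \<in> Fib N \<inter> Weq N \<Longrightarrow> has_lift K f p"
  shows "f \<in> Cof N"
proof -
  from factorization [OF model_factor(1) f] obtain e \<alpha> \<beta> where *: "\<alpha> \<in> homset K (Dom K f) e" "\<alpha> \<in> Cof N" "\<beta> \<in> homset K e (Cod K f)"
    "\<beta> \<in> Fib N \<inter> Weq N" "Comp K \<beta> \<alpha> = f" .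
  then have "arrow_retract K f \<alpha>" using f lift by (intro retract_left) auto
  then show ?thesis using model_retract(2) f *(2) by (auto simp: retract_closed_def)
qed

lemma Fib_if_lift:
  assumes f: "f \<in> Arr K" and lift: "\<And>i. i \<in> Cof N \<inter> Weq N \<Longrightarrow> has_lift K i f"
  shows "f \<in> Fib N"
proof -
  from factorization [OF model_factor(2) f] obtain e \<alpha> \<beta> where *: "\<alpha> \<in> homset K (Dom K f) e" "\<alpha> \<in> Cof N \<inter> Weq N" "\<beta> \<in> homset K e (Cod K f)"
    "\<beta> \<in> Fib N" "Comp K \<beta> \<alpha> = f" .
  then have "arrow_retract K f \<beta>" using f lift by (intro retract_right) auto
  then show ?thesis using model_retract(3) f *(4) by (auto simp: retract_closed_def)
qed

lemma trivial_Fib_if_lift: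
  assumes f: "f \<in> Arr K" and lift: "\<And>i. i \<in> Cof N \<Longrightarrow> has_lift K i f"
  shows "f \<in> Fib N \<inter> Weq N"
proof -
  from factorization [OF model_factor(1) f] obtain e \<alpha> \<beta> where *: "\<alpha> \<in> homset K (Dom K f) e" "\<alpha> \<in> Cof N" "\<beta> \<in> homset K e (Cod K f)"
    "\<beta> \<in> Fib N \<inter> Weq N" "Comp K \<beta> \<alpha> = f" .
  then have "arrow_retract K f \<beta>" using f lift by (intro retract_right) auto
  then show ?thesis using model_retract(1,3) f *(4) by (auto simp: retract_closed_def)
qed

end

end

section \<open>Tensors and cofibrant objects\<close>

context smc
begin

text \<open>The universal property of a tensor, or of a cotensor, on elements: invertibility of the induced arrow
  \<open>H \<rightarrow> [v, Q]\<close> gives a bijection of elements \<open>1 \<rightarrow> H\<close> with elements of \<open>[v, Q]\<close>, that is, with arrows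
  \<open>v \<rightarrow> Q\<close>.\<close>

lemma representing_element_ex1:
  assumes H [simp]: "H \<in> Obj V" and v [simp]: "v \<in> Obj V" and \<mu> [simp]: "\<mu> \<in> Arr V" and i [simp]: "i \<in> Arr V"
    and dom [simp]: "Dom V i = v" "Dom V \<mu> = H \<boxdot> Cod V i"
    and iso: "is_iso V (curry_arr V H v (Cod V \<mu>) (\<mu> \<cdot> (idn H \<boxtimes> i)))"
    and a: "a \<in> hm v (Cod V \<mu>)"
  shows "\<exists>!h. h \<in> hm I H \<and> lc \<mu> h i = a"
proof -
  let ?Q = "Cod V \<mu>"
  let ?f = "\<mu> \<cdot> (idn H \<boxtimes> i)"
  let ?k = "curry_arr V H v ?Q ?f"
  have [simp]: "a \<in> Arr V" "Dom V a = v" "Cod V a = ?Q" using a by (auto simp: homset_iff)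
  have k [simp]: "?k \<in> Arr V" "Dom V ?k = H" "Cod V ?k = ihom v ?Q" by (simp_all add: curry_simps)
  note kinv [simp] = inv_arr_simps(2-) [OF iso k(2,3)]
  have ev: "ev v ?Q \<cdot> ((?k \<cdot> h) \<boxtimes> idn v) = bc \<mu> h i" if h [simp]: "h \<in> hm I H" for h
  proof -
    have [simp]: "h \<in> Arr V" "Dom V h = I" "Cod V h = H" using h by (auto simp: homset_iff)
    have "ev v ?Q \<cdot> ((?k \<cdot> h) \<boxtimes> idn v) = ?f \<cdot> (h \<boxtimes> idn v)" by (rule eval_curry) simp_all
    then show ?thesis by (simp add: bc_def Comp_assoc merge)
  qed
  let ?b = "curry_arr V I v ?Q (a \<cdot> lun v)"
  have b [simp]: "?b \<in> Arr V" "Dom V ?b = I" "Cod V ?b = ihom v ?Q" "ev v ?Q \<cdot> (?b \<boxtimes> idn v) = a \<cdot> lun v"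
    by (simp_all add: curry_simps)
  let ?h = "inv_arr V ?k \<cdot> ?b"
  have hh: "?h \<in> hm I H" by (simp add: homset_iff)
  have "?k \<cdot> ?h = ?b" by (simp flip: Comp_assoc)
  then have "bc \<mu> ?h i = a \<cdot> lun v" using ev [OF hh] by simp
  then have 1: "lc \<mu> ?h i = a" by (simp add: lc_bc Comp_assoc)
  show ?thesis
  proof (rule ex1I [of _ ?h])
    show "?h \<in> hm I H \<and> lc \<mu> ?h i = a" using hh 1 by simp
    fix h assume h: "h \<in> hm I H \<and> lc \<mu> h i = a"
    then have [simp]: "h \<in> Arr V" "Dom V h = I" "Cod V h = H" by (auto simp: homset_iff)
    have "bc \<mu> h i = lc \<mu> h i \<cdot> lun v" by (simp add: lc_bc Comp_assoc)
    then have "bc \<mu> h i = bc \<mu> ?h i" using h \<open>bc \<mu> ?h i = a \<cdot> lun v\<close> by simp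
    then have "ev v ?Q \<cdot> ((?k \<cdot> h) \<boxtimes> idn v) = ev v ?Q \<cdot> ((?k \<cdot> ?h) \<boxtimes> idn v)"
      using ev [of h] ev [OF hh] by (simp add: homset_iff)
    then have "?k \<cdot> h = ?k \<cdot> ?h" by (rule curry_unique [of _ _ v ?Q, rotated -1]) simp_all
    then show "h = ?h" by (rule iso_cancel_left [OF iso, rotated -1]) simp_all
  qed
qed

end

locale tensored = vct V M for V :: "('o, 'a) smcat" and M :: "('m, 'o, 'a) vcat" +
  assumes tensored: "two_variable_vadjunction V M"
begin

abbreviation "to \<equiv> tensor_obj V M"
abbreviation "tu \<equiv> tensor_unit V M"

lemma is_tensor: "v \<in> Obj V \<Longrightarrow> m \<in> VObj M \<Longrightarrow> is_tensor V M v m (to v m) (tu v m)"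
  unfolding tensor_obj_def tensor_unit_def tensor_def
  using someI_ex [of "\<lambda>p. is_tensor V M v m (fst p) (snd p)"] tensored
  by (auto simp: case_prod_unfold two_variable_vadjunction_def)

lemma tensor_simps [simp]:
  assumes "v \<in> Obj V" "m \<in> VObj M"
  shows "to v m \<in> VObj M" "tu v m \<in> Arr V" "Dom V (tu v m) = v" "Cod V (tu v m) = hob m (to v m)"
  using is_tensor [OF assms] by (auto simp: is_tensor_def homset_iff)

lemma tensor_ex1:
  assumes [simp]: "v \<in> Obj V" "m \<in> VObj M" "n \<in> VObj M" and a: "a \<in> hm v (hob m n)"
  shows "\<exists>!h. h \<in> hm I (hob (to v m) n) \<and> lc (cmp m (to v m) n) h (tu v m) = a"
  by (rule representing_element_ex1) (use is_tensor [of v m] a in \<open>simp_all add: is_tensor_def\<close>)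

lemma tensor_unique:
  assumes "v \<in> Obj V" "m \<in> VObj M" "n \<in> VObj M" "h \<in> hm I (hob (to v m) n)" "h' \<in> hm I (hob (to v m) n)"
    and "lc (cmp m (to v m) n) h (tu v m) = lc (cmp m (to v m) n) h' (tu v m)"
  shows "h = h'"
proof (rule ex1D [OF tensor_ex1 [OF assms(1-3), of "lc (cmp m (to v m) n) h' (tu v m)"]])
  show "lc (cmp m (to v m) n) h' (tu v m) \<in> hm v (hob m n)" using assms(1-5) by (simp add: homset_iff)
qed (use assms in simp_all)

lemma initial_iff: "is_initial M0 z \<longleftrightarrow> z \<in> VObj M \<and> (\<forall>n\<in>VObj M. \<exists>!h. h \<in> hm I (hob z n))"
proof -
  have "(\<exists>!f. f \<in> homset M0 z n) \<longleftrightarrow> (\<exists>!h. h \<in> hm I (hob z n))" if "z \<in> VObj M" "n \<in> VObj M" for n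
  proof -
    have "homset M0 z n = (\<lambda>h. (z, n, h)) ` hm I (hob z n)"
      using that by (auto simp: underlying_def homset_def)
    moreover have "(\<exists>!f. f \<in> (\<lambda>h. (z, n, h)) ` S) \<longleftrightarrow> (\<exists>!h. h \<in> S)" for S :: "'a set"
    proof
      assume "\<exists>!f. f \<in> (\<lambda>h. (z, n, h)) ` S"
      then obtain h where "h \<in> S" and u: "\<And>f. f \<in> (\<lambda>h. (z, n, h)) ` S \<Longrightarrow> f = (z, n, h)" by blast
      moreover have "h' = h" if "h' \<in> S" for h' using u [of "(z, n, h')"] that by simp
      ultimately show "\<exists>!h. h \<in> S" by blast
    qed blast
    ultimately show ?thesis by simp
  qed
  then show ?thesis unfolding is_initial_def underlying_simps(1) by (intro conj_cong ball_cong refl)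
qed

text \<open>An arrow \<open>v \<rightarrow> M(z, n)\<close> is an arrow from \<open>z\<close> to the cotensor of \<open>n\<close> by \<open>v\<close>, hence unique for initial \<open>z\<close>.
  So initial objects of \<open>M\<^sub>0\<close> are initial in the enriched sense, and their tensors are again initial.\<close>

lemma initial_parametrized:
  assumes z: "is_initial M0 z" and [simp]: "n \<in> VObj M" "v \<in> Obj V" and a: "a \<in> hm v (hob z n)" "a' \<in> hm v (hob z n)"
  shows "a = a'"
proof -
  have [simp]: "z \<in> VObj M" using z by (simp add: initial_iff)
  obtain c j where "is_tensor V (vop V M) v n c j"
    using tensored assms(2,3) unfolding two_variable_vadjunction_def by blast
  then have c [simp]: "c \<in> VObj M" and j: "j \<in> hm v (hob c n)"
    and iso: "is_iso V (curry_arr V (hob z c) v (hob z n) ((cmp z c n \<cdot> sy (hob z c) (hob c n)) \<cdot> (idn (hob z c) \<boxtimes> j)))"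
    by (auto simp: is_tensor_def vop_def)
  have [simp]: "j \<in> Arr V" "Dom V j = v" "Cod V j = hob c n" using j by (auto simp: homset_iff)
  have ex: "\<exists>h. h \<in> hm I (hob z c) \<and> lc (cmp z c n \<cdot> sy (hob z c) (hob c n)) h j = b" if "b \<in> hm v (hob z n)" for b
    by (rule ex1_implies_ex, rule representing_element_ex1) (use iso that in simp_all)
  obtain h h' where h: "h \<in> hm I (hob z c)" "lc (cmp z c n \<cdot> sy (hob z c) (hob c n)) h j = a"
    and h': "h' \<in> hm I (hob z c)" "lc (cmp z c n \<cdot> sy (hob z c) (hob c n)) h' j = a'"
    using ex a by blast
  have "\<exists>!h. h \<in> hm I (hob z c)" using z c unfolding initial_iff by blast
  then have "h = h'" by (rule ex1D) (use h h' in simp_all)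
  then show ?thesis using h h' by simp
qed

lemma initial_tensor:
  assumes z: "is_initial M0 z" and v: "v \<in> Obj V"
  shows "is_initial M0 (to v z)"
  unfolding initial_iff
proof (intro conjI ballI)
  note [simp] = v
  have z' [simp]: "z \<in> VObj M" using z by (simp add: initial_iff)
  then show "to v z \<in> VObj M" by simp
  fix n assume n [simp]: "n \<in> VObj M"
  obtain c j where "is_tensor V (vop V M) v n c j" using tensored v n unfolding two_variable_vadjunction_def by blast
  then have c [simp]: "c \<in> VObj M" and j: "j \<in> hm v (hob c n)"
    by (auto simp: is_tensor_def vop_def)
  obtain h where h: "h \<in> hm I (hob z c)" using z c unfolding initial_iff by blast
  have "lc (cmp z c n \<cdot> sy (hob z c) (hob c n)) h j \<in> hm v (hob z n)"
    using h j by (simp add: homset_iff)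
  then obtain a where a: "a \<in> hm v (hob z n)" by blast
  obtain k where k: "k \<in> hm I (hob (to v z) n)" using tensor_ex1 [OF v z' n a] by blast
  show "\<exists>!h. h \<in> hm I (hob (to v z) n)"
  proof (rule ex1I [of _ k], rule k)
    fix k' assume k': "k' \<in> hm I (hob (to v z) n)"
    show "k' = k"
      by (rule tensor_unique [OF v z' n k' k], rule initial_parametrized [OF z n v])
        (use k k' in \<open>auto simp: homset_iff\<close>)
  qed
qed

lemma initial_arrows_eq:
  assumes "is_initial M0 z" "f \<in> Arr M0" "g \<in> Arr M0" "Dom M0 f = z" "Dom M0 g = z" "Cod M0 f = Cod M0 g"
  shows "f = g"
proof -
  have "\<exists>!h. h \<in> homset M0 z (Cod M0 g)" using assms und.Cod_Obj by (auto simp: is_initial_def)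
  then show ?thesis by (rule ex1D) (use assms in \<open>simp_all add: homset_iff\<close>)
qed

lemma tensor_arr_props:
  assumes f: "f \<in> Arr V" and mm [simp]: "m \<in> VObj M" "m' \<in> VObj M" and g: "g \<in> hm I (hob m m')"
  obtains h where "tensor_arr V M f (m, m', g) = (to (Dom V f) m, to (Cod V f) m', h)"
    "h \<in> hm I (hob (to (Dom V f) m) (to (Cod V f) m'))"
    "lc (cmp m (to (Dom V f) m) (to (Cod V f) m')) h (tu (Dom V f) m) =
       rc (cmp m m' (to (Cod V f) m')) (tu (Cod V f) m' \<cdot> f) g"
proof -
  let ?v = "Dom V f" and ?v' = "Cod V f"
  let ?t = "to ?v m" and ?t' = "to ?v' m'"
  have [simp]: "g \<in> Arr V" "Dom V g = I" "Cod V g = hob m m'" using g by (auto simp: homset_iff)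
  let ?P = "\<lambda>h. h \<in> hm I (hob ?t ?t') \<and> lc (cmp m ?t ?t') h (tu ?v m) = rc (cmp m m' ?t') (tu ?v' m' \<cdot> f) g"
  have "\<exists>!h. ?P h" by (rule tensor_ex1) (use f in \<open>simp_all add: homset_iff\<close>)
  then have P: "?P (THE h. ?P h)" by (rule theI')
  have "tensor_arr V M f (m, m', g) = (?t, ?t', THE h. ?P h)"
    using f by (simp add: tensor_arr_def lc_def rc_def Let_def)
  then show thesis using that P by blast
qed

end

locale model_vcat = tensored V M for V :: "('o, 'a) smcat" and M :: "('m, 'o, 'a) vcat" +
  fixes N :: "'a model" and NM :: "('m \<times> 'm \<times> 'a) model"
  assumes model_V: "model_structure V N" and model_M: "model_structure (underlying V M) NM"
    and pushout_product: "quillen_bifunctor V N (underlying V M) NM (underlying V M) NM (tensor_arr V M)"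
begin

lemma Cof_Arr: "i \<in> Cof N \<Longrightarrow> i \<in> Arr V" "k \<in> Cof NM \<Longrightarrow> k \<in> Arr M0" "p \<in> Fib NM \<Longrightarrow> p \<in> Arr M0"
  using model_V model_M by (auto simp: model_structure_def wide_subcategory_def)

text \<open>Tensoring with a cofibrant object \<open>x\<close> preserves (trivial) cofibrations: this is the
  pushout-product axiom for \<open>\<emptyset> \<rightarrow> x\<close>, whose pushout corner is trivial as tensors of \<open>\<emptyset>\<close> are initial.\<close>

lemma tensor_cofibrant:
  assumes x: "cofibrant M0 NM x" and j: "j \<in> Cof N"
  shows "tensor_arr V M j (x, x, vid x) \<in> Cof NM"
    and "j \<in> Weq N \<Longrightarrow> tensor_arr V M j (x, x, vid x) \<in> Weq NM"
proof -
  let ?T = "tensor_arr V M"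
  let ?A = "Dom V j" and ?B = "Cod V j"
  have ja [simp]: "j \<in> Arr V" using Cof_Arr(1) [OF j] .
  obtain z f where z: "is_initial M0 z" and f: "f \<in> homset M0 z x" "f \<in> Cof NM"
    using x by (auto simp: cofibrant_def)
  have zx [simp]: "z \<in> VObj M" "x \<in> VObj M" using z x by (auto simp: initial_iff cofibrant_def underlying_simps)
  obtain g where fg: "f = (z, x, g)" and g: "g \<in> hm I (hob z x)"
    using f(1) by (cases f) (auto simp: homset_iff underlying_simps)
  have Df: "Dom M0 f = z" "Cod M0 f = x" by (simp_all add: fg underlying_simps)
  have vx: "vid x \<in> hm I (hob x x)" "vid z \<in> hm I (hob z z)" by (simp_all add: homset_iff)
  have Tt: "?T h (m, n, k) \<in> Arr M0" "Dom M0 (?T h (m, n, k)) = to (Dom V h) m" "Cod M0 (?T h (m, n, k)) = to (Cod V h) n"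
    if hk: "h \<in> Arr V" "m \<in> VObj M" "n \<in> VObj M" "k \<in> hm I (hob m n)" for h m n k
  proof -
    obtain l where "?T h (m, n, k) = (to (Dom V h) m, to (Cod V h) n, l)" "l \<in> hm I (hob (to (Dom V h) m) (to (Cod V h) n))"
      using tensor_arr_props [OF hk] by blast
    then show "?T h (m, n, k) \<in> Arr M0" "Dom M0 (?T h (m, n, k)) = to (Dom V h) m" "Cod M0 (?T h (m, n, k)) = to (Cod V h) n"
      using that by (auto simp: underlying_simps homset_iff)
  qed
  let ?u = "?T j (z, z, vid z)" and ?w = "?T (idn ?A) f" and ?k = "?T j (x, x, vid x)"
  have u: "?u \<in> Arr M0" "Dom M0 ?u = to ?A z" "Cod M0 ?u = to ?B z" using Tt [OF ja _ _ vx(2)] by simp_all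
  have w: "?w \<in> Arr M0" "Dom M0 ?w = to ?A z" "Cod M0 ?w = to ?A x" using Tt [of "idn ?A", OF _ _ _ g] by (simp_all add: fg)
  have k: "?k \<in> Arr M0" "Dom M0 ?k = to ?A x" "Cod M0 ?k = to ?B x" using Tt [OF ja _ _ vx(1)] by simp_all
  have jg: "Cod M0 (?T j f) = to ?B x" using Tt [OF ja _ _ g] by (simp add: fg)
  have w': "?T (idn ?B) f \<in> Arr M0" "Dom M0 (?T (idn ?B) f) = to ?B z" "Cod M0 (?T (idn ?B) f) = to ?B x"
    using Tt [of "idn ?B", OF _ _ _ g] by (simp_all add: fg)
  have iA: "is_initial M0 (to ?A z)" and iB: "is_initial M0 (to ?B z)" using initial_tensor [OF z] by simp_all
  have tA: "to ?A x \<in> Obj M0" by (simp add: underlying_simps)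
  obtain i where i: "i \<in> homset M0 (to ?B z) (to ?A x)" using iB tA unfolding is_initial_def by blast
  have is': "i \<in> Arr M0" "Dom M0 i = to ?B z" "Cod M0 i = to ?A x" using i by (auto simp: homset_iff)
  let ?j = "Idn M0 (to ?A x)"
  have js: "?j \<in> Arr M0" "Dom M0 ?j = to ?A x" "Cod M0 ?j = to ?A x" using tA und.Idn_Arr und.Dom_Idn und.Cod_Idn by auto
  have po: "is_pushout M0 ?u ?w i ?j"
    unfolding is_pushout_def
  proof (intro conjI ballI impI)
    show "Comp M0 i ?u = Comp M0 ?j ?w"
      by (rule initial_arrows_eq [OF iA]) (use u w is' js in simp_all)
    fix i' j' assume ij: "i' \<in> Arr M0" "j' \<in> Arr M0"
      "Dom M0 i' = Cod M0 ?u \<and> Dom M0 j' = Cod M0 ?w \<and> Cod M0 i' = Cod M0 j' \<and> Comp M0 i' ?u = Comp M0 j' ?w"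
    show "\<exists>!h. h \<in> homset M0 (Cod M0 i) (Cod M0 i') \<and> Comp M0 h i = i' \<and> Comp M0 h ?j = j'"
    proof (rule ex1I [of _ j'])
      have "Comp M0 j' i = i'" by (rule initial_arrows_eq [OF iB]) (use ij u w is' in simp_all)
      then show "j' \<in> homset M0 (Cod M0 i) (Cod M0 i') \<and> Comp M0 j' i = i' \<and> Comp M0 j' ?j = j'"
        using ij w is' by (simp add: homset_iff)
      fix h assume "h \<in> homset M0 (Cod M0 i) (Cod M0 i') \<and> Comp M0 h i = i' \<and> Comp M0 h ?j = j'"
      then show "h = j'" using is' by (auto simp: homset_iff)
    qed
  qed (use u w is' js in simp_all)
  have "Comp M0 ?k i = ?T (idn ?B) f"
    by (rule initial_arrows_eq [OF iB]) (use k is' w' in simp_all)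
  moreover have "Comp M0 ?k ?j = ?k" using k by simp
  moreover have "?k \<in> homset M0 (Cod M0 i) (Cod M0 (?T j f))" using k is' jg by (simp add: homset_iff)
  moreover have "Idn M0 (Dom M0 f) = (z, z, vid z)" "Idn M0 (Cod M0 f) = (x, x, vid x)"
    by (simp_all add: Df underlying_simps)
  ultimately have "?k \<in> Cof NM \<and> (j \<in> Weq N \<or> f \<in> Weq NM \<longrightarrow> ?k \<in> Weq NM)"
    using pushout_product j f(2) po unfolding quillen_bifunctor_def by metis
  then show "?k \<in> Cof NM" "j \<in> Weq N \<Longrightarrow> ?k \<in> Weq NM" by auto
qed

text \<open>So \<open>M(x, -)\<close> preserves (trivial) fibrations, by adjunction.\<close>

lemma lift_hom:
  assumes p: "p = (m, n, e)" "p \<in> Arr M0" and x [simp]: "x \<in> VObj M" and j: "j \<in> Arr V"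
    and lift: "has_lift M0 (tensor_arr V M j (x, x, vid x)) p"
  shows "has_lift V j (lc (cmp x m n) e (idn (hob x m)))"
proof -
  have mn [simp]: "m \<in> VObj M" "n \<in> VObj M" "e \<in> Arr V" "Dom V e = I" "Cod V e = hob m n"
    using p by (auto simp: underlying_simps)
  let ?A = "Dom V j" and ?B = "Cod V j"
  note [simp] = j
  have post: "lc (cmp x m n) e (idn (hob x m)) \<cdot> u = lc (cmp x m n) e u" if "u \<in> Arr V" "Cod V u = hob x m" for u
    using lc_comp [of "cmp x m n" e "idn (hob x m)" u] that by simp
  obtain h0 where T: "tensor_arr V M j (x, x, vid x) = (to ?A x, to ?B x, h0)" and h0: "h0 \<in> hm I (hob (to ?A x) (to ?B x))"
    "lc (cmp x (to ?A x) (to ?B x)) h0 (tu ?A x) = rc (cmp x x (to ?B x)) (tu ?B x \<cdot> j) (vid x)"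
    by (rule tensor_arr_props [OF j x x, of "vid x"]) (simp_all add: homset_iff)
  have h0s [simp]: "h0 \<in> Arr V" "Dom V h0 = I" "Cod V h0 = hob (to ?A x) (to ?B x)" using h0 by (auto simp: homset_iff)
  have h0' : "lc (cmp x (to ?A x) (to ?B x)) h0 (tu ?A x) = tu ?B x \<cdot> j" using h0(2) by simp
  show ?thesis
    unfolding has_lift_def
  proof (intro ballI impI)
    fix u v assume u: "u \<in> hm ?A (Dom V (lc (cmp x m n) e (idn (hob x m))))"
      and v: "v \<in> hm ?B (Cod V (lc (cmp x m n) e (idn (hob x m))))"
      and sq: "lc (cmp x m n) e (idn (hob x m)) \<cdot> u = v \<cdot> j"
    have us [simp]: "u \<in> Arr V" "Dom V u = ?A" "Cod V u = hob x m" and vs [simp]: "v \<in> Arr V" "Dom V v = ?B" "Cod V v = hob x n"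
      using u v by (auto simp: homset_iff)
    obtain u' where u': "u' \<in> hm I (hob (to ?A x) m)" "lc (cmp x (to ?A x) m) u' (tu ?A x) = u"
      using ex1_implies_ex [OF tensor_ex1 [of ?A x m u]] by (auto simp: homset_iff)
    obtain v' where v': "v' \<in> hm I (hob (to ?B x) n)" "lc (cmp x (to ?B x) n) v' (tu ?B x) = v"
      using ex1_implies_ex [OF tensor_ex1 [of ?B x n v]] by (auto simp: homset_iff)
    have u's [simp]: "u' \<in> Arr V" "Dom V u' = I" "Cod V u' = hob (to ?A x) m"
      and v's [simp]: "v' \<in> Arr V" "Dom V v' = I" "Cod V v' = hob (to ?B x) n" using u' v' by (auto simp: homset_iff)
    have sq': "lc (cmp (to ?A x) m n) e u' = lc (cmp (to ?A x) (to ?B x) n) v' h0"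
    proof (rule tensor_unique [of ?A x n])
      have "lc (cmp x (to ?A x) n) (lc (cmp (to ?A x) m n) e u') (tu ?A x) = lc (cmp x m n) e (lc (cmp x (to ?A x) m) u' (tu ?A x))"
        by (rule asq_ll [OF vcat_asq]) simp_all
      also have "\<dots> = v \<cdot> j" using sq post [of u] by (simp add: u'(2))
      also have "\<dots> = lc (cmp x (to ?B x) n) v' (tu ?B x \<cdot> j)"
        by (subst lc_comp) (simp_all add: v'(2))
      also have "\<dots> = lc (cmp x (to ?B x) n) v' (lc (cmp x (to ?A x) (to ?B x)) h0 (tu ?A x))" by (simp add: h0')
      also have "\<dots> = lc (cmp x (to ?A x) n) (lc (cmp (to ?A x) (to ?B x) n) v' h0) (tu ?A x)"
        by (rule asq_ll [OF vcat_asq, symmetric]) simp_all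
      finally show "lc (cmp x (to ?A x) n) (lc (cmp (to ?A x) m n) e u') (tu ?A x) =
          lc (cmp x (to ?A x) n) (lc (cmp (to ?A x) (to ?B x) n) v' h0) (tu ?A x)" .
    qed (simp_all add: homset_iff)
    obtain k where k: "k \<in> homset M0 (to ?B x) m" "Comp M0 k (to ?A x, to ?B x, h0) = (to ?A x, m, u')" "Comp M0 p k = (to ?B x, n, v')"
      by (rule has_liftD [OF lift [unfolded T], of "(to ?A x, m, u')" "(to ?B x, n, v')"])
        (use sq' in \<open>simp_all add: homset_iff underlying_simps p\<close>)
    obtain h where h: "k = (to ?B x, m, h)" "h \<in> hm I (hob (to ?B x) m)"
      using k(1) by (cases k) (auto simp: homset_iff underlying_simps)
    have hs [simp]: "h \<in> Arr V" "Dom V h = I" "Cod V h = hob (to ?B x) m" using h(2) by (auto simp: homset_iff)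
    have h1: "lc (cmp (to ?A x) (to ?B x) m) h h0 = u'" and h2: "lc (cmp (to ?B x) m n) e h = v'"
      using k(2,3) by (simp_all add: h p underlying_simps)
    let ?l = "lc (cmp x (to ?B x) m) h (tu ?B x)"
    show "\<exists>l\<in>hm ?B (Dom V (lc (cmp x m n) e (idn (hob x m)))). l \<cdot> j = u \<and> lc (cmp x m n) e (idn (hob x m)) \<cdot> l = v"
    proof (rule bexI [of _ ?l], rule conjI)
      have "?l \<cdot> j = lc (cmp x (to ?B x) m) h (tu ?B x \<cdot> j)" by (subst lc_comp) simp_all
      also have "\<dots> = lc (cmp x (to ?B x) m) h (lc (cmp x (to ?A x) (to ?B x)) h0 (tu ?A x))" by (simp add: h0')
      also have "\<dots> = lc (cmp x (to ?A x) m) (lc (cmp (to ?A x) (to ?B x) m) h h0) (tu ?A x)"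
        by (rule asq_ll [OF vcat_asq, symmetric]) simp_all
      finally show "?l \<cdot> j = u" by (simp add: h1 u'(2))
      have "lc (cmp x m n) e ?l = lc (cmp x (to ?B x) n) (lc (cmp (to ?B x) m n) e h) (tu ?B x)"
        by (rule asq_ll [OF vcat_asq, symmetric]) simp_all
      then show "lc (cmp x m n) e (idn (hob x m)) \<cdot> ?l = v" by (simp add: post h2 v'(2))
    qed (simp add: homset_iff)
  qed
qed

lemma hom_cofibrant:
  assumes x: "cofibrant M0 NM x" and p: "(m, n, e) \<in> Fib NM"
  shows "lc (cmp x m n) e (idn (hob x m)) \<in> Fib N"
    and "(m, n, e) \<in> Weq NM \<Longrightarrow> lc (cmp x m n) e (idn (hob x m)) \<in> Fib N \<inter> Weq N"
proof -
  have pa: "(m, n, e) \<in> Arr M0" using Cof_Arr(3) [OF p] .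
  have x' [simp]: "x \<in> VObj M" using x by (simp add: cofibrant_def underlying_simps)
  have arr: "lc (cmp x m n) e (idn (hob x m)) \<in> Arr V" using pa by (simp add: underlying_simps)
  show "lc (cmp x m n) e (idn (hob x m)) \<in> Fib N"
  proof (rule Fib_if_lift [OF model_V arr])
    fix i assume i: "i \<in> Cof N \<inter> Weq N"
    then have "has_lift M0 (tensor_arr V M i (x, x, vid x)) (m, n, e)"
      using tensor_cofibrant [OF x, of i] p model_M by (auto simp: model_structure_def)
    then show "has_lift V i (lc (cmp x m n) e (idn (hob x m)))"
      using i Cof_Arr(1) by (intro lift_hom [OF refl pa x']) auto
  qed
  assume w: "(m, n, e) \<in> Weq NM"
  show "lc (cmp x m n) e (idn (hob x m)) \<in> Fib N \<inter> Weq N"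
  proof (rule trivial_Fib_if_lift [OF model_V arr])
    fix i assume i: "i \<in> Cof N"
    then have "has_lift M0 (tensor_arr V M i (x, x, vid x)) (m, n, e)"
      using tensor_cofibrant(1) [OF x, of i] p w model_M by (auto simp: model_structure_def)
    then show "has_lift V i (lc (cmp x m n) e (idn (hob x m)))"
      using i Cof_Arr(1) by (intro lift_hom [OF refl pa x']) auto
  qed
qed

end

section \<open>Left Quillen functors on presheaves\<close>

context psh
begin

lemma underlying_U_simps:
  "Obj (underlying V U) = Psh"
  "(F, G, f) \<in> Arr (underlying V U) \<longleftrightarrow> F \<in> Psh \<and> G \<in> Psh \<and> f \<in> Arr V \<and> Dom V f = I \<and> Cod V f = ph F G"
  "Dom (underlying V U) (F, G, f) = F" "Cod (underlying V U) (F, G, f) = G"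
  "Dom V f = I \<Longrightarrow> Comp (underlying V U) (G', H, g) (F, G, f) = (F, H, lc (ucmp F G H) g f)"
  by (auto simp: underlying_def homset_iff elem_comp_def lc_def)

end

locale quillen_lan = lan V C M D Lo la + model_vcat V M N NM
  for V :: "('o, 'a) smcat" and C :: "('c, 'd) cat" and M :: "('m, 'o, 'a) vcat"
    and D Lo la N NM +
  assumes D_cofibrant: "\<And>c. c \<in> Obj C \<Longrightarrow> cofibrant (underlying V M) NM (Fobj D c)"
begin

abbreviation "PN \<equiv> projective_model V N C"
abbreviation "U0 \<equiv> underlying V U"

text \<open>Fibrations and weak equivalences of presheaves are objectwise, and the component at \<open>c\<close> is the image
  under \<open>M(D c, -)\<close>, for which \<open>D c\<close> is cofibrant.\<close>

lemma R_fibration: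
  assumes p: "(m, n, e) \<in> Fib NM"
  shows "(Rob m, Rob n, Rar m n \<cdot> e) \<in> Fib PN"
    and "(m, n, e) \<in> Weq NM \<Longrightarrow> (Rob m, Rob n, Rar m n \<cdot> e) \<in> Weq PN"
proof -
  have [simp]: "m \<in> VObj M" "n \<in> VObj M" "e \<in> Arr V" "Dom V e = I" "Cod V e = hob m n"
    using Cof_Arr(3) [OF p] by (auto simp: underlying_simps)
  have c: "component V C (Rob m, Rob n, Rar m n \<cdot> e) c = lc (cmp (Do c) m n) e (idn (hob (Do c) m))" if "c \<in> Obj C" for c
    using that by (simp add: component_eq homset_iff lc_Rar)
  have a: "(Rob m, Rob n, Rar m n \<cdot> e) \<in> Arr U0" by (simp add: underlying_U_simps)
  show "(Rob m, Rob n, Rar m n \<cdot> e) \<in> Fib PN"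
    using a c hom_cofibrant(1) [OF D_cofibrant p] by (simp add: projective_model_def Let_def)
  show "(m, n, e) \<in> Weq NM \<Longrightarrow> (Rob m, Rob n, Rar m n \<cdot> e) \<in> Weq PN"
    using a c hom_cofibrant(2) [OF D_cofibrant p] by (simp add: projective_model_def Let_def)
qed

text \<open>The usual transposition of lifting problems: maps out of \<open>L F\<close> correspond to maps out of \<open>F\<close>, through
  the coprojections.\<close>

lemma L_lift:
  assumes i: "(F, G, f) \<in> Arr U0" and p: "(m, n, e) \<in> Arr M0"
    and lift: "has_lift U0 (F, G, f) (Rob m, Rob n, Rar m n \<cdot> e)"
  shows "has_lift M0 (Lo F, Lo G, Lar F G \<cdot> f) (m, n, e)"
  unfolding has_lift_def
proof (intro ballI impI)
  have [simp]: "m \<in> VObj M" "n \<in> VObj M" "e \<in> Arr V" "Dom V e = I" "Cod V e = hob m n"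
    using p by (auto simp: underlying_simps)
  have [simp]: "F \<in> Psh" "G \<in> Psh" "f \<in> Arr V" "Dom V f = I" "Cod V f = ph F G"
    using i by (auto simp: underlying_U_simps)
  fix u' v' assume "u' \<in> homset M0 (Dom M0 (Lo F, Lo G, Lar F G \<cdot> f)) (Dom M0 (m, n, e))"
    and "v' \<in> homset M0 (Cod M0 (Lo F, Lo G, Lar F G \<cdot> f)) (Cod M0 (m, n, e))"
    and sq: "Comp M0 (m, n, e) u' = Comp M0 v' (Lo F, Lo G, Lar F G \<cdot> f)"
  then obtain u v where u': "u' = (Lo F, m, u)" and v': "v' = (Lo G, n, v)"
    and [simp]: "u \<in> Arr V" "Dom V u = I" "Cod V u = hob (Lo F) m" "v \<in> Arr V" "Dom V v = I" "Cod V v = hob (Lo G) n"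
    by (cases u', cases v') (auto simp: homset_iff underlying_simps)
  have sq: "lc (cmp (Lo F) m n) e u = lc (cmp (Lo F) (Lo G) n) v (Lar F G \<cdot> f)"
    using sq by (simp add: u' v' underlying_simps)
  let ?tr = "\<lambda>H l x. lc (ucmp H (Rob (Lo H)) (Rob l)) (Rar (Lo H) l \<cdot> x) (eta H)"
  have tr: "lc (act H (Rob l) c) (?tr H l x) y = lc (cmp (Do c) (Lo H) l) x (la H c \<cdot> y)"
    if [simp]: "H \<in> Psh" "l \<in> VObj M" "x \<in> Arr V" "Dom V x = I" "Cod V x = hob (Lo H) l" "c \<in> Obj C" "y \<in> Arr V" "Cod V y = Fobj H c"
    for H l x c y
  proof -
    have "lc (act H (Rob l) c) (?tr H l x) y = lc (act (Rob (Lo H)) (Rob l) c) (Rar (Lo H) l \<cdot> x) (lc (act H (Rob (Lo H)) c) (eta H) y)"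
      by (rule asq_ll [OF VComp_UV(4)]) simp_all
    then show ?thesis by (simp add: eta_props(4) lc_Rar)
  qed
  have sq': "lc (ucmp F (Rob m) (Rob n)) (Rar m n \<cdot> e) (?tr F m u) = lc (ucmp F G (Rob n)) (?tr G n v) f"
  proof (rule ph_elem_unique [of F "Rob n"])
    fix c assume [simp]: "c \<in> Obj C"
    let ?i = "idn (Fobj F c)"
    have "lc (act F (Rob n) c) (lc (ucmp F (Rob m) (Rob n)) (Rar m n \<cdot> e) (?tr F m u)) ?i =
        lc (act (Rob m) (Rob n) c) (Rar m n \<cdot> e) (lc (act F (Rob m) c) (?tr F m u) ?i)"
      by (rule asq_ll [OF VComp_UV(4)]) simp_all
    also have "\<dots> = lc (cmp (Do c) m n) e (lc (cmp (Do c) (Lo F) m) u (la F c))"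
      by (simp add: tr lc_Rar)
    also have "\<dots> = lc (cmp (Do c) (Lo F) n) (lc (cmp (Lo F) m n) e u) (la F c)"
      by (rule asq_ll [OF vcat_asq, symmetric]) simp_all
    also have "\<dots> = lc (cmp (Do c) (Lo G) n) v (lc (cmp (Do c) (Lo F) (Lo G)) (Lar F G \<cdot> f) (la F c \<cdot> ?i))"
      unfolding sq by (subst asq_ll [OF vcat_asq]) simp_all
    also have "\<dots> = lc (act G (Rob n) c) (?tr G n v) (lc (act F G c) f ?i)"
      by (subst lc_Lar) (simp_all add: tr)
    also have "\<dots> = lc (act F (Rob n) c) (lc (ucmp F G (Rob n)) (?tr G n v) f) ?i"
      by (rule asq_ll [OF VComp_UV(4), symmetric]) simp_all
    finally show "lc (act F (Rob n) c) (lc (ucmp F (Rob m) (Rob n)) (Rar m n \<cdot> e) (?tr F m u)) ?i =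
      lc (act F (Rob n) c) (lc (ucmp F G (Rob n)) (?tr G n v) f) ?i" .
  qed (simp_all add: homset_iff)
  obtain k where k: "k \<in> homset U0 G (Rob m)" "Comp U0 k (F, G, f) = (F, Rob m, ?tr F m u)" "Comp U0 (Rob m, Rob n, Rar m n \<cdot> e) k = (G, Rob n, ?tr G n v)"
    by (rule has_liftD [OF lift, of "(F, Rob m, ?tr F m u)" "(G, Rob n, ?tr G n v)"])
      (use sq' in \<open>simp_all add: homset_iff underlying_U_simps\<close>)
  obtain h where kh: "k = (G, Rob m, h)" and [simp]: "h \<in> Arr V" "Dom V h = I" "Cod V h = ph G (Rob m)"
    using k(1) by (cases k) (auto simp: homset_iff underlying_U_simps)
  have h1: "lc (ucmp F G (Rob m)) h f = ?tr F m u" and h2: "lc (ucmp G (Rob m) (Rob n)) (Rar m n \<cdot> e) h = ?tr G n v"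
    using k(2,3) by (simp_all add: kh underlying_U_simps)
  let ?l = "lc (cmp (Lo G) (Lo (Rob m)) m) (eps m) (Lar G (Rob m) \<cdot> h)"
  have un: "lc (cmp (Do c) (Lo G) m) ?l (la G c \<cdot> y) = lc (act G (Rob m) c) h y"
    if [simp]: "c \<in> Obj C" "y \<in> Arr V" "Cod V y = Fobj G c" for c y
  proof -
    have "lc (cmp (Do c) (Lo G) m) ?l (la G c \<cdot> y) = lc (cmp (Do c) (Lo (Rob m)) m) (eps m) (lc (cmp (Do c) (Lo G) (Lo (Rob m))) (Lar G (Rob m) \<cdot> h) (la G c \<cdot> y))"
      by (rule asq_ll [OF vcat_asq]) simp_all
    then show ?thesis by (simp add: lc_Lar eps_props(4))
  qed
  have l1: "lc (cmp (Lo F) (Lo G) m) ?l (Lar F G \<cdot> f) = u"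
  proof (rule le_unique [of F m])
    fix c assume [simp]: "c \<in> Obj C"
    let ?i = "idn (Fobj F c)"
    have "lc (cmp (Do c) (Lo F) m) (lc (cmp (Lo F) (Lo G) m) ?l (Lar F G \<cdot> f)) (la F c) =
       lc (cmp (Do c) (Lo G) m) ?l (lc (cmp (Do c) (Lo F) (Lo G)) (Lar F G \<cdot> f) (la F c \<cdot> ?i))"
      by (subst asq_ll [OF vcat_asq]) simp_all
    also have "\<dots> = lc (act G (Rob m) c) h (lc (act F G c) f ?i)"
      by (subst lc_Lar) (simp_all add: un)
    also have "\<dots> = lc (act F (Rob m) c) (lc (ucmp F G (Rob m)) h f) ?i"
      by (rule asq_ll [OF VComp_UV(4), symmetric]) simp_all
    also have "\<dots> = lc (cmp (Do c) (Lo F) m) u (la F c)" by (simp add: h1 tr)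
    finally show "lc (cmp (Do c) (Lo F) m) (lc (cmp (Lo F) (Lo G) m) ?l (Lar F G \<cdot> f)) (la F c) = lc (cmp (Do c) (Lo F) m) u (la F c)" .
  qed (simp_all add: homset_iff)
  have l2: "lc (cmp (Lo G) m n) e ?l = v"
  proof (rule le_unique [of G n])
    fix c assume [simp]: "c \<in> Obj C"
    let ?i = "idn (Fobj G c)"
    have "lc (cmp (Do c) (Lo G) n) (lc (cmp (Lo G) m n) e ?l) (la G c) = lc (cmp (Do c) m n) e (lc (cmp (Do c) (Lo G) m) ?l (la G c \<cdot> ?i))"
      by (subst asq_ll [OF vcat_asq]) simp_all
    also have "\<dots> = lc (act (Rob m) (Rob n) c) (Rar m n \<cdot> e) (lc (act G (Rob m) c) h ?i)"
      by (subst un) (simp_all add: lc_Rar)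
    also have "\<dots> = lc (act G (Rob n) c) (lc (ucmp G (Rob m) (Rob n)) (Rar m n \<cdot> e) h) ?i"
      by (rule asq_ll [OF VComp_UV(4), symmetric]) simp_all
    also have "\<dots> = lc (cmp (Do c) (Lo G) n) v (la G c)" by (simp add: h2 tr)
    finally show "lc (cmp (Do c) (Lo G) n) (lc (cmp (Lo G) m n) e ?l) (la G c) = lc (cmp (Do c) (Lo G) n) v (la G c)" .
  qed (simp_all add: homset_iff)
  show "\<exists>h\<in>homset M0 (Cod M0 (Lo F, Lo G, Lar F G \<cdot> f)) (Dom M0 (m, n, e)).
      Comp M0 h (Lo F, Lo G, Lar F G \<cdot> f) = u' \<and> Comp M0 (m, n, e) h = v'"
    by (rule bexI [of _ "(Lo G, m, ?l)"]) (simp_all add: underlying_simps homset_iff l1 l2 u' v')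
qed

lemma Lfun_left_quillen: "left_quillen_vfunctor V U PN M NM Lfun"
  unfolding left_quillen_vfunctor_def
proof (intro exI conjI, rule adjunction)
  show "quillen_adjunction U0 PN M0 NM (underlying_functor V U Lfun) (underlying_functor V M Rfun)"
    unfolding quillen_adjunction_def
  proof (intro conjI ballI)
    fix i assume i: "i \<in> Cof PN"
    then have ia: "i \<in> Arr U0" and lift: "\<And>p. p \<in> Fib PN \<Longrightarrow> p \<in> Weq PN \<Longrightarrow> has_lift U0 i p"
      by (auto simp: projective_model_def Let_def)
    obtain F G f where iF: "i = (F, G, f)" by (cases i)
    have Li: "Farr (underlying_functor V U Lfun) i = (Lo F, Lo G, Lar F G \<cdot> f)"
      using ia by (simp add: underlying_functor_def iF underlying_U_simps)
    show "Farr (underlying_functor V U Lfun) i \<in> Cof NM"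
      unfolding Li
    proof (rule und.Cof_if_lift [OF model_M])
      show "(Lo F, Lo G, Lar F G \<cdot> f) \<in> Arr M0" using ia by (simp add: iF underlying_simps underlying_U_simps)
      fix p assume p: "p \<in> Fib NM \<inter> Weq NM"
      obtain m n e where pm: "p = (m, n, e)" by (cases p)
      show "has_lift M0 (Lo F, Lo G, Lar F G \<cdot> f) p"
        unfolding pm by (rule L_lift) (use ia p Cof_Arr(3) R_fibration lift in \<open>auto simp: iF pm\<close>)
    qed
  next
    fix p assume p: "p \<in> Fib NM"
    obtain m n e where pm: "p = (m, n, e)" by (cases p)
    have "p \<in> Arr M0" using p by (rule Cof_Arr(3))
    then have "Farr (underlying_functor V M Rfun) p = (Rob m, Rob n, Rar m n \<cdot> e)"
      by (simp add: underlying_functor_def pm underlying_simps)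
    then show "Farr (underlying_functor V M Rfun) p \<in> Fib PN" using R_fibration(1) p by (simp add: pm)
  qed
qed

end

section \<open>Existence of weighted colimits\<close>

context smc
begin

subsection \<open>Jointly epimorphic families\<close>

text \<open>Families through which equations may be tested. Unlike copowers they may have varying domains, so
  that they are closed under tensor products.\<close>

definition jepi :: "'s set \<Rightarrow> ('s \<Rightarrow> 'a) \<Rightarrow> 'o \<Rightarrow> bool" where
  "jepi S \<iota> x \<longleftrightarrow> x \<in> Obj V \<and> (\<forall>s\<in>S. \<iota> s \<in> Arr V \<and> Cod V (\<iota> s) = x) \<and>
     (\<forall>h\<in>Arr V. \<forall>h'\<in>Arr V. Dom V h = x \<longrightarrow> Dom V h' = x \<longrightarrow> Cod V h = Cod V h' \<longrightarrow>
        (\<forall>s\<in>S. h \<cdot> \<iota> s = h' \<cdot> \<iota> s) \<longrightarrow> h = h')"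

lemma jepiD:
  assumes "jepi S \<iota> x" "h \<in> Arr V" "h' \<in> Arr V" "Dom V h = x" "Dom V h' = x" "Cod V h = Cod V h'"
    "\<And>s. s \<in> S \<Longrightarrow> h \<cdot> \<iota> s = h' \<cdot> \<iota> s"
  shows "h = h'"
  using assms unfolding jepi_def by blast

lemma jepi_typing:
  "jepi S \<iota> x \<Longrightarrow> x \<in> Obj V" "jepi S \<iota> x \<Longrightarrow> s \<in> S \<Longrightarrow> \<iota> s \<in> Arr V" "jepi S \<iota> x \<Longrightarrow> s \<in> S \<Longrightarrow> Cod V (\<iota> s) = x"
  unfolding jepi_def by blast+

lemma jepiI:
  assumes "x \<in> Obj V" "\<And>s. s \<in> S \<Longrightarrow> \<iota> s \<in> Arr V" "\<And>s. s \<in> S \<Longrightarrow> Cod V (\<iota> s) = x"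
    and "\<And>h h'. h \<in> Arr V \<Longrightarrow> h' \<in> Arr V \<Longrightarrow> Dom V h = x \<Longrightarrow> Dom V h' = x \<Longrightarrow> Cod V h = Cod V h' \<Longrightarrow>
       (\<And>s. s \<in> S \<Longrightarrow> h \<cdot> \<iota> s = h' \<cdot> \<iota> s) \<Longrightarrow> h = h'"
  shows "jepi S \<iota> x"
  unfolding jepi_def using assms by blast

lemma jepi_copower: "is_copower V S a x \<iota> \<Longrightarrow> jepi S \<iota> x"
  by (rule jepiI, auto simp: is_copower_def homset_iff) (rule copower_unique, auto simp: is_copower_def homset_iff)

text \<open>The tensor product with an object, being a left adjoint, preserves these families.\<close>

lemma jepi_right:
  assumes j: "jepi S \<iota> x" and Z [simp]: "Z \<in> Obj V"
  shows "jepi S (\<lambda>s. \<iota> s \<boxtimes> idn Z) (x \<boxdot> Z)"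
proof (rule jepiI)
  note [simp] = jepi_typing [OF j]
  show "x \<boxdot> Z \<in> Obj V" by simp
  show "\<iota> s \<boxtimes> idn Z \<in> Arr V" "Cod V (\<iota> s \<boxtimes> idn Z) = x \<boxdot> Z" if "s \<in> S" for s using that by simp_all
  fix h h' assume h [simp]: "h \<in> Arr V" "h' \<in> Arr V" "Dom V h = x \<boxdot> Z" "Dom V h' = x \<boxdot> Z" "Cod V h = Cod V h'"
    and eq: "\<And>s. s \<in> S \<Longrightarrow> h \<cdot> (\<iota> s \<boxtimes> idn Z) = h' \<cdot> (\<iota> s \<boxtimes> idn Z)"
  let ?c = "\<lambda>h. curry_arr V x Z (Cod V h') h"
  note [simp] = curry_simps [of x Z "Cod V h'" h] curry_simps [of x Z "Cod V h'" h']
  have "?c h = ?c h'"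
  proof (rule jepiD [OF j])
    fix s assume s [simp]: "s \<in> S"
    show "?c h \<cdot> \<iota> s = ?c h' \<cdot> \<iota> s"
    proof (rule curry_unique [of _ _ Z "Cod V h'"])
      have "ev Z (Cod V h') \<cdot> ((?c h \<cdot> \<iota> s) \<boxtimes> idn Z) = h \<cdot> (\<iota> s \<boxtimes> idn Z)" by (rule eval_curry) simp_all
      also have "\<dots> = h' \<cdot> (\<iota> s \<boxtimes> idn Z)" by (rule eq) simp
      also have "\<dots> = ev Z (Cod V h') \<cdot> ((?c h' \<cdot> \<iota> s) \<boxtimes> idn Z)" by (rule eval_curry [symmetric]) simp_all
      finally show "ev Z (Cod V h') \<cdot> ((?c h \<cdot> \<iota> s) \<boxtimes> idn Z) = ev Z (Cod V h') \<cdot> ((?c h' \<cdot> \<iota> s) \<boxtimes> idn Z)" .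
    qed simp_all
  qed simp_all
  then have "ev Z (Cod V h') \<cdot> (?c h \<boxtimes> idn Z) = ev Z (Cod V h') \<cdot> (?c h' \<boxtimes> idn Z)" by (rule arg_cong)
  then show "h = h'" by simp
qed

lemma jepi_left:
  assumes j: "jepi S \<iota> x" and Z [simp]: "Z \<in> Obj V"
  shows "jepi S (\<lambda>s. idn Z \<boxtimes> \<iota> s) (Z \<boxdot> x)"
proof (rule jepiI)
  note [simp] = jepi_typing [OF j]
  show "Z \<boxdot> x \<in> Obj V" by simp
  show "idn Z \<boxtimes> \<iota> s \<in> Arr V" "Cod V (idn Z \<boxtimes> \<iota> s) = Z \<boxdot> x" if "s \<in> S" for s using that by simp_all
  fix h h' assume h [simp]: "h \<in> Arr V" "h' \<in> Arr V" "Dom V h = Z \<boxdot> x" "Dom V h' = Z \<boxdot> x" "Cod V h = Cod V h'"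
    and eq: "\<And>s. s \<in> S \<Longrightarrow> h \<cdot> (idn Z \<boxtimes> \<iota> s) = h' \<cdot> (idn Z \<boxtimes> \<iota> s)"
  have "h \<cdot> sy x Z = h' \<cdot> sy x Z"
  proof (rule jepiD [OF jepi_right [OF j Z]])
    fix s assume s [simp]: "s \<in> S"
    have nat: "sy x Z \<cdot> (\<iota> s \<boxtimes> idn Z) = (idn Z \<boxtimes> \<iota> s) \<cdot> sy (Dom V (\<iota> s)) Z"
      using sym_natural [of "\<iota> s" "idn Z"] by simp
    have "(k \<cdot> sy x Z) \<cdot> (\<iota> s \<boxtimes> idn Z) = (k \<cdot> (idn Z \<boxtimes> \<iota> s)) \<cdot> sy (Dom V (\<iota> s)) Z"
      if "k \<in> Arr V" "Dom V k = Z \<boxdot> x" for k using that by (simp add: Comp_assoc nat)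
    then show "(h \<cdot> sy x Z) \<cdot> (\<iota> s \<boxtimes> idn Z) = (h' \<cdot> sy x Z) \<cdot> (\<iota> s \<boxtimes> idn Z)" by (simp add: eq)
  qed simp_all
  then show "h = h'" by (rule iso_cancel_right [OF sym_iso [of x Z], rotated -1]) simp_all
qed

lemma jepi_tensor:
  assumes j: "jepi S \<iota> x" and k: "jepi T \<kappa> y"
  shows "jepi (S \<times> T) (\<lambda>(s, t). \<iota> s \<boxtimes> \<kappa> t) (x \<boxdot> y)"
proof (rule jepiI)
  note [simp] = jepi_typing [OF j] jepi_typing [OF k]
  show "x \<boxdot> y \<in> Obj V" by simp
  show "(\<lambda>(s, t). \<iota> s \<boxtimes> \<kappa> t) st \<in> Arr V" "Cod V ((\<lambda>(s, t). \<iota> s \<boxtimes> \<kappa> t) st) = x \<boxdot> y" if "st \<in> S \<times> T" for st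
    using that by auto
  fix h h' assume [simp]: "h \<in> Arr V" "h' \<in> Arr V" "Dom V h = x \<boxdot> y" "Dom V h' = x \<boxdot> y" "Cod V h = Cod V h'"
    and eq: "\<And>st. st \<in> S \<times> T \<Longrightarrow> h \<cdot> (\<lambda>(s, t). \<iota> s \<boxtimes> \<kappa> t) st = h' \<cdot> (\<lambda>(s, t). \<iota> s \<boxtimes> \<kappa> t) st"
  show "h = h'"
  proof (rule jepiD [OF jepi_right [OF j, of y]])
    fix s assume s [simp]: "s \<in> S"
    show "h \<cdot> (\<iota> s \<boxtimes> idn y) = h' \<cdot> (\<iota> s \<boxtimes> idn y)"
    proof (rule jepiD [OF jepi_left [OF k, of "Dom V (\<iota> s)"]])
      fix t assume t [simp]: "t \<in> T"
      show "(h \<cdot> (\<iota> s \<boxtimes> idn y)) \<cdot> (idn (Dom V (\<iota> s)) \<boxtimes> \<kappa> t) = (h' \<cdot> (\<iota> s \<boxtimes> idn y)) \<cdot> (idn (Dom V (\<iota> s)) \<boxtimes> \<kappa> t)"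
        using eq [of "(s, t)"] by (simp add: Comp_assoc merge)
    qed simp_all
  qed simp_all
qed

text \<open>Composition in \<open>V\<close>, evaluated.\<close>

lemma vself_comp:
  assumes [simp]: "x \<in> Obj V" "y \<in> Obj V" "z \<in> Obj V" "p \<in> Arr V" "Cod V p = ihom y z" "q \<in> Arr V" "Cod V q = ihom x y"
  shows "VComp (vself V) x y z \<cdot> (p \<boxtimes> q) \<in> Arr V" "Dom V (VComp (vself V) x y z \<cdot> (p \<boxtimes> q)) = Dom V p \<boxdot> Dom V q"
    "Cod V (VComp (vself V) x y z \<cdot> (p \<boxtimes> q)) = ihom x z"
    "ev x z \<cdot> ((VComp (vself V) x y z \<cdot> (p \<boxtimes> q)) \<boxtimes> idn x) =
     ev y z \<cdot> (p \<boxtimes> (ev x y \<cdot> (q \<boxtimes> idn x))) \<cdot> ass (Dom V p) (Dom V q) x"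
proof -
  let ?pq = "VComp (vself V) x y z \<cdot> (p \<boxtimes> q)"
  note [simp] = curry_simps
  let ?m = "ev y z \<cdot> (idn (ihom y z) \<boxtimes> ev x y) \<cdot> ass (ihom y z) (ihom x y) x"
  show "VComp (vself V) x y z \<cdot> (p \<boxtimes> q) \<in> Arr V" "Dom V ?pq = Dom V p \<boxdot> Dom V q"
    "Cod V ?pq = ihom x z"
    by (simp_all add: vself_def)
  have "ev x z \<cdot> (?pq \<boxtimes> idn x) = ?m \<cdot> ((p \<boxtimes> q) \<boxtimes> idn x)"
    unfolding vself_def by simp (rule eval_curry; simp)
  also have "\<dots> = ev y z \<cdot> (idn (ihom y z) \<boxtimes> ev x y) \<cdot> (ass (ihom y z) (ihom x y) x \<cdot> ((p \<boxtimes> q) \<boxtimes> idn x))"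
    by (simp add: Comp_assoc)
  also have "ass (ihom y z) (ihom x y) x \<cdot> ((p \<boxtimes> q) \<boxtimes> idn x) = (p \<boxtimes> (q \<boxtimes> idn x)) \<cdot> ass (Dom V p) (Dom V q) x"
    using ass_natural [of p q "idn x"] by simp
  finally show "ev x z \<cdot> (?pq \<boxtimes> idn x) =
     ev y z \<cdot> (p \<boxtimes> (ev x y \<cdot> (q \<boxtimes> idn x))) \<cdot> ass (Dom V p) (Dom V q) x"
    by (simp add: merge')
qed

end

subsection \<open>The free enriched category\<close>

context psh
begin

text \<open>The action of \<open>C\<close> on a presheaf, as an arrow \<open>y c (d) \<otimes> F c \<rightarrow> F d\<close>. For \<open>F = y b\<close> it is the composition of
  the free \<open>V\<close>-category on \<open>C\<close>.\<close>

definition rho :: "('c, 'd, 'o, 'a) presheaf \<Rightarrow> 'c \<Rightarrow> 'c \<Rightarrow> 'a" where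
  "rho F c d = bc (act (yob c) F d) (th F c) (idn (Fobj (yob c) d)) \<cdot> sy (Fobj (yob c) d) (Fobj F c)"

lemma rho_simps [simp]:
  assumes "F \<in> Psh" "c \<in> Obj C" "d \<in> Obj C"
  shows "rho F c d \<in> Arr V" "Dom V (rho F c d) = Fobj (yob c) d \<boxdot> Fobj F c" "Cod V (rho F c d) = Fobj F d"
  using assms by (simp_all add: rho_def)

lemma rho_inc:
  assumes F [simp]: "F \<in> Psh" and u: "u \<in> homset C d c" and x [simp]: "x \<in> Arr V" "Cod V x = Fobj F c"
  shows "rho F c d \<cdot> (inc c d u \<boxtimes> x) = Farr F u \<cdot> x \<cdot> lun (Dom V x)"
proof -
  note [simp] = C.homD [OF u]
  note [simp] = inc_hom [OF u]
  have "rho F c d \<cdot> (inc c d u \<boxtimes> idn (Fobj F c)) =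
      bc (act (yob c) F d) (th F c) (idn (Fobj (yob c) d)) \<cdot> sy (Fobj (yob c) d) (Fobj F c) \<cdot> (inc c d u \<boxtimes> idn (Fobj F c))"
    by (simp add: rho_def Comp_assoc)
  also have "sy (Fobj (yob c) d) (Fobj F c) \<cdot> (inc c d u \<boxtimes> idn (Fobj F c)) = (idn (Fobj F c) \<boxtimes> inc c d u) \<cdot> sy I (Fobj F c)"
    using sym_natural [of "inc c d u" "idn (Fobj F c)"] by simp
  also have "bc (act (yob c) F d) (th F c) (idn (Fobj (yob c) d)) \<cdot> \<dots> =
      (bc (act (yob c) F d) (th F c) (idn (Fobj (yob c) d) \<cdot> inc c d u)) \<cdot> sy I (Fobj F c)"
    by (subst bc_precomp_right) (simp_all add: Comp_assoc)
  also have "bc (act (yob c) F d) (th F c) (idn (Fobj (yob c) d) \<cdot> inc c d u) = rc (act (yob c) F d) (th F c) (inc c d u) \<cdot> run (Fobj F c)"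
    by (simp add: rc_bc Comp_assoc)
  also have "(rc (act (yob c) F d) (th F c) (inc c d u) \<cdot> run (Fobj F c)) \<cdot> sy I (Fobj F c) = Farr F u \<cdot> lun (Fobj F c)"
    by (simp add: th_props(4) [OF _ _ u] Comp_assoc run_sym)
  finally have 1: "rho F c d \<cdot> (inc c d u \<boxtimes> idn (Fobj F c)) = Farr F u \<cdot> lun (Fobj F c)" .
  have "rho F c d \<cdot> (inc c d u \<boxtimes> x) = (rho F c d \<cdot> (inc c d u \<boxtimes> idn (Fobj F c))) \<cdot> (idn I \<boxtimes> x)"
    by (simp add: Comp_assoc merge)
  also have "\<dots> = Farr F u \<cdot> lun (Fobj F c) \<cdot> (idn I \<boxtimes> x)" unfolding 1 by (simp add: Comp_assoc)
  also have "lun (Fobj F c) \<cdot> (idn I \<boxtimes> x) = x \<cdot> lun (Dom V x)" using lun_natural [of x] by simp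
  finally show ?thesis .
qed

lemma rho_uni:
  assumes [simp]: "F \<in> Psh" "c \<in> Obj C"
  shows "rho F c c \<cdot> (uni c \<boxtimes> idn (Fobj F c)) = lun (Fobj F c)"
  using rho_inc [of F "Idn C c" c c "idn (Fobj F c)"] by (simp add: homset_iff uni_def)

lemma rho_yob_inc:
  assumes v: "v \<in> homset C d c" and u: "u \<in> homset C c b"
  shows "rho (yob b) c d \<cdot> (inc c d v \<boxtimes> inc b c u) = inc b d (Comp C u v) \<cdot> lun I"
  (is "?lhs = _")
proof -
  note [simp] = C.homD [OF u] C.homD [OF v]
  have vu: "Comp C u v \<in> homset C d b" using u v by (auto simp: homset_iff)
  note [simp] = inc_hom [OF u] inc_hom [OF v] inc_hom [OF vu]
  have "?lhs = (Farr (yob b) v \<cdot> inc b c u) \<cdot> lun I"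
    by (subst rho_inc [OF _ v]) (simp_all add: Comp_assoc)
  then show ?thesis using yob_arr(2) [of b v u] u by simp
qed

lemma jepi_inc: "d \<in> Obj C \<Longrightarrow> jepi (homset C d c) (inc c d) (Fobj (yob c) d)"
  by (rule jepi_copower [OF copower_yob])

text \<open>Tested on the inclusions of a tensor product of two copowers, this is functoriality of \<open>F\<close>.\<close>

lemma rho_assoc:
  assumes F [simp]: "F \<in> Psh" and [simp]: "b \<in> Obj C" "c \<in> Obj C" "d \<in> Obj C"
  shows "rho F b d \<cdot> (rho (yob b) c d \<boxtimes> idn (Fobj F b)) =
    rho F c d \<cdot> (idn (Fobj (yob c) d) \<boxtimes> rho F b c) \<cdot> ass (Fobj (yob c) d) (Fobj (yob b) c) (Fobj F b)"
  (is "_ = ?rhs")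
proof (rule jepiD [OF jepi_right [OF jepi_tensor [OF jepi_inc [of d c] jepi_inc [of c b]], of "Fobj F b"]])
  fix s assume "s \<in> homset C d c \<times> homset C c b"
  then obtain v u where s: "s = (v, u)" and v: "v \<in> homset C d c" and u: "u \<in> homset C c b" by auto
  note [simp] = C.homD [OF u] C.homD [OF v]
  have vu: "Comp C u v \<in> homset C d b" using u v by (auto simp: homset_iff)
  note [simp] = inc_hom [OF u] inc_hom [OF v] inc_hom [OF vu]
  let ?i = "idn (Fobj F b)" and ?l = "lun (Fobj F b)"
  have "(rho F b d \<cdot> (rho (yob b) c d \<boxtimes> ?i)) \<cdot> ((inc c d v \<boxtimes> inc b c u) \<boxtimes> ?i) =
     rho F b d \<cdot> ((rho (yob b) c d \<cdot> (inc c d v \<boxtimes> inc b c u)) \<boxtimes> ?i)"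
    by (simp add: Comp_assoc merge)
  also have "\<dots> = (rho F b d \<cdot> (inc b d (Comp C u v) \<boxtimes> ?i)) \<cdot> (lun I \<boxtimes> ?i)"
    unfolding rho_yob_inc [OF v u] by (simp add: Comp_assoc merge)
  also have "\<dots> = Farr F v \<cdot> Farr F u \<cdot> ?l \<cdot> (lun I \<boxtimes> ?i)"
    by (subst rho_inc [OF F vu]) (simp_all add: psh_comp Comp_assoc)
  finally have L: "(rho F b d \<cdot> (rho (yob b) c d \<boxtimes> ?i)) \<cdot> ((inc c d v \<boxtimes> inc b c u) \<boxtimes> ?i) = Farr F v \<cdot> Farr F u \<cdot> ?l \<cdot> (lun I \<boxtimes> ?i)" .
  have "?rhs \<cdot> ((inc c d v \<boxtimes> inc b c u) \<boxtimes> ?i)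
     = rho F c d \<cdot> (idn (Fobj (yob c) d) \<boxtimes> rho F b c) \<cdot> (ass (Fobj (yob c) d) (Fobj (yob b) c) (Fobj F b) \<cdot> ((inc c d v \<boxtimes> inc b c u) \<boxtimes> ?i))"
    by (simp add: Comp_assoc)
  also have "ass (Fobj (yob c) d) (Fobj (yob b) c) (Fobj F b) \<cdot> ((inc c d v \<boxtimes> inc b c u) \<boxtimes> ?i) = (inc c d v \<boxtimes> (inc b c u \<boxtimes> ?i)) \<cdot> ass I I (Fobj F b)"
    using ass_natural [of "inc c d v" "inc b c u" ?i] by simp
  also have "rho F c d \<cdot> (idn (Fobj (yob c) d) \<boxtimes> rho F b c) \<cdot> (inc c d v \<boxtimes> (inc b c u \<boxtimes> ?i)) \<cdot> ass I I (Fobj F b) =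
     (rho F c d \<cdot> (inc c d v \<boxtimes> (rho F b c \<cdot> (inc b c u \<boxtimes> ?i)))) \<cdot> ass I I (Fobj F b)"
    by (simp add: Comp_assoc merge')
  also have "rho F b c \<cdot> (inc b c u \<boxtimes> ?i) = Farr F u \<cdot> ?l" using rho_inc [OF F u, of ?i] by simp
  also have "(rho F c d \<cdot> (inc c d v \<boxtimes> (Farr F u \<cdot> ?l))) \<cdot> ass I I (Fobj F b) = Farr F v \<cdot> Farr F u \<cdot> ?l \<cdot> (lun (I \<boxdot> Fobj F b) \<cdot> ass I I (Fobj F b))"
    by (subst rho_inc [OF F v]) (simp_all add: Comp_assoc)
  also have "lun (I \<boxdot> Fobj F b) \<cdot> ass I I (Fobj F b) = lun I \<boxtimes> ?i" by (simp add: lun_tensor)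
  finally show "(rho F b d \<cdot> (rho (yob b) c d \<boxtimes> ?i)) \<cdot> (\<lambda>(s, t). inc c d s \<boxtimes> inc b c t) s \<boxtimes> ?i =
    ?rhs \<cdot> (\<lambda>(s, t). inc c d s \<boxtimes> inc b c t) s \<boxtimes> ?i"
    unfolding s using L by simp
qed simp_all

lemma rho_uni_right:
  assumes [simp]: "c \<in> Obj C" "d \<in> Obj C"
  shows "rho (yob c) c d \<cdot> (idn (Fobj (yob c) d) \<boxtimes> uni c) = run (Fobj (yob c) d)"
  (is "?lhs = _")
proof (rule jepiD [OF jepi_right [OF jepi_inc [of d c], of I]])
  fix w assume w: "w \<in> homset C d c"
  note [simp] = C.homD [OF w]
  have i: "Idn C c \<in> homset C c c" by (simp add: homset_iff)
  note [simp] = inc_hom [OF w]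
  have "?lhs \<cdot> (inc c d w \<boxtimes> idn I) = rho (yob c) c d \<cdot> (inc c d w \<boxtimes> uni c)"
    by (simp add: Comp_assoc merge)
  also have "\<dots> = inc c d w \<cdot> lun I" using rho_yob_inc [OF w i] by (simp add: uni_def)
  also have "\<dots> = run (Fobj (yob c) d) \<cdot> (inc c d w \<boxtimes> idn I)" using run_natural [of "inc c d w"] by (simp add: run_Unit)
  finally show "?lhs \<cdot> (inc c d w \<boxtimes> idn I) = run (Fobj (yob c) d) \<cdot> (inc c d w \<boxtimes> idn I)" .
qed simp_all

text \<open>The free \<open>V\<close>-category on the opposite of \<open>C\<close>. Its objects are renamed along \<open>g\<close>, because enriched
  completeness is stated for diagrams whose objects are elements of the type that measures size.\<close>

definition free_vcat :: "'i set \<Rightarrow> ('i \<Rightarrow> 'c) \<Rightarrow> ('i, 'o, 'a) vcat" where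
  "free_vcat S g = \<lparr>VObj = S, VHom = (\<lambda>a b. Fobj (yob (g a)) (g b)), VId = (\<lambda>a. uni (g a)),
     VComp = (\<lambda>a b c. rho (yob (g a)) (g b) (g c))\<rparr>"

lemma free_vcat_vcategory:
  assumes g: "g ` S \<subseteq> Obj C"
  shows "vcategory V (free_vcat S g)"
proof -
  have [simp]: "g a \<in> Obj C" if "a \<in> S" for a using g that by auto
  show ?thesis
    unfolding vcategory_def free_vcat_def
    by (simp add: homset_iff rho_assoc rho_uni rho_uni_right)
qed

text \<open>A presheaf is the same thing as an enriched functor on this category.\<close>

definition weight :: "'i set \<Rightarrow> ('i \<Rightarrow> 'c) \<Rightarrow> ('c, 'd, 'o, 'a) presheaf \<Rightarrow> ('i, 'o, 'a) vfunctr" where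
  "weight S g F = \<lparr>VFobj = (\<lambda>a\<in>S. Fobj F (g a)),
     VFarr = (\<lambda>(a, b)\<in>S \<times> S. curry_arr V (Fobj (yob (g a)) (g b)) (Fobj F (g a)) (Fobj F (g b)) (rho F (g a) (g b)))\<rparr>"

lemma weight_vfunctor:
  assumes g: "g ` S \<subseteq> Obj C" and F [simp]: "F \<in> Psh"
  shows "is_vfunctor V (free_vcat S g) (vself V) (weight S g F)"
  unfolding is_vfunctor_def
proof (intro conjI ballI)
  have g' [simp]: "g a \<in> Obj C" if "a \<in> S" for a using g that by auto
  note [simp] = curry_simps
  have S [simp]: "VObj (free_vcat S g) = S" by (simp add: free_vcat_def)
  show "VFobj (weight S g F) \<in> VObj (free_vcat S g) \<rightarrow>\<^sub>E VObj (vself V)"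
    "VFarr (weight S g F) \<in> VObj (free_vcat S g) \<times> VObj (free_vcat S g) \<rightarrow>\<^sub>E Arr V"
    by (auto simp: weight_def vself_def)
  fix a assume "a \<in> VObj (free_vcat S g)"
  then have a [simp]: "a \<in> S" by simp
  show "VFarr (weight S g F) (a, a) \<cdot> VId (free_vcat S g) a = VId (vself V) (VFobj (weight S g F) a)"
  proof (rule curry_unique [of _ _ "Fobj F (g a)" "Fobj F (g a)"])
    show "ev (Fobj F (g a)) (Fobj F (g a)) \<cdot> ((VFarr (weight S g F) (a, a) \<cdot> VId (free_vcat S g) a) \<boxtimes> idn (Fobj F (g a))) =
       ev (Fobj F (g a)) (Fobj F (g a)) \<cdot> (VId (vself V) (VFobj (weight S g F) a) \<boxtimes> idn (Fobj F (g a)))"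
      by (simp add: weight_def free_vcat_def vself_def eval_curry rho_uni)
  qed (simp_all add: weight_def free_vcat_def vself_def)
  fix b assume "b \<in> VObj (free_vcat S g)"
  then have b [simp]: "b \<in> S" by simp
  show "VFarr (weight S g F) (a, b) \<in> hm (VHom (free_vcat S g) a b) (VHom (vself V) (VFobj (weight S g F) a) (VFobj (weight S g F) b))"
    by (simp add: weight_def free_vcat_def vself_def homset_iff)
  fix c assume "c \<in> VObj (free_vcat S g)"
  then have c [simp]: "c \<in> S" by simp
  let ?a = "Fobj F (g a)" and ?b = "Fobj F (g b)" and ?c = "Fobj F (g c)"
  let ?W = "\<lambda>a b. curry_arr V (Fobj (yob (g a)) (g b)) (Fobj F (g a)) (Fobj F (g b)) (rho F (g a) (g b))"
  have "?W a c \<cdot> rho (yob (g a)) (g b) (g c) = VComp (vself V) ?a ?b ?c \<cdot> (?W b c \<boxtimes> ?W a b)"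
  proof (rule curry_unique [of _ _ ?a ?c])
    have "ev ?a ?c \<cdot> ((?W a c \<cdot> rho (yob (g a)) (g b) (g c)) \<boxtimes> idn ?a) = rho F (g a) (g c) \<cdot> (rho (yob (g a)) (g b) (g c) \<boxtimes> idn ?a)"
      by (rule eval_curry) simp_all
    also have "\<dots> = rho F (g b) (g c) \<cdot> (idn (Fobj (yob (g b)) (g c)) \<boxtimes> rho F (g a) (g b)) \<cdot> ass (Fobj (yob (g b)) (g c)) (Fobj (yob (g a)) (g b)) ?a"
      by (rule rho_assoc) simp_all
    also have "\<dots> = (ev ?b ?c \<cdot> ((?W b c \<cdot> idn (Fobj (yob (g b)) (g c))) \<boxtimes> rho F (g a) (g b))) \<cdot> ass (Fobj (yob (g b)) (g c)) (Fobj (yob (g a)) (g b)) ?a"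
      by (subst eval_curry) (simp_all add: Comp_assoc)
    also have "\<dots> = ev ?b ?c \<cdot> (?W b c \<boxtimes> (ev ?a ?b \<cdot> (?W a b \<boxtimes> idn ?a))) \<cdot> ass (Fobj (yob (g b)) (g c)) (Fobj (yob (g a)) (g b)) ?a"
      by (simp add: Comp_assoc)
    also have "\<dots> = ev ?a ?c \<cdot> ((VComp (vself V) ?a ?b ?c \<cdot> (?W b c \<boxtimes> ?W a b)) \<boxtimes> idn ?a)"
      by (subst vself_comp(4)) simp_all
    finally show "ev ?a ?c \<cdot> ((?W a c \<cdot> rho (yob (g a)) (g b) (g c)) \<boxtimes> idn ?a) =
        ev ?a ?c \<cdot> ((VComp (vself V) ?a ?b ?c \<cdot> (?W b c \<boxtimes> ?W a b)) \<boxtimes> idn ?a)" .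
  qed (simp_all add: vself_comp)
  then show "VFarr (weight S g F) (a, c) \<cdot> VComp (free_vcat S g) a b c =
      VComp (vself V) (VFobj (weight S g F) a) (VFobj (weight S g F) b) (VFobj (weight S g F) c) \<cdot>
        (VFarr (weight S g F) (b, c) \<boxtimes> VFarr (weight S g F) (a, b))"
    by (simp add: weight_def free_vcat_def)
qed

end

context diag
begin

text \<open>The diagram \<open>D\<close>, as an enriched functor from the free category on the opposite of \<open>C\<close> to the opposite of
  \<open>M\<close>.\<close>

definition opdiag :: "'i set \<Rightarrow> ('i \<Rightarrow> 'c) \<Rightarrow> ('i, 'm, 'a) vfunctr" where
  "opdiag S g = \<lparr>VFobj = (\<lambda>a\<in>S. Do (g a)), VFarr = (\<lambda>(a, b)\<in>S \<times> S. tau (g a) (g b))\<rparr>"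

lemma vop_simps [simp]:
  "VObj (vop V M) = VObj M" "VHom (vop V M) x y = hob y x" "VId (vop V M) = vid"
  "VComp (vop V M) x y z = cmp z y x \<cdot> sy (hob z y) (hob y x)"
  by (simp_all add: vop_def)

lemma tau_uni: "c \<in> Obj C \<Longrightarrow> tau c c \<cdot> uni c = vid (Do c)"
  using tau_props(4) [of c c "Idn C c"] by (simp add: uni_def homset_iff)

lemma tau_comp:
  assumes [simp]: "b \<in> Obj C" "c \<in> Obj C" "d \<in> Obj C"
  shows "tau b d \<cdot> rho (yob b) c d = (cmp (Do d) (Do c) (Do b) \<cdot> sy (hob (Do d) (Do c)) (hob (Do c) (Do b))) \<cdot> (tau c d \<boxtimes> tau b c)"
  (is "?lhs = _")
proof (rule jepiD [OF jepi_tensor [OF jepi_inc [of d c] jepi_inc [of c b]]])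
  fix s assume "s \<in> homset C d c \<times> homset C c b"
  then obtain v u where s: "s = (v, u)" and v: "v \<in> homset C d c" and u: "u \<in> homset C c b" by auto
  note [simp] = C.homD [OF u] C.homD [OF v]
  have vu: "Comp C u v \<in> homset C d b" using u v by (auto simp: homset_iff)
  note [simp] = inc_hom [OF u] inc_hom [OF v] inc_hom [OF vu]
  let ?m = "cmp (Do d) (Do c) (Do b)"
  have "?lhs \<cdot> (inc c d v \<boxtimes> inc b c u) = (tau b d \<cdot> inc b d (Comp C u v)) \<cdot> lun I"
    by (simp add: Comp_assoc rho_yob_inc [OF v u])
  also have "\<dots> = lc ?m (Da u) (Da v) \<cdot> lun I" by (simp add: tau_props(4) [OF _ _ vu] Da_comp)
  also have "\<dots> = ?m \<cdot> (Da u \<boxtimes> Da v)" by (simp add: lc_def Comp_assoc)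
  also have "\<dots> = ?m \<cdot> (sy (hob (Do d) (Do c)) (hob (Do c) (Do b)) \<cdot> (Da v \<boxtimes> Da u))"
    using sym_natural [of "Da v" "Da u"] by (simp add: sym_Unit)
  also have "\<dots> = ((?m \<cdot> sy (hob (Do d) (Do c)) (hob (Do c) (Do b))) \<cdot> (tau c d \<boxtimes> tau b c)) \<cdot> (inc c d v \<boxtimes> inc b c u)"
    by (simp add: Comp_assoc merge tau_props(4) [OF _ _ u] tau_props(4) [OF _ _ v])
  finally show "?lhs \<cdot> (\<lambda>(s, t). inc c d s \<boxtimes> inc b c t) s =
     ((?m \<cdot> sy (hob (Do d) (Do c)) (hob (Do c) (Do b))) \<cdot> (tau c d \<boxtimes> tau b c)) \<cdot> (\<lambda>(s, t). inc c d s \<boxtimes> inc b c t) s"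
    by (simp add: s)
qed simp_all

lemma opdiag_vfunctor:
  assumes g: "g ` S \<subseteq> Obj C"
  shows "is_vfunctor V (free_vcat S g) (vop V M) (opdiag S g)"
proof -
  have g' [simp]: "g a \<in> Obj C" if "a \<in> S" for a using g that by auto
  show ?thesis
    unfolding is_vfunctor_def
    by (auto simp: free_vcat_def opdiag_def homset_iff tau_uni tau_comp)
qed

text \<open>The functor \<open>M(D -, m)\<close> of the definition of weighted limits is the presheaf \<open>Rob m\<close>.\<close>

lemma rho_Rob:
  assumes [simp]: "m \<in> VObj M" "c \<in> Obj C" "d \<in> Obj C"
  shows "(cmp (Do d) (Do c) m \<cdot> sy (hob (Do d) (Do c)) (hob (Do c) m)) \<cdot> (tau c d \<boxtimes> idn (hob (Do c) m)) = rho (Rob m) c d"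
proof (rule jepiD [OF jepi_right [OF jepi_inc [of d c], of "hob (Do c) m"]])
  fix u assume u: "u \<in> homset C d c"
  note [simp] = C.homD [OF u]
  note [simp] = inc_hom [OF u]
  let ?H = "hob (Do c) m" and ?m = "cmp (Do d) (Do c) m" and ?s = "sy (hob (Do d) (Do c)) (hob (Do c) m)"
  have "((?m \<cdot> ?s) \<cdot> (tau c d \<boxtimes> idn ?H)) \<cdot> (inc c d u \<boxtimes> idn ?H) = ?m \<cdot> (?s \<cdot> (Da u \<boxtimes> idn ?H))"
    by (simp add: Comp_assoc merge tau_props(4) [OF _ _ u])
  also have "?s \<cdot> (Da u \<boxtimes> idn ?H) = (idn ?H \<boxtimes> Da u) \<cdot> sy I ?H" using sym_natural [of "Da u" "idn ?H"] by simp
  also have "?m \<cdot> \<dots> = (?m \<cdot> (idn ?H \<boxtimes> Da u)) \<cdot> sy I ?H" by (simp add: Comp_assoc)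
  also have "?m \<cdot> (idn ?H \<boxtimes> Da u) = (Farr (Rob m) u \<cdot> idn ?H) \<cdot> run ?H"
    by (subst Farr_Rob) (simp_all add: rc_def Comp_assoc)
  also have "((Farr (Rob m) u \<cdot> idn ?H) \<cdot> run ?H) \<cdot> sy I ?H = Farr (Rob m) u \<cdot> lun ?H"
    by (simp add: Comp_assoc run_sym)
  also have "\<dots> = rho (Rob m) c d \<cdot> (inc c d u \<boxtimes> idn ?H)"
    by (subst rho_inc [OF _ u]) simp_all
  finally show "((?m \<cdot> ?s) \<cdot> (tau c d \<boxtimes> idn ?H)) \<cdot> (inc c d u \<boxtimes> idn ?H) = rho (Rob m) c d \<cdot> (inc c d u \<boxtimes> idn ?H)" .
qed simp_all

lemma rep_opdiag:
  assumes g: "g ` S \<subseteq> Obj C" and [simp]: "m \<in> VObj M"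
  shows "rep_functor V (free_vcat S g) (vop V M) m (opdiag S g) = weight S g (Rob m)"
proof -
  have g' [simp]: "g a \<in> Obj C" if "a \<in> S" for a using g that by auto
  show ?thesis
    unfolding rep_functor_def weight_def
    by (auto simp: free_vcat_def opdiag_def rho_Rob fun_eq_iff restrict_def)
qed

text \<open>Both sides of the enriched condition are arrows out of a tensor product with \<open>y c (d)\<close>. On the inclusion
  of \<open>u : d \<rightarrow> c\<close>, the condition becomes naturality at \<open>u\<close>.\<close>

lemma vnat_family_weight_iff:
  assumes g: "g ` S = Obj C" and F [simp]: "F \<in> Psh" and G [simp]: "G \<in> Psh" and X [simp]: "X \<in> Obj V"
    and \<kappa>: "\<And>c. c \<in> Obj C \<Longrightarrow> \<kappa> c \<in> hm (X \<boxdot> Fobj F c) (Fobj G c)"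
  shows "vnat_family V (free_vcat S g) (vself V) (weight S g F) (weight S g G) X
       (\<lambda>a. curry_arr V X (Fobj F (g a)) (Fobj G (g a)) (\<kappa> (g a))) \<longleftrightarrow> nat_fam F G X \<kappa>"
proof -
  have g' [simp]: "g a \<in> Obj C" if "a \<in> S" for a using g that by auto
  have [simp]: "\<kappa> c \<in> Arr V" "Dom V (\<kappa> c) = X \<boxdot> Fobj F c" "Cod V (\<kappa> c) = Fobj G c" if "c \<in> Obj C" for c
    using \<kappa> [OF that] by (auto simp: homset_iff)
  note [simp] = curry_simps
  let ?\<pi> = "\<lambda>c. curry_arr V X (Fobj F c) (Fobj G c) (\<kappa> c)"
  let ?W = "\<lambda>F c d. curry_arr V (Fobj (yob c) d) (Fobj F c) (Fobj F d) (rho F c d)"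
  let ?l = "\<lambda>c d. VComp (vself V) (Fobj F c) (Fobj G c) (Fobj G d) \<cdot> (?W G c d \<boxtimes> ?\<pi> c)"
  let ?r = "\<lambda>c d. VComp (vself V) (Fobj F c) (Fobj F d) (Fobj G d) \<cdot> (?\<pi> d \<boxtimes> ?W F c d) \<cdot> sy (Fobj (yob c) d) X"
  have ty: "VComp (vself V) x y z \<in> Arr V" "Dom V (VComp (vself V) x y z) = ihom y z \<boxdot> ihom x y" "Cod V (VComp (vself V) x y z) = ihom x z"
    if "x \<in> Obj V" "y \<in> Obj V" "z \<in> Obj V" for x y z using that by (simp_all add: vself_def)
  note [simp] = ty
  have key: "?l c d = ?r c d \<longleftrightarrow> (\<forall>u\<in>homset C d c. Farr G u \<cdot> \<kappa> c = \<kappa> d \<cdot> (idn X \<boxtimes> Farr F u))"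
    if c [simp]: "c \<in> Obj C" and d [simp]: "d \<in> Obj C" for c d
  proof -
    let ?f = "Fobj F c" and ?Y = "Fobj (yob c) d"
    let ?L = "rho G c d \<cdot> (idn ?Y \<boxtimes> \<kappa> c) \<cdot> ass ?Y X ?f" and ?R = "\<kappa> d \<cdot> (idn X \<boxtimes> rho F c d) \<cdot> ass X ?Y ?f \<cdot> (sy ?Y X \<boxtimes> idn ?f)"
    let ?i = "\<lambda>u. inc c d u \<boxtimes> idn X" and ?FX = "\<lambda>u. idn X \<boxtimes> Farr F u"
    let ?e = "\<lambda>u. ?i u \<boxtimes> idn ?f"
    have L: "ev ?f (Fobj G d) \<cdot> (?l c d \<boxtimes> idn ?f) = ?L"
    proof -
      have "ev ?f (Fobj G d) \<cdot> (?l c d \<boxtimes> idn ?f) = ev (Fobj G c) (Fobj G d) \<cdot> (?W G c d \<boxtimes> (ev ?f (Fobj G c) \<cdot> (?\<pi> c \<boxtimes> idn ?f))) \<cdot> ass ?Y X ?f"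
        by (subst vself_comp(4)) simp_all
      also have "\<dots> = (ev (Fobj G c) (Fobj G d) \<cdot> ((?W G c d \<cdot> idn ?Y) \<boxtimes> \<kappa> c)) \<cdot> ass ?Y X ?f"
        by (simp add: Comp_assoc)
      also have "\<dots> = (rho G c d \<cdot> (idn ?Y \<boxtimes> \<kappa> c)) \<cdot> ass ?Y X ?f" by (subst eval_curry) simp_all
      finally show ?thesis by (simp add: Comp_assoc)
    qed
    have R: "ev ?f (Fobj G d) \<cdot> (?r c d \<boxtimes> idn ?f) = ?R"
    proof -
      have "ev ?f (Fobj G d) \<cdot> (?r c d \<boxtimes> idn ?f) =
          (ev ?f (Fobj G d) \<cdot> ((VComp (vself V) (Fobj F c) (Fobj F d) (Fobj G d) \<cdot> (?\<pi> d \<boxtimes> ?W F c d)) \<boxtimes> idn ?f)) \<cdot> (sy ?Y X \<boxtimes> idn ?f)"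
        by (simp add: Comp_assoc merge)
      also have "ev ?f (Fobj G d) \<cdot> ((VComp (vself V) (Fobj F c) (Fobj F d) (Fobj G d) \<cdot> (?\<pi> d \<boxtimes> ?W F c d)) \<boxtimes> idn ?f) =
          ev (Fobj F d) (Fobj G d) \<cdot> (?\<pi> d \<boxtimes> (ev ?f (Fobj F d) \<cdot> (?W F c d \<boxtimes> idn ?f))) \<cdot> ass X ?Y ?f"
        by (subst vself_comp(4)) simp_all
      also have "\<dots> = (ev (Fobj F d) (Fobj G d) \<cdot> ((?\<pi> d \<cdot> idn X) \<boxtimes> rho F c d)) \<cdot> ass X ?Y ?f"
        by (simp add: Comp_assoc)
      also have "\<dots> = (\<kappa> d \<cdot> (idn X \<boxtimes> rho F c d)) \<cdot> ass X ?Y ?f" by (subst eval_curry) simp_all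
      finally show ?thesis by (simp add: Comp_assoc)
    qed
    have tl: "?L \<cdot> ?e u = Farr G u \<cdot> \<kappa> c \<cdot> (lun X \<boxtimes> idn ?f)"
      if u: "u \<in> homset C d c" for u
    proof -
      note [simp] = C.homD [OF u]
      note [simp] = inc_hom [OF u]
      have "?L \<cdot> ?e u =
         rho G c d \<cdot> (idn ?Y \<boxtimes> \<kappa> c) \<cdot> (ass ?Y X ?f \<cdot> ?e u)" by (simp add: Comp_assoc)
      also have "ass ?Y X ?f \<cdot> ?e u = (inc c d u \<boxtimes> idn (X \<boxdot> ?f)) \<cdot> ass I X ?f"
        using ass_natural [of "inc c d u" "idn X" "idn ?f"] by simp
      also have "rho G c d \<cdot> (idn ?Y \<boxtimes> \<kappa> c) \<cdot> (inc c d u \<boxtimes> idn (X \<boxdot> ?f)) \<cdot> ass I X ?f = (rho G c d \<cdot> (inc c d u \<boxtimes> \<kappa> c)) \<cdot> ass I X ?f"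
        by (simp add: Comp_assoc merge')
      also have "\<dots> = Farr G u \<cdot> \<kappa> c \<cdot> lun (X \<boxdot> ?f) \<cdot> ass I X ?f" by (subst rho_inc [OF G u]) (simp_all add: Comp_assoc)
      also have "lun (X \<boxdot> ?f) \<cdot> ass I X ?f = lun X \<boxtimes> idn ?f" by (simp add: lun_tensor)
      finally show ?thesis .
    qed
    have tr: "?R \<cdot> ?e u = \<kappa> d \<cdot> ?FX u \<cdot> (lun X \<boxtimes> idn ?f)"
      if u: "u \<in> homset C d c" for u
    proof -
      note [simp] = C.homD [OF u]
      note [simp] = inc_hom [OF u]
      have "?R \<cdot> ?e u =
         \<kappa> d \<cdot> (idn X \<boxtimes> rho F c d) \<cdot> ass X ?Y ?f \<cdot> ((sy ?Y X \<cdot> ?i u) \<boxtimes> idn ?f)" by (simp add: Comp_assoc merge)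
      also have "sy ?Y X \<cdot> ?i u = (idn X \<boxtimes> inc c d u) \<cdot> sy I X" using sym_natural [of "inc c d u" "idn X"] by simp
      also have "((idn X \<boxtimes> inc c d u) \<cdot> sy I X) \<boxtimes> idn ?f = ((idn X \<boxtimes> inc c d u) \<boxtimes> idn ?f) \<cdot> (sy I X \<boxtimes> idn ?f)" by (simp add: merge)
      also have "\<kappa> d \<cdot> (idn X \<boxtimes> rho F c d) \<cdot> ass X ?Y ?f \<cdot> ((idn X \<boxtimes> inc c d u) \<boxtimes> idn ?f) \<cdot> (sy I X \<boxtimes> idn ?f) =
          \<kappa> d \<cdot> (idn X \<boxtimes> rho F c d) \<cdot> (ass X ?Y ?f \<cdot> ((idn X \<boxtimes> inc c d u) \<boxtimes> idn ?f)) \<cdot> (sy I X \<boxtimes> idn ?f)" by (simp add: Comp_assoc)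
      also have "ass X ?Y ?f \<cdot> ((idn X \<boxtimes> inc c d u) \<boxtimes> idn ?f) = (idn X \<boxtimes> (inc c d u \<boxtimes> idn ?f)) \<cdot> ass X I ?f"
        using ass_natural [of "idn X" "inc c d u" "idn ?f"] by simp
      also have "\<kappa> d \<cdot> (idn X \<boxtimes> rho F c d) \<cdot> ((idn X \<boxtimes> (inc c d u \<boxtimes> idn ?f)) \<cdot> ass X I ?f) \<cdot> (sy I X \<boxtimes> idn ?f) =
          \<kappa> d \<cdot> (idn X \<boxtimes> (rho F c d \<cdot> (inc c d u \<boxtimes> idn ?f))) \<cdot> ass X I ?f \<cdot> (sy I X \<boxtimes> idn ?f)" by (simp add: Comp_assoc merge')
      also have "rho F c d \<cdot> (inc c d u \<boxtimes> idn ?f) = Farr F u \<cdot> lun ?f" using rho_inc [OF F u, of "idn ?f"] by simp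
      also have "\<kappa> d \<cdot> (idn X \<boxtimes> (Farr F u \<cdot> lun ?f)) \<cdot> ass X I ?f \<cdot> (sy I X \<boxtimes> idn ?f) =
         \<kappa> d \<cdot> ?FX u \<cdot> ((idn X \<boxtimes> lun ?f) \<cdot> ass X I ?f) \<cdot> (sy I X \<boxtimes> idn ?f)"
        by (simp add: Comp_assoc merge')
      also have "((idn X \<boxtimes> lun ?f) \<cdot> ass X I ?f) \<cdot> (sy I X \<boxtimes> idn ?f) = lun X \<boxtimes> idn ?f"
        by (simp add: triangle merge run_sym)
      finally show ?thesis .
    qed
    have "?l c d = ?r c d \<longleftrightarrow> ?L = ?R"
    proof
      assume "?l c d = ?r c d"
      then show "?L = ?R" unfolding L [symmetric] R [symmetric] by simp
    next
      assume eq: "?L = ?R"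
      show "?l c d = ?r c d"
        by (rule curry_unique [of _ _ ?f "Fobj G d"]) (simp_all only: L R eq, simp_all)
    qed
    also have "\<dots> \<longleftrightarrow> (\<forall>u\<in>homset C d c. ?L \<cdot> ?e u = ?R \<cdot> ?e u)"
    proof
      assume eq: "\<forall>u\<in>homset C d c. ?L \<cdot> ?e u = ?R \<cdot> ?e u"
      show "?L = ?R"
        by (rule jepiD [OF jepi_right [OF jepi_right [OF jepi_inc [of d c], of X], of ?f]]) (use eq in simp_all)
    qed simp
    also have "\<dots> \<longleftrightarrow> (\<forall>u\<in>homset C d c. Farr G u \<cdot> \<kappa> c = \<kappa> d \<cdot> ?FX u)"
    proof (rule ball_cong [OF refl])
      fix u assume u: "u \<in> homset C d c"
      note [simp] = C.homD [OF u]
      have iso: "is_iso V (lun X \<boxtimes> idn ?f)" by (simp add: iso_tensor iso_idn)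
      have "(Farr G u \<cdot> \<kappa> c) \<cdot> (lun X \<boxtimes> idn ?f) = (\<kappa> d \<cdot> ?FX u) \<cdot> (lun X \<boxtimes> idn ?f) \<longleftrightarrow> Farr G u \<cdot> \<kappa> c = \<kappa> d \<cdot> ?FX u"
        using iso_cancel_right [OF iso, of "Farr G u \<cdot> \<kappa> c" "\<kappa> d \<cdot> ?FX u"] by auto
      moreover have "(Farr G u \<cdot> \<kappa> c) \<cdot> (lun X \<boxtimes> idn ?f) = Farr G u \<cdot> \<kappa> c \<cdot> (lun X \<boxtimes> idn ?f)"
        "(\<kappa> d \<cdot> ?FX u) \<cdot> (lun X \<boxtimes> idn ?f) = \<kappa> d \<cdot> ?FX u \<cdot> (lun X \<boxtimes> idn ?f)"
        by (simp_all add: Comp_assoc)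
      ultimately show "?L \<cdot> ?e u = ?R \<cdot> ?e u \<longleftrightarrow> Farr G u \<cdot> \<kappa> c = \<kappa> d \<cdot> ?FX u"
        unfolding tl [OF u] tr [OF u] by simp
    qed
    finally show ?thesis .
  qed
  have "vnat_family V (free_vcat S g) (vself V) (weight S g F) (weight S g G) X (\<lambda>a. ?\<pi> (g a)) \<longleftrightarrow>
     (\<forall>a\<in>S. \<forall>b\<in>S. ?l (g a) (g b) = ?r (g a) (g b))"
    unfolding vnat_family_def by (simp add: free_vcat_def weight_def vself_def homset_iff)
  also have "\<dots> \<longleftrightarrow> (\<forall>a\<in>S. \<forall>b\<in>S. \<forall>u\<in>homset C (g b) (g a). Farr G u \<cdot> \<kappa> (g a) = \<kappa> (g b) \<cdot> (idn X \<boxtimes> Farr F u))"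
    by (simp only: key g' cong: ball_cong)
  also have "\<dots> \<longleftrightarrow> (\<forall>c\<in>g ` S. \<forall>d\<in>g ` S. \<forall>u\<in>homset C d c. Farr G u \<cdot> \<kappa> c = \<kappa> d \<cdot> (idn X \<boxtimes> Farr F u))"
    by blast
  also have "\<dots> \<longleftrightarrow> (\<forall>u\<in>Arr C. Farr G u \<cdot> \<kappa> (Cod C u) = \<kappa> (Dom C u) \<cdot> (idn X \<boxtimes> Farr F u))"
    unfolding g by (auto simp: homset_iff)
  also have "\<dots> \<longleftrightarrow> nat_fam F G X \<kappa>" using \<kappa> by (simp add: nat_fam_def)
  finally show ?thesis .
qed

text \<open>The colimit of \<open>D\<close> weighted by \<open>F\<close> is the limit of \<open>D\<close> in the opposite of \<open>M\<close>. The weighted limit provided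
  by completeness represents enriched natural families; these are the ordinary ones by
  \<open>vnat_family_weight_iff\<close>.\<close>

theorem wcolim_exists:
  assumes cpl: "vcomplete TYPE('u) V (vop V M)" and C: "small_category TYPE('u) C" and F [simp]: "F \<in> Psh"
  shows "\<exists>l \<nu>. wcolim F l \<nu>"
proof -
  obtain f :: "'c \<Rightarrow> 'u" where f: "inj_on f (Obj C)" using C small_inj by (auto simp: small_category_def)
  \<comment> \<open>The objects of \<open>C\<close>, encoded as elements of \<open>'u\<close>, and their decoding.\<close>
  let ?S = "f ` Obj C" and ?g = "inv_into (Obj C) f"
  have gS: "?g ` ?S = Obj C" using f by simp
  then have gS': "?g ` ?S \<subseteq> Obj C" by simp
  have gf [simp]: "?g (f c) = c" if "c \<in> Obj C" for c using f that by simp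
  have "small TYPE('u) (VObj (free_vcat ?S ?g))"
    using C by (simp add: free_vcat_def small_category_def small_image)
  then obtain l \<mu> where wl: "is_weighted_limit V (free_vcat ?S ?g) (vop V M) (weight ?S ?g F) (opdiag ?S ?g) l \<mu>"
    using cpl free_vcat_vcategory [OF gS'] weight_vfunctor [OF gS' F] opdiag_vfunctor [OF gS'] unfolding vcomplete_def by blast
  let ?\<nu> = "\<lambda>c. \<mu> (f c)"
  have l [simp]: "l \<in> VObj M" using wl by (simp add: is_weighted_limit_def)
  have \<nu>: "?\<nu> c \<in> hm (Fobj F c) (hob (Do c) l)" if "c \<in> Obj C" for c
  proof -
    have "\<forall>a\<in>?S. \<mu> a \<in> hm (VFobj (weight ?S ?g F) a) (hob (VFobj (opdiag ?S ?g) a) l)"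
      using wl by (simp add: is_weighted_limit_def free_vcat_def)
    then have "\<mu> (f c) \<in> hm (VFobj (weight ?S ?g F) (f c)) (hob (VFobj (opdiag ?S ?g) (f c)) l)" using that by blast
    then show ?thesis using that by (simp add: weight_def opdiag_def)
  qed
  have \<nu>s [simp]: "?\<nu> c \<in> Arr V" "Dom V (?\<nu> c) = Fobj F c" "Cod V (?\<nu> c) = hob (Do c) l" if "c \<in> Obj C" for c
    using \<nu> [OF that] by (auto simp: homset_iff)
  have fg: "f (?g a) = a" if "a \<in> ?S" for a using that by auto
  have fgs: "?g a \<in> Obj C" if "a \<in> ?S" for a using that gS' by blast
  let ?\<kappa> = "\<lambda>m c. bc (cmp (Do c) l m) (idn (hob l m)) (?\<nu> c)"
  let ?\<pi> = "\<lambda>m a. curry_arr V (hob l m) (Fobj F (?g a)) (hob (Do (?g a)) m) (?\<kappa> m (?g a))"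
  let ?A = "free_vcat ?S ?g"
  have no: "is_nat_object V ?A (vself V) (weight ?S ?g F) (weight ?S ?g (Rob m)) (hob l m) (\<lambda>a. ?\<pi> m a)"
    if m [simp]: "m \<in> VObj M" for m
  proof -
    let ?p = "\<lambda>a. curry_arr V (VHom (vop V M) m l) (VFobj (weight ?S ?g F) a) (VHom (vop V M) m (VFobj (opdiag ?S ?g) a))
           (VComp (vop V M) m l (VFobj (opdiag ?S ?g) a) \<cdot>
             (\<mu> a \<boxtimes> idn (VHom (vop V M) m l)) \<cdot> sy (VHom (vop V M) m l) (VFobj (weight ?S ?g F) a))"
    have 1: "is_nat_object V ?A (vself V) (weight ?S ?g F) (weight ?S ?g (Rob m)) (hob l m) ?p"
    proof -
      have "is_nat_object V ?A (vself V) (weight ?S ?g F) (rep_functor V ?A (vop V M) m (opdiag ?S ?g)) (VHom (vop V M) m l) ?p"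
        using wl m unfolding is_weighted_limit_def by (elim conjE, drule_tac bspec) (simp_all only: vop_simps)
      then show ?thesis by (simp only: rep_opdiag [OF gS' m] vop_simps)
    qed
    have pe: "?p a = ?\<pi> m a" if a: "a \<in> ?S" for a
    proof -
      let ?c = "?g a"
      have c [simp]: "?c \<in> Obj C" using fgs a .
      have \<mu>a: "\<mu> a = ?\<nu> ?c" using fg [OF a] by simp
      let ?h = "hob l m" and ?k = "hob (Do ?c) l"
      have "((cmp (Do ?c) l m \<cdot> sy ?k ?h) \<cdot> (?\<nu> ?c \<boxtimes> idn ?h) \<cdot> sy ?h (Fobj F ?c)) = cmp (Do ?c) l m \<cdot> (sy ?k ?h \<cdot> (?\<nu> ?c \<boxtimes> idn ?h)) \<cdot> sy ?h (Fobj F ?c)"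
        by (simp add: Comp_assoc)
      also have "sy ?k ?h \<cdot> (?\<nu> ?c \<boxtimes> idn ?h) = (idn ?h \<boxtimes> ?\<nu> ?c) \<cdot> sy (Fobj F ?c) ?h"
        using sym_natural [of "?\<nu> ?c" "idn ?h"] by simp
      also have "cmp (Do ?c) l m \<cdot> \<dots> \<cdot> sy ?h (Fobj F ?c) = ?\<kappa> m ?c"
        by (simp add: bc_def Comp_assoc)
      finally show ?thesis using a unfolding \<mu>a by (simp add: weight_def opdiag_def)
    qed
    have SA: "VObj ?A = ?S" by (simp add: free_vcat_def)
    have "vnat_family V ?A (vself V) (weight ?S ?g F) (weight ?S ?g (Rob m)) (hob l m) ?p \<longleftrightarrow>
        vnat_family V ?A (vself V) (weight ?S ?g F) (weight ?S ?g (Rob m)) (hob l m) (?\<pi> m)"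
      unfolding vnat_family_def SA using pe by (simp cong: ball_cong)
    then show ?thesis using 1 pe unfolding is_nat_object_def SA by (simp cong: ball_cong conj_cong)
  qed
  have \<kappa>_hom: "?\<kappa> m c \<in> hm (hob l m \<boxdot> Fobj F c) (Fobj (Rob m) c)" if "m \<in> VObj M" "c \<in> Obj C" for m c
    using that by (simp add: homset_iff)
  have nat\<kappa>: "nat_fam F (Rob m) (hob l m) (?\<kappa> m)" if m [simp]: "m \<in> VObj M" for m
  proof -
    have "vnat_family V ?A (vself V) (weight ?S ?g F) (weight ?S ?g (Rob m)) (hob l m)
        (\<lambda>a. curry_arr V (hob l m) (Fobj F (?g a)) (Fobj (Rob m) (?g a)) (?\<kappa> m (?g a)))
       \<longleftrightarrow> vnat_family V ?A (vself V) (weight ?S ?g F) (weight ?S ?g (Rob m)) (hob l m) (?\<pi> m)"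
      unfolding vnat_family_def using fgs by (simp add: free_vcat_def cong: ball_cong)
    then show ?thesis
      using vnat_family_weight_iff [OF gS F Rob_Psh [OF m], of "hob l m" "?\<kappa> m"] no [OF m] \<kappa>_hom [OF m]
      by (simp add: is_nat_object_def)
  qed
  have "wcolim F l ?\<nu>"
    unfolding wcolim_def
  proof (intro conjI ballI allI impI)
    show "l \<in> VObj M" by simp
    show "?\<nu> c \<in> hm (Fobj F c) (hob (Do c) l)" if "c \<in> Obj C" for c using \<nu> [OF that] .
    show "Farr (Rob l) u \<cdot> ?\<nu> (Cod C u) = ?\<nu> (Dom C u) \<cdot> Farr F u" if u [simp]: "u \<in> Arr C" for u
    proof -
      let ?c = "Cod C u" and ?d = "Dom C u"
      have R: "Farr (Rob l) u \<in> Arr V" "Dom V (Farr (Rob l) u) = hob (Do ?c) l" by simp_all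
      note [simp] = R
      have k: "?\<kappa> l c \<cdot> (vid l \<boxtimes> idn (Fobj F c)) = ?\<nu> c \<cdot> lun (Fobj F c)" if [simp]: "c \<in> Obj C" for c
      proof -
        have "?\<kappa> l c \<cdot> (vid l \<boxtimes> idn (Fobj F c)) = bc (cmp (Do c) l l) (vid l) (?\<nu> c)"
          by (simp add: bc_def Comp_assoc merge)
        also have "\<dots> = lc (cmp (Do c) l l) (vid l) (?\<nu> c) \<cdot> lun (Fobj F c)" by (simp add: lc_bc Comp_assoc del: vid_lc)
        finally show ?thesis by simp
      qed
      have "(Farr (Rob l) u \<cdot> ?\<nu> ?c) \<cdot> lun (Fobj F ?c) = (Farr (Rob l) u \<cdot> ?\<kappa> l ?c) \<cdot> (vid l \<boxtimes> idn (Fobj F ?c))"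
        by (simp add: Comp_assoc k)
      also have "Farr (Rob l) u \<cdot> ?\<kappa> l ?c = ?\<kappa> l ?d \<cdot> (idn (hob l l) \<boxtimes> Farr F u)"
        using nat\<kappa> [OF l] u unfolding nat_fam_def by blast
      also have "(?\<kappa> l ?d \<cdot> (idn (hob l l) \<boxtimes> Farr F u)) \<cdot> (vid l \<boxtimes> idn (Fobj F ?c)) = (?\<kappa> l ?d \<cdot> (vid l \<boxtimes> idn (Fobj F ?d))) \<cdot> (idn I \<boxtimes> Farr F u)"
        by (simp add: Comp_assoc merge)
      also have "\<dots> = (?\<nu> ?d \<cdot> Farr F u) \<cdot> lun (Fobj F ?c)"
        using lun_natural [of "Farr F u"] by (simp add: k Comp_assoc)
      finally show ?thesis by (rule iso_cancel_right [OF lun_iso [of "Fobj F ?c"], rotated -1]) simp_all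
    qed
    fix m X \<kappa> assume m [simp]: "m \<in> VObj M" and X [simp]: "X \<in> Obj V" and nat: "nat_fam F (Rob m) X \<kappa>"
    have \<kappa>': "\<kappa> c \<in> hm (X \<boxdot> Fobj F c) (Fobj (Rob m) c)" if "c \<in> Obj C" for c
      using nat that unfolding nat_fam_def by blast
    then have \<kappa>s [simp]: "\<kappa> c \<in> Arr V" "Dom V (\<kappa> c) = X \<boxdot> Fobj F c" "Cod V (\<kappa> c) = hob (Do c) m" if "c \<in> Obj C" for c
      using that by (auto simp: homset_iff)
    let ?q = "\<lambda>a. curry_arr V X (Fobj F (?g a)) (Fobj (Rob m) (?g a)) (\<kappa> (?g a))"
    have "vnat_family V ?A (vself V) (weight ?S ?g F) (weight ?S ?g (Rob m)) X ?q"
      using vnat_family_weight_iff [OF gS F Rob_Psh [OF m] X \<kappa>'] nat by blast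
    then have ex: "\<exists>!h. h \<in> hm X (hob l m) \<and> (\<forall>a\<in>VObj ?A. ?\<pi> m a \<cdot> h = ?q a)"
      using no [OF m] unfolding is_nat_object_def by blast
    have "(\<forall>a\<in>VObj ?A. ?\<pi> m a \<cdot> h = ?q a) \<longleftrightarrow> (\<forall>c\<in>Obj C. bc (cmp (Do c) l m) h (?\<nu> c) = \<kappa> c)" if h: "h \<in> hm X (hob l m)" for h
    proof -
      have [simp]: "h \<in> Arr V" "Dom V h = X" "Cod V h = hob l m" using h by (auto simp: homset_iff)
      have "curry_arr V (hob l m) (Fobj F c) (hob (Do c) m) (?\<kappa> m c) \<cdot> h = curry_arr V X (Fobj F c) (hob (Do c) m) (\<kappa> c) \<longleftrightarrow> bc (cmp (Do c) l m) h (?\<nu> c) = \<kappa> c"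
        (is "?a = ?b \<longleftrightarrow> _") if [simp]: "c \<in> Obj C" for c
      proof -
        note [simp] = curry_simps
        have a: "ev (Fobj F c) (hob (Do c) m) \<cdot> (?a \<boxtimes> idn (Fobj F c)) = bc (cmp (Do c) l m) h (?\<nu> c)"
          by (subst eval_curry) (simp_all, simp add: bc_def Comp_assoc merge)
        have b: "ev (Fobj F c) (hob (Do c) m) \<cdot> (?b \<boxtimes> idn (Fobj F c)) = \<kappa> c" by simp
        show ?thesis
        proof
          assume "?a = ?b" then show "bc (cmp (Do c) l m) h (?\<nu> c) = \<kappa> c" using a b by simp
        next
          assume eq: "bc (cmp (Do c) l m) h (?\<nu> c) = \<kappa> c"
          show "?a = ?b"
            by (rule curry_unique [of _ _ "Fobj F c" "hob (Do c) m"]) (simp_all only: a b eq, simp_all)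
        qed
      qed
      then show ?thesis by (simp add: free_vcat_def)
    qed
    then show "\<exists>!h. h \<in> hm X (hob l m) \<and> (\<forall>c\<in>Obj C. bc (cmp (Do c) l m) h (?\<nu> c) = \<kappa> c)"
      using ex by (simp cong: conj_cong)
  qed
  then show ?thesis by blast
qed

end

text \<open>The colimit of the empty diagram.\<close>

lemma (in tensored) initial_exists:
  assumes "vcomplete TYPE('u) V (vop V M)" "universe TYPE('u)"
  shows "\<exists>z. is_initial (underlying V M) z"
proof -
  let ?A = "\<lparr>VObj = {}, VHom = undefined, VId = undefined, VComp = undefined\<rparr> :: ('u, 'o, 'a) vcat"
  let ?W = "\<lparr>VFobj = (\<lambda>_. undefined), VFarr = (\<lambda>_. undefined)\<rparr> :: ('u, 'o, 'a) vfunctr"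
  let ?F = "\<lparr>VFobj = (\<lambda>_. undefined), VFarr = (\<lambda>_. undefined)\<rparr> :: ('u, 'm, 'a) vfunctr"
  have "vcategory V ?A" "is_vfunctor V ?A (vself V) ?W" "is_vfunctor V ?A (vop V M) ?F"
    by (simp_all add: vcategory_def is_vfunctor_def)
  moreover have "small TYPE('u) (VObj ?A)"
    unfolding small_def by (simp add: card_of_empty4)
  ultimately obtain l \<mu> where wl: "is_weighted_limit V ?A (vop V M) ?W ?F l \<mu>"
    using assms(1) unfolding vcomplete_def by blast
  have "is_initial (underlying V M) l"
    unfolding initial_iff
  proof (intro conjI ballI)
    show "l \<in> VObj M" using wl by (simp add: is_weighted_limit_def vop_def)
    fix n assume "n \<in> VObj M"
    then obtain S \<pi> where "is_nat_object V ?A (vself V) ?W S (hob l n) \<pi>"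
      using wl by (auto simp: is_weighted_limit_def vop_def)
    moreover have "vnat_family V ?A (vself V) ?W S I \<pi>" by (simp add: vnat_family_def)
    ultimately show "\<exists>!h. h \<in> hm I (hob l n)" by (auto simp: is_nat_object_def)
  qed
  then show ?thesis by blast
qed

section \<open>Contracting the category of factorizations\<close>

lemma functor_comp_functor:
  assumes "category C" "is_functor C K F" "is_functor K L G"
  shows "is_functor C L (functor_comp C G F)"
proof -
  interpret C: categ C using assms(1) by unfold_locales
  show ?thesis unfolding is_functor_def functor_comp_def homset_iff
    using is_functorD [OF assms(2)] is_functorD [OF assms(3)] by (auto simp: homset_iff)
qed

text \<open>The part of the argument that uses the extension through its universal property only. \<open>LQ\<close> consists of
  the left Quillen functors \<open>L\<close>, with restrictions \<open>res L : C \<rightarrow> K\<close>; the relation \<open>tr L L'\<close> holds of the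
  transformations \<open>L \<rightarrow> L'\<close>, with identities \<open>idt\<close> and composition \<open>ct\<close>, and \<open>res_arr\<close> restricts them;
  \<open>W\<close> is the class of weak equivalences. The pair \<open>(Q, q)\<close> is a cofibrant replacement on \<open>K\<close>.\<close>

locale weak_factorizations = C: categ C + K: categ K
  for C :: "('c, 'd) cat" and K :: "('p, 'b) cat" +
  fixes LQ :: "'l set" and tr :: "'l \<Rightarrow> 'l \<Rightarrow> 't \<Rightarrow> bool" and idt :: "'l \<Rightarrow> 't"
    and ct :: "'l \<Rightarrow> 'l \<Rightarrow> 'l \<Rightarrow> 't \<Rightarrow> 't \<Rightarrow> 't"
    and res :: "'l \<Rightarrow> ('c, 'd, 'p, 'b) functr" and res_arr :: "'l \<Rightarrow> 'l \<Rightarrow> 't \<Rightarrow> 'c \<Rightarrow> 'b"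
    and W :: "'b set" and \<gamma> :: "('c, 'd, 'p, 'b) functr"
    and cofib :: "'p \<Rightarrow> bool" and Q :: "('p, 'b, 'p, 'b) functr" and q :: "'p \<Rightarrow> 'b"
  assumes tr_id: "\<And>L. L \<in> LQ \<Longrightarrow> tr L L (idt L)"
    and tr_comp: "\<And>L L' L'' \<sigma> \<tau>. \<lbrakk>L \<in> LQ; L' \<in> LQ; L'' \<in> LQ; tr L L' \<tau>; tr L' L'' \<sigma>\<rbrakk> \<Longrightarrow> tr L L'' (ct L L' L'' \<sigma> \<tau>)"
    and ct_id: "\<And>L L' \<tau>. \<lbrakk>L \<in> LQ; L' \<in> LQ; tr L L' \<tau>\<rbrakk> \<Longrightarrow> ct L L L' \<tau> (idt L) = \<tau> \<and> ct L L' L' (idt L') \<tau> = \<tau>"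
    and ct_assoc: "\<And>L1 L2 L3 L4 \<rho> \<sigma> \<tau>. \<lbrakk>L1 \<in> LQ; L2 \<in> LQ; L3 \<in> LQ; L4 \<in> LQ; tr L1 L2 \<tau>; tr L2 L3 \<sigma>; tr L3 L4 \<rho>\<rbrakk> \<Longrightarrow>
        ct L1 L3 L4 \<rho> (ct L1 L2 L3 \<sigma> \<tau>) = ct L1 L2 L4 (ct L2 L3 L4 \<rho> \<sigma>) \<tau>"
    and res: "\<And>L. L \<in> LQ \<Longrightarrow> is_functor C K (res L)"
    and res_arr: "\<And>L L' \<tau>. \<lbrakk>L \<in> LQ; L' \<in> LQ; tr L L' \<tau>\<rbrakk> \<Longrightarrow> nat_trans C K (res L) (res L') (res_arr L L' \<tau>)"
    and res_arr_idt: "\<And>L c. \<lbrakk>L \<in> LQ; c \<in> Obj C\<rbrakk> \<Longrightarrow> res_arr L L (idt L) c = Idn K (Fobj (res L) c)"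
    and res_arr_ct: "\<And>L L' L'' \<sigma> \<tau> c. \<lbrakk>L \<in> LQ; L' \<in> LQ; L'' \<in> LQ; tr L L' \<tau>; tr L' L'' \<sigma>; c \<in> Obj C\<rbrakk> \<Longrightarrow>
        res_arr L L'' (ct L L' L'' \<sigma> \<tau>) c = Comp K (res_arr L' L'' \<sigma> c) (res_arr L L' \<tau> c)"
    and W_Arr: "W \<subseteq> Arr K" and W_iso: "\<And>f. is_iso K f \<Longrightarrow> f \<in> W" and W_two_of_three: "two_out_of_three K W"
    and \<gamma>: "is_functor C K \<gamma>"
    and Q: "is_functor K K Q" and Q_cofib: "\<And>x. x \<in> Obj K \<Longrightarrow> cofib (Fobj Q x)"
    and q_hom: "\<And>x. x \<in> Obj K \<Longrightarrow> q x \<in> homset K (Fobj Q x) x" and q_W: "\<And>x. x \<in> Obj K \<Longrightarrow> q x \<in> W"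
    and q_natural: "\<And>f. f \<in> Arr K \<Longrightarrow> Comp K (q (Cod K f)) (Farr Q f) = Comp K f (q (Dom K f))"
    and extension_exists: "\<And>D. \<lbrakk>is_functor C K D; \<And>c. c \<in> Obj C \<Longrightarrow> cofib (Fobj D c)\<rbrakk> \<Longrightarrow>
        \<exists>L i. L \<in> LQ \<and> nat_trans C K D (res L) i \<and> (\<forall>c\<in>Obj C. is_iso K (i c)) \<and>
          (\<forall>L'\<in>LQ. \<forall>\<zeta>. nat_trans C K D (res L') \<zeta> \<longrightarrow>
             (\<exists>!\<tau>. tr L L' \<tau> \<and> (\<forall>c\<in>Obj C. Comp K (res_arr L L' \<tau> c) (i c) = \<zeta> c)))"
begin

definition fobj :: "('l \<times> ('c \<Rightarrow> 'b)) set" where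
  "fobj = {(L, \<eta>). L \<in> LQ \<and> nat_trans C K (res L) \<gamma> \<eta> \<and> (\<forall>c\<in>Obj C. \<eta> c \<in> W)}"

definition farr :: "(('l \<times> ('c \<Rightarrow> 'b)) \<times> ('l \<times> ('c \<Rightarrow> 'b)) \<times> 't) set" where
  "farr = {((L, \<eta>), (L', \<eta>'), \<tau>). (L, \<eta>) \<in> fobj \<and> (L', \<eta>') \<in> fobj \<and> tr L L' \<tau> \<and>
     (\<forall>c\<in>Obj C. Comp K (\<eta>' c) (res_arr L L' \<tau> c) = \<eta> c)}"

definition fcat :: "('l \<times> ('c \<Rightarrow> 'b), ('l \<times> ('c \<Rightarrow> 'b)) \<times> ('l \<times> ('c \<Rightarrow> 'b)) \<times> 't) cat" where
  "fcat = \<lparr>Obj = fobj, Arr = farr, Dom = (\<lambda>(X, Y, \<tau>). X), Cod = (\<lambda>(X, Y, \<tau>). Y),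
     Idn = (\<lambda>(L, \<eta>). ((L, \<eta>), (L, \<eta>), idt L)),
     Comp = (\<lambda>(Y', Z, \<sigma>) (X, Y, \<tau>). (X, Z, ct (fst X) (fst Y) (fst Z) \<sigma> \<tau>))\<rparr>"

lemma fobj_iff: "X \<in> fobj \<longleftrightarrow> fst X \<in> LQ \<and> nat_trans C K (res (fst X)) \<gamma> (snd X) \<and> (\<forall>c\<in>Obj C. snd X c \<in> W)"
  by (cases X) (simp add: fobj_def)

lemma farr_iff: "(X, Y, \<tau>) \<in> farr \<longleftrightarrow> X \<in> fobj \<and> Y \<in> fobj \<and> tr (fst X) (fst Y) \<tau> \<and>
    (\<forall>c\<in>Obj C. Comp K (snd Y c) (res_arr (fst X) (fst Y) \<tau> c) = snd X c)"
  by (cases X; cases Y) (auto simp: farr_def)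

lemma fcat_simps [simp]:
  "Obj fcat = fobj" "Arr fcat = farr" "Dom fcat (X, Y, \<tau>) = X" "Cod fcat (X, Y, \<tau>) = Y"
  "Idn fcat X = (X, X, idt (fst X))"
  "Comp fcat (Y', Z, \<sigma>) (X, Y, \<tau>) = (X, Z, ct (fst X) (fst Y) (fst Z) \<sigma> \<tau>)"
  by (simp_all add: fcat_def split: prod.split)

lemma fobjD:
  assumes "X \<in> fobj"
  shows "fst X \<in> LQ" "is_functor C K (res (fst X))" "nat_trans C K (res (fst X)) \<gamma> (snd X)" "c \<in> Obj C \<Longrightarrow> snd X c \<in> W"
  using assms res by (auto simp: fobj_iff)

lemma farrD:
  assumes "(X, Y, \<tau>) \<in> farr"
  shows "X \<in> fobj" "Y \<in> fobj" "tr (fst X) (fst Y) \<tau>" "nat_trans C K (res (fst X)) (res (fst Y)) (res_arr (fst X) (fst Y) \<tau>)"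
    "c \<in> Obj C \<Longrightarrow> Comp K (snd Y c) (res_arr (fst X) (fst Y) \<tau> c) = snd X c"
  using assms fobjD res_arr by (auto simp: farr_iff)

lemma farr_comp:
  assumes a: "(X, Y, \<tau>) \<in> farr" and b: "(Y, Z, \<sigma>) \<in> farr"
  shows "(X, Z, ct (fst X) (fst Y) (fst Z) \<sigma> \<tau>) \<in> farr"
  unfolding farr_iff
proof (intro conjI ballI)
  note aD = farrD [OF a] and bD = farrD [OF b]
  note X = fobjD [OF aD(1)] and Y = fobjD [OF aD(2)] and Z = fobjD [OF bD(2)]
  show "X \<in> fobj" "Z \<in> fobj" using aD bD by simp_all
  show "tr (fst X) (fst Z) (ct (fst X) (fst Y) (fst Z) \<sigma> \<tau>)"
    using X(1) Y(1) Z(1) aD(3) bD(3) by (rule tr_comp)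
  fix c assume c [simp]: "c \<in> Obj C"
  have "Comp K (snd Z c) (res_arr (fst X) (fst Z) (ct (fst X) (fst Y) (fst Z) \<sigma> \<tau>) c) =
      Comp K (snd Z c) (Comp K (res_arr (fst Y) (fst Z) \<sigma> c) (res_arr (fst X) (fst Y) \<tau> c))"
    using X(1) Y(1) Z(1) aD(3) bD(3) by (simp add: res_arr_ct)
  also have "\<dots> = Comp K (Comp K (snd Z c) (res_arr (fst Y) (fst Z) \<sigma> c)) (res_arr (fst X) (fst Y) \<tau> c)"
    using nat_transD(1-3) [OF aD(4)] nat_transD(1-3) [OF bD(4)] nat_transD(1-3) [OF Z(3)] by (simp add: K.Comp_assoc)
  also have "\<dots> = snd X c" using aD(5) bD(5) by simp
  finally show "Comp K (snd Z c) (res_arr (fst X) (fst Z) (ct (fst X) (fst Y) (fst Z) \<sigma> \<tau>) c) = snd X c" .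
qed

lemma farr_id: "X \<in> fobj \<Longrightarrow> (X, X, idt (fst X)) \<in> farr"
  unfolding farr_iff using fobjD nat_transD [OF fobjD(3)] by (simp add: tr_id res_arr_idt)

lemma fcat_category: "category fcat"
  unfolding category_def
proof (intro conjI ballI impI)
  show "Dom fcat f \<in> Obj fcat" "Cod fcat f \<in> Obj fcat" if "f \<in> Arr fcat" for f
    using that by (cases f, auto simp: farr_iff)+
  show "Idn fcat X \<in> homset fcat X X" if "X \<in> Obj fcat" for X
    using that farr_id by (simp add: homset_iff)
  show "Comp fcat g f \<in> homset fcat (Dom fcat f) (Cod fcat g)"
    if "f \<in> Arr fcat" "g \<in> Arr fcat" "Cod fcat f = Dom fcat g" for f g
    using that farr_comp by (cases f, cases g, simp add: homset_iff)
  show "Comp fcat f (Idn fcat (Dom fcat f)) = f" "Comp fcat (Idn fcat (Cod fcat f)) f = f" if "f \<in> Arr fcat" for f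
    using that by (cases f, simp add: ct_id farr_iff fobj_iff)+
  show "Comp fcat h (Comp fcat g f) = Comp fcat (Comp fcat h g) f"
    if "f \<in> Arr fcat" "g \<in> Arr fcat" "h \<in> Arr fcat" "Cod fcat f = Dom fcat g \<and> Cod fcat g = Dom fcat h" for f g h
    using that by (cases f, cases g, cases h, simp add: ct_assoc farr_iff fobj_iff)
qed

lemma nat_comp:
  assumes F: "is_functor C K F" and G: "is_functor C K G" and H: "is_functor C K H"
    and \<theta>: "nat_trans C K F G \<theta>" and \<sigma>: "nat_trans C K G H \<sigma>"
  shows "nat_trans C K F H (\<lambda>c\<in>Obj C. Comp K (\<sigma> c) (\<theta> c))"
  unfolding nat_trans_def homset_iff
proof (intro conjI ballI)
  note D = is_functorD [OF F] is_functorD [OF G] is_functorD [OF H] nat_transD(1-3) [OF \<theta>] nat_transD(1-3) [OF \<sigma>]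
  show "(\<lambda>c\<in>Obj C. Comp K (\<sigma> c) (\<theta> c)) \<in> Obj C \<rightarrow>\<^sub>E Arr K" using D by auto
  fix f assume f: "f \<in> Arr C"
  have "Comp K (Comp K (\<sigma> (Cod C f)) (\<theta> (Cod C f))) (Farr F f) = Comp K (\<sigma> (Cod C f)) (Comp K (\<theta> (Cod C f)) (Farr F f))"
    using D f by (simp add: K.Comp_assoc)
  also have "\<dots> = Comp K (Comp K (\<sigma> (Cod C f)) (Farr G f)) (\<theta> (Dom C f))"
    unfolding nat_transD(4) [OF \<theta> f] using D f by (simp add: K.Comp_assoc)
  also have "\<dots> = Comp K (Farr H f) (Comp K (\<sigma> (Dom C f)) (\<theta> (Dom C f)))"
    unfolding nat_transD(4) [OF \<sigma> f] using D f by (simp add: K.Comp_assoc)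
  finally show "Comp K ((\<lambda>c\<in>Obj C. Comp K (\<sigma> c) (\<theta> c)) (Cod C f)) (Farr F f) = Comp K (Farr H f) ((\<lambda>c\<in>Obj C. Comp K (\<sigma> c) (\<theta> c)) (Dom C f))"
    using f by simp
qed (use nat_transD [OF \<theta>] nat_transD [OF \<sigma>] in auto)

abbreviation "QF F \<equiv> functor_comp C Q F"

lemma QF_functor: "is_functor C K F \<Longrightarrow> is_functor C K (QF F)"
  using functor_comp_functor [OF C.category _ Q] .

lemma QF_simps [simp]:
  "c \<in> Obj C \<Longrightarrow> Fobj (QF F) c = Fobj Q (Fobj F c)" "u \<in> Arr C \<Longrightarrow> Farr (QF F) u = Farr Q (Farr F u)"
  by (simp_all add: functor_comp_def)

lemma q_nat:
  assumes F: "is_functor C K F"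
  shows "nat_trans C K (QF F) F (\<lambda>c\<in>Obj C. q (Fobj F c))"
  unfolding nat_trans_def using is_functorD [OF F] q_hom q_natural [OF is_functorD(2) [OF F]] by (auto simp: homset_iff)

lemma Q_nat:
  assumes \<theta>: "nat_trans C K F G \<theta>" and F: "is_functor C K F" and G: "is_functor C K G"
  shows "nat_trans C K (QF F) (QF G) (\<lambda>c\<in>Obj C. Farr Q (\<theta> c))"
  unfolding nat_trans_def homset_iff
proof (intro conjI ballI)
  note D = nat_transD(1-3) [OF \<theta>] is_functorD(1-4) [OF F] is_functorD(1-4) [OF G]
  fix u assume u: "u \<in> Arr C"
  show "Comp K ((\<lambda>c\<in>Obj C. Farr Q (\<theta> c)) (Cod C u)) (Farr (QF F) u) = Comp K (Farr (QF G) u) ((\<lambda>c\<in>Obj C. Farr Q (\<theta> c)) (Dom C u))"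
    using u D nat_transD(4) [OF \<theta> u] by (simp flip: is_functorD(6) [OF Q])
qed (use nat_transD [OF \<theta>] is_functorD [OF Q] in auto)

text \<open>The extension of \<open>Q F\<close>, with the comparison isomorphism from \<open>Q F\<close> to its restriction.\<close>

definition extn :: "('c, 'd, 'p, 'b) functr \<Rightarrow> 'l \<times> ('c \<Rightarrow> 'b)" where
  "extn F = (SOME (L, i). L \<in> LQ \<and> nat_trans C K (QF F) (res L) i \<and> (\<forall>c\<in>Obj C. is_iso K (i c)) \<and>
     (\<forall>L'\<in>LQ. \<forall>\<zeta>. nat_trans C K (QF F) (res L') \<zeta> \<longrightarrow>
        (\<exists>!\<tau>. tr L L' \<tau> \<and> (\<forall>c\<in>Obj C. Comp K (res_arr L L' \<tau> c) (i c) = \<zeta> c))))"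

abbreviation "lo F \<equiv> fst (extn F)"
abbreviation "li F \<equiv> snd (extn F)"

lemma extn_props:
  assumes F: "is_functor C K F"
  shows "lo F \<in> LQ" "nat_trans C K (QF F) (res (lo F)) (li F)" "c \<in> Obj C \<Longrightarrow> is_iso K (li F c)"
    and "L' \<in> LQ \<Longrightarrow> nat_trans C K (QF F) (res L') \<zeta> \<Longrightarrow>
      \<exists>!\<tau>. tr (lo F) L' \<tau> \<and> (\<forall>c\<in>Obj C. Comp K (res_arr (lo F) L' \<tau> c) (li F c) = \<zeta> c)"
proof -
  let ?P = "\<lambda>L i. L \<in> LQ \<and> nat_trans C K (QF F) (res L) i \<and> (\<forall>c\<in>Obj C. is_iso K (i c)) \<and>
     (\<forall>L'\<in>LQ. \<forall>\<zeta>. nat_trans C K (QF F) (res L') \<zeta> \<longrightarrow>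
        (\<exists>!\<tau>. tr L L' \<tau> \<and> (\<forall>c\<in>Obj C. Comp K (res_arr L L' \<tau> c) (i c) = \<zeta> c)))"
  have "\<exists>L i. ?P L i"
    using is_functorD(1) [OF F] by (intro extension_exists QF_functor F) (simp add: Q_cofib)
  then have "\<exists>p. case p of (L, i) \<Rightarrow> ?P L i" by auto
  then have "case extn F of (L, i) \<Rightarrow> ?P L i" unfolding extn_def by (rule someI_ex)
  then have P: "?P (lo F) (li F)" by (simp add: case_prod_beta)
  then show "lo F \<in> LQ" "nat_trans C K (QF F) (res (lo F)) (li F)" "c \<in> Obj C \<Longrightarrow> is_iso K (li F c)" by blast+
  show "\<exists>!\<tau>. tr (lo F) L' \<tau> \<and> (\<forall>c\<in>Obj C. Comp K (res_arr (lo F) L' \<tau> c) (li F c) = \<zeta> c)"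
    if "L' \<in> LQ" "nat_trans C K (QF F) (res L') \<zeta>"
    using P that by blast
qed

definition fac :: "('c, 'd, 'p, 'b) functr \<Rightarrow> 'l \<Rightarrow> ('c \<Rightarrow> 'b) \<Rightarrow> 't" where
  "fac F L' \<zeta> = (THE \<tau>. tr (lo F) L' \<tau> \<and> (\<forall>c\<in>Obj C. Comp K (res_arr (lo F) L' \<tau> c) (li F c) = \<zeta> c))"

lemma fac_props:
  assumes "is_functor C K F" "L' \<in> LQ" "nat_trans C K (QF F) (res L') \<zeta>"
  shows "tr (lo F) L' (fac F L' \<zeta>)" "c \<in> Obj C \<Longrightarrow> Comp K (res_arr (lo F) L' (fac F L' \<zeta>) c) (li F c) = \<zeta> c"
  using theI' [OF extn_props(4) [OF assms]] by (simp_all add: fac_def)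

lemma tr_unique:
  assumes F: "is_functor C K F" and L': "L' \<in> LQ" and \<tau>: "tr (lo F) L' \<tau>" and \<sigma>: "tr (lo F) L' \<sigma>"
    and eq: "\<And>c. c \<in> Obj C \<Longrightarrow> Comp K (res_arr (lo F) L' \<tau> c) (li F c) = Comp K (res_arr (lo F) L' \<sigma> c) (li F c)"
  shows "\<tau> = \<sigma>"
proof -
  have "nat_trans C K (QF F) (res L') (\<lambda>c\<in>Obj C. Comp K (res_arr (lo F) L' \<tau> c) (li F c))"
    by (rule nat_comp [OF QF_functor [OF F] res [OF extn_props(1) [OF F]] res [OF L'] extn_props(2) [OF F] res_arr [OF extn_props(1) [OF F] L' \<tau>]])
  from extn_props(4) [OF F L' this] show ?thesis using \<tau> \<sigma> eq by auto
qed

abbreviation "el L \<equiv> lo (res L)"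
abbreviation "ei L \<equiv> li (res L)"

lemmas li_hom = nat_transD(1-3) [OF extn_props(2)]
lemmas tr_hom = nat_transD(1-3) [OF res_arr]

lemma tr_triangle:
  assumes F: "is_functor C K F" and L: "L \<in> LQ" "L' \<in> LQ" and \<tau>: "tr (lo F) L \<tau>" and \<sigma>: "tr L L' \<sigma>" and c: "c \<in> Obj C"
  shows "Comp K (res_arr (lo F) L' (ct (lo F) L L' \<sigma> \<tau>) c) (li F c) = Comp K (res_arr L L' \<sigma> c) (Comp K (res_arr (lo F) L \<tau> c) (li F c))"
  using res_arr_ct [OF extn_props(1) [OF F] L \<tau> \<sigma> c] tr_hom [OF extn_props(1) [OF F] L(1) \<tau> c] tr_hom [OF L \<sigma> c] li_hom [OF F c]
  by (simp add: K.Comp_assoc)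

lemma W_comp: "f \<in> W \<Longrightarrow> g \<in> W \<Longrightarrow> Cod K f = Dom K g \<Longrightarrow> Comp K g f \<in> W"
  using W_two_of_three W_Arr unfolding two_out_of_three_def by blast

lemma W_cancel: "f \<in> W \<Longrightarrow> g \<in> Arr K \<Longrightarrow> Cod K f = Dom K g \<Longrightarrow> Comp K g f \<in> W \<Longrightarrow> g \<in> W"
  using W_two_of_three W_Arr unfolding two_out_of_three_def by blast

subsection \<open>Replacing a factorization by the extension of its cofibrant replacement\<close>

text \<open>The transformation from the extension of \<open>Q L y\<close> to \<open>L\<close> that corresponds to \<open>q : Q L y \<rightarrow> L y\<close>.\<close>

definition counit :: "'l \<times> ('c \<Rightarrow> 'b) \<Rightarrow> 't" where
  "counit X = fac (res (fst X)) (fst X) (\<lambda>c\<in>Obj C. q (Fobj (res (fst X)) c))"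

definition repl :: "'l \<times> ('c \<Rightarrow> 'b) \<Rightarrow> 'l \<times> ('c \<Rightarrow> 'b)" where
  "repl X = (el (fst X), \<lambda>c\<in>Obj C. Comp K (snd X c) (res_arr (el (fst X)) (fst X) (counit X) c))"

lemma counit_props:
  assumes "X \<in> fobj"
  shows "tr (el (fst X)) (fst X) (counit X)"
    and "c \<in> Obj C \<Longrightarrow> Comp K (res_arr (el (fst X)) (fst X) (counit X) c) (ei (fst X) c) = q (Fobj (res (fst X)) c)"
  using fac_props [OF fobjD(2,1) [OF assms] q_nat [OF fobjD(2) [OF assms]]] by (simp_all add: counit_def)

lemma counit_simps:
  assumes X: "X \<in> fobj" and c: "c \<in> Obj C"
  shows "res_arr (el (fst X)) (fst X) (counit X) c \<in> Arr K"
    "Dom K (res_arr (el (fst X)) (fst X) (counit X) c) = Fobj (res (el (fst X))) c"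
    "Cod K (res_arr (el (fst X)) (fst X) (counit X) c) = Fobj (res (fst X)) c"
  using tr_hom [OF extn_props(1) [OF fobjD(2) [OF X]] fobjD(1) [OF X] counit_props(1) [OF X] c] by simp_all

lemma repl_simps:
  "fst (repl X) = el (fst X)"
  "c \<in> Obj C \<Longrightarrow> snd (repl X) c = Comp K (snd X c) (res_arr (el (fst X)) (fst X) (counit X) c)"
  by (simp_all add: repl_def)

lemma repl_li:
  assumes X: "X \<in> fobj" and c: "c \<in> Obj C"
  shows "Comp K (snd (repl X) c) (ei (fst X) c) = Comp K (snd X c) (q (Fobj (res (fst X)) c))"
  using counit_simps [OF X c] counit_props(2) [OF X c] li_hom [OF fobjD(2) [OF X] c] nat_transD(1-3) [OF fobjD(3) [OF X] c] c
  by (simp add: repl_simps K.Comp_assoc)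

text \<open>Composed with the comparison isomorphism, the new transformation is \<open>\<eta> q\<close>, a weak equivalence; so it is
  one itself, by two out of three.\<close>

lemma repl_fobj:
  assumes X: "X \<in> fobj"
  shows "repl X \<in> fobj"
  unfolding fobj_iff repl_simps
proof (intro conjI ballI)
  note F = fobjD(2) [OF X]
  show L: "el (fst X) \<in> LQ" using extn_props(1) [OF F] .
  show n: "nat_trans C K (res (el (fst X))) \<gamma> (snd (repl X))"
    unfolding repl_def snd_conv
    by (rule nat_comp [OF res [OF L] F \<gamma> res_arr [OF L fobjD(1) [OF X] counit_props(1) [OF X]] fobjD(3) [OF X]])
  fix c assume c: "c \<in> Obj C"
  show "snd (repl X) c \<in> W"
  proof (rule W_cancel)
    show "ei (fst X) c \<in> W" using W_iso extn_props(3) [OF F c] .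
    show "Comp K (snd (repl X) c) (ei (fst X) c) \<in> W"
      unfolding repl_li [OF X c] using fobjD(4) [OF X c] q_W is_functorD(1) [OF F c] nat_transD(2) [OF fobjD(3) [OF X] c] q_hom [of "Fobj (res (fst X)) c"]
      by (intro W_comp) (auto simp: homset_iff)
  qed (use li_hom [OF F c] nat_transD [OF n] c in simp_all)
qed

lemma counit_farr: "X \<in> fobj \<Longrightarrow> (repl X, X, counit X) \<in> farr"
  by (simp add: farr_iff repl_fobj counit_props repl_simps)

definition repl_arr :: "'l \<Rightarrow> 'l \<Rightarrow> 't \<Rightarrow> 't" where
  "repl_arr L L' \<tau> = fac (res L) (el L') (\<lambda>c\<in>Obj C. Comp K (ei L' c) (Farr Q (res_arr L L' \<tau> c)))"

lemma repl_arr_props: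
  assumes L: "L \<in> LQ" "L' \<in> LQ" and \<tau>: "tr L L' \<tau>"
  shows "tr (el L) (el L') (repl_arr L L' \<tau>)"
    and "c \<in> Obj C \<Longrightarrow> Comp K (res_arr (el L) (el L') (repl_arr L L' \<tau>) c) (ei L c) =
           Comp K (ei L' c) (Farr Q (res_arr L L' \<tau> c))"
proof -
  note F = res [OF L(1)] and G = res [OF L(2)]
  note n = nat_comp [OF QF_functor [OF F] QF_functor [OF G] res [OF extn_props(1) [OF G]]
      Q_nat [OF res_arr [OF L \<tau>] F G] extn_props(2) [OF G]]
  have e: "(\<lambda>c\<in>Obj C. Comp K (ei L' c) ((\<lambda>c\<in>Obj C. Farr Q (res_arr L L' \<tau> c)) c)) =
      (\<lambda>c\<in>Obj C. Comp K (ei L' c) (Farr Q (res_arr L L' \<tau> c)))"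
    by (auto simp: restrict_def)
  note f = fac_props [OF F extn_props(1) [OF G] n [unfolded e], folded repl_arr_def]
  show "tr (el L) (el L') (repl_arr L L' \<tau>)" by (rule f(1))
  show "Comp K (res_arr (el L) (el L') (repl_arr L L' \<tau>) c) (ei L c) =
           Comp K (ei L' c) (Farr Q (res_arr L L' \<tau> c))" if "c \<in> Obj C"
    using f(2) [OF that] that by simp
qed

text \<open>Transformations out of an extension are determined by their composites with the comparison isomorphism,
  and there the claim is naturality of \<open>q\<close>.\<close>

lemma counit_natural:
  assumes a: "(X, Y, \<tau>) \<in> farr"
  shows "ct (el (fst X)) (el (fst Y)) (fst Y) (counit Y) (repl_arr (fst X) (fst Y) \<tau>) =
    ct (el (fst X)) (fst X) (fst Y) \<tau> (counit X)"
  (is "?lhs = ?rhs")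
proof -
  note X = farrD(1) [OF a] and Y = farrD(2) [OF a]
  note LX = fobjD(1) [OF X] and LY = fobjD(1) [OF Y] and t = farrD(3) [OF a]
  note FX = res [OF LX] and FY = res [OF LY]
  note eX = extn_props(1) [OF FX] and eY = extn_props(1) [OF FY]
  note r = repl_arr_props [OF LX LY t] and cX = counit_props [OF X] and cY = counit_props [OF Y]
  show ?thesis
  proof (rule tr_unique [OF FX LY])
    show "tr (el (fst X)) (fst Y) ?lhs"
      by (rule tr_comp [OF eX eY LY r(1) cY(1)])
    show "tr (el (fst X)) (fst Y) ?rhs"
      by (rule tr_comp [OF eX LX LY cX(1) t])
    fix c assume c: "c \<in> Obj C"
    note h = tr_hom [OF LX LY t c]
    have "Comp K (res_arr (el (fst X)) (fst Y) ?lhs c) (ei (fst X) c)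
      = Comp K (res_arr (el (fst Y)) (fst Y) (counit Y) c) (Comp K (ei (fst Y) c) (Farr Q (res_arr (fst X) (fst Y) \<tau> c)))"
      unfolding tr_triangle [OF FX eY LY r(1) cY(1) c] r(2) [OF c] ..
    also have "\<dots> = Comp K (Comp K (res_arr (el (fst Y)) (fst Y) (counit Y) c) (ei (fst Y) c)) (Farr Q (res_arr (fst X) (fst Y) \<tau> c))"
      using counit_simps [OF Y c] li_hom [OF FY c] h is_functorD(2-4) [OF Q h(1)] c by (subst K.Comp_assoc) simp_all
    also have "\<dots> = Comp K (res_arr (fst X) (fst Y) \<tau> c) (q (Fobj (res (fst X)) c))"
      unfolding cY(2) [OF c] using q_natural [OF h(1)] h by simp
    also have "\<dots> = Comp K (res_arr (el (fst X)) (fst Y) ?rhs c) (ei (fst X) c)"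
      unfolding tr_triangle [OF FX LX LY cX(1) t c] cX(2) [OF c] ..
    finally show "Comp K (res_arr (el (fst X)) (fst Y) ?lhs c) (ei (fst X) c)
      = Comp K (res_arr (el (fst X)) (fst Y) ?rhs c) (ei (fst X) c)" .
  qed
qed

lemma repl_arr_farr:
  assumes a: "(X, Y, \<tau>) \<in> farr"
  shows "(repl X, repl Y, repl_arr (fst X) (fst Y) \<tau>) \<in> farr"
  unfolding farr_iff
proof (intro conjI ballI)
  note X = farrD(1) [OF a] and Y = farrD(2) [OF a] and t = farrD(3) [OF a]
  note LX = fobjD(1) [OF X] and LY = fobjD(1) [OF Y]
  note r = repl_arr_props(1) [OF LX LY t]
  show "repl X \<in> fobj" "repl Y \<in> fobj" using repl_fobj X Y by auto
  note LX' = fobjD(1) [OF repl_fobj [OF X]] and LY' = fobjD(1) [OF repl_fobj [OF Y]]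
  show r': "tr (fst (repl X)) (fst (repl Y)) (repl_arr (fst X) (fst Y) \<tau>)" using r by (simp add: repl_simps)
  fix c assume c: "c \<in> Obj C"
  let ?r = "res_arr (fst (repl X)) (fst (repl Y)) (repl_arr (fst X) (fst Y) \<tau>) c"
  note h = tr_hom [OF LX' LY' r' c]
  note cX = counit_farr [OF X] and cY = counit_farr [OF Y]
  note hX = tr_hom [OF farrD(1) [OF cX, THEN fobjD(1)] farrD(2) [OF cX, THEN fobjD(1)] farrD(3) [OF cX] c]
  note hY = tr_hom [OF farrD(1) [OF cY, THEN fobjD(1)] farrD(2) [OF cY, THEN fobjD(1)] farrD(3) [OF cY] c]
  note ht = tr_hom [OF LX LY t c]
  have "Comp K (snd (repl Y) c) ?r = Comp K (snd Y c) (Comp K (res_arr (fst (repl Y)) (fst Y) (counit Y) c) ?r)"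
    using c h hY nat_transD(1-3) [OF fobjD(3) [OF Y] c] farrD(5) [OF cY c, symmetric] by (simp add: K.Comp_assoc)
  also have "Comp K (res_arr (fst (repl Y)) (fst Y) (counit Y) c) ?r = Comp K (res_arr (fst X) (fst Y) \<tau> c) (res_arr (fst (repl X)) (fst X) (counit X) c)"
    unfolding res_arr_ct [OF LX' LY' LY r' farrD(3) [OF cY] c, symmetric] res_arr_ct [OF LX' LX LY farrD(3) [OF cX] t c, symmetric]
    using counit_natural [OF a] by (simp add: repl_simps)
  also have "Comp K (snd Y c) \<dots> = Comp K (Comp K (snd Y c) (res_arr (fst X) (fst Y) \<tau> c)) (res_arr (fst (repl X)) (fst X) (counit X) c)"
    using hX ht nat_transD(1-3) [OF fobjD(3) [OF Y] c] by (subst K.Comp_assoc) simp_all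
  also have "\<dots> = snd (repl X) c" unfolding farrD(5) [OF a c] farrD(5) [OF cX c] ..
  finally show "Comp K (snd (repl Y) c) ?r = snd (repl X) c" .
qed

lemma repl_arr_id:
  assumes L: "L \<in> LQ"
  shows "repl_arr L L (idt L) = idt (el L)"
proof (rule tr_unique [OF res [OF L]])
  note F = res [OF L] and r = repl_arr_props [OF L L tr_id [OF L]]
  show e: "el L \<in> LQ" by (rule extn_props(1) [OF F])
  show "tr (el L) (el L) (repl_arr L L (idt L))" "tr (el L) (el L) (idt (el L))"
    using r(1) tr_id [OF e] .
  show "Comp K (res_arr (el L) (el L) (repl_arr L L (idt L)) c) (ei L c) =
      Comp K (res_arr (el L) (el L) (idt (el L)) c) (ei L c)" if c: "c \<in> Obj C" for c
    using r(2) [OF c] li_hom [OF F c] is_functorD(1) [OF F c] c by (simp add: res_arr_idt L e is_functorD(5) [OF Q])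
qed

lemma repl_arr_comp:
  assumes L: "L \<in> LQ" "L' \<in> LQ" "L'' \<in> LQ" and \<tau>: "tr L L' \<tau>" and \<sigma>: "tr L' L'' \<sigma>"
  shows "repl_arr L L'' (ct L L' L'' \<sigma> \<tau>) = ct (el L) (el L') (el L'') (repl_arr L' L'' \<sigma>) (repl_arr L L' \<tau>)"
  (is "?lhs = ?rhs")
proof (rule tr_unique [OF res [OF L(1)]])
  note F = res [OF L(1)] and G = res [OF L(2)] and H = res [OF L(3)]
  note e = extn_props(1) [OF F] extn_props(1) [OF G] extn_props(1) [OF H]
  note r = repl_arr_props [OF L(1,2) \<tau>] and s = repl_arr_props [OF L(2,3) \<sigma>]
    and rs = repl_arr_props [OF L(1,3) tr_comp [OF L \<tau> \<sigma>]]
  show "el L'' \<in> LQ" using e by simp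
  show "tr (el L) (el L'') ?lhs" using rs(1) .
  show "tr (el L) (el L'') ?rhs"
    by (rule tr_comp [OF e r(1) s(1)])
  fix c assume c: "c \<in> Obj C"
  note ht = tr_hom [OF L(1,2) \<tau> c] and hs = tr_hom [OF L(2,3) \<sigma> c]
  note Qt = is_functorD(2-4) [OF Q ht(1)] and Qs = is_functorD(2-4) [OF Q hs(1)]
  note hs' = tr_hom [OF e(2,3) s(1) c]
  note i = li_hom [OF F c] li_hom [OF G c] li_hom [OF H c]
  have "Comp K (res_arr (el L) (el L'') ?lhs c) (ei L c) =
      Comp K (ei L'' c) (Comp K (Farr Q (res_arr L' L'' \<sigma> c)) (Farr Q (res_arr L L' \<tau> c)))"
    unfolding rs(2) [OF c] res_arr_ct [OF L \<tau> \<sigma> c] using ht hs by (simp add: is_functorD(6) [OF Q])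
  also have "\<dots> = Comp K (Comp K (ei L'' c) (Farr Q (res_arr L' L'' \<sigma> c))) (Farr Q (res_arr L L' \<tau> c))"
    using Qt Qs i c ht hs by (subst K.Comp_assoc) simp_all
  also have "\<dots> = Comp K (res_arr (el L') (el L'') (repl_arr L' L'' \<sigma>) c) (Comp K (ei L' c) (Farr Q (res_arr L L' \<tau> c)))"
    unfolding s(2) [OF c, symmetric] using Qt Qs i c ht hs hs' by (subst K.Comp_assoc) simp_all
  also have "\<dots> = Comp K (res_arr (el L) (el L'') ?rhs c) (ei L c)"
    unfolding r(2) [OF c, symmetric] tr_triangle [OF F e(2,3) r(1) s(1) c] ..
  finally show "Comp K (res_arr (el L) (el L'') ?lhs c) (ei L c) =
    Comp K (res_arr (el L) (el L'') ?rhs c) (ei L c)" .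
qed

definition repl_functor where
  "repl_functor = \<lparr>Fobj = (\<lambda>X\<in>fobj. repl X), Farr = (\<lambda>(X, Y, \<tau>)\<in>farr. (repl X, repl Y, repl_arr (fst X) (fst Y) \<tau>))\<rparr>"

lemma repl_functor_simps:
  "X \<in> fobj \<Longrightarrow> Fobj repl_functor X = repl X"
  "(X, Y, \<tau>) \<in> farr \<Longrightarrow> Farr repl_functor (X, Y, \<tau>) = (repl X, repl Y, repl_arr (fst X) (fst Y) \<tau>)"
  by (simp_all add: repl_functor_def)

lemma repl_functor: "is_functor fcat fcat repl_functor"
  unfolding is_functor_def
proof (intro conjI ballI impI)
  show "Fobj repl_functor \<in> Obj fcat \<rightarrow>\<^sub>E Obj fcat" by (auto simp: repl_functor_def repl_fobj)
  show "Farr repl_functor \<in> Arr fcat \<rightarrow>\<^sub>E Arr fcat"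
    unfolding repl_functor_def fcat_simps functr.simps using repl_arr_farr [of "(_, _)" "(_, _)"] by (auto simp del: split_paired_All)
  show "Farr repl_functor (Idn fcat X) = Idn fcat (Fobj repl_functor X)" if "X \<in> Obj fcat" for X
    using that farr_id [of X] fobjD(1) [of X] by (simp add: repl_functor_simps repl_arr_id repl_simps)
  fix f assume f: "f \<in> Arr fcat"
  obtain X Y \<tau> where fe: "f = (X, Y, \<tau>)" by (cases f)
  note a = f [unfolded fe, simplified]
  show "Farr repl_functor f \<in> homset fcat (Fobj repl_functor (Dom fcat f)) (Fobj repl_functor (Cod fcat f))"
    using a repl_arr_farr [OF a] farrD(1,2) [OF a] by (simp add: fe homset_iff repl_functor_simps)
  fix g assume g: "g \<in> Arr fcat" "Cod fcat f = Dom fcat g"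
  obtain Z \<sigma> where ge: "g = (Y, Z, \<sigma>)" using g(2) fe by (cases g) simp
  note b = g(1) [unfolded ge, simplified]
  show "Farr repl_functor (Comp fcat g f) = Comp fcat (Farr repl_functor g) (Farr repl_functor f)"
    using farr_comp [OF a b] a b repl_arr_comp [OF fobjD(1) [OF farrD(1) [OF a]] fobjD(1) [OF farrD(2) [OF a]] fobjD(1) [OF farrD(2) [OF b]] farrD(3) [OF a] farrD(3) [OF b]]
    by (simp add: fe ge repl_functor_simps repl_simps)
qed

lemma counit_nat_trans:
  "nat_trans fcat fcat repl_functor (identity_functor fcat) (\<lambda>X\<in>fobj. (repl X, X, counit X))"
  (is "nat_trans _ _ _ ?F ?t")
  unfolding nat_trans_def
proof (intro conjI ballI)
  show "?t \<in> Obj fcat \<rightarrow>\<^sub>E Arr fcat" by (auto simp: counit_farr)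
  show "?t X \<in> homset fcat (Fobj repl_functor X) (Fobj ?F X)"
    if "X \<in> Obj fcat" for X using that by (simp add: homset_iff counit_farr repl_functor_simps)
  fix f assume f: "f \<in> Arr fcat"
  obtain X Y \<tau> where fe: "f = (X, Y, \<tau>)" by (cases f)
  note a = f [unfolded fe, simplified]
  show "Comp fcat (?t (Cod fcat f)) (Farr repl_functor f) =
     Comp fcat (Farr ?F f) (?t (Dom fcat f))"
    using a farrD(1,2) [OF a] counit_natural [OF a] by (simp add: fe repl_functor_simps repl_simps)
qed

subsection \<open>Comparison with the extension of the cofibrant replacement of the given functor\<close>

text \<open>The factorization onto which the category contracts: the extension of \<open>Q \<gamma>\<close>, with \<open>q : Q \<gamma> \<rightarrow> \<gamma>\<close>
  transported along the comparison isomorphism.\<close>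

definition base :: "'l \<times> ('c \<Rightarrow> 'b)" where
  "base = (lo \<gamma>, \<lambda>c\<in>Obj C. Comp K (q (Fobj \<gamma> c)) (inv_arr K (li \<gamma> c)))"

lemma base_li:
  assumes c: "c \<in> Obj C"
  shows "Comp K (snd base c) (li \<gamma> c) = q (Fobj \<gamma> c)"
  using K.inv_arr_simps [OF extn_props(3) [OF \<gamma> c] refl refl] li_hom [OF \<gamma> c] q_hom [OF is_functorD(1) [OF \<gamma> c]] c
  by (simp add: base_def K.Comp_assoc homset_iff)

lemma base_simps:
  assumes c: "c \<in> Obj C"
  shows "snd base c \<in> Arr K" "Dom K (snd base c) = Fobj (res (lo \<gamma>)) c" "Cod K (snd base c) = Fobj \<gamma> c"
  using K.inv_arr_simps [OF extn_props(3) [OF \<gamma> c] refl refl] li_hom [OF \<gamma> c] q_hom [OF is_functorD(1) [OF \<gamma> c]] c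
  by (simp_all add: base_def homset_iff)

lemma base_fobj: "base \<in> fobj"
  unfolding fobj_iff
proof (intro conjI ballI)
  show L: "fst base \<in> LQ" by (simp add: base_def extn_props(1) [OF \<gamma>])
  note F = res [OF L]
  note F' = is_functorD(1-4) [OF F] is_functorD(1-4) [OF \<gamma>]
  have fb: "fst base = lo \<gamma>" by (simp add: base_def)
  show "nat_trans C K (res (fst base)) \<gamma> (snd base)"
    unfolding nat_trans_def homset_iff
  proof (intro conjI ballI)
    show "snd base \<in> Obj C \<rightarrow>\<^sub>E Arr K"
      by (rule PiE_I) (simp_all add: base_simps(1), simp add: base_def)
    fix u assume u: "u \<in> Arr C"
    let ?c = "Dom C u" and ?d = "Cod C u"
    have cd: "?c \<in> Obj C" "?d \<in> Obj C" using u by simp_all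
    note i = li_hom [OF \<gamma> cd(1)] li_hom [OF \<gamma> cd(2)] and b = base_simps [OF cd(1)] base_simps [OF cd(2)]
    note qs = q_hom [OF is_functorD(1) [OF \<gamma> cd(1)], unfolded homset_iff] q_hom [OF is_functorD(1) [OF \<gamma> cd(2)], unfolded homset_iff]
    have QF: "Farr Q (Farr \<gamma> u) \<in> Arr K" "Dom K (Farr Q (Farr \<gamma> u)) = Fobj Q (Fobj \<gamma> ?c)" "Cod K (Farr Q (Farr \<gamma> u)) = Fobj Q (Fobj \<gamma> ?d)"
      using is_functorD(2-4) [OF Q is_functorD(2) [OF \<gamma> u]] is_functorD(3,4) [OF \<gamma> u] by simp_all
    have "Comp K (Comp K (snd base ?d) (Farr (res (fst base)) u)) (li \<gamma> ?c) = Comp K (snd base ?d) (Comp K (Farr (res (lo \<gamma>)) u) (li \<gamma> ?c))"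
      using u cd i b F' by (simp add: K.Comp_assoc fb)
    also have "Comp K (Farr (res (lo \<gamma>)) u) (li \<gamma> ?c) = Comp K (li \<gamma> ?d) (Farr Q (Farr \<gamma> u))"
      using nat_transD(4) [OF extn_props(2) [OF \<gamma>] u] u by simp
    also have "Comp K (snd base ?d) \<dots> = Comp K (Comp K (snd base ?d) (li \<gamma> ?d)) (Farr Q (Farr \<gamma> u))"
      using u cd i b QF by (simp add: K.Comp_assoc)
    also have "\<dots> = Comp K (Farr \<gamma> u) (q (Fobj \<gamma> ?c))"
      unfolding base_li [OF cd(2)] using q_natural [OF is_functorD(2) [OF \<gamma> u]] is_functorD(3,4) [OF \<gamma> u] by simp
    also have "\<dots> = Comp K (Comp K (Farr \<gamma> u) (snd base ?c)) (li \<gamma> ?c)"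
      unfolding base_li [OF cd(1), symmetric] using u cd i b F' by (simp add: K.Comp_assoc)
    finally show "Comp K (snd base ?d) (Farr (res (fst base)) u) = Comp K (Farr \<gamma> u) (snd base ?c)"
      by (rule K.iso_cancel_right [OF extn_props(3) [OF \<gamma> cd(1)], rotated -1]) (use u cd i b F' in \<open>simp_all add: fb\<close>)
  qed (use base_simps in \<open>simp_all add: fb\<close>)
  fix c assume c: "c \<in> Obj C"
  show "snd base c \<in> W"
  proof (rule W_cancel)
    show "li \<gamma> c \<in> W" using W_iso extn_props(3) [OF \<gamma> c] .
    show "Comp K (snd base c) (li \<gamma> c) \<in> W" unfolding base_li [OF c] using q_W is_functorD(1) [OF \<gamma> c] .
  qed (use li_hom [OF \<gamma> c] base_simps [OF c] c in simp_all)
qed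

text \<open>Unlike the comparison with \<open>X\<close> itself, this one is induced by the structure map \<open>\<eta> : L y \<rightarrow> \<gamma>\<close> of the
  factorization, through \<open>Q \<eta> : Q L y \<rightarrow> Q \<gamma>\<close>.\<close>

definition to_base :: "'l \<times> ('c \<Rightarrow> 'b) \<Rightarrow> 't" where
  "to_base X = fac (res (fst X)) (lo \<gamma>) (\<lambda>c\<in>Obj C. Comp K (li \<gamma> c) (Farr Q (snd X c)))"

lemma to_base_props:
  assumes X: "X \<in> fobj"
  shows "tr (el (fst X)) (lo \<gamma>) (to_base X)"
    and "c \<in> Obj C \<Longrightarrow> Comp K (res_arr (el (fst X)) (lo \<gamma>) (to_base X) c) (ei (fst X) c) =
           Comp K (li \<gamma> c) (Farr Q (snd X c))"
proof -
  note F = fobjD(2) [OF X]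
  note n = nat_comp [OF QF_functor [OF F] QF_functor [OF \<gamma>] res [OF extn_props(1) [OF \<gamma>]]
      Q_nat [OF fobjD(3) [OF X] F \<gamma>] extn_props(2) [OF \<gamma>]]
  have e: "(\<lambda>c\<in>Obj C. Comp K (li \<gamma> c) ((\<lambda>c\<in>Obj C. Farr Q (snd X c)) c)) = (\<lambda>c\<in>Obj C. Comp K (li \<gamma> c) (Farr Q (snd X c)))"
    by (auto simp: restrict_def)
  note f = fac_props [OF F extn_props(1) [OF \<gamma>] n [unfolded e], folded to_base_def]
  show "tr (el (fst X)) (lo \<gamma>) (to_base X)" by (rule f(1))
  show "Comp K (res_arr (el (fst X)) (lo \<gamma>) (to_base X) c) (ei (fst X) c) = Comp K (li \<gamma> c) (Farr Q (snd X c))"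
    if "c \<in> Obj C" using f(2) [OF that] that by simp
qed

lemma to_base_farr:
  assumes X: "X \<in> fobj"
  shows "(repl X, base, to_base X) \<in> farr"
  unfolding farr_iff
proof (intro conjI ballI)
  note F = fobjD(2) [OF X]
  have fb: "fst base = lo \<gamma>" by (simp add: base_def)
  show rX: "repl X \<in> fobj" "base \<in> fobj" using repl_fobj [OF X] base_fobj .
  show t: "tr (fst (repl X)) (fst base) (to_base X)" using to_base_props(1) [OF X] by (simp add: fb repl_simps)
  fix c assume c: "c \<in> Obj C"
  let ?t = "res_arr (fst (repl X)) (fst base) (to_base X) c"
  note h = tr_hom [OF fobjD(1) [OF rX(1)] fobjD(1) [OF rX(2)] t c]
  note i = li_hom [OF F c] li_hom [OF \<gamma> c] and b = base_simps [OF c]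
  note e = nat_transD(1-3) [OF fobjD(3) [OF X] c] and r = nat_transD(1-3) [OF fobjD(3) [OF rX(1)] c]
  have QF: "Farr Q (snd X c) \<in> Arr K" "Dom K (Farr Q (snd X c)) = Fobj Q (Fobj (res (fst X)) c)" "Cod K (Farr Q (snd X c)) = Fobj Q (Fobj \<gamma> c)"
    using is_functorD(2-4) [OF Q e(1)] e by simp_all
  have "Comp K (Comp K (snd base c) ?t) (ei (fst X) c) = Comp K (snd base c) (Comp K ?t (ei (fst X) c))"
    using c h i b by (simp add: K.Comp_assoc fb repl_simps)
  also have "Comp K ?t (ei (fst X) c) = Comp K (li \<gamma> c) (Farr Q (snd X c))"
    using to_base_props(2) [OF X c] by (simp add: fb repl_simps)
  also have "Comp K (snd base c) \<dots> = Comp K (Comp K (snd base c) (li \<gamma> c)) (Farr Q (snd X c))"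
    using c i b QF by (simp add: K.Comp_assoc)
  also have "\<dots> = Comp K (snd (repl X) c) (ei (fst X) c)"
    unfolding base_li [OF c] repl_li [OF X c] using q_natural [OF e(1)] e by simp
  finally show "Comp K (snd base c) ?t = snd (repl X) c"
    by (rule K.iso_cancel_right [OF extn_props(3) [OF F c], rotated -1]) (use c h i b r in \<open>simp_all add: fb repl_simps\<close>)
qed

lemma to_base_natural:
  assumes a: "(X, Y, \<tau>) \<in> farr"
  shows "ct (el (fst X)) (el (fst Y)) (lo \<gamma>) (to_base Y) (repl_arr (fst X) (fst Y) \<tau>) = to_base X"
  (is "?lhs = _")
proof -
  note X = farrD(1) [OF a] and Y = farrD(2) [OF a] and t = farrD(3) [OF a]
  note LX = fobjD(1) [OF X] and LY = fobjD(1) [OF Y]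
  note FX = res [OF LX] and FY = res [OF LY]
  note e = extn_props(1) [OF FX] extn_props(1) [OF FY] extn_props(1) [OF \<gamma>]
  note r = repl_arr_props [OF LX LY t] and bX = to_base_props [OF X] and bY = to_base_props [OF Y]
  show ?thesis
  proof (rule tr_unique [OF FX e(3)])
    show "tr (el (fst X)) (lo \<gamma>) ?lhs"
      by (rule tr_comp [OF e r(1) bY(1)])
    show "tr (el (fst X)) (lo \<gamma>) (to_base X)" by (rule bX(1))
    fix c assume c: "c \<in> Obj C"
    note h = tr_hom [OF LX LY t c] and hb = tr_hom [OF e(2,3) bY(1) c]
    note y = nat_transD(1-3) [OF fobjD(3) [OF Y] c]
    note i = li_hom [OF FY c] li_hom [OF \<gamma> c]
    note Qh = is_functorD(2-4) [OF Q h(1)] and Qy = is_functorD(2-4) [OF Q y(1)]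
    have "Comp K (res_arr (el (fst X)) (lo \<gamma>) ?lhs c) (ei (fst X) c)
      = Comp K (res_arr (el (fst Y)) (lo \<gamma>) (to_base Y) c) (Comp K (ei (fst Y) c) (Farr Q (res_arr (fst X) (fst Y) \<tau> c)))"
      unfolding tr_triangle [OF FX e(2,3) r(1) bY(1) c] r(2) [OF c] ..
    also have "\<dots> = Comp K (Comp K (li \<gamma> c) (Farr Q (snd Y c))) (Farr Q (res_arr (fst X) (fst Y) \<tau> c))"
      unfolding bY(2) [OF c, symmetric] using c h hb i Qh by (subst K.Comp_assoc) simp_all
    also have "\<dots> = Comp K (li \<gamma> c) (Farr Q (Comp K (snd Y c) (res_arr (fst X) (fst Y) \<tau> c)))"
      using c h y i Qh Qy by (simp add: K.Comp_assoc is_functorD(6) [OF Q])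
    also have "\<dots> = Comp K (res_arr (el (fst X)) (lo \<gamma>) (to_base X) c) (ei (fst X) c)"
      unfolding farrD(5) [OF a c] bX(2) [OF c] ..
    finally show "Comp K (res_arr (el (fst X)) (lo \<gamma>) ?lhs c) (ei (fst X) c)
      = Comp K (res_arr (el (fst X)) (lo \<gamma>) (to_base X) c) (ei (fst X) c)" .
  qed
qed

lemma to_base_nat_trans:
  "nat_trans fcat fcat repl_functor (constant_functor fcat base) (\<lambda>X\<in>fobj. (repl X, base, to_base X))"
  (is "nat_trans _ _ _ ?F ?t")
  unfolding nat_trans_def
proof (intro conjI ballI)
  show "?t \<in> Obj fcat \<rightarrow>\<^sub>E Arr fcat" by (auto simp: to_base_farr)
  show "?t X \<in> homset fcat (Fobj repl_functor X) (Fobj ?F X)"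
    if "X \<in> Obj fcat" for X using that by (simp add: homset_iff to_base_farr repl_functor_simps)
  fix f assume f: "f \<in> Arr fcat"
  obtain X Y \<tau> where fe: "f = (X, Y, \<tau>)" by (cases f)
  note a = f [unfolded fe, simplified]
  note b = farrD(1,2,3) [OF to_base_farr [OF farrD(1) [OF a]]]
  have fb: "fst base = lo \<gamma>" by (simp add: base_def)
  show "Comp fcat (?t (Cod fcat f)) (Farr repl_functor f) =
     Comp fcat (Farr ?F f) (?t (Dom fcat f))"
    using a farrD(1,2) [OF a] to_base_natural [OF a] ct_id [OF fobjD(1) [OF b(1)] fobjD(1) [OF b(2)] b(3)]
    by (simp add: fe repl_functor_simps repl_simps fb)
qed

theorem fcat_contractible: "contractible_category fcat"
  by (rule contractible_categoryI [OF fcat_category _ repl_functor counit_nat_trans to_base_nat_trans]) (simp add: base_fobj)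

end

context psh_vct
begin

subsection \<open>The category of enriched functors\<close>

lemma vnat_trans_iff:
  assumes L: "is_vfunctor V U M L" and L': "is_vfunctor V U M L'"
  shows "vnat_trans V U M L L' \<tau> \<longleftrightarrow> \<tau> \<in> Psh \<rightarrow>\<^sub>E Arr V \<and> (\<forall>F\<in>Psh. \<tau> F \<in> hm I (hob (VFobj L F) (VFobj L' F))) \<and>
     (\<forall>F\<in>Psh. \<forall>G\<in>Psh. lc (cmp (VFobj L F) (VFobj L G) (VFobj L' G)) (\<tau> G) (VFarr L (F, G)) =
        rc (cmp (VFobj L F) (VFobj L' F) (VFobj L' G)) (VFarr L' (F, G)) (\<tau> F))"
  using vfun_simps [OF L] vfun_simps [OF L'] unfolding vnat_trans_def lc_def rc_def by simp

lemma vnat_simps: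
  assumes "vnat_trans V U M L L' \<tau>" "F \<in> Psh"
  shows "\<tau> F \<in> Arr V" "Dom V (\<tau> F) = I" "Cod V (\<tau> F) = hob (VFobj L F) (VFobj L' F)"
  using assms by (auto simp: vnat_trans_def homset_iff)

lemma vnat_undefined: "vnat_trans V U M L L' \<tau> \<Longrightarrow> F \<notin> Psh \<Longrightarrow> \<tau> F = undefined"
  by (auto simp: vnat_trans_def PiE_def extensional_def)

abbreviation (input) "vnid L \<equiv> \<lambda>F\<in>Psh. vid (VFobj L F)"
abbreviation (input) "vncomp L L' L'' \<sigma> \<tau> \<equiv> \<lambda>F\<in>Psh. elem_comp V M (VFobj L F) (VFobj L' F) (VFobj L'' F) (\<sigma> F) (\<tau> F)"

lemma vnat_id:
  assumes L: "is_vfunctor V U M L"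
  shows "vnat_trans V U M L L (vnid L)"
  using vfun_simps [OF L] by (auto simp: vnat_trans_iff [OF L L] homset_iff)

context
  fixes L L' L''
  assumes L: "is_vfunctor V U M L" and L': "is_vfunctor V U M L'" and L'': "is_vfunctor V U M L''"
begin

lemma vnat_comp:
  assumes \<tau>: "vnat_trans V U M L L' \<tau>" and \<sigma>: "vnat_trans V U M L' L'' \<sigma>"
  shows "vnat_trans V U M L L'' (vncomp L L' L'' \<sigma> \<tau>)"
  unfolding vnat_trans_iff [OF L L'']
proof (intro conjI ballI)
  note [simp] = vfun_simps [OF L] vfun_simps [OF L'] vfun_simps [OF L''] vnat_simps [OF \<tau>] vnat_simps [OF \<sigma>]
  show "vncomp L L' L'' \<sigma> \<tau> \<in> Psh \<rightarrow>\<^sub>E Arr V" by (auto simp: elem_comp_lc)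
  fix F assume [simp]: "F \<in> Psh"
  show "vncomp L L' L'' \<sigma> \<tau> F \<in> hm I (hob (VFobj L F) (VFobj L'' F))" by (simp add: elem_comp_lc homset_iff)
  fix G assume [simp]: "G \<in> Psh"
  let ?lF = "VFobj L F" and ?lG = "VFobj L G" and ?mF = "VFobj L' F" and ?mG = "VFobj L' G" and ?nF = "VFobj L'' F" and ?nG = "VFobj L'' G"
  have "lc (cmp ?lF ?lG ?nG) (lc (cmp ?lG ?mG ?nG) (\<sigma> G) (\<tau> G)) (VFarr L (F, G)) =
      lc (cmp ?lF ?mG ?nG) (\<sigma> G) (lc (cmp ?lF ?lG ?mG) (\<tau> G) (VFarr L (F, G)))"
    by (rule asq_ll [OF vcat_asq]) simp_all
  also have "lc (cmp ?lF ?lG ?mG) (\<tau> G) (VFarr L (F, G)) = rc (cmp ?lF ?mF ?mG) (VFarr L' (F, G)) (\<tau> F)"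
    using \<tau> by (simp add: vnat_trans_iff [OF L L'])
  also have "lc (cmp ?lF ?mG ?nG) (\<sigma> G) \<dots> = rc (cmp ?lF ?mF ?nG) (lc (cmp ?mF ?mG ?nG) (\<sigma> G) (VFarr L' (F, G))) (\<tau> F)"
    by (rule asq_lr [OF vcat_asq, symmetric]) simp_all
  also have "lc (cmp ?mF ?mG ?nG) (\<sigma> G) (VFarr L' (F, G)) = rc (cmp ?mF ?nF ?nG) (VFarr L'' (F, G)) (\<sigma> F)"
    using \<sigma> by (simp add: vnat_trans_iff [OF L' L''])
  also have "rc (cmp ?lF ?mF ?nG) \<dots> (\<tau> F) = rc (cmp ?lF ?nF ?nG) (VFarr L'' (F, G)) (lc (cmp ?lF ?mF ?nF) (\<sigma> F) (\<tau> F))"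
    by (rule asq_rr [OF vcat_asq]) simp_all
  finally show "lc (cmp ?lF ?lG ?nG) (vncomp L L' L'' \<sigma> \<tau> G) (VFarr L (F, G)) =
      rc (cmp ?lF ?nF ?nG) (VFarr L'' (F, G)) (vncomp L L' L'' \<sigma> \<tau> F)"
    by (simp add: elem_comp_lc)
qed

lemma vncomp_id:
  assumes \<tau>: "vnat_trans V U M L L' \<tau>"
  shows "vncomp L L L' \<tau> (vnid L) = \<tau>" "vncomp L L' L' (vnid L') \<tau> = \<tau>"
  using vfun_simps [OF L] vfun_simps [OF L'] vnat_simps [OF \<tau>] vnat_undefined [OF \<tau>]
  by (auto simp: elem_comp_lc fun_eq_iff restrict_def)

lemma vncomp_assoc:
  assumes M': "is_vfunctor V U M M'"
    and \<tau>: "vnat_trans V U M L L' \<tau>" and \<sigma>: "vnat_trans V U M L' L'' \<sigma>" and \<rho>: "vnat_trans V U M L'' M' \<rho>"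
  shows "vncomp L L'' M' \<rho> (vncomp L L' L'' \<sigma> \<tau>) = vncomp L L' M' (vncomp L' L'' M' \<rho> \<sigma>) \<tau>"
proof (rule restrict_ext)
  note [simp] = vfun_simps [OF L] vfun_simps [OF L'] vfun_simps [OF L''] vfun_simps [OF M'] vnat_simps [OF \<tau>] vnat_simps [OF \<sigma>] vnat_simps [OF \<rho>]
  fix F assume F [simp]: "F \<in> Psh"
  have "lc (cmp (VFobj L F) (VFobj L' F) (VFobj M' F)) (lc (cmp (VFobj L' F) (VFobj L'' F) (VFobj M' F)) (\<rho> F) (\<sigma> F)) (\<tau> F) =
      lc (cmp (VFobj L F) (VFobj L'' F) (VFobj M' F)) (\<rho> F) (lc (cmp (VFobj L F) (VFobj L' F) (VFobj L'' F)) (\<sigma> F) (\<tau> F))"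
    by (rule asq_ll [OF vcat_asq]) simp_all
  then show "elem_comp V M (VFobj L F) (VFobj L'' F) (VFobj M' F) (\<rho> F) (vncomp L L' L'' \<sigma> \<tau> F) =
      elem_comp V M (VFobj L F) (VFobj L' F) (VFobj M' F) (vncomp L' L'' M' \<rho> \<sigma> F) (\<tau> F)"
    by (simp add: elem_comp_lc)
qed

end

subsection \<open>Restriction along the Yoneda embedding\<close>

lemma ym_Idn:
  assumes c [simp]: "c \<in> Obj C"
  shows "ym (Idn C c) = VId U (yob c)"
proof (rule ph_yob_unique [OF c yob_Psh [OF c]])
  fix d w assume w: "w \<in> homset C d c"
  note [simp] = C.homD [OF w]
  note [simp] = inc_hom [OF w]
  have w': "w \<in> homset C d (Dom C (Idn C c))" using w by simp
  show "rc (act (yob c) (yob c) d) (ym (Idn C c)) (inc c d w) = rc (act (yob c) (yob c) d) (VId U (yob c)) (inc c d w)"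
    using ym_props(4) [OF _ w'] by (simp add: VId_UV(4) flip: lc_eq_rc)
qed simp_all

lemma ym_Comp:
  assumes [simp]: "u \<in> Arr C" "v \<in> Arr C" and uv [simp]: "Cod C u = Dom C v"
  shows "ym (Comp C v u) = lc (ucmp (yob (Dom C u)) (yob (Dom C v)) (yob (Cod C v))) (ym v) (ym u)"
proof (rule ph_yob_unique [of "Dom C u" "yob (Cod C v)"])
  let ?a = "Dom C u" and ?b = "Dom C v" and ?c = "Cod C v"
  fix d w assume w: "w \<in> homset C d ?a"
  note [simp] = C.homD [OF w]
  note [simp] = inc_hom [OF w]
  have uw: "Comp C u w \<in> homset C d ?b" and w': "w \<in> homset C d (Dom C (Comp C v u))" using w by (simp_all add: homset_iff)
  note [simp] = inc_hom [OF uw]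
  have "lc (act (yob ?a) (yob ?c) d) (lc (ucmp (yob ?a) (yob ?b) (yob ?c)) (ym v) (ym u)) (inc ?a d w) =
      lc (act (yob ?b) (yob ?c) d) (ym v) (lc (act (yob ?a) (yob ?b) d) (ym u) (inc ?a d w))"
    by (rule asq_ll [OF VComp_UV(4)]) simp_all
  also have "\<dots> = inc ?c d (Comp C v (Comp C u w))"
    using ym_props(4) [of u w d] ym_props(4) [of v "Comp C u w" d] w uw by simp
  also have "\<dots> = lc (act (yob ?a) (yob ?c) d) (ym (Comp C v u)) (inc ?a d w)"
    using ym_props(4) [OF _ w'] by (simp add: C.Comp_assoc)
  finally show "rc (act (yob ?a) (yob ?c) d) (ym (Comp C v u)) (inc ?a d w) =
      rc (act (yob ?a) (yob ?c) d) (lc (ucmp (yob ?a) (yob ?b) (yob ?c)) (ym v) (ym u)) (inc ?a d w)"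
    by (simp flip: lc_eq_rc)
qed simp_all

definition res :: "(('c, 'd, 'o, 'a) presheaf, 'm, 'a) vfunctr \<Rightarrow> ('c, 'd, 'm, 'm \<times> 'm \<times> 'a) functr" where
  "res L = functor_comp C (underlying_functor V U L) (yoneda V C)"

lemma res_simps:
  "c \<in> Obj C \<Longrightarrow> Fobj (res L) c = VFobj L (yob c)"
  "u \<in> Arr C \<Longrightarrow> Farr (res L) u = (VFobj L (yob (Dom C u)), VFobj L (yob (Cod C u)), VFarr L (yob (Dom C u), yob (Cod C u)) \<cdot> ym u)"
  by (simp_all add: res_def functor_comp_def underlying_functor_def yoneda_simps underlying_def homset_iff)

lemma res_functor:
  assumes L: "is_vfunctor V U M L"
  shows "is_functor C M0 (res L)"
  unfolding is_functor_def homset_iff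
proof (intro conjI ballI impI)
  note [simp] = vfun_simps [OF L]
  show "Fobj (res L) \<in> Obj C \<rightarrow>\<^sub>E Obj M0"
    by (rule PiE_I) (simp_all add: res_simps underlying_simps, simp add: res_def functor_comp_def)
  show "Farr (res L) \<in> Arr C \<rightarrow>\<^sub>E Arr M0"
    by (rule PiE_I) (simp_all add: res_simps underlying_simps, simp add: res_def functor_comp_def)
  show "Farr (res L) (Idn C c) = Idn M0 (Fobj (res L) c)" if "c \<in> Obj C" for c
    using that by (simp add: res_simps underlying_simps ym_Idn)
  fix u assume [simp]: "u \<in> Arr C"
  show "Farr (res L) u \<in> Arr M0" "Dom M0 (Farr (res L) u) = Fobj (res L) (Dom C u)" "Cod M0 (Farr (res L) u) = Fobj (res L) (Cod C u)"
    by (simp_all add: res_simps underlying_simps)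
  fix v assume [simp]: "v \<in> Arr C" and uv [simp]: "Cod C u = Dom C v"
  show "Farr (res L) (Comp C v u) = Comp M0 (Farr (res L) v) (Farr (res L) u)"
    by (simp add: res_simps underlying_simps ym_Comp vfun_lc [OF L])
qed

definition res_arr ::
  "(('c, 'd, 'o, 'a) presheaf, 'm, 'a) vfunctr \<Rightarrow> (('c, 'd, 'o, 'a) presheaf, 'm, 'a) vfunctr \<Rightarrow>
   (('c, 'd, 'o, 'a) presheaf \<Rightarrow> 'a) \<Rightarrow> 'c \<Rightarrow> 'm \<times> 'm \<times> 'a" where
  "res_arr L L' \<tau> = (\<lambda>c\<in>Obj C. (VFobj L (yob c), VFobj L' (yob c), \<tau> (yob c)))"

lemma res_arr_nat_trans:
  assumes L: "is_vfunctor V U M L" and L': "is_vfunctor V U M L'" and \<tau>: "vnat_trans V U M L L' \<tau>"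
  shows "nat_trans C M0 (res L) (res L') (res_arr L L' \<tau>)"
  unfolding nat_trans_def homset_iff
proof (intro conjI ballI)
  note [simp] = vfun_simps [OF L] vfun_simps [OF L'] vnat_simps [OF \<tau>]
  show "res_arr L L' \<tau> \<in> Obj C \<rightarrow>\<^sub>E Arr M0" by (auto simp: res_arr_def underlying_simps)
  show "res_arr L L' \<tau> c \<in> Arr M0" "Dom M0 (res_arr L L' \<tau> c) = Fobj (res L) c" "Cod M0 (res_arr L L' \<tau> c) = Fobj (res L') c"
    if "c \<in> Obj C" for c using that by (simp_all add: res_arr_def underlying_simps res_simps)
  fix u assume [simp]: "u \<in> Arr C"
  let ?y = "yob (Dom C u)" and ?z = "yob (Cod C u)"
  have "lc (cmp (VFobj L ?y) (VFobj L ?z) (VFobj L' ?z)) (\<tau> ?z) (VFarr L (?y, ?z)) \<cdot> ym u =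
      rc (cmp (VFobj L ?y) (VFobj L' ?y) (VFobj L' ?z)) (VFarr L' (?y, ?z)) (\<tau> ?y) \<cdot> ym u"
    using \<tau> by (simp add: vnat_trans_iff [OF L L'])
  then have "lc (cmp (VFobj L ?y) (VFobj L ?z) (VFobj L' ?z)) (\<tau> ?z) (VFarr L (?y, ?z) \<cdot> ym u) =
      lc (cmp (VFobj L ?y) (VFobj L' ?y) (VFobj L' ?z)) (VFarr L' (?y, ?z) \<cdot> ym u) (\<tau> ?y)"
    by (simp add: lc_comp rc_comp lc_eq_rc [of "VFarr L' (?y, ?z) \<cdot> ym u"])
  then show "Comp M0 (res_arr L L' \<tau> (Cod C u)) (Farr (res L) u) = Comp M0 (Farr (res L') u) (res_arr L L' \<tau> (Dom C u))"
    by (simp add: res_arr_def res_simps underlying_simps)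
qed

lemma res_arr_id: "c \<in> Obj C \<Longrightarrow> res_arr L L (vnid L) c = Idn M0 (Fobj (res L) c)"
  by (simp add: res_arr_def underlying_simps res_simps)

lemma res_arr_comp:
  assumes "vnat_trans V U M L L' \<tau>" "c \<in> Obj C"
  shows "res_arr L L'' (vncomp L L' L'' \<sigma> \<tau>) c = Comp M0 (res_arr L' L'' \<sigma> c) (res_arr L L' \<tau> c)"
  using assms by (simp add: res_arr_def underlying_def)

end

subsection \<open>Cofibrant replacement\<close>

context categ
begin

text \<open>An isomorphism is a retract of an identity.\<close>

lemma iso_weak_equivalence:
  assumes N: "model_structure K N" and f: "is_iso K f"
  shows "f \<in> Weq N"
proof -
  note i = inv_arr_simps [OF f refl refl]
  have "arrow_retract K f (Idn K (Dom K f))"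
    unfolding arrow_retract_def
    by (rule bexI [of _ "Idn K (Dom K f)"], rule bexI [of _ "Idn K (Dom K f)"], rule bexI [of _ "inv_arr K f"], rule bexI [of _ f])
      (use i in \<open>simp_all add: homset_iff\<close>)
  moreover have "Idn K (Dom K f) \<in> Weq N"
    using N i(1) by (simp add: model_structure_def wide_subcategory_def)
  ultimately show ?thesis
    using N i(1) unfolding model_structure_def retract_closed_def by blast
qed

text \<open>The functorial factorization of the maps from the initial object into a cofibration followed by a
  trivial fibration.\<close>

lemma cofibrant_replacement:
  assumes N: "model_structure K N" and z: "is_initial K z"
  obtains Q q where "is_functor K K Q" "\<And>x. x \<in> Obj K \<Longrightarrow> cofibrant K N (Fobj Q x)"
    "\<And>x. x \<in> Obj K \<Longrightarrow> q x \<in> homset K (Fobj Q x) x" "\<And>x. x \<in> Obj K \<Longrightarrow> q x \<in> Weq N"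
    "\<And>f. f \<in> Arr K \<Longrightarrow> Comp K (q (Cod K f)) (Farr Q f) = Comp K f (q (Dom K f))"
proof -
  have "functorial_factorization K (Cof N) (Fib N \<inter> Weq N)" using N by (simp add: model_structure_def)
  then obtain E \<alpha> \<beta> \<phi> where
    fact: "\<forall>f\<in>Arr K. \<alpha> f \<in> homset K (Dom K f) (E f) \<inter> Cof N \<and> \<beta> f \<in> homset K (E f) (Cod K f) \<inter> (Fib N \<inter> Weq N) \<and>
        Comp K (\<beta> f) (\<alpha> f) = f"
    and sq: "\<forall>f g u v. arrow_square K f g u v \<longrightarrow> \<phi> f g u v \<in> homset K (E f) (E g) \<and>
        Comp K (\<phi> f g u v) (\<alpha> f) = Comp K (\<alpha> g) u \<and> Comp K (\<beta> g) (\<phi> f g u v) = Comp K v (\<beta> f)"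
    and \<phi>_id: "\<forall>f\<in>Arr K. \<phi> f f (Idn K (Dom K f)) (Idn K (Cod K f)) = Idn K (E f)"
    and \<phi>_comp: "\<forall>f g h u v u' v'. arrow_square K f g u v \<and> arrow_square K g h u' v' \<longrightarrow>
        \<phi> f h (Comp K u' u) (Comp K v' v) = Comp K (\<phi> g h u' v') (\<phi> f g u v)"
    unfolding functorial_factorization_def by (elim exE conjE) (rule that)
  have zO [simp]: "z \<in> Obj K" using z by (simp add: is_initial_def)
  obtain b where b: "\<And>x. x \<in> Obj K \<Longrightarrow> b x \<in> homset K z x"
    using z unfolding is_initial_def by metis
  have bs [simp]: "b x \<in> Arr K" "Dom K (b x) = z" "Cod K (b x) = x" if "x \<in> Obj K" for x
    using b [OF that] by (auto simp: homset_iff)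
  have uniq: "f = g" if "f \<in> homset K z x" "g \<in> homset K z x" "x \<in> Obj K" for f g x
    using z that unfolding is_initial_def by blast
  have square: "arrow_square K (b (Dom K f)) (b (Cod K f)) (Idn K z) f" if "f \<in> Arr K" for f
    unfolding arrow_square_def using that
    by (auto simp: homset_iff intro: uniq [of _ "Cod K f"])
  have fs: "\<alpha> (b x) \<in> homset K z (E (b x))" "\<alpha> (b x) \<in> Cof N" "\<beta> (b x) \<in> homset K (E (b x)) x" "\<beta> (b x) \<in> Weq N" "E (b x) \<in> Obj K"
    if "x \<in> Obj K" for x
    using bspec [OF fact bs(1) [OF that]] Cod_Obj [of "\<alpha> (b x)"] that by (auto simp: homset_iff)
  let ?Q = "\<lparr>Fobj = (\<lambda>x\<in>Obj K. E (b x)), Farr = (\<lambda>f\<in>Arr K. \<phi> (b (Dom K f)) (b (Cod K f)) (Idn K z) f)\<rparr>"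
  have Qf: "\<phi> (b (Dom K f)) (b (Cod K f)) (Idn K z) f \<in> homset K (E (b (Dom K f))) (E (b (Cod K f)))" if "f \<in> Arr K" for f
    using sq square [OF that] by blast
  show thesis
  proof
    show "is_functor K K ?Q"
      unfolding is_functor_def
    proof (intro conjI ballI impI)
      show "Fobj ?Q \<in> Obj K \<rightarrow>\<^sub>E Obj K" using fs(5) by auto
      show "Farr ?Q \<in> Arr K \<rightarrow>\<^sub>E Arr K" using Qf by (auto simp: homset_iff)
      show "Farr ?Q f \<in> homset K (Fobj ?Q (Dom K f)) (Fobj ?Q (Cod K f))" if "f \<in> Arr K" for f
        using Qf [OF that] that by simp
      show "Farr ?Q (Idn K x) = Idn K (Fobj ?Q x)" if "x \<in> Obj K" for x
        using bspec [OF \<phi>_id bs(1) [OF that]] that by simp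
      show "Farr ?Q (Comp K g f) = Comp K (Farr ?Q g) (Farr ?Q f)" if "f \<in> Arr K" "g \<in> Arr K" "Cod K f = Dom K g" for f g
      proof -
        have "arrow_square K (b (Cod K f)) (b (Cod K g)) (Idn K z) g" using square [OF that(2)] that(3) by simp
        then have "\<phi> (b (Dom K f)) (b (Cod K g)) (Comp K (Idn K z) (Idn K z)) (Comp K g f) =
            Comp K (\<phi> (b (Cod K f)) (b (Cod K g)) (Idn K z) g) (\<phi> (b (Dom K f)) (b (Cod K f)) (Idn K z) f)"
          using \<phi>_comp square [OF that(1)] by blast
        then show ?thesis using that by simp
      qed
    qed
    show "cofibrant K N (Fobj ?Q x)" if "x \<in> Obj K" for x
      using fs [OF that] z that unfolding cofibrant_def by auto
    show "\<beta> (b x) \<in> homset K (Fobj ?Q x) x" "\<beta> (b x) \<in> Weq N" if "x \<in> Obj K" for x using fs [OF that] that by simp_all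
    show "Comp K (\<beta> (b (Cod K f))) (Farr ?Q f) = Comp K f (\<beta> (b (Dom K f)))" if "f \<in> Arr K" for f
      using sq [rule_format, OF square [OF that]] that by simp
  qed
qed

end

context quillen_lan
begin

text \<open>The universal property of the extension, in terms of the underlying category of \<open>M\<close>.\<close>

lemma extension:
  defines "i \<equiv> \<lambda>c\<in>Obj C. (Do c, Lo (yob c), io c)"
  shows "nat_trans C M0 D (res Lfun) i"
    and "c \<in> Obj C \<Longrightarrow> is_iso M0 (i c)"
    and "is_vfunctor V U M L' \<Longrightarrow> nat_trans C M0 D (res L') \<zeta> \<Longrightarrow>
      \<exists>!\<tau>. vnat_trans V U M Lfun L' \<tau> \<and> (\<forall>c\<in>Obj C. Comp M0 (res_arr Lfun L' \<tau> c) (i c) = \<zeta> c)"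
proof -
  show "nat_trans C M0 D (res Lfun) i"
    unfolding nat_trans_def homset_iff i_def
    by (auto simp: underlying_simps res_simps Farr_D io_natural)
  show "is_iso M0 (i c)" if c: "c \<in> Obj C"
  proof (rule io_iso [OF c])
    fix j assume j: "j \<in> hm I (hob (Lo (yob c)) (Do c))"
      "lc (cmp (Do c) (Lo (yob c)) (Do c)) j (io c) = vid (Do c)"
      "lc (cmp (Lo (yob c)) (Do c) (Lo (yob c))) (io c) j = vid (Lo (yob c))"
    then show ?thesis
      unfolding is_iso_def inverse_arr_def
      by (intro exI [of _ "(Lo (yob c), Do c, j)"]) (use c in \<open>simp add: i_def underlying_simps homset_iff\<close>)
  qed
  assume L': "is_vfunctor V U M L'" and \<zeta>: "nat_trans C M0 D (res L') \<zeta>"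
  note [simp] = vfun_simps [OF L']
  let ?z = "\<lambda>c. snd (snd (\<zeta> c))"
  have \<zeta>e: "\<zeta> c = (Do c, VFobj L' (yob c), ?z c)" and z: "?z c \<in> hm I (hob (Do c) (VFobj L' (yob c)))" if "c \<in> Obj C" for c
    using nat_transD(1-3) [OF \<zeta> that] that by (cases "\<zeta> c"; simp add: underlying_simps res_simps homset_iff)+
  have zD: "Dom V (?z c) = I" if "c \<in> Obj C" for c using z [OF that] by (simp add: homset_iff)
  have "\<exists>!\<tau>. vnat_trans V U M Lfun L' \<tau> \<and>
     (\<forall>c\<in>Obj C. lc (cmp (Do c) (Lo (yob c)) (VFobj L' (yob c))) (\<tau> (yob c)) (io c) = ?z c)"
  proof (rule extension_ex1 [OF L' z])
    fix u assume u: "u \<in> Arr C"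
    have cd: "Dom C u \<in> Obj C" "Cod C u \<in> Obj C" using u by simp_all
    show "lc (cmp (Do (Dom C u)) (VFobj L' (yob (Dom C u))) (VFobj L' (yob (Cod C u))))
          (VFarr L' (yob (Dom C u), yob (Cod C u)) \<cdot> ym u) (?z (Dom C u)) =
       lc (cmp (Do (Dom C u)) (Do (Cod C u)) (VFobj L' (yob (Cod C u)))) (?z (Cod C u)) (Da u)"
      using nat_transD(4) [OF \<zeta> u] zD [OF cd(1)] u
      by (subst (asm) \<zeta>e [OF cd(1)], subst (asm) \<zeta>e [OF cd(2)]) (simp add: underlying_simps res_simps Farr_D)
  qed
  moreover have "Comp M0 (res_arr Lfun L' \<tau> c) (i c) = \<zeta> c \<longleftrightarrow>
      lc (cmp (Do c) (Lo (yob c)) (VFobj L' (yob c))) (\<tau> (yob c)) (io c) = ?z c" if "c \<in> Obj C" for c \<tau>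
    using that by (subst \<zeta>e [OF that]) (simp add: res_arr_def i_def underlying_simps)
  ultimately show "\<exists>!\<tau>. vnat_trans V U M Lfun L' \<tau> \<and> (\<forall>c\<in>Obj C. Comp M0 (res_arr Lfun L' \<tau> c) (i c) = \<zeta> c)"
    by simp
qed

end

section \<open>Contractibility\<close>

lemma small_subset: "small U B \<Longrightarrow> A \<subseteq> B \<Longrightarrow> small U A"
  unfolding small_def using card_of_mono1 ordLeq_ordLess_trans by blast

theorem proposition2p9:
  fixes V :: "('o, 'a) smcat"
    and N :: "'a model"
    and C :: "('c, 'd) cat"
    and M :: "('m, 'o, 'a) vcat"
    and NM :: "('m \<times> 'm \<times> 'a) model"
    and \<gamma> :: "('c, 'd, 'm, 'm \<times> 'm \<times> 'a) functr"
  assumes "universe TYPE('u)"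
    and "closed_symmetric_monoidal V"
    and "complete_cat TYPE('u) V" and "cocomplete_cat TYPE('u) V"
    and "symmetric_monoidal_model_category V N"
    and "cofibrantly_generated TYPE('u) V N"
    and "cofibrant V N (Unit V)"
    and "small_category TYPE('u) C"
    and "model_vcategory TYPE('u) V N M NM"
    and "is_functor C (underlying V M) \<gamma>"
  shows "contractible_category (Fact V N C M NM \<gamma>)"
proof -
  interpret V: smc V using assms(2) by unfold_locales
  have C: "category C" using assms(8) by (simp add: small_category_def)
  have end_exists: "\<exists>e \<pi>. is_presheaf_end V C F G e \<pi>" if "F \<in> presheaves V C" "G \<in> presheaves V C" for F G
    using V.presheaf_end_exists [OF assms(1,3,8) that] by blast
  have copower_exists: "\<exists>x \<iota>. is_copower V (homset C d c) (Unit V) x \<iota>" for c d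
  proof (rule cocomplete_cat_copower [OF assms(4) V.category])
    show "small TYPE('u) (homset C d c)"
      using assms(8) by (auto simp: small_category_def homset_iff intro: small_subset)
  qed simp
  have M: "vcategory V M" "vcomplete TYPE('u) V (vop V M)" "two_variable_vadjunction V M" "model_structure (underlying V M) NM"
    "quillen_bifunctor V N (underlying V M) NM (underlying V M) NM (tensor_arr V M)"
    using assms(9) by (simp_all add: model_vcategory_def vbicomplete_def)
  have N: "model_structure V N" using assms(5) by (simp add: symmetric_monoidal_model_category_def)
  interpret psh_vct V C M
    by unfold_locales (use C end_exists copower_exists M(1) in auto)
  interpret model_vcat V M N NM
    by unfold_locales (use M(3-5) N in auto)
  obtain z where z: "is_initial M0 z" using initial_exists [OF M(2) assms(1)] by blast
  obtain Q q where Q: "is_functor M0 M0 Q" "\<And>x. x \<in> Obj M0 \<Longrightarrow> cofibrant M0 NM (Fobj Q x)"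
    "\<And>x. x \<in> Obj M0 \<Longrightarrow> q x \<in> homset M0 (Fobj Q x) x" "\<And>x. x \<in> Obj M0 \<Longrightarrow> q x \<in> Weq NM"
    "\<And>f. f \<in> Arr M0 \<Longrightarrow> Comp M0 (q (Cod M0 f)) (Farr Q f) = Comp M0 f (q (Dom M0 f))"
    using und.cofibrant_replacement [OF M(4) z] by blast
  let ?LQ = "{L. left_quillen_vfunctor V U (projective_model V N C) M NM L}"
  have LQ: "is_vfunctor V U M L" if "L \<in> ?LQ" for L
    using that by (auto simp: left_quillen_vfunctor_def vadjunction_def)
  have ext: "\<exists>L i. L \<in> ?LQ \<and> nat_trans C M0 D (res L) i \<and> (\<forall>c\<in>Obj C. is_iso M0 (i c)) \<and>
      (\<forall>L'\<in>?LQ. \<forall>\<zeta>. nat_trans C M0 D (res L') \<zeta> \<longrightarrow>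
         (\<exists>!\<tau>. vnat_trans V U M L L' \<tau> \<and> (\<forall>c\<in>Obj C. Comp M0 (res_arr L L' \<tau> c) (i c) = \<zeta> c)))"
    if D: "is_functor C M0 D" "\<And>c. c \<in> Obj C \<Longrightarrow> cofibrant M0 NM (Fobj D c)" for D
  proof -
    interpret D: diag V C M D using D(1) by unfold_locales
    have "\<forall>F. \<exists>l \<nu>. F \<in> Psh \<longrightarrow> D.wcolim F l \<nu>" using D.wcolim_exists [OF M(2) assms(8)] by blast
    then obtain Lo la where "\<And>F. F \<in> Psh \<Longrightarrow> D.wcolim F (Lo F) (la F)" by metis
    then interpret D: quillen_lan V C M D Lo la N NM
      by unfold_locales (use D(2) in auto)
    show ?thesis
      using D.Lfun_left_quillen D.extension LQ by blast
  qed
  interpret F: weak_factorizations C M0 ?LQ "vnat_trans V U M" "\<lambda>L. \<lambda>F\<in>Psh. vid (VFobj L F)"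
    "\<lambda>L L' L'' \<sigma> \<tau>. \<lambda>F\<in>Psh. elem_comp V M (VFobj L F) (VFobj L' F) (VFobj L'' F) (\<sigma> F) (\<tau> F)"
    res res_arr "Weq NM" \<gamma> "cofibrant M0 NM" Q q
  proof (unfold_locales, goal_cases)
    case 1 then show ?case using vnat_id LQ by blast
  next
    case 2 then show ?case by (intro vnat_comp LQ)
  next
    case 3 then show ?case by (intro conjI vncomp_id LQ)
  next
    case 4 then show ?case by (intro vncomp_assoc LQ)
  next
    case 5 then show ?case by (intro res_functor LQ)
  next
    case 6 then show ?case by (intro res_arr_nat_trans LQ)
  next
    case 7 then show ?case by (intro res_arr_id)
  next
    case 8 then show ?case by (intro res_arr_comp)
  next
    case 9 then show ?case using M(4) by (simp add: model_structure_def wide_subcategory_def)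
  next
    case 10 then show ?case by (rule und.iso_weak_equivalence [OF M(4)])
  next
    case 11 then show ?case using M(4) by (simp add: model_structure_def)
  next
    case 12 show ?case by (rule assms(10))
  next
    case 18 then show ?case by (rule ext)
  qed (rule Q; assumption)+
  \<comment> \<open>Unfolding the definitions identifies the two categories on the nose.\<close>
  have "Fact V N C M NM \<gamma> = F.fcat"
    unfolding Fact_def F.fcat_def F.farr_def F.fobj_def fact_arrows_def fact_objects_def
    by (auto simp: res_def res_arr_def yoneda_simps Let_def)
  then show ?thesis using F.fcat_contractible by simp
qed

end
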